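(* Let $\nu$ be an arbitrary positive measure on the Borel $\sigma$-field $\mathcal B(J)$ (not necessarily locally finite). Then $\mathsf P$-a.s. we have $$\int_JL^y_t(Y)\,\nu(dy)<\infty\quad\text{for all }t\in[0,\tau^Y_{D^\nu}),$$ $$\int_JL^y_t(Y)\,\nu(dy)=\infty\quad\text{for all }t\in(\tau^Y_{D^\nu},\zeta].$$
   Context: Let $J=(l,r)$, $-\infty\le l<r\le\infty$, and let $\mu,\sigma\colon J\to\mathbb R$ be Borel functions with $\sigma(x)\ne0$ for all $x\in J$ and $\frac1{\sigma^2},\frac{\mu}{\sigma^2}\in L^1_{\mathrm{loc}}(J)$ (integrable on compact subsets of $J$ with respect to Lebesgue measure). On a filtered probability space $(\Omega,\mathcal F,(\mathcal F_t)_{t\in[0,\infty)},\mathsf P)$ with an $(\mathcal F_t,\mathsf P)$-Brownian motion $W$, let $Y=(Y_t)_{t\in[0,\infty)}$ be a solution of $dY_t=\mu(Y_t)\,dt+\sigma(Y_t)\,dW_t$, $Y_0=x_0\in J$, which may exit $J$ continuously at a finite time; $\zeta$ denotes its exit time from $J$. That is, $\mathsf P$-a.s. on $\{\zeta=\infty\}$ the trajectories do not exit $J$, and $\mathsf P$-a.s. on $\{\zeta<\infty\}$ either $\lim_{t\uparrow\zeta}Y_t=r$ or $\lim_{t\uparrow\zeta}Y_t=l$; on $\{\zeta<\infty\}$ the process $Y$ stays after $\zeta$ at the endpoint where it exits. $(L^y_t(Y);\,t\in[0,\zeta),\,y\in J)$ is an a.s. continuous in $t$ and càdlàg in $y$ version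 of the local time of the continuous semimartingale $Y$ on the stochastic interval $[0,\zeta)$, and $L^y_\zeta(Y):=\lim_{t\uparrow\zeta}L^y_t(Y)\in[0,\infty]$ (monotone limit). With $B_\varepsilon(x):=(x-\varepsilon,x+\varepsilon)$, put $$D^\nu:=\{l,r\}\cup\{x\in J:\ \forall\varepsilon>0\ \text{it holds}\ \nu(B_\varepsilon(x))=\infty\},$$ where $\nu(B_\varepsilon(x))$ is understood as $\nu(B_\varepsilon(x)\cap J)$; $D^\nu$ is closed in $[l,r]$. For a closed subset $E$ of $[l,r]$, $\tau^Y_E:=\inf\{t\in[0,\infty):Y_t\in E\}$ with $\inf\emptyset:=\infty$. *)

theory Defs
  imports "HOL-Probability.Probability"
begin

text \<open>
  Processes are indexed by real times and only their values at times \<open>t \<ge> 0\<close> matter. Random times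
  take values in the extended reals. The state interval \<open>J = (l, r)\<close> is \<^term>\<open>einterval l r\<close>.
  The filtration need not satisfy the usual conditions; path properties are required only almost
  surely.
\<close>

definition filtered_prob_space :: "'a measure \<Rightarrow> (real \<Rightarrow> 'a measure) \<Rightarrow> bool" where
  "filtered_prob_space M F \<longleftrightarrow>
     prob_space M \<and>
     (\<forall>t\<ge>0. subalgebra M (F t)) \<and>
     (\<forall>s t. 0 \<le> s \<and> s \<le> t \<longrightarrow> subalgebra (F t) (F s))"

definition brownian_motion ::
  "'a measure \<Rightarrow> (real \<Rightarrow> 'a measure) \<Rightarrow> (real \<Rightarrow> 'a \<Rightarrow> real) \<Rightarrow> bool" where
  "brownian_motion M F W \<longleftrightarrow>
     (\<forall>t\<ge>0. W t \<in> borel_measurable (F t)) \<and>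
     (AE \<omega> in M. W 0 \<omega> = 0 \<and> continuous_on {0..} (\<lambda>t. W t \<omega>)) \<and>
     (\<forall>s t. 0 \<le> s \<and> s < t \<longrightarrow>
        distributed M lborel (\<lambda>\<omega>. W t \<omega> - W s \<omega>) (normal_density 0 (sqrt (t - s))) \<and>
        prob_space.indep_set M (sets (F s))
          {(\<lambda>\<omega>. W t \<omega> - W s \<omega>) -` B \<inter> space M | B. B \<in> sets borel})"


section \<open>Stochastic integrals\<close>

text \<open>
  A simple process is \<open>H\<^sub>s = \<Sum>i<N. \<xi>\<^sub>i 1\<^bsub>(p\<^sub>i, p\<^sub>i\<^sub>+\<^sub>1]\<^esub>(s)\<close> with \<open>\<xi>\<^sub>i\<close> bounded and measurable at time
  \<open>p\<^sub>i\<close>.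
\<close>

definition simple_process ::
  "'a measure \<Rightarrow> (real \<Rightarrow> 'a measure) \<Rightarrow> nat \<Rightarrow> (nat \<Rightarrow> real) \<Rightarrow> (nat \<Rightarrow> 'a \<Rightarrow> real) \<Rightarrow> bool" where
  "simple_process M F N p \<xi> \<longleftrightarrow>
     0 \<le> p 0 \<and>
     (\<forall>i<N. p i \<le> p (Suc i) \<and> \<xi> i \<in> borel_measurable (F (p i)) \<and>
        (\<exists>C. \<forall>\<omega>\<in>space M. \<bar>\<xi> i \<omega>\<bar> \<le> C))"

definition simple_val ::
  "nat \<Rightarrow> (nat \<Rightarrow> real) \<Rightarrow> (nat \<Rightarrow> 'a \<Rightarrow> real) \<Rightarrow> real \<Rightarrow> 'a \<Rightarrow> real" where
  "simple_val N p \<xi> s \<omega> = (\<Sum>i<N. \<xi> i \<omega> * indicator {p i<..p (Suc i)} s)"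

definition simple_integral ::
  "(real \<Rightarrow> 'a \<Rightarrow> real) \<Rightarrow> nat \<Rightarrow> (nat \<Rightarrow> real) \<Rightarrow> (nat \<Rightarrow> 'a \<Rightarrow> real) \<Rightarrow> real \<Rightarrow> 'a \<Rightarrow> real" where
  "simple_integral W N p \<xi> t \<omega> =
     (\<Sum>i<N. \<xi> i \<omega> * (W (min t (p (Suc i))) \<omega> - W (min t (p i)) \<omega>))"

text \<open>
  \<open>I\<close> is the It\^o integral process \<open>\<integral> H dW\<close> for an integrand with \<open>\<integral>\<^sub>0\<^sup>T H\<^sup>2 ds < \<infinity>\<close> a.s. for all
  \<open>T\<close>: it is the locally uniform limit of simple integrals whose integrands converge to \<open>H\<close> in
  \<open>L\<^sup>2[0, T]\<close> for every \<open>T\<close>. Almost sure convergence is used in place of convergence in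
  probability; by passing to subsequences this determines the same process up to
  indistinguishability. The integral of squares is a nonnegative integral, so no
  integrability of \<open>H\<close> is silently presupposed.
\<close>

definition has_ito_integral ::
  "'a measure \<Rightarrow> (real \<Rightarrow> 'a measure) \<Rightarrow> (real \<Rightarrow> 'a \<Rightarrow> real) \<Rightarrow>
   (real \<Rightarrow> 'a \<Rightarrow> real) \<Rightarrow> (real \<Rightarrow> 'a \<Rightarrow> real) \<Rightarrow> bool" where
  "has_ito_integral M F W H I \<longleftrightarrow>
     (\<exists>N p \<xi>.
        (\<forall>n. simple_process M F (N n) (p n) (\<xi> n)) \<and>
        (AE \<omega> in M. \<forall>T\<ge>0.
           (\<lambda>n. \<integral>\<^sup>+s\<in>{0..T}. ennreal ((simple_val (N n) (p n) (\<xi> n) s \<omega> - H s \<omega>)\<^sup>2) \<partial>lborel)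
              \<longlonglongrightarrow> 0 \<and>
           uniform_limit {0..T} (\<lambda>n t. simple_integral W (N n) (p n) (\<xi> n) t \<omega>)
             (\<lambda>t. I t \<omega>) sequentially))"

text \<open>
  \<open>Z = \<integral> H dX\<close>, where \<open>dX = b ds + a dW\<close>, i.e. \<open>Z\<^sub>t = \<integral>\<^sub>0\<^sup>t H b ds + \<integral>\<^sub>0\<^sup>t H a dW\<close> for all \<open>t\<close>, a.s.
  With \<open>H\<close> vanishing after a random time, \<open>b\<close> and \<open>a\<close> matter only up to that time.
\<close>

definition has_stoch_integral ::
  "'a measure \<Rightarrow> (real \<Rightarrow> 'a measure) \<Rightarrow> (real \<Rightarrow> 'a \<Rightarrow> real) \<Rightarrow>
   (real \<Rightarrow> 'a \<Rightarrow> real) \<Rightarrow> (real \<Rightarrow> 'a \<Rightarrow> real) \<Rightarrow>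
   (real \<Rightarrow> 'a \<Rightarrow> real) \<Rightarrow> (real \<Rightarrow> 'a \<Rightarrow> real) \<Rightarrow> bool" where
  "has_stoch_integral M F W b a H Z \<longleftrightarrow>
     (\<exists>I. has_ito_integral M F W (\<lambda>s \<omega>. H s \<omega> * a s \<omega>) I \<and>
        (AE \<omega> in M. \<forall>t\<ge>0.
           set_integrable lborel {0..t} (\<lambda>s. H s \<omega> * b s \<omega>) \<and>
           Z t \<omega> = (LINT s:{0..t}|lborel. H s \<omega> * b s \<omega>) + I t \<omega>))"


section \<open>The diffusion and its exit time\<close>

definition hit_time :: "(real \<Rightarrow> 'a \<Rightarrow> ereal) \<Rightarrow> ereal set \<Rightarrow> 'a \<Rightarrow> ereal" where
  "hit_time Y E \<omega> = Inf (ereal ` {t. 0 \<le> t \<and> Y t \<omega> \<in> E})"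

definition exit_time :: "(real \<Rightarrow> 'a \<Rightarrow> ereal) \<Rightarrow> ereal \<Rightarrow> ereal \<Rightarrow> 'a \<Rightarrow> ereal" where
  "exit_time Y l r = hit_time Y (- {l<..<r})"

definition stopped_at :: "real \<Rightarrow> ereal \<Rightarrow> real" where
  "stopped_at t \<tau> = real_of_ereal (min (ereal t) \<tau>)"

text \<open>
  \<open>Y\<close> takes values in \<open>[l, r]\<close>, and the equation is imposed up to the exit time \<open>\<tau>\<close> from
  each interval \<open>(c, d)\<close> containing \<open>x\<^sub>0\<close> with \<open>[c, d] \<subseteq> J\<close>, as \<open>Y\<^bsub>t \<and> \<tau>\<^esub> - x\<^sub>0 = \<integral>\<^sub>0\<^sup>t 1\<^bsub>s \<le> \<tau>\<^esub> (\<mu>(Y\<^sub>s) ds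
  + \<sigma>(Y\<^sub>s) dW\<^sub>s)\<close>. These \<open>\<tau>\<close> increase to the exit time from \<open>J\<close>. Continuity in the extended reals
  entails that at a finite exit time \<open>Y\<close> tends to, and equals, \<open>l\<close> or \<open>r\<close>.
\<close>

definition sde_solution ::
  "'a measure \<Rightarrow> (real \<Rightarrow> 'a measure) \<Rightarrow> (real \<Rightarrow> 'a \<Rightarrow> real) \<Rightarrow> ereal \<Rightarrow> ereal \<Rightarrow>
   (real \<Rightarrow> real) \<Rightarrow> (real \<Rightarrow> real) \<Rightarrow> real \<Rightarrow> (real \<Rightarrow> 'a \<Rightarrow> ereal) \<Rightarrow> bool" where
  "sde_solution M F W l r \<mu> \<sigma> x\<^sub>0 Y \<longleftrightarrow>
     (\<forall>t\<ge>0. Y t \<in> borel_measurable (F t)) \<and>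
     (AE \<omega> in M.
        Y 0 \<omega> = ereal x\<^sub>0 \<and>
        continuous_on {0..} (\<lambda>t. Y t \<omega>) \<and>
        (\<forall>t\<ge>0. Y t \<omega> \<in> {l..r}) \<and>
        (\<forall>s t. 0 \<le> s \<and> s \<le> t \<and> Y s \<omega> \<in> {l, r} \<longrightarrow> Y t \<omega> = Y s \<omega>)) \<and>
     (\<forall>c d. l < ereal c \<and> c < x\<^sub>0 \<and> x\<^sub>0 < d \<and> ereal d < r \<longrightarrow>
        (let \<tau> = exit_time Y (ereal c) (ereal d) in
           has_stoch_integral M F W
             (\<lambda>s \<omega>. \<mu> (real_of_ereal (Y s \<omega>))) (\<lambda>s \<omega>. \<sigma> (real_of_ereal (Y s \<omega>)))
             (\<lambda>s \<omega>. of_bool (ereal s \<le> \<tau> \<omega>))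
             (\<lambda>t \<omega>. real_of_ereal (Y (stopped_at t (\<tau> \<omega>)) \<omega>) - x\<^sub>0)))"


section \<open>Local time\<close>

text \<open>
  \<open>L t y \<omega>\<close> is \<open>L\<^sup>y\<^sub>t(Y)(\<omega>)\<close>, meaningful for \<open>0 \<le> t < \<zeta>(\<omega>)\<close> and \<open>y \<in> J\<close>. It is the (right) local
  time of the semimartingale \<open>Y\<close>, given by Tanaka's formula
  \<open>(Y\<^sub>t - y)\<^sup>+ = (x\<^sub>0 - y)\<^sup>+ + \<integral>\<^sub>0\<^sup>t 1\<^bsub>Y\<^sub>s > y\<^esub> dY\<^sub>s + 1/2 L\<^sup>y\<^sub>t\<close> on \<open>[0, \<zeta>)\<close>, which is localized by the same
  exit times as the equation.
\<close>

definition local_time ::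
  "'a measure \<Rightarrow> (real \<Rightarrow> 'a measure) \<Rightarrow> (real \<Rightarrow> 'a \<Rightarrow> real) \<Rightarrow> ereal \<Rightarrow> ereal \<Rightarrow>
   (real \<Rightarrow> real) \<Rightarrow> (real \<Rightarrow> real) \<Rightarrow> real \<Rightarrow> (real \<Rightarrow> 'a \<Rightarrow> ereal) \<Rightarrow>
   (real \<Rightarrow> real \<Rightarrow> 'a \<Rightarrow> real) \<Rightarrow> bool" where
  "local_time M F W l r \<mu> \<sigma> x\<^sub>0 Y L \<longleftrightarrow>
     (\<forall>y\<in>einterval l r. \<forall>c d. l < ereal c \<and> c < x\<^sub>0 \<and> x\<^sub>0 < d \<and> ereal d < r \<longrightarrow>
        (let \<tau> = exit_time Y (ereal c) (ereal d) in
           has_stoch_integral M F W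
             (\<lambda>s \<omega>. \<mu> (real_of_ereal (Y s \<omega>))) (\<lambda>s \<omega>. \<sigma> (real_of_ereal (Y s \<omega>)))
             (\<lambda>s \<omega>. of_bool (ereal s \<le> \<tau> \<omega>) * of_bool (ereal y < Y s \<omega>))
             (\<lambda>t \<omega>. max 0 (real_of_ereal (Y (stopped_at t (\<tau> \<omega>)) \<omega>) - y) - max 0 (x\<^sub>0 - y)
                     - L (stopped_at t (\<tau> \<omega>)) y \<omega> / 2))) \<and>
     (AE \<omega> in M.
        (\<forall>y\<in>einterval l r.
           mono_on {t. 0 \<le> t \<and> ereal t < exit_time Y l r \<omega>} (\<lambda>t. L t y \<omega>) \<and>
           continuous_on {t. 0 \<le> t \<and> ereal t < exit_time Y l r \<omega>} (\<lambda>t. L t y \<omega>)) \<and>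
        (\<forall>t\<ge>0. ereal t < exit_time Y l r \<omega> \<longrightarrow>
           (\<forall>y\<in>einterval l r.
              ((\<lambda>z. L t z \<omega>) \<longlongrightarrow> L t y \<omega>) (at_right y) \<and>
              (\<exists>c. ((\<lambda>z. L t z \<omega>) \<longlongrightarrow> c) (at_left y)))))"

text \<open>
  The local time on \<open>[0, \<zeta>]\<close>: at time \<open>\<zeta>\<close>, finite or infinite, its value is the monotone limit
  \<open>\<lim>\<^bsub>t \<up> \<zeta>\<^esub> L\<^sup>y\<^sub>t \<in> [0, \<infinity>]\<close>. Only times \<open>t \<le> \<zeta>\<close> are relevant.
\<close>

definition local_time_ext ::
  "('a \<Rightarrow> ereal) \<Rightarrow> (real \<Rightarrow> real \<Rightarrow> 'a \<Rightarrow> real) \<Rightarrow> ereal \<Rightarrow> real \<Rightarrow> 'a \<Rightarrow> ennreal" where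
  "local_time_ext \<zeta> L t y \<omega> =
     (if t < \<zeta> \<omega> then ennreal (L (real_of_ereal t) y \<omega>)
      else Lim (at_left (\<zeta> \<omega>)) (\<lambda>s. ennreal (L (real_of_ereal s) y \<omega>)))"


definition D_set :: "ereal \<Rightarrow> ereal \<Rightarrow> real measure \<Rightarrow> ereal set" where
  "D_set l r \<nu> =
     {l, r} \<union> ereal ` {x \<in> einterval l r. \<forall>\<epsilon>>0. emeasure \<nu> (ball x \<epsilon> \<inter> einterval l r) = \<infinity>}"

end

theory Submission
  imports Defs
begin

text \<open>
  Three facts about the local time decide the matter: (i) \<open>L\<^sup>y\<^sub>t = 0\<close> if \<open>y\<close> lies outside the range of \<open>Y\<close> on \<open>[0, t]\<close>;
  (ii) for fixed \<open>x\<close>, \<open>L\<^sup>x\<^sub>t > 0\<close> for all \<open>t\<close> after the first visit to \<open>x\<close>; (iii) for fixed \<open>x\<close> and \<open>t\<close>, the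
  left limit of \<open>L\<^sub>t\<close> at \<open>x\<close> is \<open>L\<^sup>x\<^sub>t\<close>. Before \<open>D\<close> is reached, the range of \<open>Y\<close> is a compact interval, covered by
  finitely many balls of finite measure on which the cadlag function \<open>L\<^sub>t\<close> is bounded, and the integral is finite by (i).
  After \<open>D\<close> has been reached, \<open>Y\<close> has passed one of the at most two points of \<open>D\<close> that are closest to \<open>x\<^sub>0\<close> on either
  side. These are deterministic, so by (ii) and (iii) \<open>L\<^sub>t\<close> is bounded away from \<open>0\<close> near that point, where the
  measure is infinite.

  Stop \<open>Y\<close> on leaving \<open>[c, d] \<subseteq> J\<close>, so that it becomes a bounded process \<open>dX = b ds + a dW\<close> with \<open>\<bar>b\<bar> = \<psi>(X) a\<^sup>2\<close> and
  \<open>\<psi>\<close> integrable on \<open>[c, d]\<close>. Then (i) holds as the stochastic integral in Tanaka's formula vanishes. Mixing Tanaka's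
  formula over \<open>y\<close> and comparing with Ito's formula, in expectation, shows that \<open>f y = E L\<^sup>y\<^sub>T\<close> is the density of
  the occupation measure \<open>E \<integral>\<^sub>0\<^sup>T 1\<^bsub>X \<in> dy\<^esub> a\<^sup>2 ds\<close>. It follows that no time is spent at a single point, which gives (iii) by
  the isometry. For (ii), let \<open>f\<close> be the occupation density between the first visit to \<open>x\<close> and the first time
  \<open>L\<^sup>x\<close> is positive. Tanaka's formula bounds \<open>f\<close> near \<open>x\<close> by \<open>2 \<integral> \<psi> f\<close> over a small interval around \<open>x\<close>, so
  \<open>f = 0\<close> near \<open>x\<close>, and \<open>X\<close> would have to stay at \<open>x\<close> although \<open>a \<noteq> 0\<close>.
\<close>

section \<open>Brownian filtrations and elementary integrals\<close>

text \<open>Tanaka's formula holds outside a null set that depends on the level y, while the point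
  at which Y enters D is random. Hence every fact is proved for countably many deterministic levels,
  times and localising intervals, and regularity in y and t supplies the rest. The occupation
  formula is needed in expectation only. It is then enough to test it with Lipschitz densities, and
  the isometry controls all errors, provided that the energies of drift and noise are bounded up to
  the stopping time. This is the origin of the budgets K; they are released path by path at the end,
  as each path exhausts only a finite budget on a bounded time interval. The relation between drift
  and noise through \<psi> expresses the drift integral by the occupation density itself. This
  closes the Gronwall argument and takes the place of a change of scale that would remove the drift.
  Monotonicity of the local time enters (ii) in two ways: it makes the density between two times
  nonnegative, and it carries positivity forward in time.\<close>

lemma (in prob_space) indep_var_of_vimage:
  fixes X Y :: "'a \<Rightarrow> real"
  assumes X: "random_variable borel X" and Y: "random_variable borel Y"
    and G: "\<forall>B\<in>sets borel. X -` B \<inter> space M \<in> A"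
    and ind: "indep_set A {Y -` B \<inter> space M | B. B \<in> sets borel}"
  shows "indep_var borel X borel Y"
proof -
  have st: "{X -` B \<inter> space M | B. B \<in> sets borel} \<subseteq> A" using G by auto
  \<comment> \<open>Preimages of all Borel sets already form a \<sigma>-algebra, so passing to the
    generated one adds nothing.\<close>
  have sx: "sigma_sets (space M) {X -` B \<inter> space M | B. B \<in> sets borel} = {X -` B \<inter> space M | B. B \<in> sets borel}"
    using sets_vimage_algebra2[of X "space M" borel] sets_vimage_algebra[of "space M" X borel] by simp
  have sy: "sigma_sets (space M) {Y -` B \<inter> space M | B. B \<in> sets borel} = {Y -` B \<inter> space M | B. B \<in> sets borel}"
    using sets_vimage_algebra2[of Y "space M" borel] sets_vimage_algebra[of "space M" Y borel] by simp
  show ?thesis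
    unfolding indep_var_eq sx sy
    using X Y st ind unfolding indep_sets2_eq by blast
qed

text \<open>All paths of \<open>W\<close> are continuous and null sets are known at every time,
  although the given filtration promises neither. Both are arranged by augmentation in
  \<open>augmented_bm\<close>; they allow processes to be corrected on a null set without losing
  adaptedness.\<close>

locale bm_filtration = prob_space M for M :: "'a measure" +
  fixes G :: "real \<Rightarrow> 'a measure" and W :: "real \<Rightarrow> 'a \<Rightarrow> real"
  assumes subalg: "t \<ge> 0 \<Longrightarrow> subalgebra M (G t)"
    and filt: "0 \<le> s \<Longrightarrow> s \<le> t \<Longrightarrow> subalgebra (G t) (G s)"
    and null_G: "t \<ge> 0 \<Longrightarrow> N \<in> null_sets M \<Longrightarrow> N \<in> sets (G t)"
    and W_adapted: "t \<ge> 0 \<Longrightarrow> W t \<in> borel_measurable (G t)"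
    and W_cont: "w \<in> space M \<Longrightarrow> continuous_on {0..} (\<lambda>t. W t w)"
    and W_normal: "0 \<le> s \<Longrightarrow> s < t \<Longrightarrow> distributed M lborel (\<lambda>w. W t w - W s w) (normal_density 0 (sqrt (t - s)))"
    and W_indep: "0 \<le> s \<Longrightarrow> s < t \<Longrightarrow> indep_set (sets (G s)) {(\<lambda>w. W t w - W s w) -` B \<inter> space M | B. B \<in> sets borel}"
begin

lemma space_G [simp]: "t \<ge> 0 \<Longrightarrow> space (G t) = space M"
  using subalg by (auto simp: subalgebra_def)

lemma meas_GM: "t \<ge> 0 \<Longrightarrow> f \<in> measurable (G t) N \<Longrightarrow> f \<in> measurable M N"
  using measurable_from_subalg subalg by blast

lemma meas_mono: "0 \<le> s \<Longrightarrow> s \<le> t \<Longrightarrow> f \<in> measurable (G s) N \<Longrightarrow> f \<in> measurable (G t) N"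
  using measurable_from_subalg filt by blast

lemma sets_mono: "0 \<le> s \<Longrightarrow> s \<le> t \<Longrightarrow> A \<in> sets (G s) \<Longrightarrow> A \<in> sets (G t)"
  using filt by (auto simp: subalgebra_def)

lemma sets_GM: "0 \<le> t \<Longrightarrow> A \<in> sets (G t) \<Longrightarrow> A \<in> sets M"
  using subalg by (auto simp: subalgebra_def)

lemma W_meas: "t \<ge> 0 \<Longrightarrow> W t \<in> borel_measurable M"
  using meas_GM W_adapted by blast

text \<open>The map f lets one statement serve both the first and the second moment of the
  increment.\<close>

lemma incr_indep:
  assumes "0 \<le> s" "s < t" "\<eta> \<in> borel_measurable (G s)" "f \<in> borel_measurable borel"
  shows "indep_var borel \<eta> borel (\<lambda>w. f (W t w - W s w) :: real)"
proof -
  have "indep_var borel (id \<circ> \<eta>) borel (f \<circ> (\<lambda>w. W t w - W s w))"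
  proof (rule indep_var_compose)
    show "indep_var borel \<eta> borel (\<lambda>w. W t w - W s w)"
    proof (rule indep_var_of_vimage[OF _ _ _ W_indep[of s t]])
      show "\<forall>B\<in>sets borel. \<eta> -` B \<inter> space M \<in> sets (G s)"
        using measurable_sets[OF assms(3)] assms(1) by auto
      show "random_variable borel \<eta>" using assms meas_GM by blast
      show "random_variable borel (\<lambda>w. W t w - W s w)"
        using assms by (intro borel_measurable_diff W_meas) auto
    qed (use assms in auto)
  qed (use assms in auto)
  then show ?thesis by (simp add: comp_def)
qed

lemma incr_moment:
  assumes "0 \<le> s" "s < t"
  shows "integrable M (\<lambda>w. (W t w - W s w) ^ k)"
    and "(\<integral>w. (W t w - W s w) ^ k \<partial>M) = (\<integral>x. normal_density 0 (sqrt (t - s)) x * x ^ k \<partial>lborel)"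
proof -
  have 1: "integrable lborel (\<lambda>x. normal_density 0 (sqrt (t - s)) x * (x - 0) ^ k)"
    using assms by (intro integrable_normal_moment) auto
  show "integrable M (\<lambda>w. (W t w - W s w) ^ k)"
    using distributed_integrable[OF W_normal[OF assms], of "\<lambda>x. x ^ k"] 1 by simp
  show "(\<integral>w. (W t w - W s w) ^ k \<partial>M) = (\<integral>x. normal_density 0 (sqrt (t - s)) x * x ^ k \<partial>lborel)"
    using distributed_integral[OF W_normal[OF assms], of "\<lambda>x. x ^ k"] by simp
qed

text \<open>Independence factorises the expectation and leaves the mean of a centred Gaussian. The
  case s = t is separate because the increment then has no density. \<open>incr_square\<close> is
  the second-moment analogue; together they generate the martingale property and the
  isometry.\<close>

lemma incr_mean:
  assumes "0 \<le> s" "s \<le> t" "\<eta> \<in> borel_measurable (G s)" "integrable M \<eta>"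
  shows "integrable M (\<lambda>w. \<eta> w * (W t w - W s w))" "(\<integral>w. \<eta> w * (W t w - W s w) \<partial>M) = 0"
proof -
  have "integrable M (\<lambda>w. \<eta> w * (W t w - W s w)) \<and> (\<integral>w. \<eta> w * (W t w - W s w) \<partial>M) = 0"
  proof (cases "s = t")
    case False
    then have st: "s < t" using assms by auto
    have i: "integrable M (\<lambda>w. W t w - W s w)" using incr_moment(1)[of s t 1] assms st by simp
    have z: "(\<integral>w. W t w - W s w \<partial>M) = 0"
      using incr_moment(2)[of s t 1] normal_moment_odd[of "sqrt (t - s)" 0 0] assms st
      by (auto dest: has_bochner_integral_integral_eq)
    have "indep_var borel \<eta> borel (\<lambda>w. id (W t w - W s w))"
      using assms st by (intro incr_indep) auto
    then show ?thesis
      using indep_var_integrable[of \<eta> "\<lambda>w. W t w - W s w"] indep_var_lebesgue_integral[of \<eta> "\<lambda>w. W t w - W s w"] i assms z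
      by auto
  qed auto
  then show "integrable M (\<lambda>w. \<eta> w * (W t w - W s w))" "(\<integral>w. \<eta> w * (W t w - W s w) \<partial>M) = 0" by auto
qed

lemma incr_square:
  assumes "0 \<le> s" "s \<le> t" "\<eta> \<in> borel_measurable (G s)" "integrable M \<eta>"
  shows "integrable M (\<lambda>w. \<eta> w * (W t w - W s w)\<^sup>2)"
    and "(\<integral>w. \<eta> w * (W t w - W s w)\<^sup>2 \<partial>M) = (t - s) * (\<integral>w. \<eta> w \<partial>M)"
proof -
  have "integrable M (\<lambda>w. \<eta> w * (W t w - W s w)\<^sup>2) \<and> (\<integral>w. \<eta> w * (W t w - W s w)\<^sup>2 \<partial>M) = (t - s) * (\<integral>w. \<eta> w \<partial>M)"
  proof (cases "s = t")
    case False
    then have st: "s < t" using assms by auto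
    have i: "integrable M (\<lambda>w. (W t w - W s w)\<^sup>2)" using incr_moment(1)[of s t 2] assms st by simp
    have z: "(\<integral>w. (W t w - W s w)\<^sup>2 \<partial>M) = t - s"
      using incr_moment(2)[of s t 2] normal_moment_even[of "sqrt (t - s)" 0 1] assms st
      by (auto dest!: has_bochner_integral_integral_eq simp: power2_eq_square fact_numeral)
    have "indep_var borel \<eta> borel (\<lambda>w. (W t w - W s w)\<^sup>2)"
      using assms st by (intro incr_indep) auto
    then show ?thesis
      using indep_var_integrable[of \<eta> "\<lambda>w. (W t w - W s w)\<^sup>2"] indep_var_lebesgue_integral[of \<eta> "\<lambda>w. (W t w - W s w)\<^sup>2"] i assms z
      by auto
  qed auto
  then show "integrable M (\<lambda>w. \<eta> w * (W t w - W s w)\<^sup>2)"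
    "(\<integral>w. \<eta> w * (W t w - W s w)\<^sup>2 \<partial>M) = (t - s) * (\<integral>w. \<eta> w \<partial>M)" by auto
qed

end

lemma integrable_square_mult:
  fixes X Y :: "'a \<Rightarrow> real"
  assumes [measurable]: "X \<in> borel_measurable M" "Y \<in> borel_measurable M"
    and "integrable M (\<lambda>x. (X x)\<^sup>2)" "integrable M (\<lambda>x. (Y x)\<^sup>2)"
  shows "integrable M (\<lambda>x. X x * Y x)"
proof (rule Bochner_Integration.integrable_bound)
  show "integrable M (\<lambda>x. (X x)\<^sup>2 + (Y x)\<^sup>2)" using assms by simp
  have "\<bar>a * b\<bar> \<le> a\<^sup>2 + b\<^sup>2" for a b :: real
  proof -
    have "0 \<le> (\<bar>a\<bar> - \<bar>b\<bar>)\<^sup>2" by simp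
    then have "2 * (\<bar>a\<bar> * \<bar>b\<bar>) \<le> a\<^sup>2 + b\<^sup>2" by (simp add: power2_diff)
    moreover have "0 \<le> \<bar>a\<bar> * \<bar>b\<bar>" by simp
    ultimately show ?thesis unfolding abs_mult by linarith
  qed
  then show "AE x in M. norm (X x * Y x) \<le> norm ((X x)\<^sup>2 + (Y x)\<^sup>2)"
    by (simp add: order_trans[OF _ abs_ge_self])
qed simp

lemma integrable_square_add:
  fixes X Y :: "'a \<Rightarrow> real"
  assumes "X \<in> borel_measurable M" "Y \<in> borel_measurable M"
    and "integrable M (\<lambda>x. (X x)\<^sup>2)" "integrable M (\<lambda>x. (Y x)\<^sup>2)"
  shows "integrable M (\<lambda>x. (X x + Y x)\<^sup>2)" "integrable M (\<lambda>x. (X x - Y x)\<^sup>2)"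
  using integrable_square_mult[OF assms] assms by (simp_all add: power2_sum power2_diff mult.assoc)

lemma integrable_mult_bounded:
  fixes X \<zeta> :: "'a \<Rightarrow> real"
  assumes "integrable M X" "\<zeta> \<in> borel_measurable M" "\<And>x. x \<in> space M \<Longrightarrow> \<bar>\<zeta> x\<bar> \<le> C"
  shows "integrable M (\<lambda>x. \<zeta> x * X x)"
proof (rule Bochner_Integration.integrable_bound)
  show "integrable M (\<lambda>x. C * X x)" using assms by simp
  have "\<bar>\<zeta> x * X x\<bar> \<le> \<bar>C * X x\<bar>" if "x \<in> space M" for x
    unfolding abs_mult using assms(3)[OF that] by (intro mult_right_mono) auto
  then show "AE x in M. norm (\<zeta> x * X x) \<le> norm (C * X x)" by (intro AE_I2) simp
qed (use assms in auto)

lemma (in prob_space) integrable_of_square: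
  fixes X :: "'a \<Rightarrow> real"
  assumes "X \<in> borel_measurable M" "integrable M (\<lambda>x. (X x)\<^sup>2)"
  shows "integrable M X"
  using integrable_square_mult[of X M "\<lambda>_. 1"] assms by simp

text \<open>Lebesgue measure on the time axis is infinite; cutting time to a bounded interval makes
  bounded integrands integrable on the product space.\<close>

lemma (in prob_space) integrable_strip:
  fixes f :: "real \<times> 'a \<Rightarrow> real"
  assumes [measurable]: "f \<in> borel_measurable (borel \<Otimes>\<^sub>M M)"
    and bd: "\<And>u w. w \<in> space M \<Longrightarrow> \<bar>f (u, w)\<bar> \<le> C"
  shows "integrable (lborel \<Otimes>\<^sub>M M) (\<lambda>(u, w). indicator {s<..t} u * f (u, w))"
proof (rule Bochner_Integration.integrable_bound)
  interpret P: pair_sigma_finite lborel M ..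
  have *: "emeasure (lborel \<Otimes>\<^sub>M M) ({s<..t} \<times> space M) < \<infinity>"
    by (subst emeasure_pair_measure_Times, simp, simp, cases "s \<le> t") (auto simp: emeasure_space_1)
  have "integrable (lborel \<Otimes>\<^sub>M M) (indicator ({s<..t} \<times> space M) :: _ \<Rightarrow> real)"
    using * by (intro integrable_real_indicator) auto
  then show "integrable (lborel \<Otimes>\<^sub>M M) (\<lambda>z. C * indicator ({s<..t} \<times> space M) z)" by simp
  have [measurable]: "f \<in> borel_measurable (lborel \<Otimes>\<^sub>M M)"
    using assms(1) by (simp cong: measurable_cong_sets sets_pair_measure_cong)
  show "(\<lambda>(u, w). indicator {s<..t} u * f (u, w)) \<in> borel_measurable (lborel \<Otimes>\<^sub>M M)"
    by measurable
  have "\<bar>f (u, w)\<bar> \<le> \<bar>C\<bar>" if "w \<in> space M" for u w using bd[OF that, of u] by linarith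
  then show "AE x in lborel \<Otimes>\<^sub>M M. norm (case x of (u, w) \<Rightarrow> indicator {s<..t} u * f (u, w))
         \<le> norm (C * indicator ({s<..t} \<times> space M) x)"
    by (intro AE_I2) (auto simp: space_pair_measure indicator_def)
qed

lemma (in prob_space) integral_strip_const:
  fixes \<eta> :: "'a \<Rightarrow> real"
  assumes "s \<le> t" "integrable M \<eta>"
  shows "(\<integral>(u, w). indicator {s<..t} u * \<eta> w \<partial>(lborel \<Otimes>\<^sub>M M)) = (t - s) * (\<integral>w. \<eta> w \<partial>M)"
proof -
  interpret P: pair_sigma_finite lborel M ..
  have "integrable (lborel \<Otimes>\<^sub>M M) (\<lambda>(u, w). indicator {s<..t} u * \<eta> w)"
  proof (rule P.Fubini_integrable)
    show "(\<lambda>(u, w). indicator {s<..t} u * \<eta> w) \<in> borel_measurable (lborel \<Otimes>\<^sub>M M)"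
      using borel_measurable_integrable[OF assms(2)] by measurable
  qed (use assms in \<open>auto simp: abs_mult\<close>)
  from P.integral_fst'[OF this] show ?thesis
    using assms by simp
qed

context bm_filtration begin

text \<open>Progressive measurability. Negative times are included in order to avoid restricted product spaces.\<close>

definition prog :: "(real \<Rightarrow> 'a \<Rightarrow> real) \<Rightarrow> bool" where
  "prog h \<longleftrightarrow> (\<forall>t\<ge>0. (\<lambda>(s, w). h s w * indicator {..t} s) \<in> borel_measurable (borel \<Otimes>\<^sub>M G t))"

text \<open>An elementary integrand together with its integral process. The steps are \<open>\<xi> 1\<^bsub>(a, \<infinity>)\<^esub>\<close>, so that sums of
  integrands need no common partition; a step on \<open>(a, b]\<close> is the difference of two of them.\<close>

inductive elem :: "(real \<Rightarrow> 'a \<Rightarrow> real) \<Rightarrow> (real \<Rightarrow> 'a \<Rightarrow> real) \<Rightarrow> bool" where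
  zero: "elem (\<lambda>_ _. 0) (\<lambda>_ _. 0)"
| add: "elem e E \<Longrightarrow> 0 \<le> a \<Longrightarrow> \<xi> \<in> borel_measurable (G a) \<Longrightarrow> (\<And>w. w \<in> space M \<Longrightarrow> \<bar>\<xi> w\<bar> \<le> C) \<Longrightarrow>
    elem (\<lambda>s w. e s w + \<xi> w * of_bool (a < s)) (\<lambda>t w. E t w + \<xi> w * (W t w - W (min t a) w))"
| on_space: "elem e E \<Longrightarrow> (\<And>s w. w \<in> space M \<Longrightarrow> e' s w = e s w) \<Longrightarrow> (\<And>s w. w \<in> space M \<Longrightarrow> E' s w = E s w) \<Longrightarrow>
    elem e' E'"

lemma elem_diff:
  assumes "elem e E" "elem e' E'"
  shows "elem (\<lambda>s w. e s w - e' s w) (\<lambda>s w. E s w - E' s w)"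
  using assms(2)
proof induction
  case zero
  then show ?case using assms(1) by simp
next
  case (add e' E' a \<xi> C)
  show ?case
    by (rule elem.on_space[OF elem.add[OF add.IH add.hyps(2), of "\<lambda>w. - \<xi> w" C]])
      (use add in \<open>auto simp: algebra_simps\<close>)
next
  case (on_space e' E' e'' E'')
  show ?case by (rule elem.on_space[OF on_space.IH]) (use on_space in auto)
qed

text \<open>The form in which stopped integrands and simple processes turn out to be
  elementary.\<close>

lemma elem_sum_term:
  assumes "elem e E" "finite V"
    and "\<And>v. v \<in> V \<Longrightarrow> 0 \<le> a v" "\<And>v. v \<in> V \<Longrightarrow> \<xi> v \<in> borel_measurable (G (a v))"
    and "\<And>v w. v \<in> V \<Longrightarrow> w \<in> space M \<Longrightarrow> \<bar>\<xi> v w\<bar> \<le> C"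
  shows "elem (\<lambda>s w. e s w + (\<Sum>v\<in>V. \<xi> v w * of_bool (a v < s)))
           (\<lambda>t w. E t w + (\<Sum>v\<in>V. \<xi> v w * (W t w - W (min t (a v)) w)))"
  using assms(2-)
proof (induction V)
  case empty
  then show ?case using assms(1) by simp
next
  case (insert v V)
  show ?case
    by (rule elem.on_space[OF elem.add[OF insert.IH, of "a v" "\<xi> v" C]])
      (use insert in \<open>auto simp: algebra_simps\<close>)
qed

lemma elem_bounded:
  assumes "elem e E"
  shows "\<exists>C. \<forall>s. \<forall>w\<in>space M. \<bar>e s w\<bar> \<le> C"
  using assms
proof induction
  case (add e E a \<xi> C)
  from add.IH obtain D where D: "\<And>s w. w \<in> space M \<Longrightarrow> \<bar>e s w\<bar> \<le> D" by auto
  have "\<bar>e s w + \<xi> w * of_bool (a < s)\<bar> \<le> D + C" if "w \<in> space M" for s w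
    using D[OF that, of s] add.hyps(4)[OF that] by (auto simp: of_bool_def)
  then show ?case by blast
qed auto

lemma elem_prog:
  assumes "elem e E"
  shows "prog e"
  using assms
proof induction
  case zero
  then show ?case by (simp add: prog_def)
next
  case (add e E a \<xi> C)
  show ?case unfolding prog_def
  proof (intro allI impI)
    fix t :: real assume t: "0 \<le> t"
    have 1[measurable]: "(\<lambda>(s, w). e s w * indicator {..t} s) \<in> borel_measurable (borel \<Otimes>\<^sub>M G t)"
      using add.IH t by (auto simp: prog_def)
    have 2[measurable]: "(\<lambda>(s, w). \<xi> w * of_bool (a < s) * indicator {..t} s) \<in> borel_measurable (borel \<Otimes>\<^sub>M G t)"
    proof (cases "a \<le> t")
      case True
      then have [measurable]: "\<xi> \<in> borel_measurable (G t)" using add meas_mono by blast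
      show ?thesis by measurable
    next
      case False
      then have "(\<lambda>(s, w). \<xi> w * of_bool (a < s) * indicator {..t} s) = (\<lambda>_. 0)"
        by (auto simp: fun_eq_iff indicator_def)
      then show ?thesis by simp
    qed
    have "(\<lambda>(s, w). (e s w + \<xi> w * of_bool (a < s)) * indicator {..t} s)
       = (\<lambda>z. (\<lambda>(s, w). e s w * indicator {..t} s) z + (\<lambda>(s, w). \<xi> w * of_bool (a < s) * indicator {..t} s) z)"
      by (auto simp: fun_eq_iff algebra_simps)
    then show "(\<lambda>(s, w). (e s w + \<xi> w * of_bool (a < s)) * indicator {..t} s) \<in> borel_measurable (borel \<Otimes>\<^sub>M G t)"
      using 1 2 by simp
  qed
next
  case (on_space e E e' E')
  have "(\<lambda>(s, w). e' s w * indicator {..t} s) \<in> borel_measurable (borel \<Otimes>\<^sub>M G t)" if "0 \<le> t" for t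
    by (rule measurable_cong[THEN iffD1, OF _ on_space.IH[unfolded prog_def, rule_format, OF that]])
      (use on_space that in \<open>auto simp: space_pair_measure\<close>)
  then show ?case unfolding prog_def by simp
qed

lemma prog_measurable:
  assumes "prog h"
  shows "(\<lambda>(s, w). h s w) \<in> borel_measurable (borel \<Otimes>\<^sub>M M)"
proof (rule borel_measurable_LIMSEQ_real)
  fix n :: nat
  \<comment> \<open>\<open>G n\<close> is coarser than M, so the identity is measurable in this
    direction.\<close>
  have id: "(\<lambda>z. z) \<in> measurable (borel \<Otimes>\<^sub>M M) (borel \<Otimes>\<^sub>M G (real n))"
    by (intro measurable_Pair[of fst _ _ snd, simplified] measurable_fst measurable_compose[OF measurable_snd] meas_GM[of "real n"]) auto
  show "(\<lambda>z. (\<lambda>(s, w). h s w * indicator {..real n} s) z) \<in> borel_measurable (borel \<Otimes>\<^sub>M M)"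
    using assms by (intro measurable_compose[OF id]) (auto simp: prog_def)
next
  fix z :: "real \<times> 'a"
  obtain s w where z: "z = (s, w)" by (cases z)
  obtain N :: nat where "s \<le> real N" using real_arch_simple by blast
  then have "\<forall>\<^sub>F n in sequentially. (\<lambda>(s, w). h s w * indicator {..real n} s) z = (\<lambda>(s, w). h s w) z"
    using z by (intro eventually_sequentiallyI[of N]) auto
  then show "(\<lambda>n. (\<lambda>(s, w). h s w * indicator {..real n} s) z) \<longlonglongrightarrow> (\<lambda>(s, w). h s w) z"
    by (rule tendsto_eventually)
qed

lemma elem_adapted:
  assumes "elem e E" "0 \<le> t"
  shows "E t \<in> borel_measurable (G t)"
  using assms(1)
proof induction
  case (add e E a \<xi> C)
  show ?case
  proof (cases "a \<le> t")
    case True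
    then have [measurable]: "\<xi> \<in> borel_measurable (G t)" using add meas_mono by blast
    have [measurable]: "W t \<in> borel_measurable (G t)" "W (min t a) \<in> borel_measurable (G t)"
      using assms(2) add.hyps W_adapted[of "min t a"] W_adapted[of t] meas_mono[of "min t a" t] by auto
    show ?thesis using add.IH by measurable
  next
    case False
    then show ?thesis using add.IH by (simp add: min_def)
  qed
next
  case (on_space e E e' E')
  show ?case
    by (rule measurable_cong[THEN iffD1, OF _ on_space.IH]) (use on_space assms(2) in auto)
qed simp

lemma elem_continuous:
  assumes "elem e E" "w \<in> space M"
  shows "continuous_on {0..} (\<lambda>t. E t w)"
  using assms(1)
proof induction
  case (add e E a \<xi> C)
  have "continuous_on {0..} (\<lambda>t. W (min t a) w)"
    using add.hyps by (intro continuous_on_compose2[OF W_cont[OF assms(2)]]) (auto intro!: continuous_intros)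
  then show ?case using add.IH W_cont[OF assms(2)] by (intro continuous_intros)
next
  case (on_space e E e' E')
  then show ?case using assms(2) by auto
qed simp

lemma elem_0:
  assumes "elem e E" "w \<in> space M"
  shows "E 0 w = 0"
  using assms by induction auto

section \<open>Moments, martingale property and isometry of elementary integrals\<close>

lemma elem_square_integrable:
  assumes "elem e E" "0 \<le> t"
  shows "integrable M (\<lambda>w. (E t w)\<^sup>2)"
  using assms(1)
proof induction
  case (add e E a \<xi> C)
  show ?case
  proof (cases "a \<le> t")
    case True
    have xm: "\<xi> \<in> borel_measurable M" using add meas_GM by blast
    have wm: "(\<lambda>w. W t w - W a w) \<in> borel_measurable M" using W_meas add.hyps assms(2) by auto
    have "integrable M (\<lambda>w. (\<xi> w)\<^sup>2)"
      using add.hyps xm by (intro integrable_const_bound[of _ "C\<^sup>2"] AE_I2) (auto simp: abs_le_square_iff[symmetric] intro: order_trans[OF _ abs_ge_self])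
    then have 1: "integrable M (\<lambda>w. (\<xi> w)\<^sup>2 * (W t w - W a w)\<^sup>2)"
      using add.hyps True assms by (intro incr_square) auto
    have em: "E t \<in> borel_measurable M"
      using elem_adapted[OF add.hyps(1) assms(2)] assms(2) meas_GM by blast
    have "integrable M (\<lambda>w. (E t w + \<xi> w * (W t w - W a w))\<^sup>2)"
      using xm wm 1 by (intro integrable_square_add(1)[OF em _ add.IH]) (simp_all add: power_mult_distrib)
    then show ?thesis using True by (simp add: min_absorb2)
  next
    case False
    then show ?thesis using add.IH by (simp add: min_def)
  qed
next
  case (on_space e E e' E')
  show ?case
    by (rule Bochner_Integration.integrable_cong[THEN iffD1, OF refl _ on_space.IH]) (use on_space in simp)
qed simp

lemma elem_measurable: "elem e E \<Longrightarrow> 0 \<le> t \<Longrightarrow> E t \<in> borel_measurable M"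
  by (rule meas_GM[OF _ elem_adapted])

lemma elem_integrable: "elem e E \<Longrightarrow> 0 \<le> t \<Longrightarrow> integrable M (E t)"
  by (rule integrable_of_square[OF elem_measurable elem_square_integrable])

text \<open>Testing with bounded weights known at time s expresses the martingale property without
  conditional expectations. As the integrand is built step by step, induction reduces the claim to a
  single Brownian increment.\<close>

lemma elem_weighted_mean:
  assumes "elem e E" "0 \<le> s" "s \<le> t" "\<zeta> \<in> borel_measurable (G s)" "\<And>w. w \<in> space M \<Longrightarrow> \<bar>\<zeta> w\<bar> \<le> C"
  shows "(\<integral>w. \<zeta> w * (E t w - E s w) \<partial>M) = 0"
  using assms(1)
proof induction
  case (add e E a \<xi> D)
  have z: "\<zeta> \<in> borel_measurable M" using assms meas_GM by blast
  have i: "integrable M (\<lambda>w. \<zeta> w * (E t w - E s w))"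
    using elem_integrable[OF add.hyps(1)] assms by (intro integrable_mult_bounded[OF _ z assms(5)]) auto
  show ?case
  proof (cases "a \<le> t")
    case True
    \<comment> \<open>On (s, t] the new step contributes only the increment of W over (b, t], and at
      time b both \<zeta> and \<xi> are known.\<close>
    define b where "b = max a s"
    have b: "0 \<le> b" "b \<le> t" "a \<le> b" "s \<le> b" using True assms by (auto simp: b_def)
    have m: "(\<lambda>w. \<zeta> w * \<xi> w) \<in> borel_measurable (G b)"
      using meas_mono[OF assms(2) b(4) assms(4)] meas_mono[OF add.hyps(2) b(3) add.hyps(3)] by simp
    have "integrable M (\<lambda>w. \<zeta> w * \<xi> w)"
    proof (rule integrable_mult_bounded[OF _ z assms(5)])
      show "integrable M \<xi>" using add.hyps meas_GM
        by (intro integrable_const_bound[of _ D]) auto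
    qed
    from incr_mean[OF b(1,2) m this]
    have j: "integrable M (\<lambda>w. \<zeta> w * \<xi> w * (W t w - W b w))" "(\<integral>w. \<zeta> w * \<xi> w * (W t w - W b w) \<partial>M) = 0"
      by auto
    have "\<zeta> w * (E t w + \<xi> w * (W t w - W (min t a) w) - (E s w + \<xi> w * (W s w - W (min s a) w)))
      = \<zeta> w * (E t w - E s w) + \<zeta> w * \<xi> w * (W t w - W b w)" for w
      using True assms(3) by (auto simp: b_def max_def min_def algebra_simps)
    then show ?thesis using i j add.IH by simp
  next
    case False
    then show ?thesis using add.IH assms(3) by (simp add: min_def)
  qed
next
  case (on_space e E e' E')
  then show ?case by (subst Bochner_Integration.integral_cong[OF refl]) auto
qed simp

lemma strip_integrable:
  assumes "prog e" "\<And>s w. w \<in> space M \<Longrightarrow> \<bar>e s w\<bar> \<le> C" "\<eta> \<in> borel_measurable M" "\<And>w. w \<in> space M \<Longrightarrow> \<bar>\<eta> w\<bar> \<le> D"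
  shows "integrable (lborel \<Otimes>\<^sub>M M) (\<lambda>(u, w). indicator {s<..t} u * (\<eta> w * e u w))"
    "integrable (lborel \<Otimes>\<^sub>M M) (\<lambda>(u, w). indicator {s<..t} u * (\<eta> w * (e u w)\<^sup>2))"
proof -
  note [measurable] = prog_measurable[OF assms(1)] assms(3)
  have D: "\<bar>e s w\<bar> \<le> \<bar>C\<bar>" if "w \<in> space M" for s w using assms(2)[OF that, of s] by linarith
  have E: "\<bar>\<eta> w\<bar> \<le> \<bar>D\<bar>" if "w \<in> space M" for w using assms(4)[OF that] by linarith
  show "integrable (lborel \<Otimes>\<^sub>M M) (\<lambda>(u, w). indicator {s<..t} u * (\<eta> w * e u w))"
    using integrable_strip[of "\<lambda>z. \<eta> (snd z) * (\<lambda>(u, w). e u w) z" "\<bar>D\<bar> * \<bar>C\<bar>" s t]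
    by (simp add: abs_mult mult_mono D E)
  show "integrable (lborel \<Otimes>\<^sub>M M) (\<lambda>(u, w). indicator {s<..t} u * (\<eta> w * (e u w)\<^sup>2))"
    using integrable_strip[of "\<lambda>z. \<eta> (snd z) * ((\<lambda>(u, w). e u w) z)\<^sup>2" "\<bar>D\<bar> * \<bar>C\<bar>\<^sup>2" s t]
    by (simp add: abs_mult mult_mono power_mono D E abs_le_square_iff[symmetric])
qed

text \<open>The mixed term that appears when a step is added in the proof of the isometry. Splitting
  at the time c at which the new step becomes active inside (b, t] leaves the square of an
  increment, which gives the time integral of \<xi>, and a product of increments over adjacent
  intervals, which has mean zero.\<close>

lemma elem_cross:
  assumes "elem e E" "0 \<le> b" "b \<le> t" "\<eta> \<in> borel_measurable (G b)" "\<And>w. w \<in> space M \<Longrightarrow> \<bar>\<eta> w\<bar> \<le> C"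
  shows "(\<integral>w. \<eta> w * (E t w - E b w) * (W t w - W b w) \<partial>M)
       = (\<integral>(u, w). indicator {b<..t} u * (\<eta> w * e u w) \<partial>(lborel \<Otimes>\<^sub>M M))"
  using assms(1)
proof induction
  case (add e E a \<xi> D)
  have z: "\<eta> \<in> borel_measurable M" using assms meas_GM by blast
  have wm: "W t \<in> borel_measurable M" "W b \<in> borel_measurable M" using W_meas assms by auto
  have wsq: "integrable M (\<lambda>w. (W t w - W b w)\<^sup>2)" if "0 \<le> b" "b \<le> t" for b t
    using that incr_moment(1)[of b t 2] by (cases "b = t") auto
  have i: "integrable M (\<lambda>w. \<eta> w * ((E t w - E b w) * (W t w - W b w)))"
  proof (rule integrable_mult_bounded[OF integrable_square_mult z assms(5)])
    have *: "0 \<le> t" using assms by simp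
    note em = elem_measurable[OF add.hyps(1) *] elem_measurable[OF add.hyps(1) assms(2)]
    show "(\<lambda>w. E t w - E b w) \<in> borel_measurable M" using em by simp
    show "(\<lambda>w. W t w - W b w) \<in> borel_measurable M" using wm by simp
    show "integrable M (\<lambda>w. (E t w - E b w)\<^sup>2)"
      by (rule integrable_square_add(2)[OF em elem_square_integrable[OF add.hyps(1) *] elem_square_integrable[OF add.hyps(1) assms(2)]])
  qed (use wsq[OF assms(2,3)] in simp_all)
  obtain B where B: "\<And>u w. w \<in> space M \<Longrightarrow> \<bar>e u w\<bar> \<le> B" using elem_bounded[OF add.hyps(1)] by blast
  have I: "integrable (lborel \<Otimes>\<^sub>M M) (\<lambda>(u, w). indicator {b<..t} u * (\<eta> w * e u w))"
    using strip_integrable[OF elem_prog[OF add.hyps(1)] B z assms(5)] by simp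
  show ?case
  proof (cases "a \<le> t")
    case True
    define c where "c = max a b"
    have c: "0 \<le> c" "c \<le> t" "a \<le> c" "b \<le> c" using True assms by (auto simp: c_def)
    have m: "(\<lambda>w. \<eta> w * \<xi> w) \<in> borel_measurable (G c)"
      using meas_mono[OF assms(2) c(4) assms(4)] meas_mono[OF add.hyps(2) c(3) add.hyps(3)] by simp
    have mx: "integrable M \<xi>" using add.hyps meas_GM by (intro integrable_const_bound[of _ D]) auto
    have int: "integrable M (\<lambda>w. \<eta> w * \<xi> w)" by (rule integrable_mult_bounded[OF mx z assms(5)])
    note J = incr_square[OF c(1,2) m int]
    \<comment> \<open>At time c the increment over (b, c] is known and acts as a coefficient of the
      increment over (c, t].\<close>
    have m2: "(\<lambda>w. \<eta> w * \<xi> w * (W c w - W b w)) \<in> borel_measurable (G c)"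
      using m W_adapted[OF c(1)] meas_mono[OF assms(2) c(4) W_adapted[OF assms(2)]] by simp
    have int2: "integrable M (\<lambda>w. \<eta> w * \<xi> w * (W c w - W b w))"
    proof -
      have "(\<lambda>w. W c w - W b w) \<in> borel_measurable M" using W_meas[OF c(1)] wm by simp
      from integrable_mult_bounded[OF integrable_of_square[OF this wsq[OF assms(2) c(4)]] borel_measurable_integrable[OF mx] add.hyps(4)]
      have "integrable M (\<lambda>w. \<xi> w * (W c w - W b w))" by simp
      from integrable_mult_bounded[OF this z assms(5)] show ?thesis by (simp add: mult.assoc)
    qed
    note K = incr_mean[OF c(1,2) m2 int2]
    have eq: "\<eta> w * (E t w + \<xi> w * (W t w - W (min t a) w) - (E b w + \<xi> w * (W b w - W (min b a) w))) * (W t w - W b w)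
      = \<eta> w * ((E t w - E b w) * (W t w - W b w)) + \<eta> w * \<xi> w * (W t w - W c w)\<^sup>2
        + \<eta> w * \<xi> w * (W c w - W b w) * (W t w - W c w)" for w
      using True assms(3) by (auto simp: c_def max_def min_def algebra_simps power2_eq_square)
    have "(\<integral>w. \<eta> w * (E t w + \<xi> w * (W t w - W (min t a) w) - (E b w + \<xi> w * (W b w - W (min b a) w))) * (W t w - W b w) \<partial>M)
      = (\<integral>w. \<eta> w * ((E t w - E b w) * (W t w - W b w)) \<partial>M) + (t - c) * (\<integral>w. \<eta> w * \<xi> w \<partial>M)"
      unfolding eq using i J K by simp
    also have "(t - c) * (\<integral>w. \<eta> w * \<xi> w \<partial>M) = (\<integral>(u, w). indicator {c<..t} u * (\<eta> w * \<xi> w) \<partial>(lborel \<Otimes>\<^sub>M M))"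
      using integral_strip_const[OF c(2) int] by simp
    also have "(\<integral>w. \<eta> w * ((E t w - E b w) * (W t w - W b w)) \<partial>M) = (\<integral>(u, w). indicator {b<..t} u * (\<eta> w * e u w) \<partial>(lborel \<Otimes>\<^sub>M M))"
      using add.IH by (simp add: mult.assoc)
    also have "\<dots> + (\<integral>(u, w). indicator {c<..t} u * (\<eta> w * \<xi> w) \<partial>(lborel \<Otimes>\<^sub>M M))
       = (\<integral>z. (\<lambda>(u, w). indicator {b<..t} u * (\<eta> w * e u w)) z + (\<lambda>(u, w). indicator {c<..t} u * (\<eta> w * \<xi> w)) z \<partial>(lborel \<Otimes>\<^sub>M M))"
    proof -
      have "\<bar>\<eta> w * \<xi> w\<bar> \<le> C * D" if "w \<in> space M" for w
        using assms(5)[OF that] add.hyps(4)[OF that] by (auto simp: abs_mult intro!: mult_mono)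
      then have "integrable (lborel \<Otimes>\<^sub>M M) (\<lambda>(u, w). indicator {c<..t} u * (\<eta> w * \<xi> w))"
        using integrable_strip[of "\<lambda>z. \<eta> (snd z) * \<xi> (snd z)" "C * D" c t] mx z by simp
      then show ?thesis using I by simp
    qed
    also have "\<dots> = (\<integral>(u, w). indicator {b<..t} u * (\<eta> w * (e u w + \<xi> w * of_bool (a < u))) \<partial>(lborel \<Otimes>\<^sub>M M))"
      by (intro Bochner_Integration.integral_cong) (auto simp: c_def indicator_def algebra_simps)
    finally show ?thesis .
  next
    case False
    have "(\<integral>(u, w). indicator {b<..t} u * (\<eta> w * (e u w + \<xi> w * of_bool (a < u))) \<partial>(lborel \<Otimes>\<^sub>M M))
       = (\<integral>(u, w). indicator {b<..t} u * (\<eta> w * e u w) \<partial>(lborel \<Otimes>\<^sub>M M))"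
      using False by (intro Bochner_Integration.integral_cong) (auto simp: indicator_def)
    then show ?thesis using add.IH assms(3) False by (simp add: min_def)
  qed
next
  case (on_space e E e' E')
  have "(\<integral>w. \<eta> w * (E' t w - E' b w) * (W t w - W b w) \<partial>M) = (\<integral>w. \<eta> w * (E t w - E b w) * (W t w - W b w) \<partial>M)"
    using on_space by (intro Bochner_Integration.integral_cong) auto
  moreover have "(\<integral>(u, w). indicator {b<..t} u * (\<eta> w * e' u w) \<partial>(lborel \<Otimes>\<^sub>M M)) = (\<integral>(u, w). indicator {b<..t} u * (\<eta> w * e u w) \<partial>(lborel \<Otimes>\<^sub>M M))"
    using on_space by (intro Bochner_Integration.integral_cong) (auto simp: space_pair_measure)
  ultimately show ?case using on_space by simp
qed simp

text \<open>Expanding the square after adding a step, the old part is the induction hypothesis, the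
  mixed part over (b, t] is \<open>elem_cross\<close>, the mixed part before b has mean zero, and
  the new square is \<open>incr_square\<close>. The weight \<zeta> makes this a conditional
  isometry, which is what Riemann sums with adapted coefficients call for.\<close>

lemma elem_isometry:
  assumes "elem e E" "0 \<le> s" "s \<le> t" "\<zeta> \<in> borel_measurable (G s)" "\<And>w. w \<in> space M \<Longrightarrow> \<bar>\<zeta> w\<bar> \<le> C"
  shows "(\<integral>w. \<zeta> w * (E t w - E s w)\<^sup>2 \<partial>M)
       = (\<integral>(u, w). indicator {s<..t} u * (\<zeta> w * (e u w)\<^sup>2) \<partial>(lborel \<Otimes>\<^sub>M M))"
  using assms(1)
proof induction
  case (add e E a \<xi> D)
  have z: "\<zeta> \<in> borel_measurable M" using assms meas_GM by blast
  have sq: "integrable M (\<lambda>w. (E v w - E u w)\<^sup>2)" if "0 \<le> u" "0 \<le> v" for u v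
    using that elem_measurable[OF add.hyps(1)] elem_square_integrable[OF add.hyps(1)]
    by (simp add: integrable_square_add(2))
  have i: "integrable M (\<lambda>w. \<zeta> w * (E t w - E s w)\<^sup>2)"
    using assms by (intro integrable_mult_bounded[OF _ z assms(5)] sq) auto
  obtain B where B: "\<And>u w. w \<in> space M \<Longrightarrow> \<bar>e u w\<bar> \<le> B" using elem_bounded[OF add.hyps(1)] by blast
  have I: "integrable (lborel \<Otimes>\<^sub>M M) (\<lambda>(u, w). indicator {s<..t} u * (\<zeta> w * (e u w)\<^sup>2))"
    using strip_integrable[OF elem_prog[OF add.hyps(1)] B z assms(5)] by simp
  show ?case
  proof (cases "a \<le> t")
    case True
    define b where "b = max a s"
    have b: "0 \<le> b" "b \<le> t" "a \<le> b" "s \<le> b" using True assms by (auto simp: b_def)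
    have bi: "integrable M f" if "f \<in> borel_measurable M" "\<And>w. w \<in> space M \<Longrightarrow> \<bar>f w\<bar> \<le> B" for f :: "'a \<Rightarrow> real" and B
      using that by (intro integrable_const_bound[of _ B]) auto
    have xm: "\<xi> \<in> borel_measurable M" using add.hyps meas_GM by blast
    have zb: "\<zeta> \<in> borel_measurable (G b)" and xb: "\<xi> \<in> borel_measurable (G b)"
      using meas_mono[OF assms(2) b(4) assms(4)] meas_mono[OF add.hyps(2) b(3) add.hyps(3)] by auto
    have zx: "\<bar>\<zeta> w * \<xi> w\<bar> \<le> C * D" if "w \<in> space M" for w
      using assms(5)[OF that] add.hyps(4)[OF that] by (auto simp: abs_mult intro!: mult_mono)
    have zxx: "\<bar>\<zeta> w * (\<xi> w)\<^sup>2\<bar> \<le> C * D * D" if "w \<in> space M" for w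
      using mult_mono[OF zx[OF that] add.hyps(4)[OF that]] order_trans[OF abs_ge_zero zx[OF that]]
      by (auto simp: abs_mult power2_eq_square mult.assoc)
    have sqw: "integrable M (\<lambda>w. (W t w - W b w)\<^sup>2)"
      using b incr_moment(1)[of b t 2] by (cases "b = t") auto
    have wm: "W t \<in> borel_measurable M" "W b \<in> borel_measurable M" using W_meas b by auto
    have em: "E u \<in> borel_measurable M" if "0 \<le> u" for u using elem_measurable[OF add.hyps(1) that] .
    have zxb: "(\<lambda>w. \<zeta> w * \<xi> w) \<in> borel_measurable (G b)" using zb xb by simp
    have zxm: "(\<lambda>w. \<zeta> w * \<xi> w) \<in> borel_measurable M" using z xm by simp
    have J1: "integrable M (\<lambda>w. \<zeta> w * \<xi> w * ((E t w - E b w) * (W t w - W b w)))"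
      using b em wm by (intro integrable_mult_bounded[OF integrable_square_mult zxm zx] sqw sq) auto
    have J1v: "(\<integral>w. \<zeta> w * \<xi> w * ((E t w - E b w) * (W t w - W b w)) \<partial>M)
       = (\<integral>(u, w). indicator {b<..t} u * (\<zeta> w * \<xi> w * e u w) \<partial>(lborel \<Otimes>\<^sub>M M))"
      using elem_cross[OF add.hyps(1) b(1,2) zxb zx] by (simp add: mult.assoc)
    \<comment> \<open>What E has accumulated before b is known at b and multiplies a centred
      increment.\<close>
    have m2: "(\<lambda>w. \<zeta> w * \<xi> w * (E b w - E s w)) \<in> borel_measurable (G b)"
      using zxb elem_adapted[OF add.hyps(1) b(1)] meas_mono[OF assms(2) b(4) elem_adapted[OF add.hyps(1) assms(2)]] by simp
    have "integrable M (\<lambda>w. \<zeta> w * \<xi> w * (E b w - E s w))"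
      using elem_integrable[OF add.hyps(1)] b assms by (intro integrable_mult_bounded[OF _ zxm zx]) auto
    note J2 = incr_mean[OF b(1,2) m2 this]
    have "integrable M (\<lambda>w. \<zeta> w * (\<xi> w)\<^sup>2)" using z xm by (intro bi[OF _ zxx]) auto
    note J3 = incr_square[OF b(1,2) _ this] and I3 = this
    have J3m: "(\<lambda>w. \<zeta> w * (\<xi> w)\<^sup>2) \<in> borel_measurable (G b)" using zb xb by simp
    have eq: "\<zeta> w * (E t w + \<xi> w * (W t w - W (min t a) w) - (E s w + \<xi> w * (W s w - W (min s a) w)))\<^sup>2
      = \<zeta> w * (E t w - E s w)\<^sup>2 + 2 * (\<zeta> w * \<xi> w * ((E t w - E b w) * (W t w - W b w)))
        + 2 * (\<zeta> w * \<xi> w * (E b w - E s w) * (W t w - W b w)) + \<zeta> w * (\<xi> w)\<^sup>2 * (W t w - W b w)\<^sup>2" for w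
      using True assms(3) by (auto simp: b_def max_def min_def algebra_simps power2_eq_square)
    have "(\<integral>w. \<zeta> w * (E t w + \<xi> w * (W t w - W (min t a) w) - (E s w + \<xi> w * (W s w - W (min s a) w)))\<^sup>2 \<partial>M)
      = (\<integral>w. \<zeta> w * (E t w - E s w)\<^sup>2 \<partial>M) + 2 * (\<integral>(u, w). indicator {b<..t} u * (\<zeta> w * \<xi> w * e u w) \<partial>(lborel \<Otimes>\<^sub>M M))
        + (t - b) * (\<integral>w. \<zeta> w * (\<xi> w)\<^sup>2 \<partial>M)"
      unfolding eq using i J1 J2 J3[OF J3m] J1v by simp
    also have "(t - b) * (\<integral>w. \<zeta> w * (\<xi> w)\<^sup>2 \<partial>M) = (\<integral>(u, w). indicator {b<..t} u * (\<zeta> w * (\<xi> w)\<^sup>2) \<partial>(lborel \<Otimes>\<^sub>M M))"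
      using integral_strip_const[OF b(2) I3] by simp
    also have "(\<integral>w. \<zeta> w * (E t w - E s w)\<^sup>2 \<partial>M) = (\<integral>(u, w). indicator {s<..t} u * (\<zeta> w * (e u w)\<^sup>2) \<partial>(lborel \<Otimes>\<^sub>M M))"
      using add.IH .
    also have "\<dots> + 2 * (\<integral>(u, w). indicator {b<..t} u * (\<zeta> w * \<xi> w * e u w) \<partial>(lborel \<Otimes>\<^sub>M M))
       + (\<integral>(u, w). indicator {b<..t} u * (\<zeta> w * (\<xi> w)\<^sup>2) \<partial>(lborel \<Otimes>\<^sub>M M))
       = (\<integral>z. (\<lambda>(u, w). indicator {s<..t} u * (\<zeta> w * (e u w)\<^sup>2)) z
           + 2 * (\<lambda>(u, w). indicator {b<..t} u * (\<zeta> w * \<xi> w * e u w)) z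
           + (\<lambda>(u, w). indicator {b<..t} u * (\<zeta> w * (\<xi> w)\<^sup>2)) z \<partial>(lborel \<Otimes>\<^sub>M M))"
    proof -
      have "integrable (lborel \<Otimes>\<^sub>M M) (\<lambda>(u, w). indicator {b<..t} u * (\<zeta> w * \<xi> w * e u w))"
        using strip_integrable(1)[OF elem_prog[OF add.hyps(1)] B zxm zx] by simp
      moreover have "integrable (lborel \<Otimes>\<^sub>M M) (\<lambda>(u, w). indicator {b<..t} u * (\<zeta> w * (\<xi> w)\<^sup>2))"
        using integrable_strip[of "\<lambda>z. \<zeta> (snd z) * (\<xi> (snd z))\<^sup>2" "C * D * D" b t] z xm zxx by simp
      ultimately show ?thesis using I by simp
    qed
    also have "\<dots> = (\<integral>(u, w). indicator {s<..t} u * (\<zeta> w * (e u w + \<xi> w * of_bool (a < u))\<^sup>2) \<partial>(lborel \<Otimes>\<^sub>M M))"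
      by (intro Bochner_Integration.integral_cong)
        (auto simp: b_def indicator_def algebra_simps power2_eq_square)
    finally show ?thesis .
  next
    case False
    have "(\<integral>(u, w). indicator {s<..t} u * (\<zeta> w * (e u w + \<xi> w * of_bool (a < u))\<^sup>2) \<partial>(lborel \<Otimes>\<^sub>M M))
       = (\<integral>(u, w). indicator {s<..t} u * (\<zeta> w * (e u w)\<^sup>2) \<partial>(lborel \<Otimes>\<^sub>M M))"
      using False by (intro Bochner_Integration.integral_cong) (auto simp: indicator_def)
    then show ?thesis using add.IH assms(3) False by (simp add: min_def)
  qed
next
  case (on_space e E e' E')
  have "(\<integral>w. \<zeta> w * (E' t w - E' s w)\<^sup>2 \<partial>M) = (\<integral>w. \<zeta> w * (E t w - E s w)\<^sup>2 \<partial>M)"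
    using on_space by (intro Bochner_Integration.integral_cong) auto
  moreover have "(\<integral>(u, w). indicator {s<..t} u * (\<zeta> w * (e' u w)\<^sup>2) \<partial>(lborel \<Otimes>\<^sub>M M)) = (\<integral>(u, w). indicator {s<..t} u * (\<zeta> w * (e u w)\<^sup>2) \<partial>(lborel \<Otimes>\<^sub>M M))"
    using on_space by (intro Bochner_Integration.integral_cong) (auto simp: space_pair_measure)
  ultimately show ?case using on_space by simp
qed simp

end

section \<open>Optional times\<close>

lemma floor_grid:
  assumes "0 < (N :: real)"
  shows "u - 1 / N \<le> real_of_int \<lfloor>u * N\<rfloor> / N" "real_of_int \<lfloor>u * N\<rfloor> / N \<le> u"
proof -
  have "(u * N - 1) / N \<le> real_of_int \<lfloor>u * N\<rfloor> / N"
    using assms real_of_int_floor_ge_diff_one[of "u * N"] by (intro divide_right_mono) auto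
  then show "u - 1 / N \<le> real_of_int \<lfloor>u * N\<rfloor> / N" using assms by (simp add: diff_divide_distrib)
  show "real_of_int \<lfloor>u * N\<rfloor> / N \<le> u"
    using assms by (simp only: pos_divide_le_eq of_int_floor_le)
qed

lemma floor_grid_tendsto: "(\<lambda>n. real_of_int \<lfloor>u * real (Suc n)\<rfloor> / real (Suc n)) \<longlonglongrightarrow> u"
proof (rule tendsto_sandwich)
  show "\<forall>\<^sub>F n in sequentially. u - 1 / real (Suc n) \<le> real_of_int \<lfloor>u * real (Suc n)\<rfloor> / real (Suc n)"
    "\<forall>\<^sub>F n in sequentially. real_of_int \<lfloor>u * real (Suc n)\<rfloor> / real (Suc n) \<le> u"
    by (rule always_eventually, rule allI, rule floor_grid, rule of_nat_0_less_iff[THEN iffD2], rule zero_less_Suc)+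
  show "(\<lambda>n. u - 1 / real (Suc n)) \<longlonglongrightarrow> u"
    using tendsto_diff[OF tendsto_const LIMSEQ_inverse_real_of_nat, of u] by (simp add: inverse_eq_divide)
qed (rule tendsto_const)

context bm_filtration begin

text \<open>Optional times: \<open>G\<close> is not assumed to be right-continuous, hence the strict inequality.\<close>

definition opt :: "('a \<Rightarrow> real) \<Rightarrow> bool" where
  "opt T \<longleftrightarrow> (\<forall>w\<in>space M. 0 \<le> T w) \<and> (\<forall>t\<ge>0. {w \<in> space M. T w < t} \<in> sets (G t))"

lemma opt_nonneg: "opt T \<Longrightarrow> w \<in> space M \<Longrightarrow> 0 \<le> T w"
  by (simp add: opt_def)

lemma space_in_G: "0 \<le> t \<Longrightarrow> space M \<in> sets (G t)"
  by (metis sets.top space_G)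

lemma opt_const:
  assumes "0 \<le> c"
  shows "opt (\<lambda>_. c)"
  using assms space_in_G unfolding opt_def by simp

lemma opt_min:
  assumes "opt S" "opt T"
  shows "opt (\<lambda>w. min (S w) (T w))"
proof -
  have "{w \<in> space M. min (S w) (T w) < t} = {w \<in> space M. S w < t} \<union> {w \<in> space M. T w < t}" for t
    by (auto simp: min_less_iff_disj)
  then show ?thesis using assms unfolding opt_def by (simp add: sets.Un)
qed

text \<open>Only values up to t have to be told apart, and for u \<le> t the event {T < u} is
  already known at time u. Strict events thus suffice for progressive measurability of stopped
  processes.\<close>

lemma opt_min_adapted:
  assumes "opt T" "0 \<le> t"
  shows "(\<lambda>w. min t (T w)) \<in> borel_measurable (G t)"
  unfolding borel_measurable_iff_less
proof
  fix u :: real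
  show "{w \<in> space (G t). min t (T w) < u} \<in> sets (G t)"
  proof (cases "u \<le> t")
    case True
    show ?thesis
    proof (cases "0 \<le> u")
      case u: True
      have "{w \<in> space (G t). min t (T w) < u} = {w \<in> space M. T w < u}"
        using True assms(2) by (auto simp: min_less_iff_disj)
      moreover have "{w \<in> space M. T w < u} \<in> sets (G u)" using assms(1) u by (simp add: opt_def)
      ultimately show ?thesis using u True sets_mono[of u t] by metis
    next
      case False
      then have "{w \<in> space (G t). min t (T w) < u} = {}"
        using opt_nonneg[OF assms(1)] assms(2) by fastforce
      then show ?thesis by (metis sets.empty_sets)
    qed
  next
    case False
    then have "{w \<in> space (G t). min t (T w) < u} = space (G t)" by auto
    then show ?thesis by simp
  qed
qed

lemma opt_measurable:
  assumes "opt T"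
  shows "T \<in> borel_measurable M"
  unfolding borel_measurable_iff_less
proof
  fix u :: real
  show "{w \<in> space M. T w < u} \<in> sets M"
  proof (cases "0 \<le> u")
    case True
    then have "{w \<in> space M. T w < u} \<in> sets (G u)" using assms by (simp add: opt_def)
    then show ?thesis by (rule sets_GM[OF True])
  next
    case False
    then have "{w \<in> space M. T w < u} = {}"
      using opt_nonneg[OF assms(1)] by fastforce
    then show ?thesis by (metis sets.empty_sets)
  qed
qed

section \<open>Operations on progressive processes and evaluation at optional times\<close>

lemma progI:
  assumes "\<And>t. 0 \<le> t \<Longrightarrow> (\<lambda>z. h (fst z) (snd z) * indicator {..t} (fst z)) \<in> borel_measurable (borel \<Otimes>\<^sub>M G t)"
  shows "prog h"
  using assms by (simp add: prog_def case_prod_beta')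

lemma progD:
  assumes "prog h" "0 \<le> t"
  shows "(\<lambda>z. h (fst z) (snd z) * indicator {..t} (fst z)) \<in> borel_measurable (borel \<Otimes>\<^sub>M G t)"
  using assms by (simp add: prog_def case_prod_beta')

lemma prog_mult:
  assumes "prog h" "prog k"
  shows "prog (\<lambda>s w. h s w * k s w)"
proof (rule progI)
  fix t :: real assume t: "0 \<le> t"
  have "(\<lambda>z. (h (fst z) (snd z) * indicator {..t} (fst z)) * (k (fst z) (snd z) * indicator {..t} (fst z))) \<in> borel_measurable (borel \<Otimes>\<^sub>M G t)"
    by (intro borel_measurable_times progD assms t)
  also have "(\<lambda>z. (h (fst z) (snd z) * indicator {..t} (fst z)) * (k (fst z) (snd z) * indicator {..t} (fst z)))
     = (\<lambda>z. h (fst z) (snd z) * k (fst z) (snd z) * indicator {..t} (fst z) :: real)"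
    by (auto simp: fun_eq_iff indicator_def)
  finally show "(\<lambda>z. h (fst z) (snd z) * k (fst z) (snd z) * indicator {..t} (fst z)) \<in> borel_measurable (borel \<Otimes>\<^sub>M G t)" .
qed

lemma prog_add:
  assumes "prog h" "prog k"
  shows "prog (\<lambda>s w. h s w + k s w)"
proof (rule progI)
  fix t :: real assume t: "0 \<le> t"
  show "(\<lambda>z. (h (fst z) (snd z) + k (fst z) (snd z)) * indicator {..t} (fst z)) \<in> borel_measurable (borel \<Otimes>\<^sub>M G t)"
    using borel_measurable_add[OF progD[OF assms(1) t] progD[OF assms(2) t]] by (simp add: algebra_simps)
qed

lemma prog_diff:
  assumes "prog h" "prog k"
  shows "prog (\<lambda>s w. h s w - k s w)"
proof (rule progI)
  fix t :: real assume t: "0 \<le> t"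
  show "(\<lambda>z. (h (fst z) (snd z) - k (fst z) (snd z)) * indicator {..t} (fst z)) \<in> borel_measurable (borel \<Otimes>\<^sub>M G t)"
    using borel_measurable_diff[OF progD[OF assms(1) t] progD[OF assms(2) t]] by (simp add: algebra_simps)
qed

lemma prog_compose:
  assumes "prog h" and [measurable]: "f \<in> borel_measurable borel"
  shows "prog (\<lambda>s w. f (h s w))"
proof (rule progI)
  fix t :: real assume t: "0 \<le> t"
  note [measurable] = progD[OF assms(1) t]
  have "(\<lambda>z. f (h (fst z) (snd z) * indicator {..t} (fst z)) * indicator {..t} (fst z)) \<in> borel_measurable (borel \<Otimes>\<^sub>M G t)"
    by measurable
  also have "(\<lambda>z. f (h (fst z) (snd z) * indicator {..t} (fst z)) * indicator {..t} (fst z)) = (\<lambda>z. f (h (fst z) (snd z)) * indicator {..t} (fst z))"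
    by (auto simp: fun_eq_iff indicator_def)
  finally show "(\<lambda>z. f (h (fst z) (snd z)) * indicator {..t} (fst z)) \<in> borel_measurable (borel \<Otimes>\<^sub>M G t)" .
qed

lemma prog_before:
  assumes "opt T"
  shows "prog (\<lambda>s w. of_bool (s \<le> T w))"
proof (rule progI)
  fix t :: real assume t: "0 \<le> t"
  note [measurable] = opt_min_adapted[OF assms t]
  have "(\<lambda>z. of_bool (fst z \<le> min t (T (snd z))) :: real) \<in> borel_measurable (borel \<Otimes>\<^sub>M G t)"
    by measurable
  also have "(\<lambda>z. of_bool (fst z \<le> min t (T (snd z)))) = (\<lambda>z. of_bool (fst z \<le> T (snd z)) * indicator {..t} (fst z) :: real)"
    by (auto simp: fun_eq_iff indicator_def)
  finally show "(\<lambda>z. of_bool (fst z \<le> T (snd z)) * indicator {..t} (fst z) :: real) \<in> borel_measurable (borel \<Otimes>\<^sub>M G t)" .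
qed

lemma prog_stopped:
  assumes "prog h" "opt T" "0 \<le> t"
  shows "(\<lambda>w. h (min t (T w)) w) \<in> borel_measurable (G t)"
proof -
  note [measurable] = opt_min_adapted[OF assms(2,3)]
  have m: "(\<lambda>(s, w). h s w * indicator {..t} s) \<in> borel_measurable (borel \<Otimes>\<^sub>M G t)"
    using assms by (simp add: prog_def)
  have "(\<lambda>w. (min t (T w), w)) \<in> measurable (G t) (borel \<Otimes>\<^sub>M G t)" by measurable
  from measurable_compose[OF this m] show ?thesis by simp
qed

lemma prog_adapted:
  assumes "prog h" "0 \<le> t"
  shows "h t \<in> borel_measurable (G t)"
  using prog_stopped[OF assms(1) opt_const[OF assms(2)] assms(2)] by simp

text \<open>Rounding time down to a grid uses values from the past only, and continuity recovers the
  process in the limit. Times are clamped at 0 because continuity is known on [0, \<infinity>),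
  while progressive measurability is stated for all real times.\<close>

lemma prog_of_continuous:
  assumes ad: "\<And>t. 0 \<le> t \<Longrightarrow> X t \<in> borel_measurable (G t)"
    and cont: "\<And>w. w \<in> space M \<Longrightarrow> continuous_on {0..} (\<lambda>t. X t w)"
  shows "prog (\<lambda>s w. X (max 0 s) w)"
  unfolding prog_def
proof (intro allI impI)
  fix t :: real assume t: "0 \<le> t"
  \<comment> \<open>The cap at t makes the value at every grid point measurable for
    \<open>G t\<close>; it is inactive when s \<le> t.\<close>
  define q :: "nat \<Rightarrow> nat \<Rightarrow> real" where "q n j = min t (real j / real (Suc n))" for n j
  define g :: "nat \<Rightarrow> real \<Rightarrow> nat" where "g n s = nat \<lfloor>max 0 s * real (Suc n)\<rfloor>" for n s
  have q: "0 \<le> q n j" "q n j \<le> t" for n j using t by (auto simp: q_def)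
  have gm: "(\<lambda>z. g n (fst (z :: real \<times> 'a))) \<in> measurable (borel \<Otimes>\<^sub>M G t) (count_space UNIV)" for n
    unfolding g_def by measurable
  have m: "(\<lambda>z. X (q n (g n (fst (z :: real \<times> 'a)))) (snd z) * indicator {..t} (fst z)) \<in> borel_measurable (borel \<Otimes>\<^sub>M G t)" for n
  proof -
    have xm: "(\<lambda>z. X (q n j) (snd z)) \<in> borel_measurable (borel \<Otimes>\<^sub>M G t)" for j
      by (rule measurable_compose[OF measurable_snd meas_mono[OF q ad[OF q(1)]]])
    have "(\<lambda>z. X (q n (g n (fst (z :: real \<times> 'a)))) (snd z)) \<in> borel_measurable (borel \<Otimes>\<^sub>M G t)"
      by (rule measurable_compose_countable'[OF xm gm]) auto
    then show ?thesis by measurable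
  qed
  have "(\<lambda>z. X (max 0 (fst z)) (snd z) * indicator {..t} (fst z)) \<in> borel_measurable (borel \<Otimes>\<^sub>M G t)"
  proof (rule borel_measurable_LIMSEQ_real[OF _ m])
    fix z :: "real \<times> 'a" assume "z \<in> space (borel \<Otimes>\<^sub>M G t)"
    then obtain s w where z: "z = (s, w)" "w \<in> space M" using t by (auto simp: space_pair_measure)
    show "(\<lambda>n. X (q n (g n (fst z))) (snd z) * indicator {..t} (fst z)) \<longlonglongrightarrow> X (max 0 (fst z)) (snd z) * indicator {..t} (fst z)"
    proof (cases "s \<le> t")
      case True
      define u where "u = max 0 s"
      have u: "0 \<le> u" "u \<le> t" using True t by (auto simp: u_def)
      from tendsto_min[OF tendsto_const[of t] floor_grid_tendsto[of u]]
      have "(\<lambda>n. min t (real_of_int \<lfloor>u * real (Suc n)\<rfloor> / real (Suc n))) \<longlonglongrightarrow> min t u"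
        by simp
      moreover have "min t (real_of_int \<lfloor>u * real (Suc n)\<rfloor> / real (Suc n)) = q n (g n s)" for n
        using u(1) by (simp add: q_def g_def u_def[symmetric] of_nat_nat)
      ultimately have "(\<lambda>n. q n (g n s)) \<longlonglongrightarrow> u" using u by simp
      then have "(\<lambda>n. X (q n (g n s)) w) \<longlonglongrightarrow> X u w"
        by (rule continuous_on_tendsto_compose[OF cont[OF z(2)]]) (simp_all add: q u)
      then show ?thesis using z True by (simp add: u_def)
    qed (use z in simp)
  qed
  then show "(\<lambda>(s, w). X (max 0 s) w * indicator {..t} s) \<in> borel_measurable (borel \<Otimes>\<^sub>M G t)"
    by (simp add: case_prod_beta')
qed

lemma prog_nn_integral:
  assumes "prog h" "0 \<le> t"
  shows "(\<lambda>w. \<integral>\<^sup>+s\<in>{0..t}. ennreal (h s w) \<partial>lborel) \<in> borel_measurable (G t)"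
proof -
  have [measurable]: "(\<lambda>z. h (snd z) (fst z) * indicator {..t} (snd z)) \<in> borel_measurable (G t \<Otimes>\<^sub>M borel)"
    using measurable_compose[OF measurable_pair_swap' progD[OF assms]] by (simp add: case_prod_beta')
  have "(\<lambda>w. \<integral>\<^sup>+s. ennreal (h s w * indicator {..t} s) * indicator {0..t} s \<partial>lborel) \<in> borel_measurable (G t)"
    by (rule sigma_finite_measure.borel_measurable_nn_integral) (unfold_locales, measurable)
  also have "(\<lambda>w. \<integral>\<^sup>+s. ennreal (h s w * indicator {..t} s) * indicator {0..t} s \<partial>lborel)
     = (\<lambda>w. \<integral>\<^sup>+s\<in>{0..t}. ennreal (h s w) \<partial>lborel)"
    by (rule ext, rule nn_integral_cong) (auto simp: indicator_def)
  finally show ?thesis .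
qed

lemma prog_lebesgue_integral:
  assumes "prog h" "0 \<le> t"
  shows "(\<lambda>w. LINT s:{0..t}|lborel. h s w) \<in> borel_measurable (G t)"
proof -
  have [measurable]: "(\<lambda>z. h (snd z) (fst z) * indicator {..t} (snd z)) \<in> borel_measurable (G t \<Otimes>\<^sub>M borel)"
    using measurable_compose[OF measurable_pair_swap' progD[OF assms]] by (simp add: case_prod_beta')
  have "(\<lambda>w. \<integral>s. (h s w * indicator {..t} s) * indicator {0..t} s \<partial>lborel) \<in> borel_measurable (G t)"
    by (rule sigma_finite_measure.borel_measurable_lebesgue_integral) (unfold_locales, measurable)
  also have "(\<lambda>w. \<integral>s. (h s w * indicator {..t} s) * indicator {0..t} s \<partial>lborel)
     = (\<lambda>w. LINT s:{0..t}|lborel. h s w)"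
    unfolding set_lebesgue_integral_def
    by (rule ext, rule Bochner_Integration.integral_cong) (auto simp: indicator_def)
  finally show ?thesis .
qed

text \<open>Rounds up to the next grid point, strictly so even on the grid. Only {T < v} is known at
  time v, and with this convention the rounded time equals v precisely on {T < v} minus {T < v -
  1/m}.\<close>

definition disc :: "real \<Rightarrow> ('a \<Rightarrow> real) \<Rightarrow> 'a \<Rightarrow> real" where
  "disc m T w = (real_of_int \<lfloor>T w * m\<rfloor> + 1) / m"

lemma disc_bounds:
  assumes "0 < m"
  shows "T w < disc m T w" "disc m T w \<le> T w + 1 / m"
proof -
  have "T w * m < real_of_int \<lfloor>T w * m\<rfloor> + 1" by linarith
  then show "T w < disc m T w" using assms by (simp add: disc_def pos_less_divide_eq)
  have "real_of_int \<lfloor>T w * m\<rfloor> + 1 \<le> T w * m + 1" by linarith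
  then show "disc m T w \<le> T w + 1 / m" using assms by (simp add: disc_def field_simps)
qed

lemma disc_finite:
  assumes "opt T" "\<And>w. w \<in> space M \<Longrightarrow> T w \<le> c" "0 < m"
  obtains V where "finite V" "\<And>v. v \<in> V \<Longrightarrow> 0 \<le> v" "\<And>w. w \<in> space M \<Longrightarrow> disc m T w \<in> V"
    "\<And>v. v \<in> V \<Longrightarrow> {w \<in> space M. disc m T w = v} \<in> sets (G v)"
proof
  define V where "V = (\<lambda>j::nat. (real j + 1) / m) ` {..nat \<lfloor>c * m\<rfloor>}"
  show "finite V" by (simp add: V_def)
  show "0 \<le> v" if "v \<in> V" for v using that assms(3) by (auto simp: V_def)
  show "disc m T w \<in> V" if wM: "w \<in> space M" for w
  proof -
    have "0 \<le> T w * m" "T w * m \<le> c * m" using opt_nonneg[OF assms(1) wM] assms(2)[OF wM] assms(3) by auto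
    then have "0 \<le> \<lfloor>T w * m\<rfloor>" "\<lfloor>T w * m\<rfloor> \<le> \<lfloor>c * m\<rfloor>" by (auto intro: floor_mono)
    then show ?thesis unfolding V_def disc_def
      by (intro image_eqI[of _ _ "nat \<lfloor>T w * m\<rfloor>"]) auto
  qed
  show "{w \<in> space M. disc m T w = v} \<in> sets (G v)" if "v \<in> V" for v
  proof -
    from that obtain j :: nat where v: "v = (real j + 1) / m" by (auto simp: V_def)
    have "disc m T w = v \<longleftrightarrow> T w < v \<and> \<not> T w < real j / m" for w
    proof -
      have "disc m T w = v \<longleftrightarrow> real_of_int \<lfloor>T w * m\<rfloor> = real j" using assms(3) by (simp add: disc_def v)
      also have "\<dots> \<longleftrightarrow> \<lfloor>T w * m\<rfloor> = int j" by linarith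
      also have "\<dots> \<longleftrightarrow> real j \<le> T w * m \<and> T w * m < real j + 1" by (simp add: floor_eq_iff)
      finally show ?thesis using assms(3) by (auto simp: v field_simps)
    qed
    then have "{w \<in> space M. disc m T w = v} = {w \<in> space M. T w < v} - {w \<in> space M. T w < real j / m}"
      by auto
    moreover have "{w \<in> space M. T w < v} \<in> sets (G v)"
      using assms v by (auto simp: opt_def)
    moreover have "{w \<in> space M. T w < real j / m} \<in> sets (G v)"
      using assms v sets_mono[of "real j / m" v "{w \<in> space M. T w < real j / m}"] by (auto simp: opt_def divide_right_mono)
    ultimately show ?thesis by auto
  qed
qed

lemma sum_of_bool_eq:
  fixes c :: real
  assumes "finite V" "d \<in> V"
  shows "(\<Sum>v\<in>V. c * of_bool (d = v) * f v) = c * f d"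
proof -
  have "(\<Sum>v\<in>V. c * of_bool (d = v) * f v) = (\<Sum>v\<in>V. if d = v then c * f v else 0)"
    by (intro sum.cong) auto
  then show ?thesis using assms by simp
qed

text \<open>A time with finitely many values can be built into the integrand: for each value v the
  step \<xi> is cancelled, on the event that the rounded time is v, by a further step that starts at
  max a v, when both \<xi> and this event are known.\<close>

lemma elem_stop:
  assumes "elem e E" "opt T" "\<And>w. w \<in> space M \<Longrightarrow> T w \<le> c" "0 < m"
  shows "elem (\<lambda>s w. e s w * of_bool (s \<le> disc m T w)) (\<lambda>t w. E (min t (disc m T w)) w)"
  using assms(1)
proof induction
  case zero
  show ?case by (rule elem.on_space[OF elem.zero]) auto
next
  case (add e E a \<xi> C)
  obtain V where V: "finite V" "\<And>v. v \<in> V \<Longrightarrow> 0 \<le> v" "\<And>w. w \<in> space M \<Longrightarrow> disc m T w \<in> V"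
    "\<And>v. v \<in> V \<Longrightarrow> {w \<in> space M. disc m T w = v} \<in> sets (G v)"
    using disc_finite[OF assms(2-4)] by metis
  let ?D = "disc m T"
  have m: "(\<lambda>w. - \<xi> w * of_bool (?D w = v)) \<in> borel_measurable (G (max a v))" if "v \<in> V" for v
  proof -
    have "\<xi> \<in> borel_measurable (G (max a v))" by (rule meas_mono[OF add.hyps(2) _ add.hyps(3)]) simp
    moreover have "{w \<in> space M. ?D w = v} \<in> sets (G (max a v))"
      by (rule sets_mono[OF V(2)[OF that] _ V(4)[OF that]]) simp
    then have "(\<lambda>w. of_bool (?D w = v) :: real) \<in> borel_measurable (G (max a v))"
      using add.hyps(2) by (intro measurable_cong[THEN iffD1, OF _ borel_measurable_indicator]) (auto simp: indicator_def)
    ultimately show ?thesis by (intro borel_measurable_times borel_measurable_uminus)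
  qed
  have "elem (\<lambda>s w. e s w * of_bool (s \<le> ?D w) + \<xi> w * of_bool (a < s) + (\<Sum>v\<in>V. - \<xi> w * of_bool (?D w = v) * of_bool (max a v < s)))
      (\<lambda>t w. E (min t (?D w)) w + \<xi> w * (W t w - W (min t a) w) + (\<Sum>v\<in>V. - \<xi> w * of_bool (?D w = v) * (W t w - W (min t (max a v)) w)))"
    using add.hyps m V(1,2)
    by (intro elem_sum_term[where C = C, OF elem.add[OF add.IH add.hyps(2-4)]])
      (auto simp: of_bool_def max_def intro: order_trans[OF abs_ge_zero])
  then show ?case
  proof (rule elem.on_space)
    fix s w assume wM: "w \<in> space M"
    show "(e s w + \<xi> w * of_bool (a < s)) * of_bool (s \<le> ?D w) =
      e s w * of_bool (s \<le> ?D w) + \<xi> w * of_bool (a < s) + (\<Sum>v\<in>V. - \<xi> w * of_bool (?D w = v) * of_bool (max a v < s))"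
      unfolding sum_of_bool_eq[OF V(1) V(3)[OF wM]] by (auto simp: of_bool_def)
    show "E (min s (?D w)) w + \<xi> w * (W (min s (?D w)) w - W (min (min s (?D w)) a) w) =
      E (min s (?D w)) w + \<xi> w * (W s w - W (min s a) w) + (\<Sum>v\<in>V. - \<xi> w * of_bool (?D w = v) * (W s w - W (min s (max a v)) w))"
      unfolding sum_of_bool_eq[OF V(1) V(3)[OF wM]] by (auto simp: min_def max_def algebra_simps)
  qed
qed (rule elem.on_space, assumption, auto)

end

section \<open>Elementary inequalities and limits in mean square\<close>

lemma two_square_bound:
  fixes a b :: real
  shows "(a + b)\<^sup>2 \<le> 2 * a\<^sup>2 + 2 * b\<^sup>2" "(a - b)\<^sup>2 \<le> 2 * a\<^sup>2 + 2 * b\<^sup>2"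
  using zero_le_power2[of "a - b"] zero_le_power2[of "a + b"] by (simp_all add: power2_sum power2_diff)

lemma square_split_bound:
  fixes a b \<delta> :: real
  assumes "0 < \<delta>"
  shows "2 * \<bar>a * b\<bar> \<le> \<delta> * a\<^sup>2 + b\<^sup>2 / \<delta>"
proof -
  have "0 \<le> (\<delta> * \<bar>a\<bar> - \<bar>b\<bar>)\<^sup>2 / \<delta>" using assms by simp
  also have "\<dots> = \<delta> * a\<^sup>2 + b\<^sup>2 / \<delta> - 2 * \<bar>a * b\<bar>"
    using assms by (simp add: power2_diff field_simps power2_eq_square abs_mult)
  finally show ?thesis by simp
qed

text \<open>The difference of the squares is (Xn - X)^2 + 2 X (Xn - X), and the product is split by
  a weighted Young inequality, so that only second moments appear.\<close>

lemma L2_limit: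
  fixes X :: "'a \<Rightarrow> real"
  assumes [measurable]: "\<And>n. Xn n \<in> borel_measurable N" "X \<in> borel_measurable N" "\<zeta> \<in> borel_measurable N"
    and lim: "(\<lambda>n. \<integral>\<^sup>+x. ennreal ((Xn n x - X x)\<^sup>2) \<partial>N) \<longlonglongrightarrow> 0"
    and int: "\<And>n. integrable N (\<lambda>x. (Xn n x)\<^sup>2)"
    and bd: "\<And>x. x \<in> space N \<Longrightarrow> \<bar>\<zeta> x\<bar> \<le> C"
  shows "integrable N (\<lambda>x. (X x)\<^sup>2)" "(\<lambda>n. \<integral>x. \<zeta> x * (Xn n x)\<^sup>2 \<partial>N) \<longlonglongrightarrow> (\<integral>x. \<zeta> x * (X x)\<^sup>2 \<partial>N)"
proof -
  obtain m where m: "(\<integral>\<^sup>+x. ennreal ((Xn m x - X x)\<^sup>2) \<partial>N) < 1"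
    using order_tendstoD(2)[OF lim, of 1] by (auto simp: eventually_sequentially)
  have im: "integrable N (\<lambda>x. (Xn m x - X x)\<^sup>2)"
    using m by (intro integrableI_bounded) (auto intro: less_trans)
  have b: "(X x)\<^sup>2 \<le> 2 * (Xn m x)\<^sup>2 + 2 * (Xn m x - X x)\<^sup>2" for x
    using two_square_bound(2)[of "Xn m x" "Xn m x - X x"] by simp
  show iX: "integrable N (\<lambda>x. (X x)\<^sup>2)"
  proof (rule Bochner_Integration.integrable_bound)
    show "integrable N (\<lambda>x. 2 * (Xn m x)\<^sup>2 + 2 * (Xn m x - X x)\<^sup>2)" using im int by simp
    show "AE x in N. norm ((X x)\<^sup>2) \<le> norm (2 * (Xn m x)\<^sup>2 + 2 * (Xn m x - X x)\<^sup>2)"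
      using b by (intro AE_I2) (simp add: order_trans[OF _ abs_ge_self])
  qed simp
  have id: "integrable N (\<lambda>x. (Xn n x - X x)\<^sup>2)" for n
    by (rule integrable_square_add(2)) (use int iX in auto)
  define d where "d n = (\<integral>x. (Xn n x - X x)\<^sup>2 \<partial>N)" for n
  have d0: "0 \<le> d n" for n by (simp add: d_def)
  have dlim: "d \<longlonglongrightarrow> 0"
  proof -
    have "(\<lambda>n. enn2real (\<integral>\<^sup>+x. ennreal ((Xn n x - X x)\<^sup>2) \<partial>N)) \<longlonglongrightarrow> enn2real 0"
      by (rule tendsto_enn2real) (use lim in auto)
    then show ?thesis by (simp add: d_def[abs_def] integral_eq_nn_integral)
  qed
  \<comment> \<open>The root balances \<epsilon> B against d / \<epsilon>; the second summand keeps
    \<epsilon> positive when d vanishes.\<close>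
  define \<epsilon> where "\<epsilon> n = sqrt (d n) + 1 / real (Suc n)" for n
  have \<epsilon>: "0 < \<epsilon> n" for n using d0[of n] by (simp add: \<epsilon>_def add_nonneg_pos)
  have \<epsilon>lim: "\<epsilon> \<longlonglongrightarrow> 0"
    unfolding \<epsilon>_def using tendsto_add[OF tendsto_real_sqrt[OF dlim] LIMSEQ_inverse_real_of_nat] by (simp add: inverse_eq_divide)
  define B where "B = (\<integral>x. (X x)\<^sup>2 \<partial>N)"
  have est: "\<bar>(\<integral>x. \<zeta> x * (Xn n x)\<^sup>2 \<partial>N) - (\<integral>x. \<zeta> x * (X x)\<^sup>2 \<partial>N)\<bar> \<le> \<bar>C\<bar> * (d n + \<epsilon> n * B + sqrt (d n))" for n
  proof -
    have bd': "\<bar>\<zeta> x\<bar> \<le> \<bar>C\<bar>" if "x \<in> space N" for x using bd[OF that] by linarith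
    have i1: "integrable N (\<lambda>x. \<zeta> x * (Xn n x)\<^sup>2)" "integrable N (\<lambda>x. \<zeta> x * (X x)\<^sup>2)"
      using int[of n] iX bd by (auto intro!: integrable_mult_bounded)
    have pt: "\<bar>\<zeta> x * (Xn n x)\<^sup>2 - \<zeta> x * (X x)\<^sup>2\<bar> \<le> \<bar>C\<bar> * ((Xn n x - X x)\<^sup>2 + (\<epsilon> n * (X x)\<^sup>2 + (Xn n x - X x)\<^sup>2 / \<epsilon> n))"
      if "x \<in> space N" for x
    proof -
      have "(Xn n x)\<^sup>2 - (X x)\<^sup>2 = (Xn n x - X x)\<^sup>2 + 2 * (X x * (Xn n x - X x))"
        by (simp add: power2_eq_square algebra_simps)
      then have "\<bar>(Xn n x)\<^sup>2 - (X x)\<^sup>2\<bar> \<le> (Xn n x - X x)\<^sup>2 + 2 * \<bar>X x * (Xn n x - X x)\<bar>"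
        by (simp add: abs_mult order_trans[OF abs_triangle_ineq])
      also have "\<dots> \<le> (Xn n x - X x)\<^sup>2 + (\<epsilon> n * (X x)\<^sup>2 + (Xn n x - X x)\<^sup>2 / \<epsilon> n)"
        using square_split_bound[OF \<epsilon>[of n], of "X x" "Xn n x - X x"] by simp
      finally show ?thesis
        unfolding right_diff_distrib[symmetric] abs_mult using bd'[OF that] by (intro mult_mono) auto
    qed
    have "\<bar>(\<integral>x. \<zeta> x * (Xn n x)\<^sup>2 \<partial>N) - (\<integral>x. \<zeta> x * (X x)\<^sup>2 \<partial>N)\<bar> = \<bar>\<integral>x. \<zeta> x * (Xn n x)\<^sup>2 - \<zeta> x * (X x)\<^sup>2 \<partial>N\<bar>"
      using i1 by simp
    also have "\<dots> \<le> (\<integral>x. \<bar>C\<bar> * ((Xn n x - X x)\<^sup>2 + (\<epsilon> n * (X x)\<^sup>2 + (Xn n x - X x)\<^sup>2 / \<epsilon> n)) \<partial>N)"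
      using i1 id[of n] iX pt by (intro order_trans[OF integral_abs_bound] integral_mono) auto
    also have "\<dots> = \<bar>C\<bar> * (d n + (\<epsilon> n * B + d n / \<epsilon> n))"
      using id[of n] iX by (simp add: d_def B_def)
    also have "\<dots> \<le> \<bar>C\<bar> * (d n + \<epsilon> n * B + sqrt (d n))"
    proof -
      have "d n = sqrt (d n) * sqrt (d n)" using d0[of n] by simp
      also have "\<dots> \<le> sqrt (d n) * \<epsilon> n" using d0[of n] by (intro mult_left_mono) (auto simp: \<epsilon>_def)
      finally have "d n / \<epsilon> n \<le> sqrt (d n)" using \<epsilon>[of n] by (simp add: pos_divide_le_eq)
      then show ?thesis by (intro mult_left_mono) auto
    qed
    finally show ?thesis .
  qed
  have "(\<lambda>n. \<bar>C\<bar> * (d n + \<epsilon> n * B + sqrt (d n))) \<longlonglongrightarrow> \<bar>C\<bar> * (0 + 0 * B + sqrt 0)"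
    by (intro tendsto_intros dlim \<epsilon>lim)
  then have "(\<lambda>n. \<bar>C\<bar> * (d n + \<epsilon> n * B + sqrt (d n))) \<longlonglongrightarrow> 0" by simp
  then have "(\<lambda>n. (\<integral>x. \<zeta> x * (Xn n x)\<^sup>2 \<partial>N) - (\<integral>x. \<zeta> x * (X x)\<^sup>2 \<partial>N)) \<longlonglongrightarrow> 0"
    by (rule Lim_null_comparison[rotated]) (use est in auto)
  then show "(\<lambda>n. \<integral>x. \<zeta> x * (Xn n x)\<^sup>2 \<partial>N) \<longlonglongrightarrow> (\<integral>x. \<zeta> x * (X x)\<^sup>2 \<partial>N)"
    by (simp add: LIM_zero_iff)
qed

text \<open>Polarisation: 2 X = (X + 1)^2 - X^2 - 1, so convergence of weighted means follows from
  convergence of weighted second moments.\<close>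

lemma (in prob_space) L2_limit_mean:
  fixes X :: "'a \<Rightarrow> real"
  assumes [measurable]: "\<And>n. Xn n \<in> borel_measurable M" "X \<in> borel_measurable M" "\<zeta> \<in> borel_measurable M"
    and lim: "(\<lambda>n. \<integral>\<^sup>+x. ennreal ((Xn n x - X x)\<^sup>2) \<partial>M) \<longlonglongrightarrow> 0"
    and int: "\<And>n. integrable M (\<lambda>x. (Xn n x)\<^sup>2)"
    and bd: "\<And>x. x \<in> space M \<Longrightarrow> \<bar>\<zeta> x\<bar> \<le> C"
  shows "(\<lambda>n. \<integral>x. \<zeta> x * Xn n x \<partial>M) \<longlonglongrightarrow> (\<integral>x. \<zeta> x * X x \<partial>M)"
proof -
  have i1: "integrable M (\<lambda>x. (Xn n x + 1)\<^sup>2)" for n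
    by (rule integrable_square_add(1)) (use int in auto)
  note A = L2_limit[OF assms(1-3) lim int bd]
  note B = L2_limit[of "\<lambda>n x. Xn n x + 1" M "\<lambda>x. X x + 1" \<zeta> C]
  have Bl: "(\<lambda>n. \<integral>x. \<zeta> x * (Xn n x + 1)\<^sup>2 \<partial>M) \<longlonglongrightarrow> (\<integral>x. \<zeta> x * (X x + 1)\<^sup>2 \<partial>M)" and Bi: "integrable M (\<lambda>x. (X x + 1)\<^sup>2)"
    using B i1 lim bd by auto
  have iz: "integrable M \<zeta>" by (rule integrable_const_bound[of _ C]) (use bd in auto)
  have eq: "(\<integral>x. \<zeta> x * (Z x + 1)\<^sup>2 \<partial>M) - (\<integral>x. \<zeta> x * (Z x)\<^sup>2 \<partial>M) - (\<integral>x. \<zeta> x \<partial>M) = 2 * (\<integral>x. \<zeta> x * Z x \<partial>M)"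
    if "integrable M (\<lambda>x. (Z x)\<^sup>2)" "Z \<in> borel_measurable M" for Z
  proof -
    have "integrable M (\<lambda>x. \<zeta> x * Z x)" "integrable M (\<lambda>x. \<zeta> x * (Z x)\<^sup>2)"
      using that integrable_of_square[OF that(2,1)] bd by (auto intro!: integrable_mult_bounded)
    moreover have "(\<lambda>x. \<zeta> x * (Z x + 1)\<^sup>2) = (\<lambda>x. \<zeta> x * (Z x)\<^sup>2 + 2 * (\<zeta> x * Z x) + \<zeta> x)"
      by (auto simp: fun_eq_iff power2_eq_square algebra_simps)
    ultimately show ?thesis using iz by simp
  qed
  have "(\<lambda>n. ((\<integral>x. \<zeta> x * (Xn n x + 1)\<^sup>2 \<partial>M) - (\<integral>x. \<zeta> x * (Xn n x)\<^sup>2 \<partial>M) - (\<integral>x. \<zeta> x \<partial>M)) / 2)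
     \<longlonglongrightarrow> ((\<integral>x. \<zeta> x * (X x + 1)\<^sup>2 \<partial>M) - (\<integral>x. \<zeta> x * (X x)\<^sup>2 \<partial>M) - (\<integral>x. \<zeta> x \<partial>M)) / 2"
    by (intro tendsto_intros A Bl) auto
  then show ?thesis using eq[OF int assms(1)] eq[OF A(1) assms(2)] by simp
qed

text \<open>The hitting times below inspect rational times and yield bounds strictly before T.
  Fatou's lemma along rational times tending to T from below closes the interval; for T \<le> 0 the
  interval is a null set.\<close>

lemma nn_integral_Icc_le:
  fixes f :: "real \<Rightarrow> ennreal"
  assumes [measurable]: "f \<in> borel_measurable borel"
    and le: "\<And>s. s \<in> \<rat> \<Longrightarrow> 0 \<le> s \<Longrightarrow> s < T \<Longrightarrow> (\<integral>\<^sup>+u\<in>{0..s}. f u \<partial>lborel) \<le> K"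
  shows "(\<integral>\<^sup>+u\<in>{0..T}. f u \<partial>lborel) \<le> K"
proof (cases "0 < T")
  case True
  have "\<exists>s\<in>\<rat>. max 0 (T - 1 / real (Suc k)) < s \<and> s < T" for k :: nat
    using True by (intro Rats_dense_in_real) simp
  then obtain s where s: "\<And>k. s k \<in> \<rat>" "\<And>k. max 0 (T - 1 / real (Suc k)) < s k" "\<And>k. s k < T" by metis
  have slim: "s \<longlonglongrightarrow> T"
  proof (rule tendsto_sandwich)
    show "(\<lambda>k. T - 1 / real (Suc k)) \<longlonglongrightarrow> T"
      using tendsto_diff[OF tendsto_const LIMSEQ_inverse_real_of_nat, of T] by (simp add: inverse_eq_divide)
    show "\<forall>\<^sub>F k in sequentially. T - 1 / real (Suc k) \<le> s k" using s(2) by (auto simp: less_imp_le)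
    show "\<forall>\<^sub>F k in sequentially. s k \<le> T" using s(3) by (auto simp: less_imp_le)
  qed (rule tendsto_const)
  have "(\<integral>\<^sup>+u\<in>{0..T}. f u \<partial>lborel) \<le> (\<integral>\<^sup>+u. liminf (\<lambda>k. f u * indicator {0..s k} u) \<partial>lborel)"
  proof (rule nn_integral_mono_AE)
    show "AE u in lborel. f u * indicator {0..T} u \<le> liminf (\<lambda>k. f u * indicator {0..s k} u)"
      using AE_lborel_singleton[of T]
    proof eventually_elim
      case (elim u)
      show ?case
      proof (cases "0 \<le> u \<and> u < T")
        case True
        then have "\<forall>\<^sub>F k in sequentially. u < s k" using order_tendstoD(1)[OF slim] by auto
        then have "\<forall>\<^sub>F k in sequentially. f u \<le> f u * indicator {0..s k} u"
          by eventually_elim (use True in auto)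
        then have "f u \<le> liminf (\<lambda>k. f u * indicator {0..s k} u)" by (rule Liminf_bounded)
        then show ?thesis by (auto simp: indicator_def)
      qed (use elim in \<open>auto simp: indicator_def\<close>)
    qed
  qed
  also have "\<dots> \<le> liminf (\<lambda>k. \<integral>\<^sup>+u. f u * indicator {0..s k} u \<partial>lborel)"
    by (rule nn_integral_liminf) simp
  also have "\<dots> \<le> K"
  proof -
    have "(\<integral>\<^sup>+u. f u * indicator {0..s k} u \<partial>lborel) \<le> K" for k
      using s(2)[of k] by (intro le s) auto
    then show ?thesis by (intro Liminf_le always_eventually) auto
  qed
  finally show ?thesis .
next
  case False
  have "AE u in lborel. f u * indicator {0..T} u = 0"
    using AE_lborel_singleton[of 0] by eventually_elim (use False in \<open>auto simp: indicator_def\<close>)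
  then have "(\<integral>\<^sup>+u\<in>{0..T}. f u \<partial>lborel) = 0" by (simp add: nn_integral_0_iff_AE)
  then show ?thesis by simp
qed

context bm_filtration begin

text \<open>Only rational times are inspected, so that {hit < t} is a countable union of events
  known before t. The cap c keeps the set nonempty and the time finite.\<close>

definition hit :: "real \<Rightarrow> (real \<Rightarrow> 'a \<Rightarrow> bool) \<Rightarrow> 'a \<Rightarrow> real" where
  "hit c P w = Inf (insert c {t \<in> \<rat>. 0 \<le> t \<and> P t w})"

lemma hit_less_iff:
  assumes "0 \<le> c"
  shows "hit c P w < t \<longleftrightarrow> c < t \<or> (\<exists>u\<in>\<rat>. 0 \<le> u \<and> u < t \<and> P u w)"
proof -
  have "bdd_below (insert c {t \<in> \<rat>. 0 \<le> t \<and> P t w})"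
    using assms by (intro bdd_belowI[of _ 0]) auto
  then show ?thesis unfolding hit_def by (subst cInf_less_iff) auto
qed

lemma hit_le: "0 \<le> c \<Longrightarrow> hit c P w \<le> c"
  using hit_less_iff[of c P w] by (metis less_irrefl linorder_not_le less_le_not_le not_less_iff_gr_or_eq dense)

lemma opt_hit:
  assumes "0 \<le> c" "\<And>u. u \<in> \<rat> \<Longrightarrow> 0 \<le> u \<Longrightarrow> {w \<in> space M. P u w} \<in> sets (G u)"
  shows "opt (hit c P)"
  unfolding opt_def
proof (intro conjI ballI allI impI)
  fix w show "0 \<le> hit c P w" unfolding hit_def using assms(1) by (intro cInf_greatest) auto
next
  fix t :: real assume t: "0 \<le> t"
  have "{w \<in> space M. hit c P w < t} = (if c < t then space M else (\<Union>u\<in>\<rat> \<inter> {0..<t}. {w \<in> space M. P u w}))"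
    using hit_less_iff[OF assms(1)] by auto
  moreover have "(\<Union>u\<in>\<rat> \<inter> {0..<t}. {w \<in> space M. P u w}) \<in> sets (G t)"
  proof (rule sets.countable_UN'')
    show "countable (\<rat> \<inter> {0..<t})" using countable_rat by (rule countable_subset[rotated]) auto
    fix u assume "u \<in> \<rat> \<inter> {0..<t}"
    then show "{w \<in> space M. P u w} \<in> sets (G t)"
      using sets_mono[OF _ _ assms(2), of u t] by auto
  qed
  ultimately show "{w \<in> space M. hit c P w < t} \<in> sets (G t)" using space_in_G[OF t] by simp
qed

lemma prog_section:
  assumes "prog h" "w \<in> space M"
  shows "(\<lambda>s. h s w) \<in> borel_measurable borel"
  using measurable_compose[OF measurable_Pair2'[OF assms(2)] prog_measurable[OF assms(1)]] by simp

end

section \<open>Stopped stochastic integrals\<close>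

context bm_filtration begin

definition ito_approx where
  "ito_approx h I e E \<longleftrightarrow> (\<forall>n. elem (e n) (E n)) \<and>
     (AE w in M. \<forall>c\<ge>0. (\<lambda>n. \<integral>\<^sup>+s\<in>{0..c}. ennreal ((e n s w - h s w)\<^sup>2) \<partial>lborel) \<longlonglongrightarrow> 0 \<and>
        uniform_limit {0..c} (\<lambda>n t. E n t w) (\<lambda>t. I t w) sequentially)"

text \<open>A version that is continuous on every path and adapted. The given integrals are
  prescribed almost surely only; \<open>ito_of_approx\<close> produces the version.\<close>

definition ito where
  "ito h I \<longleftrightarrow> prog h \<and> (\<forall>t\<ge>0. I t \<in> borel_measurable (G t)) \<and>
     (\<forall>w\<in>space M. continuous_on {0..} (\<lambda>t. I t w)) \<and> (\<exists>e E. ito_approx h I e E)"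

text \<open>Upgrades pathwise convergence to convergence in mean square. Each approximation is
  stopped once its own energy exceeds K + 1. As the energy of h up to T is at most K, this cut is
  eventually inactive on almost every path, and the common energy bound permits dominated
  convergence. The cut is then rounded up so that the integrand stays elementary.\<close>

lemma ito_stop_approx:
  assumes "ito h I" "opt T" and Tc: "\<And>w. w \<in> space M \<Longrightarrow> T w \<le> c" and c: "0 \<le> c" and K: "0 \<le> K"
    and bd: "AE w in M. (\<integral>\<^sup>+s\<in>{0..T w}. ennreal ((h s w)\<^sup>2) \<partial>lborel) \<le> ennreal K"
  shows "\<exists>g J. (\<forall>n. elem (g n) (J n)) \<and>
    (\<lambda>n. \<integral>\<^sup>+z. ennreal (indicator {0<..} (fst z) * (g n (fst z) (snd z) - h (fst z) (snd z) * of_bool (fst z \<le> T (snd z)))\<^sup>2)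
        \<partial>(lborel \<Otimes>\<^sub>M M)) \<longlonglongrightarrow> 0 \<and>
    (AE w in M. \<forall>t\<ge>0. (\<lambda>n. J n t w) \<longlonglongrightarrow> I (min t (T w)) w)"
proof -
  interpret P: pair_sigma_finite lborel M ..
  from assms(1) obtain e E where h: "prog h" and el: "\<And>n. elem (e n) (E n)"
    and Ic: "\<And>w. w \<in> space M \<Longrightarrow> continuous_on {0..} (\<lambda>t. I t w)"
    and ap: "AE w in M. \<forall>c\<ge>0. (\<lambda>n. \<integral>\<^sup>+s\<in>{0..c}. ennreal ((e n s w - h s w)\<^sup>2) \<partial>lborel) \<longlonglongrightarrow> 0 \<and>
        uniform_limit {0..c} (\<lambda>n t. E n t w) (\<lambda>t. I t w) sequentially"
    by (auto simp: ito_def ito_approx_def)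
  have "\<exists>C. 0 \<le> C \<and> (\<forall>s. \<forall>w\<in>space M. \<bar>e n s w\<bar> \<le> C)" for n
    using elem_bounded[OF el[of n]] by (metis abs_ge_zero order_trans not_empty ex_in_conv)
  then obtain C where C: "\<And>n. 0 \<le> C n" "\<And>n s w. w \<in> space M \<Longrightarrow> \<bar>e n s w\<bar> \<le> C n" by metis
  define Pr where "Pr n u w \<longleftrightarrow> ennreal (K + 1) < (\<integral>\<^sup>+s\<in>{0..u}. ennreal ((e n s w)\<^sup>2) \<partial>lborel)" for n u w
  define S where "S n w = min (T w) (hit c (Pr n) w)" for n w
  \<comment> \<open>The rounding mesh depends on the sup bound of the n-th integrand: the energy
    gained on (S n, D n] is at most (C n)^2 / m n, hence at most 1 / (n + 1).\<close>
  define m where "m n = ((C n)\<^sup>2 + 1) * real (Suc n)" for n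
  define D where "D n = disc (m n) (S n)" for n
  have e2: "prog (\<lambda>s w. (e n s w)\<^sup>2)" for n
    using prog_mult[OF elem_prog[OF el] elem_prog[OF el], of n n] by (simp add: power2_eq_square)
  have "opt (hit c (Pr n))" for n
  proof (rule opt_hit[OF c])
    fix u :: real assume u: "0 \<le> u"
    note [measurable] = prog_nn_integral[OF e2 u, of n]
    have "{w \<in> space (G u). Pr n u w} \<in> sets (G u)" unfolding Pr_def by measurable
    then show "{w \<in> space M. Pr n u w} \<in> sets (G u)" using u by simp
  qed
  then have Sopt: "opt (S n)" for n
    unfolding S_def by (rule opt_min[OF assms(2)])
  have Sc: "S n w \<le> c" if "w \<in> space M" for n w using Tc[OF that] by (simp add: S_def)
  have ST: "S n w \<le> T w" for n w by (simp add: S_def)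
  have m0: "0 < m n" for n unfolding m_def by (intro mult_pos_pos add_nonneg_pos) auto
  have Dm: "S n w < D n w" "D n w \<le> S n w + 1 / m n" for n w
    unfolding D_def by (rule disc_bounds[OF m0])+
  have msuc: "real (Suc n) \<le> m n" for n
    unfolding m_def using mult_right_mono[of 1 "(C n)\<^sup>2 + 1" "real (Suc n)"] by simp
  have m1: "1 / m n \<le> 1 / real (Suc n)" for n
    using msuc[of n] by (intro divide_left_mono mult_pos_pos m0) auto
  have m2: "(C n)\<^sup>2 / m n \<le> 1 / real (Suc n)" for n
  proof -
    have "(C n)\<^sup>2 * real (Suc n) \<le> m n" unfolding m_def by (intro mult_right_mono) auto
    then show ?thesis using m0[of n] by (simp add: field_simps)
  qed
  have S0: "0 \<le> S n w" if "w \<in> space M" for n w using opt_nonneg[OF Sopt that] .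
  have sec: "(\<lambda>s. e n s w) \<in> borel_measurable borel" "(\<lambda>s. h s w) \<in> borel_measurable borel" if "w \<in> space M" for n w
    using prog_section[OF elem_prog[OF el] that] prog_section[OF h that] by auto
  \<comment> \<open>No rational time before the cut has energy above K + 1; the closed interval
    follows by \<open>nn_integral_Icc_le\<close>.\<close>
  have bS: "(\<integral>\<^sup>+s\<in>{0..S n w}. ennreal ((e n s w)\<^sup>2) \<partial>lborel) \<le> ennreal (K + 1)" if "w \<in> space M" for n w
  proof (rule nn_integral_Icc_le)
    note [measurable] = sec[OF that]
    show "(\<lambda>s. ennreal ((e n s w)\<^sup>2)) \<in> borel_measurable borel" by measurable
    fix s assume s: "s \<in> \<rat>" "0 \<le> s" "s < S n w"
    then have "s < hit c (Pr n) w" by (simp add: S_def)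
    then have "\<not> Pr n s w" using hit_less_iff[OF c, of "Pr n" w "hit c (Pr n) w"] s by auto
    then show "(\<integral>\<^sup>+s\<in>{0..s}. ennreal ((e n s w)\<^sup>2) \<partial>lborel) \<le> ennreal (K + 1)" by (simp add: Pr_def not_less)
  qed
  \<comment> \<open>In (u + v)^2 \<le> (1 + \<delta>) u^2 + (1 + 1/\<delta>) v^2 the first term may
    use up K + 1/2, and the second, through \<eta> below, the remaining 1/2 of the allowance K +
    1.\<close>
  define \<delta> where "\<delta> = 1 / (2 * (K + 1))"
  have \<delta>: "0 < \<delta>" "(1 + \<delta>) * K \<le> K + 1 / 2" using K by (auto simp: \<delta>_def field_simps)
  have evS: "AE w in M. \<forall>\<^sub>F n in sequentially. S n w = T w"
    using ap bd AE_space
  proof eventually_elim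
    case (elim w)
    note [measurable] = sec[OF elim(3)]
    define \<eta> where "\<eta> = 1 / (2 * (1 + 1 / \<delta>))"
    have "0 < 1 + 1 / \<delta>" using \<delta>(1) by (simp add: add_pos_pos)
    then have \<eta>: "0 < \<eta>" "(1 + 1 / \<delta>) * \<eta> = 1 / 2" unfolding \<eta>_def by simp_all
    have "(\<lambda>n. \<integral>\<^sup>+s\<in>{0..c}. ennreal ((e n s w - h s w)\<^sup>2) \<partial>lborel) \<longlonglongrightarrow> 0" using elim(1) c by auto
    from order_tendstoD(2)[OF this, of "ennreal \<eta>"] \<eta>(1)
    have "\<forall>\<^sub>F n in sequentially. (\<integral>\<^sup>+s\<in>{0..c}. ennreal ((e n s w - h s w)\<^sup>2) \<partial>lborel) < ennreal \<eta>" by simp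
    then show ?case
    proof eventually_elim
      case (elim n)
      have "(\<integral>\<^sup>+s\<in>{0..T w}. ennreal ((e n s w)\<^sup>2) \<partial>lborel)
        \<le> (\<integral>\<^sup>+s. ennreal (1 + \<delta>) * (ennreal ((h s w)\<^sup>2) * indicator {0..T w} s) + ennreal (1 + 1 / \<delta>) * (ennreal ((e n s w - h s w)\<^sup>2) * indicator {0..c} s) \<partial>lborel)"
      proof (rule nn_integral_mono)
        fix s
        have "(e n s w)\<^sup>2 = (h s w)\<^sup>2 + 2 * (h s w * (e n s w - h s w)) + (e n s w - h s w)\<^sup>2"
          by (simp add: power2_eq_square algebra_simps)
        also have "2 * (h s w * (e n s w - h s w)) \<le> \<delta> * (h s w)\<^sup>2 + (e n s w - h s w)\<^sup>2 / \<delta>"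
          using square_split_bound[OF \<delta>(1), of "h s w" "e n s w - h s w"] by linarith
        finally have "(e n s w)\<^sup>2 \<le> (1 + \<delta>) * (h s w)\<^sup>2 + (1 + 1 / \<delta>) * (e n s w - h s w)\<^sup>2"
          by (simp add: algebra_simps)
        then have "ennreal ((e n s w)\<^sup>2) \<le> ennreal (1 + \<delta>) * ennreal ((h s w)\<^sup>2) + ennreal (1 + 1 / \<delta>) * ennreal ((e n s w - h s w)\<^sup>2)"
          using \<delta>(1) by (simp add: ennreal_mult[symmetric] ennreal_plus[symmetric] del: ennreal_plus)
        then show "ennreal ((e n s w)\<^sup>2) * indicator {0..T w} s
          \<le> ennreal (1 + \<delta>) * (ennreal ((h s w)\<^sup>2) * indicator {0..T w} s) + ennreal (1 + 1 / \<delta>) * (ennreal ((e n s w - h s w)\<^sup>2) * indicator {0..c} s)"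
          using Tc[OF \<open>w \<in> space M\<close>] by (auto simp: indicator_def)
      qed
      also have "\<dots> = ennreal (1 + \<delta>) * (\<integral>\<^sup>+s\<in>{0..T w}. ennreal ((h s w)\<^sup>2) \<partial>lborel) + ennreal (1 + 1 / \<delta>) * (\<integral>\<^sup>+s\<in>{0..c}. ennreal ((e n s w - h s w)\<^sup>2) \<partial>lborel)"
        by (subst nn_integral_add) (simp_all add: nn_integral_cmult)
      also have "\<dots> \<le> ennreal (1 + \<delta>) * ennreal K + ennreal (1 + 1 / \<delta>) * ennreal \<eta>"
        using elim \<open>set_nn_integral lborel {0..T w} (\<lambda>s. ennreal ((h s w)\<^sup>2)) \<le> ennreal K\<close>
        by (intro add_mono mult_left_mono) auto
      also have "\<dots> = ennreal ((1 + \<delta>) * K + 1 / 2)"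
        using \<delta>(1) K \<eta> by (simp add: ennreal_mult[symmetric] ennreal_plus[symmetric] del: ennreal_plus)
      also have "\<dots> \<le> ennreal (K + 1)" using \<delta>(2) by (intro ennreal_leI) simp
      finally have le: "(\<integral>\<^sup>+s\<in>{0..T w}. ennreal ((e n s w)\<^sup>2) \<partial>lborel) \<le> ennreal (K + 1)" .
      have "\<not> hit c (Pr n) w < T w"
      proof
        assume "hit c (Pr n) w < T w"
        then obtain u where u: "0 \<le> u" "u < T w" "Pr n u w"
          using hit_less_iff[OF c, of "Pr n" w "T w"] Tc[OF \<open>w \<in> space M\<close>] by auto
        have "(\<integral>\<^sup>+s\<in>{0..u}. ennreal ((e n s w)\<^sup>2) \<partial>lborel) \<le> (\<integral>\<^sup>+s\<in>{0..T w}. ennreal ((e n s w)\<^sup>2) \<partial>lborel)"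
          using u by (intro nn_integral_mono) (auto simp: indicator_def)
        then show False using u(3) le by (simp add: Pr_def)
      qed
      then show ?case by (simp add: S_def)
    qed
  qed
  \<comment> \<open>The error for the cut before rounding. It is at most 4 K + 2 and tends to 0 on
    almost every path; the rounding is accounted for separately.\<close>
  define F where "F n w = (\<integral>\<^sup>+s. ennreal (indicator {0<..} s * (e n s w * of_bool (s \<le> S n w) - h s w * of_bool (s \<le> T w))\<^sup>2) \<partial>lborel)" for n w
  note [measurable] = opt_measurable[OF Sopt] opt_measurable[OF assms(2)] prog_measurable[OF h] prog_measurable[OF elem_prog[OF el]]
  have pm: "(\<lambda>z. k (fst z) (snd z)) \<in> borel_measurable (lborel \<Otimes>\<^sub>M M)" if "prog k" for k
    using prog_measurable[OF that] by (simp add: case_prod_beta' cong: measurable_cong_sets sets_pair_measure_cong)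
  note [measurable] = pm[OF h] pm[OF elem_prog[OF el]]
  have Fm: "F n \<in> borel_measurable M" for n
  proof -
    have "(\<lambda>z. ennreal (indicator {0<..} (fst z) * (e n (fst z) (snd z) * of_bool (fst z \<le> S n (snd z)) - h (fst z) (snd z) * of_bool (fst z \<le> T (snd z)))\<^sup>2)) \<in> borel_measurable (lborel \<Otimes>\<^sub>M M)"
      by measurable
    from lborel.borel_measurable_nn_integral_fst[OF measurable_compose[OF measurable_pair_swap' this]]
    show ?thesis by (simp add: F_def[abs_def])
  qed
  have Fbd: "AE w in M. F n w \<le> ennreal (2 * (K + 1) + 2 * K)" for n
    using bd AE_space
  proof eventually_elim
    case (elim w)
    note [measurable] = sec[OF elim(2)]
    have "F n w \<le> (\<integral>\<^sup>+s. 2 * (ennreal ((e n s w)\<^sup>2) * indicator {0..S n w} s) + 2 * (ennreal ((h s w)\<^sup>2) * indicator {0..T w} s) \<partial>lborel)"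
      unfolding F_def
    proof (rule nn_integral_mono)
      fix s
      have "ennreal ((e n s w - h s w)\<^sup>2) \<le> 2 * ennreal ((e n s w)\<^sup>2) + 2 * ennreal ((h s w)\<^sup>2)"
        using two_square_bound(2)[of "e n s w" "h s w"]
        by (simp add: ennreal_mult[symmetric] ennreal_plus[symmetric] ennreal_numeral[symmetric] del: ennreal_plus ennreal_numeral)
      moreover have "x \<le> 2 * x" for x :: ennreal
        using add_increasing[of x x x] by (simp add: mult_2)
      ultimately show "ennreal (indicator {0<..} s * (e n s w * of_bool (s \<le> S n w) - h s w * of_bool (s \<le> T w))\<^sup>2)
         \<le> 2 * (ennreal ((e n s w)\<^sup>2) * indicator {0..S n w} s) + 2 * (ennreal ((h s w)\<^sup>2) * indicator {0..T w} s)"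
        by (auto simp: indicator_def)
    qed
    also have "\<dots> = 2 * (\<integral>\<^sup>+s\<in>{0..S n w}. ennreal ((e n s w)\<^sup>2) \<partial>lborel) + 2 * (\<integral>\<^sup>+s\<in>{0..T w}. ennreal ((h s w)\<^sup>2) \<partial>lborel)"
      by (subst nn_integral_add) (simp_all add: nn_integral_cmult)
    also have "\<dots> \<le> 2 * ennreal (K + 1) + 2 * ennreal K"
      using elim bS[OF elim(2), of n] by (intro add_mono mult_left_mono) auto
    also have "2 * ennreal (K + 1) = ennreal (2 * (K + 1))" by (subst ennreal_mult') simp_all
    also have "2 * ennreal K = ennreal (2 * K)" by (subst ennreal_mult') simp_all
    also have "ennreal (2 * (K + 1)) + ennreal (2 * K) = ennreal (2 * (K + 1) + 2 * K)"
      using K by (subst ennreal_plus) simp_all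
    finally show ?case .
  qed
  have Flim: "AE w in M. (\<lambda>n. F n w) \<longlonglongrightarrow> 0"
    using ap evS AE_space
  proof eventually_elim
    case (elim w)
    have L: "(\<lambda>n. \<integral>\<^sup>+s\<in>{0..c}. ennreal ((e n s w - h s w)\<^sup>2) \<partial>lborel) \<longlonglongrightarrow> 0" using elim(1) c by auto
    show ?case
    proof (rule tendsto_sandwich[OF _ _ tendsto_const L])
      show "\<forall>\<^sub>F n in sequentially. F n w \<le> (\<integral>\<^sup>+s\<in>{0..c}. ennreal ((e n s w - h s w)\<^sup>2) \<partial>lborel)"
        using elim(2)
      proof eventually_elim
        case (elim n)
        show ?case unfolding F_def using elim Tc[OF \<open>w \<in> space M\<close>]
          by (intro nn_integral_mono) (auto simp: indicator_def)
      qed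
    qed simp
  qed
  have Fint: "(\<lambda>n. \<integral>\<^sup>+w. F n w \<partial>M) \<longlonglongrightarrow> 0"
  proof -
    have "(\<lambda>n. \<integral>\<^sup>+w. F n w \<partial>M) \<longlonglongrightarrow> (\<integral>\<^sup>+w. 0 \<partial>M)"
      by (rule nn_integral_dominated_convergence[where w = "\<lambda>_. ennreal (2 * (K + 1) + 2 * K)"])
        (use Fm Fbd Flim in \<open>auto simp: emeasure_space_1\<close>)
    then show ?thesis by simp
  qed
  show ?thesis
  proof (rule exI, rule exI, intro conjI allI)
    show "elem (\<lambda>s w. e n s w * of_bool (s \<le> D n w)) (\<lambda>t w. E n (min t (D n w)) w)" for n
      unfolding D_def by (rule elem_stop[OF el Sopt Sc m0])
    show "AE w in M. \<forall>t\<ge>0. (\<lambda>n. E n (min t (D n w)) w) \<longlonglongrightarrow> I (min t (T w)) w"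
      using ap evS AE_space
    proof eventually_elim
      case (elim w)
      show ?case
      proof (intro allI impI)
        fix t :: real assume t: "0 \<le> t"
        have D0: "min t (D n w) \<in> {0..c + 1}" for n
        proof -
          have "1 / m n \<le> 1" using msuc[of n] m0[of n] by (simp add: divide_le_eq)
          then have "D n w \<le> c + 1" using Dm(2)[of n w] Sc[OF elim(3), of n] by linarith
          then show ?thesis using Dm(1)[of n w] S0[OF elim(3), of n] t by auto
        qed
        have Dl: "(\<lambda>n. D n w) \<longlonglongrightarrow> T w"
        proof (rule tendsto_sandwich)
          show "\<forall>\<^sub>F n in sequentially. T w \<le> D n w"
            using elim(2) by eventually_elim (use Dm(1) in \<open>metis less_imp_le\<close>)
          show "\<forall>\<^sub>F n in sequentially. D n w \<le> T w + 1 / real (Suc n)"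
          proof (intro always_eventually allI)
            fix n show "D n w \<le> T w + 1 / real (Suc n)"
              using Dm(2)[of n w] ST[of n w] m1[of n] by linarith
          qed
          show "(\<lambda>n. T w + 1 / real (Suc n)) \<longlonglongrightarrow> T w"
            using tendsto_add[OF tendsto_const LIMSEQ_inverse_real_of_nat, of "T w"] by (simp add: inverse_eq_divide)
        qed (rule tendsto_const)
        have T0: "0 \<le> T w" using opt_nonneg[OF assms(2) elim(3)] .
        have I: "(\<lambda>n. I (min t (D n w)) w) \<longlonglongrightarrow> I (min t (T w)) w"
          by (rule continuous_on_tendsto_compose[OF Ic[OF elim(3)] tendsto_min[OF tendsto_const Dl]])
            (use D0 t T0 in auto)
        have u: "uniform_limit {0..c + 1} (\<lambda>n t. E n t w) (\<lambda>t. I t w) sequentially"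
          using elim(1) c by auto
        have "(\<lambda>n. E n (min t (D n w)) w - I (min t (D n w)) w) \<longlonglongrightarrow> 0"
        proof (rule tendstoI)
          fix \<epsilon> :: real assume "0 < \<epsilon>"
          from uniform_limitD[OF u this]
          show "\<forall>\<^sub>F n in sequentially. dist (E n (min t (D n w)) w - I (min t (D n w)) w) 0 < \<epsilon>"
            by eventually_elim (use D0 in \<open>auto simp: dist_norm\<close>)
        qed
        from tendsto_add[OF this I] show "(\<lambda>n. E n (min t (D n w)) w) \<longlonglongrightarrow> I (min t (T w)) w" by simp
      qed
    qed
    define A where "A n = (\<integral>\<^sup>+z. ennreal (indicator {0<..} (fst z) * (e n (fst z) (snd z) * of_bool (fst z \<le> D n (snd z)) - h (fst z) (snd z) * of_bool (fst z \<le> T (snd z)))\<^sup>2)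
        \<partial>(lborel \<Otimes>\<^sub>M M))" for n
    have [measurable]: "D n \<in> borel_measurable M" for n unfolding D_def disc_def by measurable
    have Ab: "A n \<le> 2 * ennreal (1 / real (Suc n)) + 2 * (\<integral>\<^sup>+w. F n w \<partial>M)" for n
    proof -
      have "A n = (\<integral>\<^sup>+w. (\<integral>\<^sup>+s. ennreal (indicator {0<..} s * (e n s w * of_bool (s \<le> D n w) - h s w * of_bool (s \<le> T w))\<^sup>2) \<partial>lborel) \<partial>M)"
        unfolding A_def by (subst P.nn_integral_snd[symmetric]) simp_all
      also have "\<dots> \<le> (\<integral>\<^sup>+w. 2 * ennreal (1 / real (Suc n)) + 2 * F n w \<partial>M)"
      proof (rule nn_integral_mono)
        fix w assume wM: "w \<in> space M"
        note [measurable] = sec[OF wM]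
        have "(\<integral>\<^sup>+s. ennreal (indicator {0<..} s * (e n s w * of_bool (s \<le> D n w) - h s w * of_bool (s \<le> T w))\<^sup>2) \<partial>lborel)
          \<le> (\<integral>\<^sup>+s. 2 * (ennreal ((C n)\<^sup>2) * indicator {S n w<..D n w} s) + 2 * ennreal (indicator {0<..} s * (e n s w * of_bool (s \<le> S n w) - h s w * of_bool (s \<le> T w))\<^sup>2) \<partial>lborel)"
        proof (rule nn_integral_mono)
          fix s
          \<comment> \<open>x is the rounding error, supported on (S n, D n], and y is the error
            measured by \<open>F\<close>.\<close>
          define x where "x = e n s w * of_bool (s \<le> D n w) - e n s w * of_bool (s \<le> S n w)"
          define y where "y = e n s w * of_bool (s \<le> S n w) - h s w * of_bool (s \<le> T w)"
          have "x\<^sup>2 \<le> (C n)\<^sup>2 * indicator {S n w<..D n w} s"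
            using C(2)[OF wM, of n s] C(1)[of n] Dm(1)[of n w] by (auto simp: x_def abs_le_square_iff[symmetric] indicator_def)
          then have x: "ennreal (x\<^sup>2) \<le> ennreal ((C n)\<^sup>2) * indicator {S n w<..D n w} s"
            by (auto simp: indicator_def split: if_splits)
          have "ennreal ((x + y)\<^sup>2) \<le> 2 * ennreal (x\<^sup>2) + 2 * ennreal (y\<^sup>2)"
            using two_square_bound(1)[of x y]
            by (simp add: ennreal_mult[symmetric] ennreal_plus[symmetric] ennreal_numeral[symmetric] del: ennreal_plus ennreal_numeral)
          also have "\<dots> \<le> 2 * (ennreal ((C n)\<^sup>2) * indicator {S n w<..D n w} s) + 2 * ennreal (y\<^sup>2)"
            by (intro add_mono mult_left_mono x) auto
          finally have "ennreal ((x + y)\<^sup>2) \<le> 2 * (ennreal ((C n)\<^sup>2) * indicator {S n w<..D n w} s) + 2 * ennreal (y\<^sup>2)" .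
          then show "ennreal (indicator {0<..} s * (e n s w * of_bool (s \<le> D n w) - h s w * of_bool (s \<le> T w))\<^sup>2)
            \<le> 2 * (ennreal ((C n)\<^sup>2) * indicator {S n w<..D n w} s) + 2 * ennreal (indicator {0<..} s * (e n s w * of_bool (s \<le> S n w) - h s w * of_bool (s \<le> T w))\<^sup>2)"
            unfolding y_def[symmetric] by (cases "0 < s") (simp_all add: x_def y_def)
        qed
        also have "\<dots> = 2 * (ennreal ((C n)\<^sup>2) * ennreal (D n w - S n w)) + 2 * F n w"
          unfolding F_def by (subst nn_integral_add) (use Dm(1)[of n w] in \<open>simp_all add: nn_integral_cmult less_imp_le\<close>)
        also have "ennreal ((C n)\<^sup>2) * ennreal (D n w - S n w) \<le> ennreal (1 / real (Suc n))"
        proof -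
          have "(C n)\<^sup>2 * (D n w - S n w) \<le> (C n)\<^sup>2 * (1 / m n)"
            using Dm(2)[of n w] by (intro mult_left_mono) auto
          also have "\<dots> \<le> 1 / real (Suc n)" using m2[of n] by simp
          finally show ?thesis using Dm(1)[of n w] by (subst ennreal_mult[symmetric]) (auto intro!: ennreal_leI)
        qed
        finally show "(\<integral>\<^sup>+s. ennreal (indicator {0<..} s * (e n s w * of_bool (s \<le> D n w) - h s w * of_bool (s \<le> T w))\<^sup>2) \<partial>lborel)
           \<le> 2 * ennreal (1 / real (Suc n)) + 2 * F n w"
          by (simp add: add_right_mono mult_left_mono)
      qed
      also have "\<dots> = 2 * ennreal (1 / real (Suc n)) + 2 * (\<integral>\<^sup>+w. F n w \<partial>M)"
        using Fm[of n] by (subst nn_integral_add) (simp_all add: nn_integral_cmult emeasure_space_1)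
      finally show ?thesis .
    qed
    have "(\<lambda>n. 2 * ennreal (1 / real (Suc n)) + 2 * (\<integral>\<^sup>+w. F n w \<partial>M)) \<longlonglongrightarrow> 2 * ennreal 0 + 2 * 0"
    proof (intro tendsto_add tendsto_mult_ennreal tendsto_const)
      show "(\<lambda>n. ennreal (1 / real (Suc n))) \<longlonglongrightarrow> ennreal 0"
        using LIMSEQ_inverse_real_of_nat by (intro tendsto_ennrealI) (simp add: inverse_eq_divide)
    qed (use Fint in auto)
    then have "(\<lambda>n. 2 * ennreal (1 / real (Suc n)) + 2 * (\<integral>\<^sup>+w. F n w \<partial>M)) \<longlonglongrightarrow> 0" by simp
    from this have "A \<longlonglongrightarrow> 0"
      by (rule tendsto_sandwich[OF _ _ tendsto_const, rotated 2]) (simp_all add: Ab del: of_nat_Suc)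
    then show "(\<lambda>n. \<integral>\<^sup>+z. ennreal (indicator {0<..} (fst z) * (e n (fst z) (snd z) * of_bool (fst z \<le> D n (snd z)) - h (fst z) (snd z) * of_bool (fst z \<le> T (snd z)))\<^sup>2)
        \<partial>(lborel \<Otimes>\<^sub>M M)) \<longlonglongrightarrow> 0"
      by (simp add: A_def[abs_def])
  qed
qed

lemma prog_pair:
  assumes "prog k"
  shows "(\<lambda>z. k (fst z) (snd z)) \<in> borel_measurable (lborel \<Otimes>\<^sub>M M)"
  using prog_measurable[OF assms] by (simp add: case_prod_beta' cong: measurable_cong_sets sets_pair_measure_cong)

lemma itoD:
  assumes "ito h I"
  shows "prog h" "0 \<le> t \<Longrightarrow> I t \<in> borel_measurable (G t)" "w \<in> space M \<Longrightarrow> continuous_on {0..} (\<lambda>t. I t w)"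
  using assms by (auto simp: ito_def)

lemma stopped_adapted:
  fixes X :: "real \<Rightarrow> 'a \<Rightarrow> real"
  assumes "\<And>t. 0 \<le> t \<Longrightarrow> X t \<in> borel_measurable (G t)" "\<And>w. w \<in> space M \<Longrightarrow> continuous_on {0..} (\<lambda>t. X t w)"
    and "opt T" "0 \<le> t"
  shows "(\<lambda>w. X (min t (T w)) w) \<in> borel_measurable (G t)"
proof -
  have "prog (\<lambda>s. X (max 0 s))" by (rule prog_of_continuous) (use assms in auto)
  from prog_stopped[OF this assms(3,4)] show ?thesis
    by (rule measurable_cong[THEN iffD1, rotated]) (use opt_nonneg[OF assms(3)] assms(4) in \<open>simp add: max_def\<close>)
qed

text \<open>The energy bound makes the stopped integral a square-integrable martingale. The
  elementary integrals form a Cauchy sequence in mean square by their own isometry, and pathwise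
  convergence identifies the limit; mean and second moment then pass over together with the weight
  \<zeta>.\<close>

lemma ito_stopped:
  assumes ito: "ito h I" and T: "opt T" and Tc: "\<And>w. w \<in> space M \<Longrightarrow> T w \<le> c" and c: "0 \<le> c" and K: "0 \<le> K"
    and bd: "AE w in M. (\<integral>\<^sup>+s\<in>{0..T w}. ennreal ((h s w)\<^sup>2) \<partial>lborel) \<le> ennreal K"
    and s: "0 \<le> s" and st: "s \<le> t" and \<zeta>: "\<zeta> \<in> borel_measurable (G s)" and \<zeta>C: "\<And>w. w \<in> space M \<Longrightarrow> \<bar>\<zeta> w\<bar> \<le> C"
  shows "integrable M (\<lambda>w. (I (min t (T w)) w - I (min s (T w)) w)\<^sup>2)" (is ?i)
    and "(\<integral>w. \<zeta> w * (I (min t (T w)) w - I (min s (T w)) w) \<partial>M) = 0" (is ?m)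
    and "integrable (lborel \<Otimes>\<^sub>M M) (\<lambda>z. (indicator {s<..t} (fst z) * (h (fst z) (snd z) * of_bool (fst z \<le> T (snd z))))\<^sup>2)" (is ?j)
    and "(\<integral>w. \<zeta> w * (I (min t (T w)) w - I (min s (T w)) w)\<^sup>2 \<partial>M)
      = (\<integral>z. \<zeta> (snd z) * (indicator {s<..t} (fst z) * (h (fst z) (snd z) * of_bool (fst z \<le> T (snd z))))\<^sup>2 \<partial>(lborel \<Otimes>\<^sub>M M))" (is ?q)
proof -
  obtain g J where el: "\<And>n. elem (g n) (J n)"
    and A: "(\<lambda>n. \<integral>\<^sup>+z. ennreal (indicator {0<..} (fst z) * (g n (fst z) (snd z) - h (fst z) (snd z) * of_bool (fst z \<le> T (snd z)))\<^sup>2)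
        \<partial>(lborel \<Otimes>\<^sub>M M)) \<longlonglongrightarrow> 0"
    and J: "AE w in M. \<forall>t\<ge>0. (\<lambda>n. J n t w) \<longlonglongrightarrow> I (min t (T w)) w"
    using ito_stop_approx[OF ito T Tc c K bd] by blast
  define k where "k u w = h u w * of_bool (u \<le> T w)" for u w
  define An where "An n = (\<integral>\<^sup>+z. ennreal (indicator {0<..} (fst z) * (g n (fst z) (snd z) - k (fst z) (snd z))\<^sup>2) \<partial>(lborel \<Otimes>\<^sub>M M))" for n
  have A: "An \<longlonglongrightarrow> 0" using A by (simp add: An_def[abs_def] k_def)
  have t: "0 \<le> t" using s st by simp
  have pk: "prog k" unfolding k_def by (rule prog_mult[OF itoD(1)[OF ito] prog_before[OF T]])
  note [measurable] = prog_pair[OF pk] prog_pair[OF elem_prog[OF el]]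
  have \<zeta>M[measurable]: "\<zeta> \<in> borel_measurable M" using meas_GM[OF s \<zeta>] .
  define X where "X w = I (min t (T w)) w - I (min s (T w)) w" for w
  have Xm[measurable]: "X \<in> borel_measurable M"
    unfolding X_def using meas_GM[OF s stopped_adapted[of I, OF itoD(2,3)[OF ito] T s]]
      meas_GM[OF t stopped_adapted[of I, OF itoD(2,3)[OF ito] T t]] by simp
  define Xn where "Xn n w = J n t w - J n s w" for n w
  have Xnm[measurable]: "Xn n \<in> borel_measurable M" for n
    unfolding Xn_def using elem_measurable[OF el s] elem_measurable[OF el t] by simp
  have Xnsq: "integrable M (\<lambda>w. (Xn n w)\<^sup>2)" for n
    unfolding Xn_def by (rule integrable_square_add(2)[OF elem_measurable[OF el t] elem_measurable[OF el s] elem_square_integrable[OF el t] elem_square_integrable[OF el s]])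
  \<comment> \<open>A difference of elementary integrals is elementary, so the isometry applies to
    it before any limit is taken.\<close>
  have diff: "(\<integral>\<^sup>+w. ennreal ((Xn n w - Xn m w)\<^sup>2) \<partial>M) \<le> 2 * An n + 2 * An m" for n m
  proof -
    note el2 = elem_diff[OF el[of n] el[of m]]
    obtain B where B: "\<And>u w. w \<in> space M \<Longrightarrow> \<bar>g n u w - g m u w\<bar> \<le> B" using elem_bounded[OF el2] by blast
    have I1: "integrable M (\<lambda>w. (Xn n w - Xn m w)\<^sup>2)" by (rule integrable_square_add(2)[OF Xnm Xnm Xnsq Xnsq])
    have I2: "integrable (lborel \<Otimes>\<^sub>M M) (\<lambda>z. indicator {s<..t} (fst z) * (g n (fst z) (snd z) - g m (fst z) (snd z))\<^sup>2)"
      using strip_integrable(2)[OF elem_prog[OF el2] B, of "\<lambda>_. 1" 1 s t] by (simp add: case_prod_beta')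
    have "(\<integral>\<^sup>+w. ennreal ((Xn n w - Xn m w)\<^sup>2) \<partial>M) = ennreal (\<integral>w. (Xn n w - Xn m w)\<^sup>2 \<partial>M)"
      by (rule nn_integral_eq_integral[OF I1]) simp
    also have "(\<integral>w. (Xn n w - Xn m w)\<^sup>2 \<partial>M) = (\<integral>z. indicator {s<..t} (fst z) * (g n (fst z) (snd z) - g m (fst z) (snd z))\<^sup>2 \<partial>(lborel \<Otimes>\<^sub>M M))"
      using elem_isometry[OF el2 s st, of "\<lambda>_. 1" 1] by (simp add: Xn_def case_prod_beta' algebra_simps)
    also have "ennreal \<dots> = (\<integral>\<^sup>+z. ennreal (indicator {s<..t} (fst z) * (g n (fst z) (snd z) - g m (fst z) (snd z))\<^sup>2) \<partial>(lborel \<Otimes>\<^sub>M M))"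
      by (rule nn_integral_eq_integral[OF I2, symmetric]) simp
    also have "\<dots> \<le> (\<integral>\<^sup>+z. 2 * ennreal (indicator {0<..} (fst z) * (g n (fst z) (snd z) - k (fst z) (snd z))\<^sup>2)
        + 2 * ennreal (indicator {0<..} (fst z) * (g m (fst z) (snd z) - k (fst z) (snd z))\<^sup>2) \<partial>(lborel \<Otimes>\<^sub>M M))"
    proof (rule nn_integral_mono)
      fix z :: "real \<times> 'a"
      define x where "x = g n (fst z) (snd z) - k (fst z) (snd z)"
      define y where "y = g m (fst z) (snd z) - k (fst z) (snd z)"
      have "ennreal ((x - y)\<^sup>2) \<le> 2 * ennreal (x\<^sup>2) + 2 * ennreal (y\<^sup>2)"
        using two_square_bound(2)[of x y]
        by (simp add: ennreal_mult[symmetric] ennreal_plus[symmetric] ennreal_numeral[symmetric] del: ennreal_plus ennreal_numeral)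
      moreover have "g n (fst z) (snd z) - g m (fst z) (snd z) = x - y" by (simp add: x_def y_def)
      ultimately show "ennreal (indicator {s<..t} (fst z) * (g n (fst z) (snd z) - g m (fst z) (snd z))\<^sup>2)
        \<le> 2 * ennreal (indicator {0<..} (fst z) * (g n (fst z) (snd z) - k (fst z) (snd z))\<^sup>2)
        + 2 * ennreal (indicator {0<..} (fst z) * (g m (fst z) (snd z) - k (fst z) (snd z))\<^sup>2)"
        using s unfolding x_def[symmetric] y_def[symmetric] by (auto simp: indicator_def)
    qed
    also have "\<dots> = 2 * An n + 2 * An m"
      unfolding An_def by (subst nn_integral_add) (simp_all add: nn_integral_cmult)
    finally show ?thesis .
  qed
  have lim: "(\<lambda>n. \<integral>\<^sup>+w. ennreal ((Xn n w - X w)\<^sup>2) \<partial>M) \<longlonglongrightarrow> 0"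
  proof (rule tendsto_sandwich[OF _ _ tendsto_const])
    have "(\<lambda>n. 2 * An n) \<longlonglongrightarrow> 2 * 0" by (intro tendsto_mult_ennreal tendsto_const A) auto
    then show "(\<lambda>n. 2 * An n) \<longlonglongrightarrow> 0" by simp
    show "\<forall>\<^sub>F n in sequentially. (\<integral>\<^sup>+w. ennreal ((Xn n w - X w)\<^sup>2) \<partial>M) \<le> 2 * An n"
    proof (intro always_eventually allI)
      \<comment> \<open>Fatou's lemma in the second index m turns the Cauchy estimate into a
        distance to the pathwise limit.\<close>
      fix n
      have "(\<integral>\<^sup>+w. ennreal ((Xn n w - X w)\<^sup>2) \<partial>M) = (\<integral>\<^sup>+w. liminf (\<lambda>m. ennreal ((Xn n w - Xn m w)\<^sup>2)) \<partial>M)"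
      proof (rule nn_integral_cong_AE)
        show "AE w in M. ennreal ((Xn n w - X w)\<^sup>2) = liminf (\<lambda>m. ennreal ((Xn n w - Xn m w)\<^sup>2))"
          using J
        proof eventually_elim
          case (elim w)
          then have "(\<lambda>m. Xn m w) \<longlonglongrightarrow> X w" unfolding Xn_def X_def using s t by (intro tendsto_diff) auto
          then have "(\<lambda>m. ennreal ((Xn n w - Xn m w)\<^sup>2)) \<longlonglongrightarrow> ennreal ((Xn n w - X w)\<^sup>2)"
            by (intro tendsto_ennrealI tendsto_power tendsto_diff tendsto_const)
          then show ?case by (intro lim_imp_Liminf[symmetric]) auto
        qed
      qed
      also have "\<dots> \<le> liminf (\<lambda>m. \<integral>\<^sup>+w. ennreal ((Xn n w - Xn m w)\<^sup>2) \<partial>M)"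
        by (rule nn_integral_liminf) simp
      also have "\<dots> \<le> liminf (\<lambda>m. 2 * An n + 2 * An m)"
        by (intro Liminf_mono always_eventually allI diff)
      also have "\<dots> = 2 * An n + 2 * 0"
        by (intro lim_imp_Liminf tendsto_add tendsto_const tendsto_mult_ennreal A) auto
      finally show "(\<integral>\<^sup>+w. ennreal ((Xn n w - X w)\<^sup>2) \<partial>M) \<le> 2 * An n" by simp
    qed
  qed simp
  note L = L2_limit[OF Xnm Xm \<zeta>M lim Xnsq \<zeta>C]
  show ?i using L(1) by (simp add: X_def)
  have mean0: "(\<integral>w. \<zeta> w * Xn n w \<partial>M) = 0" for n
    using elem_weighted_mean[OF el s st \<zeta> \<zeta>C] by (simp add: Xn_def)
  have "(\<lambda>n. \<integral>w. \<zeta> w * Xn n w \<partial>M) \<longlonglongrightarrow> (\<integral>w. \<zeta> w * X w \<partial>M)"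
    by (rule L2_limit_mean[OF Xnm Xm \<zeta>M lim Xnsq \<zeta>C])
  then have "(\<integral>w. \<zeta> w * X w \<partial>M) = 0" using mean0 by (simp add: LIMSEQ_const_iff)
  then show ?m by (simp add: X_def)
  define Z where "Z z = indicator {s<..t} (fst z) * k (fst z) (snd z)" for z
  define Zn where "Zn n z = indicator {s<..t} (fst z) * g n (fst z) (snd z)" for n z
  have Zm: "Z \<in> borel_measurable (lborel \<Otimes>\<^sub>M M)" unfolding Z_def by measurable
  have Znm: "Zn n \<in> borel_measurable (lborel \<Otimes>\<^sub>M M)" for n unfolding Zn_def by measurable
  have Zsq: "(Zn n z)\<^sup>2 = indicator {s<..t} (fst z) * (g n (fst z) (snd z))\<^sup>2" for n z
    by (simp add: Zn_def indicator_def)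
  have Znsq: "integrable (lborel \<Otimes>\<^sub>M M) (\<lambda>z. (Zn n z)\<^sup>2)" for n
  proof -
    obtain B where B: "\<And>u w. w \<in> space M \<Longrightarrow> \<bar>g n u w\<bar> \<le> B" using elem_bounded[OF el] by blast
    show ?thesis
      using strip_integrable(2)[OF elem_prog[OF el] B, of "\<lambda>_. 1" 1 s t]
      by (simp add: case_prod_beta' Zsq)
  qed
  have Zlim: "(\<lambda>n. \<integral>\<^sup>+z. ennreal ((Zn n z - Z z)\<^sup>2) \<partial>(lborel \<Otimes>\<^sub>M M)) \<longlonglongrightarrow> 0"
  proof (rule tendsto_sandwich[OF _ _ tendsto_const A])
    show "\<forall>\<^sub>F n in sequentially. (\<integral>\<^sup>+z. ennreal ((Zn n z - Z z)\<^sup>2) \<partial>(lborel \<Otimes>\<^sub>M M)) \<le> An n"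
      unfolding An_def
      by (intro always_eventually allI nn_integral_mono ennreal_leI)
        (use s in \<open>auto simp: Zn_def Z_def indicator_def\<close>)
  qed simp
  have \<zeta>2: "(\<lambda>z. \<zeta> (snd z)) \<in> borel_measurable (lborel \<Otimes>\<^sub>M M)" by measurable
  have \<zeta>2C: "\<bar>\<zeta> (snd z)\<bar> \<le> C" if "z \<in> space (lborel \<Otimes>\<^sub>M M)" for z
    using that by (intro \<zeta>C) (auto simp: space_pair_measure)
  note L2 = L2_limit[OF Znm Zm \<zeta>2 Zlim Znsq \<zeta>2C]
  show ?j using L2(1) by (simp add: Z_def k_def)
  have "(\<integral>w. \<zeta> w * (Xn n w)\<^sup>2 \<partial>M) = (\<integral>z. \<zeta> (snd z) * (Zn n z)\<^sup>2 \<partial>(lborel \<Otimes>\<^sub>M M))" for n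
    using elem_isometry[OF el s st \<zeta> \<zeta>C]
    by (simp add: Xn_def Zsq case_prod_beta' mult.left_commute)
  then have "(\<lambda>n. \<integral>w. \<zeta> w * (Xn n w)\<^sup>2 \<partial>M) \<longlonglongrightarrow> (\<integral>z. \<zeta> (snd z) * (Z z)\<^sup>2 \<partial>(lborel \<Otimes>\<^sub>M M))"
    using L2(2) by simp
  from LIMSEQ_unique[OF L(2) this] show ?q by (simp add: X_def Z_def k_def)
qed

lemma ito_diff:
  assumes "ito h I" "ito k J"
  shows "ito (\<lambda>s w. h s w - k s w) (\<lambda>s w. I s w - J s w)"
proof -
  from assms(1) obtain e E where e: "\<And>n. elem (e n) (E n)"
    and eA: "AE w in M. \<forall>c\<ge>0. (\<lambda>n. \<integral>\<^sup>+s\<in>{0..c}. ennreal ((e n s w - h s w)\<^sup>2) \<partial>lborel) \<longlonglongrightarrow> 0 \<and>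
        uniform_limit {0..c} (\<lambda>n t. E n t w) (\<lambda>t. I t w) sequentially"
    by (auto simp: ito_def ito_approx_def)
  from assms(2) obtain f F where f: "\<And>n. elem (f n) (F n)"
    and fA: "AE w in M. \<forall>c\<ge>0. (\<lambda>n. \<integral>\<^sup>+s\<in>{0..c}. ennreal ((f n s w - k s w)\<^sup>2) \<partial>lborel) \<longlonglongrightarrow> 0 \<and>
        uniform_limit {0..c} (\<lambda>n t. F n t w) (\<lambda>t. J t w) sequentially"
    by (auto simp: ito_def ito_approx_def)
  have "ito_approx (\<lambda>s w. h s w - k s w) (\<lambda>s w. I s w - J s w) (\<lambda>n s w. e n s w - f n s w) (\<lambda>n s w. E n s w - F n s w)"
    unfolding ito_approx_def
  proof (intro conjI allI elem_diff e f)
    show "AE w in M. \<forall>c\<ge>0. (\<lambda>n. \<integral>\<^sup>+s\<in>{0..c}. ennreal ((e n s w - f n s w - (h s w - k s w))\<^sup>2) \<partial>lborel) \<longlonglongrightarrow> 0 \<and>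
        uniform_limit {0..c} (\<lambda>n t. E n t w - F n t w) (\<lambda>t. I t w - J t w) sequentially"
      using eA fA AE_space
    proof eventually_elim
      case (elim w)
      note [measurable] = prog_section[OF itoD(1)[OF assms(1)] elim(3)] prog_section[OF itoD(1)[OF assms(2)] elim(3)]
        prog_section[OF elem_prog[OF e] elim(3)] prog_section[OF elem_prog[OF f] elim(3)]
      show ?case
      proof (intro allI impI conjI)
        fix c :: real assume c: "0 \<le> c"
        let ?a = "\<lambda>n. \<integral>\<^sup>+s\<in>{0..c}. ennreal ((e n s w - h s w)\<^sup>2) \<partial>lborel"
        let ?b = "\<lambda>n. \<integral>\<^sup>+s\<in>{0..c}. ennreal ((f n s w - k s w)\<^sup>2) \<partial>lborel"
        show "uniform_limit {0..c} (\<lambda>n t. E n t w - F n t w) (\<lambda>t. I t w - J t w) sequentially"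
          using elim c by (intro uniform_limit_minus) auto
        show "(\<lambda>n. \<integral>\<^sup>+s\<in>{0..c}. ennreal ((e n s w - f n s w - (h s w - k s w))\<^sup>2) \<partial>lborel) \<longlonglongrightarrow> 0"
        proof (rule tendsto_sandwich[OF _ _ tendsto_const])
          have "(\<lambda>n. 2 * ?a n + 2 * ?b n) \<longlonglongrightarrow> 2 * 0 + 2 * 0"
            using elim(1,2) c by (intro tendsto_add tendsto_mult_ennreal tendsto_const) auto
          then show "(\<lambda>n. 2 * ?a n + 2 * ?b n) \<longlonglongrightarrow> 0" by simp
          show "\<forall>\<^sub>F n in sequentially. (\<integral>\<^sup>+s\<in>{0..c}. ennreal ((e n s w - f n s w - (h s w - k s w))\<^sup>2) \<partial>lborel) \<le> 2 * ?a n + 2 * ?b n"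
          proof (intro always_eventually allI)
            fix n
            have "(\<integral>\<^sup>+s\<in>{0..c}. ennreal ((e n s w - f n s w - (h s w - k s w))\<^sup>2) \<partial>lborel)
              \<le> (\<integral>\<^sup>+s. 2 * (ennreal ((e n s w - h s w)\<^sup>2) * indicator {0..c} s) + 2 * (ennreal ((f n s w - k s w)\<^sup>2) * indicator {0..c} s) \<partial>lborel)"
            proof (rule nn_integral_mono)
              fix s
              have "ennreal ((e n s w - f n s w - (h s w - k s w))\<^sup>2) \<le> 2 * ennreal ((e n s w - h s w)\<^sup>2) + 2 * ennreal ((f n s w - k s w)\<^sup>2)"
                using two_square_bound(2)[of "e n s w - h s w" "f n s w - k s w"]
                by (simp add: ennreal_mult[symmetric] ennreal_plus[symmetric] ennreal_numeral[symmetric] algebra_simps del: ennreal_plus ennreal_numeral)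
              then show "ennreal ((e n s w - f n s w - (h s w - k s w))\<^sup>2) * indicator {0..c} s
                \<le> 2 * (ennreal ((e n s w - h s w)\<^sup>2) * indicator {0..c} s) + 2 * (ennreal ((f n s w - k s w)\<^sup>2) * indicator {0..c} s)"
                by (auto simp: indicator_def)
            qed
            also have "\<dots> = 2 * ?a n + 2 * ?b n"
              by (subst nn_integral_add) (simp_all add: nn_integral_cmult)
            finally show "(\<integral>\<^sup>+s\<in>{0..c}. ennreal ((e n s w - f n s w - (h s w - k s w))\<^sup>2) \<partial>lborel) \<le> 2 * ?a n + 2 * ?b n" .
          qed
        qed simp
      qed
    qed
  qed
  then show ?thesis
    unfolding ito_def
    using prog_diff[OF itoD(1)[OF assms(1)] itoD(1)[OF assms(2)]]
      borel_measurable_diff[OF itoD(2)[OF assms(1)] itoD(2)[OF assms(2)]]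
      continuous_on_diff[OF itoD(3)[OF assms(1)] itoD(3)[OF assms(2)]]
    by (intro conjI allI impI ballI exI)
qed

end

section \<open>Dynkin's formula for convex functions\<close>

text \<open>For \<phi> \<ge> 0 the convex function with second derivative \<phi> on [c, d], written
  as a mixture of the ramps (z - y)^+: this is what Tanaka's formula produces after integration over
  the level. \<open>cvx'\<close> is its derivative, with the strict inequality y < z of Tanaka's
  formula.\<close>

definition cvx :: "(real \<Rightarrow> real) \<Rightarrow> real \<Rightarrow> real \<Rightarrow> real \<Rightarrow> real" where
  "cvx \<phi> c d z = (\<integral>y. indicator {c..d} y * \<phi> y * max 0 (z - y) \<partial>lborel)"

definition cvx' :: "(real \<Rightarrow> real) \<Rightarrow> real \<Rightarrow> real \<Rightarrow> real \<Rightarrow> real" where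
  "cvx' \<phi> c d z = (\<integral>y. indicator {c..d} y * \<phi> y * of_bool (y < z) \<partial>lborel)"

lemma integrable_Icc_bounded:
  fixes g :: "real \<Rightarrow> real"
  assumes [measurable]: "g \<in> borel_measurable borel" and "\<And>y. c \<le> y \<Longrightarrow> y \<le> d \<Longrightarrow> \<bar>g y\<bar> \<le> C"
  shows "integrable lborel (\<lambda>y. indicator {c..d} y * g y)"
proof (rule Bochner_Integration.integrable_bound)
  show "integrable lborel (\<lambda>y. indicator {c..d} y *\<^sub>R \<bar>C\<bar> :: real)"
    by (rule borel_integrable_compact) auto
  show "AE y in lborel. norm (indicator {c..d} y * g y) \<le> norm (indicator {c..d} y *\<^sub>R \<bar>C\<bar>)"
    using assms(2) by (intro AE_I2) (auto simp: indicator_def intro: order_trans[OF _ abs_ge_self])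
qed simp

lemma cvx_integrable:
  fixes \<phi> :: "real \<Rightarrow> real"
  assumes [measurable]: "\<phi> \<in> borel_measurable borel" and "\<And>y. \<bar>\<phi> y\<bar> \<le> C" "c \<le> z" "z \<le> d"
  shows "integrable lborel (\<lambda>y. indicator {c..d} y * \<phi> y * max 0 (z - y))"
    "integrable lborel (\<lambda>y. indicator {c..d} y * \<phi> y * of_bool (y < z))"
proof -
  have C: "0 \<le> C" using assms(2)[of 0] by linarith
  have "\<bar>\<phi> y * max 0 (z - y)\<bar> \<le> C * (d - c)" if "c \<le> y" "y \<le> d" for y
    unfolding abs_mult using that assms C by (intro mult_mono assms) auto
  from integrable_Icc_bounded[OF _ this] show "integrable lborel (\<lambda>y. indicator {c..d} y * \<phi> y * max 0 (z - y))"
    by (simp add: mult.assoc)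
  have "\<bar>\<phi> y * of_bool (y < z)\<bar> \<le> C" for y
    using assms(2)[of y] C by (auto simp: of_bool_def)
  from integrable_Icc_bounded[OF _ this] show "integrable lborel (\<lambda>y. indicator {c..d} y * \<phi> y * of_bool (y < z))"
    by (simp add: mult.assoc)
qed

lemma integral_ramp:
  fixes c d z :: real
  assumes "c \<le> z" "z \<le> d"
  shows "(\<integral>y. indicator {c..d} y * max 0 (z - y) \<partial>lborel) = (z - c)\<^sup>2 / 2"
    "(\<integral>y. indicator {c..d} y * of_bool (y < z) \<partial>lborel) = z - c"
proof -
  have "(\<integral>y. indicator {c..d} y * max 0 (z - y) \<partial>lborel) = (\<integral>y. (z - y) * indicator {c..z} y \<partial>lborel)"
    using assms by (intro Bochner_Integration.integral_cong) (auto simp: indicator_def)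
  also have "\<dots> = (- ((z - z)\<^sup>2 / 2)) - (- ((z - c)\<^sup>2 / 2))"
    by (rule integral_FTC_Icc_real[OF assms(1)]) (auto intro!: derivative_eq_intros continuous_intros simp: field_simps)
  finally show "(\<integral>y. indicator {c..d} y * max 0 (z - y) \<partial>lborel) = (z - c)\<^sup>2 / 2" by simp
  have "(\<integral>y. indicator {c..d} y * of_bool (y < z) \<partial>lborel) = (\<integral>y. (indicator {c..<z} y :: real) \<partial>lborel)"
    using assms by (intro Bochner_Integration.integral_cong) (auto simp: indicator_def)
  then show "(\<integral>y. indicator {c..d} y * of_bool (y < z) \<partial>lborel) = z - c"
    using assms by simp
qed

lemma cvx'_bound:
  assumes "\<phi> \<in> borel_measurable borel" "\<And>y. \<bar>\<phi> y\<bar> \<le> C" "c \<le> z" "z \<le> d"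
  shows "\<bar>cvx' \<phi> c d z\<bar> \<le> C * (d - c)"
proof -
  have C: "0 \<le> C" using assms(2)[of 0] by linarith
  have "\<bar>cvx' \<phi> c d z\<bar> \<le> (\<integral>y. C * (indicator {c..d} y * of_bool (y < z)) \<partial>lborel)"
    unfolding cvx'_def
  proof (rule order_trans[OF integral_abs_bound integral_mono])
    show "integrable lborel (\<lambda>y. \<bar>indicator {c..d} y * \<phi> y * of_bool (y < z)\<bar>)"
      using cvx_integrable(2)[OF assms] by simp
    show "integrable lborel (\<lambda>y. C * (indicator {c..d} y * of_bool (y < z)))"
      using cvx_integrable(2)[of "\<lambda>_. 1" 1 c z d] assms by simp
    show "\<bar>indicator {c..d} y * \<phi> y * of_bool (y < z)\<bar> \<le> C * (indicator {c..d} y * of_bool (y < z))" for y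
      using assms(2)[of y] C by (auto simp: indicator_def)
  qed
  also have "\<dots> = C * (z - c)" using integral_ramp(2)[OF assms(3,4)] by simp
  also have "\<dots> \<le> C * (d - c)" using assms(4) C by (intro mult_left_mono) auto
  finally show ?thesis .
qed

text \<open>Gives the continuity of the derivative that the Riemann sums of the drift
  require.\<close>

lemma cvx'_mono:
  assumes "\<phi> \<in> borel_measurable borel" "\<And>y. \<bar>\<phi> y\<bar> \<le> C" "\<And>y. 0 \<le> \<phi> y" "c \<le> u" "u \<le> v" "v \<le> d"
  shows "cvx' \<phi> c d u \<le> cvx' \<phi> c d v" "cvx' \<phi> c d v - cvx' \<phi> c d u \<le> C * (v - u)"
proof -
  have i: "integrable lborel (\<lambda>y. indicator {c..d} y * \<phi> y * of_bool (y < u))" "integrable lborel (\<lambda>y. indicator {c..d} y * \<phi> y * of_bool (y < v))"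
    by (rule cvx_integrable(2)[OF assms(1,2)]; use assms in simp)+
  show "cvx' \<phi> c d u \<le> cvx' \<phi> c d v" unfolding cvx'_def
    using i assms by (intro integral_mono) (auto simp: indicator_def)
  have C: "0 \<le> C" using assms(2)[of 0] by linarith
  have j: "integrable lborel (\<lambda>y. indicator {c..d} y * of_bool (y < u) :: real)" "integrable lborel (\<lambda>y. indicator {c..d} y * of_bool (y < v) :: real)"
    using cvx_integrable(2)[of "\<lambda>_. 1" 1 c _ d] assms by simp_all
  have "cvx' \<phi> c d v - cvx' \<phi> c d u = (\<integral>y. indicator {c..d} y * \<phi> y * of_bool (y < v) - indicator {c..d} y * \<phi> y * of_bool (y < u) \<partial>lborel)"
    unfolding cvx'_def using i by simp
  also have "\<dots> \<le> (\<integral>y. C * (indicator {c..d} y * of_bool (y < v)) - C * (indicator {c..d} y * of_bool (y < u)) \<partial>lborel)"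
  proof (rule integral_mono)
    fix y show "indicator {c..d} y * \<phi> y * of_bool (y < v) - indicator {c..d} y * \<phi> y * of_bool (y < u)
       \<le> C * (indicator {c..d} y * of_bool (y < v)) - C * (indicator {c..d} y * of_bool (y < u))"
      using assms(2)[of y] assms(5) C by (auto simp: indicator_def)
  qed (use i j in auto)
  also have "\<dots> = C * (\<integral>y. indicator {c..d} y * of_bool (y < v) \<partial>lborel) - C * (\<integral>y. indicator {c..d} y * of_bool (y < u) \<partial>lborel)"
    using j by simp
  also have "\<dots> = C * (v - u)"
    unfolding integral_ramp(2)[OF order_trans[OF assms(4,5)] assms(6)] integral_ramp(2)[OF assms(4) order_trans[OF assms(5,6)]]
    by (simp add: algebra_simps)
  finally show "cvx' \<phi> c d v - cvx' \<phi> c d u \<le> C * (v - u)" .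
qed

text \<open>Each ramp has its own Taylor remainder \<open>D y\<close>: nonnegative, zero for levels
  not between u and v, and with integral (v - u)^2 / 2 over the levels. Replacing \<phi> y by \<phi>
  u where it is nonzero costs at most B \<bar>v - u\<bar>.\<close>

lemma cvx_taylor:
  fixes \<phi> :: "real \<Rightarrow> real"
  assumes [measurable]: "\<phi> \<in> borel_measurable borel" and C: "\<And>y. \<bar>\<phi> y\<bar> \<le> C"
    and lip: "\<And>y z. \<bar>\<phi> y - \<phi> z\<bar> \<le> B * \<bar>y - z\<bar>"
    and u: "c \<le> u" "u \<le> d" and v: "c \<le> v" "v \<le> d"
  shows "\<bar>cvx \<phi> c d v - cvx \<phi> c d u - cvx' \<phi> c d u * (v - u) - \<phi> u * (v - u)\<^sup>2 / 2\<bar> \<le> B * \<bar>v - u\<bar> * (v - u)\<^sup>2"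
proof -
  have B: "0 \<le> B" using lip[of 1 0] by simp
  define D where "D y = max 0 (v - y) - max 0 (u - y) - of_bool (y < u) * (v - u)" for y
  have D: "0 \<le> D y" "\<bar>y - u\<bar> \<le> \<bar>v - u\<bar> \<or> D y = 0" for y unfolding D_def by (auto simp: max_def)
  have i: "integrable lborel (\<lambda>y. indicator {c..d} y * \<phi> y * D y)"
    and eq: "(\<integral>y. indicator {c..d} y * \<phi> y * D y \<partial>lborel) = cvx \<phi> c d v - cvx \<phi> c d u - cvx' \<phi> c d u * (v - u)"
    if "\<phi> \<in> borel_measurable borel" "\<And>y. \<bar>\<phi> y\<bar> \<le> C" for \<phi> :: "real \<Rightarrow> real" and C
  proof -
    have "(\<lambda>y. indicator {c..d} y * \<phi> y * D y) = (\<lambda>y. indicator {c..d} y * \<phi> y * max 0 (v - y) - indicator {c..d} y * \<phi> y * max 0 (u - y) - indicator {c..d} y * \<phi> y * of_bool (y < u) * (v - u))"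
      by (auto simp: D_def fun_eq_iff algebra_simps)
    moreover note cvx_integrable(1)[OF that v] cvx_integrable(1)[OF that u] cvx_integrable(2)[OF that u]
    ultimately show "integrable lborel (\<lambda>y. indicator {c..d} y * \<phi> y * D y)"
      "(\<integral>y. indicator {c..d} y * \<phi> y * D y \<partial>lborel) = cvx \<phi> c d v - cvx \<phi> c d u - cvx' \<phi> c d u * (v - u)"
      by (simp_all add: cvx_def cvx'_def)
  qed
  have i1: "integrable lborel (\<lambda>y. indicator {c..d} y * D y)" using i[of "\<lambda>_. 1" 1] by simp
  \<comment> \<open>The total mass comes from the same identity with \<phi> = 1, where all terms are
    explicit.\<close>
  have ID: "(\<integral>y. indicator {c..d} y * D y \<partial>lborel) = (v - u)\<^sup>2 / 2"
  proof -
    have "(\<integral>y. indicator {c..d} y * D y \<partial>lborel) = cvx (\<lambda>_. 1) c d v - cvx (\<lambda>_. 1) c d u - cvx' (\<lambda>_. 1) c d u * (v - u)"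
      using eq[of "\<lambda>_. 1" 1] by simp
    also have "\<dots> = (v - c)\<^sup>2 / 2 - (u - c)\<^sup>2 / 2 - (u - c) * (v - u)"
      using integral_ramp[OF u] integral_ramp[OF v] by (simp add: cvx_def cvx'_def)
    also have "\<dots> = (v - u)\<^sup>2 / 2" by (simp add: power2_eq_square field_simps)
    finally show ?thesis .
  qed
  have E: "cvx \<phi> c d v - cvx \<phi> c d u - cvx' \<phi> c d u * (v - u) - \<phi> u * (v - u)\<^sup>2 / 2
     = (\<integral>y. indicator {c..d} y * \<phi> y * D y - \<phi> u * (indicator {c..d} y * D y) \<partial>lborel)"
    using i[OF assms(1) C] i1 by (simp add: eq[OF assms(1) C] ID)
  have "\<bar>\<integral>y. indicator {c..d} y * \<phi> y * D y - \<phi> u * (indicator {c..d} y * D y) \<partial>lborel\<bar> \<le> (\<integral>y. B * \<bar>v - u\<bar> * (indicator {c..d} y * D y) \<partial>lborel)"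
  proof (rule order_trans[OF integral_abs_bound integral_mono])
    show "integrable lborel (\<lambda>y. \<bar>indicator {c..d} y * \<phi> y * D y - \<phi> u * (indicator {c..d} y * D y)\<bar>)"
      using i[OF assms(1) C] i1 by simp
    show "integrable lborel (\<lambda>y. B * \<bar>v - u\<bar> * (indicator {c..d} y * D y))" using i1 by simp
    fix y
    have "\<bar>\<phi> y - \<phi> u\<bar> * D y \<le> B * \<bar>v - u\<bar> * D y"
      using D(2)[of y]
    proof
      assume "\<bar>y - u\<bar> \<le> \<bar>v - u\<bar>"
      then have "\<bar>\<phi> y - \<phi> u\<bar> \<le> B * \<bar>v - u\<bar>" using lip[of y u] B by (meson mult_left_mono order_trans)
      then show ?thesis using D(1) by (rule mult_right_mono)
    qed simp
    moreover have "\<bar>indicator {c..d} y * \<phi> y * D y - \<phi> u * (indicator {c..d} y * D y)\<bar> = indicator {c..d} y * (\<bar>\<phi> y - \<phi> u\<bar> * D y)"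
    proof -
      have "indicator {c..d} y * \<phi> y * D y - \<phi> u * (indicator {c..d} y * D y) = indicator {c..d} y * ((\<phi> y - \<phi> u) * D y)"
        by (simp add: algebra_simps)
      then show ?thesis using D(1)[of y] by (simp add: abs_mult)
    qed
    ultimately show "\<bar>indicator {c..d} y * \<phi> y * D y - \<phi> u * (indicator {c..d} y * D y)\<bar> \<le> B * \<bar>v - u\<bar> * (indicator {c..d} y * D y)"
      by (auto simp: indicator_def)
  qed
  also have "\<dots> = B * \<bar>v - u\<bar> * ((v - u)\<^sup>2 / 2)" by (simp only: integral_mult_right_zero ID)
  also have "\<dots> \<le> B * \<bar>v - u\<bar> * (v - u)\<^sup>2"
    using B by (intro mult_left_mono) simp_all
  finally show ?thesis unfolding E .
qed

section \<open>Cells of an equidistant time grid\<close>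

lemma grid_cell:
  fixes \<delta> s :: real
  assumes "0 < \<delta>" "0 < s" "s \<le> real n * \<delta>"
  obtains k where "k < n" "real k * \<delta> < s" "s \<le> real (Suc k) * \<delta>"
    "\<And>f :: nat \<Rightarrow> real. (\<Sum>j<n. f j * indicator {real j * \<delta><..real (Suc j) * \<delta>} s) = f k"
proof -
  \<comment> \<open>The cells (j \<delta>, (j + 1) \<delta>] are closed on the right, hence a
    ceiling minus one instead of a floor.\<close>
  define k where "k = nat (\<lceil>s / \<delta>\<rceil> - 1)"
  have pos: "0 < \<lceil>s / \<delta>\<rceil>" using assms by simp
  then have k: "real k = real_of_int \<lceil>s / \<delta>\<rceil> - 1" by (simp add: k_def of_nat_diff)
  have 1: "real k * \<delta> < s" "s \<le> real (Suc k) * \<delta>"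
  proof -
    have "real k < s / \<delta>" "s / \<delta> \<le> real (Suc k)" using k by linarith+
    then show "real k * \<delta> < s" "s \<le> real (Suc k) * \<delta>"
      using assms(1) by (simp_all only: pos_less_divide_eq pos_divide_le_eq)
  qed
  have "real k * \<delta> < real n * \<delta>" using 1 assms by linarith
  then have kn: "k < n" using assms(1) by simp
  have uniq: "s \<in> {real j * \<delta><..real (Suc j) * \<delta>} \<longleftrightarrow> j = k" for j
  proof
    assume j: "s \<in> {real j * \<delta><..real (Suc j) * \<delta>}"
    then have "real j * \<delta> < real (Suc k) * \<delta>" "real k * \<delta> < real (Suc j) * \<delta>" using 1 by auto
    then have "real j < real (Suc k)" "real k < real (Suc j)" using assms(1) by (simp_all only: mult_less_cancel_right_pos)
    then show "j = k" by simp
  qed (use 1 in simp)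
  have "(\<Sum>j<n. f j * indicator {real j * \<delta><..real (Suc j) * \<delta>} s) = f k" for f :: "nat \<Rightarrow> real"
  proof -
    have "(\<Sum>j<n. f j * indicator {real j * \<delta><..real (Suc j) * \<delta>} s) = (\<Sum>j<n. if j = k then f j else 0)"
      using uniq by (intro sum.cong) (auto simp: indicator_def)
    then show ?thesis using kn by simp
  qed
  then show thesis using that[OF kn 1] by blast
qed

lemma grid_outside:
  fixes \<delta> s :: real
  assumes "0 < \<delta>" "\<not> (0 < s \<and> s \<le> real n * \<delta>)"
  shows "(\<Sum>j<n. f j * indicator {real j * \<delta><..real (Suc j) * \<delta>} s) = (0::real)"
proof (rule sum.neutral, rule ballI)
  fix j assume "j \<in> {..<n}"
  then have "real (Suc j) * \<delta> \<le> real n * \<delta>" using assms(1) by (intro mult_right_mono) (auto simp: Suc_le_eq)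
  moreover have "0 \<le> real j * \<delta>" using assms(1) by simp
  ultimately have "s \<notin> {real j * \<delta><..real (Suc j) * \<delta>}" using assms(2) by auto
  then show "f j * indicator {real j * \<delta><..real (Suc j) * \<delta>} s = 0" by simp
qed

text \<open>X is bounded, and one constant bounds the energies of drift and noise up to T. The
  stopped martingale part is then bounded as well, and all moments below exist.\<close>

locale stopped_diffusion = bm_filtration M G W
  for M :: "'a measure" and G and W +
  fixes X N a b :: "real \<Rightarrow> 'a \<Rightarrow> real" and c d x\<^sub>0 q K :: real and T :: "'a \<Rightarrow> real"
  assumes X_prog: "prog X"
    and X_cont: "w \<in> space M \<Longrightarrow> continuous_on {0..} (\<lambda>t. X t w)"
    and X_range: "w \<in> space M \<Longrightarrow> 0 \<le> t \<Longrightarrow> c \<le> X t w \<and> X t w \<le> d"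
    and X_0: "w \<in> space M \<Longrightarrow> X 0 w = x\<^sub>0"
    and b_prog: "prog b"
    and ito_N: "ito a N"
    and X_eq: "w \<in> space M \<Longrightarrow> 0 \<le> t \<Longrightarrow> X t w = x\<^sub>0 + (LINT s:{0..t}|lborel. b s w) + N t w"
    and T_opt: "opt T" and T_le: "w \<in> space M \<Longrightarrow> T w \<le> q" and q_pos: "0 < q" and K: "0 \<le> K"
    and b_bound: "w \<in> space M \<Longrightarrow> (\<integral>\<^sup>+s\<in>{0..T w}. ennreal \<bar>b s w\<bar> \<partial>lborel) \<le> ennreal K"
    and a_bound: "w \<in> space M \<Longrightarrow> (\<integral>\<^sup>+s\<in>{0..T w}. ennreal ((a s w)\<^sup>2) \<partial>lborel) \<le> ennreal K"
begin

sublocale P: pair_sigma_finite lborel M ..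

abbreviation PP where "PP \<equiv> lborel \<Otimes>\<^sub>M M"

text \<open>Cut to (0, T], with time 0 left out to fit the cells (u, t]; the same holds for the
  noise energy \<open>as2\<close>.\<close>

definition bs :: "real \<times> 'a \<Rightarrow> real" where
  "bs z = of_bool (0 < fst z \<and> fst z \<le> T (snd z)) * b (fst z) (snd z)"

definition as2 :: "real \<times> 'a \<Rightarrow> real" where
  "as2 z = of_bool (0 < fst z \<and> fst z \<le> T (snd z)) * (a (fst z) (snd z))\<^sup>2"

lemma a_prog: "prog a" using itoD(1)[OF ito_N] .

lemma T_nonneg: "w \<in> space M \<Longrightarrow> 0 \<le> T w" using opt_nonneg[OF T_opt] .

lemmas pair_measurable [measurable] = prog_pair[OF X_prog] prog_pair[OF b_prog] prog_pair[OF a_prog]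
lemmas T_measurable [measurable] = opt_measurable[OF T_opt]

lemma bs_measurable [measurable]: "bs \<in> borel_measurable PP" unfolding bs_def by measurable
lemma as2_measurable [measurable]: "as2 \<in> borel_measurable PP" unfolding as2_def by measurable
lemma as2_nonneg: "0 \<le> as2 z" by (simp add: as2_def)

lemma path_bound:
  assumes wM: "w \<in> space M"
  shows "integrable lborel (\<lambda>s. bs (s, w))" "(\<integral>s. \<bar>bs (s, w)\<bar> \<partial>lborel) \<le> K"
    "integrable lborel (\<lambda>s. as2 (s, w))" "(\<integral>s. as2 (s, w) \<partial>lborel) \<le> K"
proof -
  have [measurable]: "(\<lambda>s. bs (s, w)) \<in> borel_measurable borel" "(\<lambda>s. as2 (s, w)) \<in> borel_measurable borel"
    using measurable_compose[OF measurable_Pair2'[OF wM] bs_measurable] measurable_compose[OF measurable_Pair2'[OF wM] as2_measurable]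
    by simp_all
  have 1: "(\<integral>\<^sup>+s. ennreal \<bar>bs (s, w)\<bar> \<partial>lborel) \<le> ennreal K"
    by (rule order_trans[OF nn_integral_mono b_bound[OF wM]]) (auto simp: bs_def indicator_def)
  have 2: "(\<integral>\<^sup>+s. ennreal (as2 (s, w)) \<partial>lborel) \<le> ennreal K"
    by (rule order_trans[OF nn_integral_mono a_bound[OF wM]]) (auto simp: as2_def indicator_def)
  show i: "integrable lborel (\<lambda>s. bs (s, w))"
    using 1 by (intro integrableI_bounded) (auto intro: le_less_trans)
  show j: "integrable lborel (\<lambda>s. as2 (s, w))"
    using 2 as2_nonneg by (intro integrableI_bounded) (auto intro: le_less_trans)
  have "ennreal (\<integral>s. \<bar>bs (s, w)\<bar> \<partial>lborel) \<le> ennreal K"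
    using 1 i by (subst nn_integral_eq_integral[symmetric]) auto
  then show "(\<integral>s. \<bar>bs (s, w)\<bar> \<partial>lborel) \<le> K" using K by simp
  have "ennreal (\<integral>s. as2 (s, w) \<partial>lborel) \<le> ennreal K"
    using 2 j as2_nonneg by (subst nn_integral_eq_integral[symmetric]) auto
  then show "(\<integral>s. as2 (s, w) \<partial>lborel) \<le> K" using K by simp
qed

lemma PP_integrable:
  shows "integrable PP bs" "integrable PP as2" "(\<integral>z. as2 z \<partial>PP) \<le> K" "(\<integral>z. \<bar>bs z\<bar> \<partial>PP) \<le> K"
proof -
  have ib: "integrable PP (\<lambda>z. g z)" if [measurable]: "g \<in> borel_measurable PP"
    and i: "\<And>w. w \<in> space M \<Longrightarrow> integrable lborel (\<lambda>s. g (s, w))"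
    and k: "\<And>w. w \<in> space M \<Longrightarrow> (\<integral>s. \<bar>g (s, w)\<bar> \<partial>lborel) \<le> K" for g :: "real \<times> 'a \<Rightarrow> real"
  proof (rule integrableI_bounded)
    have "(\<integral>\<^sup>+z. ennreal (norm (g z)) \<partial>PP) = (\<integral>\<^sup>+w. (\<integral>\<^sup>+s. ennreal \<bar>g (s, w)\<bar> \<partial>lborel) \<partial>M)"
      by (subst P.nn_integral_snd[symmetric]) auto
    also have "\<dots> \<le> (\<integral>\<^sup>+w. ennreal K \<partial>M)"
      using i k by (intro nn_integral_mono) (auto simp: nn_integral_eq_integral intro!: ennreal_leI)
    also have "\<dots> < \<infinity>" by (simp add: emeasure_space_1)
    finally show "(\<integral>\<^sup>+z. ennreal (norm (g z)) \<partial>PP) < \<infinity>" .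
  qed simp
  show ib1: "integrable PP bs" by (rule ib) (use path_bound in auto)
  show ia: "integrable PP as2" by (rule ib) (use path_bound as2_nonneg in auto)
  have le: "(\<integral>z. g z \<partial>PP) \<le> K" if "integrable PP g" "\<And>w. w \<in> space M \<Longrightarrow> (\<integral>s. g (s, w) \<partial>lborel) \<le> K" for g :: "real \<times> 'a \<Rightarrow> real"
  proof -
    have g: "integrable PP (\<lambda>(s, w). g (s, w))" using that(1) by simp
    have "(\<integral>z. g z \<partial>PP) = (\<integral>w. (\<integral>s. g (s, w) \<partial>lborel) \<partial>M)"
      using P.integral_snd[OF g] by simp
    also have "\<dots> \<le> (\<integral>w. K \<partial>M)"
      by (rule integral_mono[OF P.integrable_snd[OF g]]) (use that(2) in auto)
    also have "\<dots> = K" by (simp add: prob_space)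
    finally show ?thesis .
  qed
  show "(\<integral>z. as2 z \<partial>PP) \<le> K" by (rule le[OF ia path_bound(4)])
  show "(\<integral>z. \<bar>bs z\<bar> \<partial>PP) \<le> K" by (rule le) (use ib1 path_bound(2) in auto)
qed

definition Z where "Z t w = X (min t (T w)) w"
definition Nn where "Nn t w = N (min t (T w)) w"
definition A where "A t w = (\<integral>s. indicator {0<..t} s * bs (s, w) \<partial>lborel)"

lemma strip_path_integrable:
  assumes "w \<in> space M"
  shows "integrable lborel (\<lambda>s. indicator {u<..t} s * bs (s, w))"
  using integrable_mult_indicator[OF _ path_bound(1)[OF assms], of "{u<..t}"] by simp

lemma Z_eq:
  assumes "w \<in> space M" "0 \<le> t"
  shows "Z t w = x\<^sub>0 + A t w + Nn t w"
proof -
  have "(LINT s:{0..min t (T w)}|lborel. b s w) = A t w"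
    unfolding A_def set_lebesgue_integral_def
  proof (rule integral_cong_AE)
    have [measurable]: "(\<lambda>s. b s w) \<in> borel_measurable borel" by (rule prog_section[OF b_prog assms(1)])
    show "(\<lambda>s. indicat_real {0..min t (T w)} s *\<^sub>R b s w) \<in> borel_measurable lborel" by measurable
    show "(\<lambda>s. indicat_real {0<..t} s * bs (s, w)) \<in> borel_measurable lborel"
      using strip_path_integrable[OF assms(1)] by (rule borel_measurable_integrable)
    show "AE s in lborel. indicat_real {0..min t (T w)} s *\<^sub>R b s w = indicat_real {0<..t} s * bs (s, w)"
      using AE_lborel_singleton[of 0] by eventually_elim (auto simp: bs_def indicator_def)
  qed
  then show ?thesis
    using X_eq[OF assms(1), of "min t (T w)"] assms T_nonneg by (simp add: Z_def Nn_def)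
qed

lemma Z_range: "w \<in> space M \<Longrightarrow> 0 \<le> t \<Longrightarrow> c \<le> Z t w \<and> Z t w \<le> d"
  using X_range[of w "min t (T w)"] T_nonneg by (simp add: Z_def)

lemma Z_0: "w \<in> space M \<Longrightarrow> Z 0 w = x\<^sub>0"
  using X_0 T_nonneg by (simp add: Z_def)

lemma x0_range: "c \<le> x\<^sub>0 \<and> x\<^sub>0 \<le> d"
  using X_range X_0 not_empty by (metis all_not_in_conv order_refl)

lemma Z_adapted: "0 \<le> t \<Longrightarrow> Z t \<in> borel_measurable (G t)"
  unfolding Z_def using prog_stopped[OF X_prog T_opt] .

lemma Nn_adapted: "0 \<le> t \<Longrightarrow> Nn t \<in> borel_measurable (G t)"
  unfolding Nn_def by (rule stopped_adapted[OF itoD(2,3)[OF ito_N] T_opt])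

lemma A_diff:
  assumes "w \<in> space M" "0 \<le> u" "u \<le> t"
  shows "A t w - A u w = (\<integral>s. indicator {u<..t} s * bs (s, w) \<partial>lborel)"
    "\<bar>A t w - A u w\<bar> \<le> (\<integral>s. indicator {u<..t} s * \<bar>bs (s, w)\<bar> \<partial>lborel)"
proof -
  show 1: "A t w - A u w = (\<integral>s. indicator {u<..t} s * bs (s, w) \<partial>lborel)"
    unfolding A_def Bochner_Integration.integral_diff[OF strip_path_integrable[OF assms(1)] strip_path_integrable[OF assms(1)], symmetric]
    by (rule Bochner_Integration.integral_cong) (use assms(2,3) in \<open>auto simp: indicator_def\<close>)
  show "\<bar>A t w - A u w\<bar> \<le> (\<integral>s. indicator {u<..t} s * \<bar>bs (s, w)\<bar> \<partial>lborel)"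
    unfolding 1 using integral_abs_bound[of lborel "\<lambda>s. indicator {u<..t} s * bs (s, w)"] by (simp add: abs_mult)
qed

lemma abs_strip_integrable:
  assumes "w \<in> space M"
  shows "integrable lborel (\<lambda>s. indicator {u<..t} s * \<bar>bs (s, w)\<bar>)"
  using integrable_mult_indicator[OF _ integrable_abs[OF path_bound(1)[OF assms]], of "{u<..t}"] by simp

lemma A_diff_bound:
  assumes "w \<in> space M" "0 \<le> u" "u \<le> t"
  shows "\<bar>A t w - A u w\<bar> \<le> K"
proof -
  have "(\<integral>s. indicator {u<..t} s * \<bar>bs (s, w)\<bar> \<partial>lborel) \<le> (\<integral>s. \<bar>bs (s, w)\<bar> \<partial>lborel)"
    by (rule integral_mono[OF abs_strip_integrable[OF assms(1)]]) (use path_bound(1)[OF assms(1)] in \<open>auto simp: indicator_def\<close>)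
  then show ?thesis using A_diff(2)[OF assms] path_bound(2)[OF assms(1)] by linarith
qed

text \<open>Bounds the martingale part, which is the displacement, at most d - c, minus the drift,
  at most K.\<close>

definition BN where "BN = d - c + K"

lemma Nn_bound:
  assumes "w \<in> space M" "0 \<le> t"
  shows "\<bar>Nn t w\<bar> \<le> BN"
proof -
  have "\<bar>Z t w - x\<^sub>0\<bar> \<le> d - c" using Z_range[OF assms] x0_range by auto
  moreover have "A 0 w = 0" by (simp add: A_def)
  then have "\<bar>A t w\<bar> \<le> K" using A_diff_bound[OF assms(1) order_refl assms(2)] by simp
  ultimately show ?thesis unfolding BN_def using Z_eq[OF assms] by linarith
qed

lemma isometry:
  assumes "0 \<le> s" "s \<le> t" "\<zeta> \<in> borel_measurable (G s)" "\<And>w. w \<in> space M \<Longrightarrow> \<bar>\<zeta> w\<bar> \<le> C"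
  shows "(\<integral>w. \<zeta> w * (Nn t w - Nn s w) \<partial>M) = 0"
    "(\<integral>w. \<zeta> w * (Nn t w - Nn s w)\<^sup>2 \<partial>M) = (\<integral>z. \<zeta> (snd z) * (indicator {s<..t} (fst z) * as2 z) \<partial>PP)"
proof -
  have bd: "AE w in M. (\<integral>\<^sup>+s\<in>{0..T w}. ennreal ((a s w)\<^sup>2) \<partial>lborel) \<le> ennreal K"
    using a_bound by (intro AE_I2)
  note I = ito_stopped[OF ito_N T_opt T_le less_imp_le[OF q_pos] K bd assms]
  show "(\<integral>w. \<zeta> w * (Nn t w - Nn s w) \<partial>M) = 0" using I(2) by (simp add: Nn_def)
  have "\<zeta> (snd z) * (indicator {s<..t} (fst z) * (a (fst z) (snd z) * of_bool (fst z \<le> T (snd z))))\<^sup>2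
     = \<zeta> (snd z) * (indicator {s<..t} (fst z) * as2 z)" for z
    using assms(1) by (auto simp: as2_def indicator_def)
  then show "(\<integral>w. \<zeta> w * (Nn t w - Nn s w)\<^sup>2 \<partial>M) = (\<integral>z. \<zeta> (snd z) * (indicator {s<..t} (fst z) * as2 z) \<partial>PP)"
    using I(4) unfolding Nn_def by (simp only:)
qed

lemma weighted_integrable:
  fixes g \<zeta> :: "real \<times> 'a \<Rightarrow> real"
  assumes "integrable PP g" "\<zeta> \<in> borel_measurable PP" "\<And>s w. w \<in> space M \<Longrightarrow> \<bar>\<zeta> (s, w)\<bar> \<le> C"
  shows "integrable PP (\<lambda>z. \<zeta> z * g z)"
  by (rule integrable_mult_bounded[OF assms(1,2), of C]) (use assms(3) in \<open>auto simp: space_pair_measure\<close>)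

section \<open>Quadratic variation of the martingale part along the grid\<close>

definition tt :: "nat \<Rightarrow> nat \<Rightarrow> real" where "tt n j = real j * (q / real (Suc n))"
definition cell :: "nat \<Rightarrow> nat \<Rightarrow> real \<Rightarrow> real" where "cell n j s = indicator {tt n j<..tt n (Suc j)} s"
definition dN where "dN n j w = Nn (tt n (Suc j)) w - Nn (tt n j) w"
definition dZ where "dZ n j w = Z (tt n (Suc j)) w - Z (tt n j) w"
definition dA where "dA n j w = A (tt n (Suc j)) w - A (tt n j) w"
definition QV where "QV n k w = (\<Sum>j<k. (dN n j w)\<^sup>2)"

lemma mesh_pos: "0 < q / real (Suc n)" using q_pos by simp

lemma tt: "0 \<le> tt n j" "tt n j \<le> tt n (Suc j)" "tt n (Suc n) = q" "tt n 0 = 0" "tt n (Suc j) - tt n j = q / real (Suc n)"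
proof -
  show "0 \<le> tt n j" using q_pos by (simp add: tt_def)
  have "tt n (Suc j) = tt n j + q / real (Suc n)" by (simp add: tt_def distrib_right add_divide_distrib[symmetric] add.commute)
  then show "tt n j \<le> tt n (Suc j)" "tt n (Suc j) - tt n j = q / real (Suc n)" using q_pos by simp_all
  show "tt n (Suc n) = q" unfolding tt_def by (simp del: of_nat_Suc)
qed (simp add: tt_def)

lemma tt_mono: "i \<le> j \<Longrightarrow> tt n i \<le> tt n j"
  using q_pos by (simp add: tt_def divide_right_mono mult_right_mono)

lemma cell_measurable [measurable]: "cell n j \<in> borel_measurable borel"
  unfolding cell_def by measurable

text \<open>At any time at most one cell is active, so a weighted sum over the cells is either one
  of the weights or 0. This is how sums of isometries are compared with a single integral.\<close>

lemma cell_sum_cases: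
  obtains (inside) k where "k < Suc n" "tt n k < s" "s \<le> tt n (Suc k)" "\<And>f :: nat \<Rightarrow> real. (\<Sum>j<Suc n. f j * cell n j s) = f k"
  | (outside) "\<not> (0 < s \<and> s \<le> q)" "\<And>f :: nat \<Rightarrow> real. (\<Sum>j<Suc n. f j * cell n j s) = 0"
proof (cases "0 < s \<and> s \<le> q")
  case True
  then have "s \<le> real (Suc n) * (q / real (Suc n))" by simp
  from grid_cell[OF mesh_pos _ this] True obtain k where "k < Suc n" "real k * (q / real (Suc n)) < s" "s \<le> real (Suc k) * (q / real (Suc n))"
    "\<And>f :: nat \<Rightarrow> real. (\<Sum>j<Suc n. f j * indicator {real j * (q / real (Suc n))<..real (Suc j) * (q / real (Suc n))} s) = f k"
    by blast
  then show thesis by (intro inside[of k]) (simp_all only: tt_def cell_def)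
next
  case False
  then have "\<not> (0 < s \<and> s \<le> real (Suc n) * (q / real (Suc n)))" by simp
  from grid_outside[OF mesh_pos this] have "(\<Sum>j<Suc n. f j * cell n j s) = 0" for f :: "nat \<Rightarrow> real"
    unfolding tt_def cell_def .
  with False show thesis by (rule outside)
qed

lemma dZ_eq: "w \<in> space M \<Longrightarrow> dZ n j w = dA n j w + dN n j w"
  using Z_eq[of w "tt n (Suc j)"] Z_eq[of w "tt n j"] tt(1)[of n j] tt(1)[of n "Suc j"] by (simp add: dZ_def dA_def dN_def)

lemma dN_adapted: "dN n j \<in> borel_measurable (G (tt n (Suc j)))"
  unfolding dN_def using Nn_adapted[OF tt(1)] meas_mono[OF tt(1) tt(2) Nn_adapted[OF tt(1)]] by simp

lemma dN_measurable [measurable]: "dN n j \<in> borel_measurable M"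
  using meas_GM[OF tt(1) dN_adapted] .

lemma dN_bound: "w \<in> space M \<Longrightarrow> (dN n j w)\<^sup>2 \<le> 4 * BN\<^sup>2"
proof -
  assume "w \<in> space M"
  from Nn_bound[OF this tt(1)[of n j]] Nn_bound[OF this tt(1)[of n "Suc j"]]
  have "\<bar>dN n j w\<bar> \<le> 2 * BN" unfolding dN_def by linarith
  from power_mono[OF this, where n = 2] show "(dN n j w)\<^sup>2 \<le> 4 * BN\<^sup>2" by (simp add: power_mult_distrib)
qed

lemma QV_adapted: "k \<le> m \<Longrightarrow> QV n k \<in> borel_measurable (G (tt n m))"
  unfolding QV_def
  by (intro borel_measurable_sum borel_measurable_power meas_mono[OF tt(1) _ dN_adapted] tt_mono) auto

lemma QV_measurable [measurable]: "QV n k \<in> borel_measurable M"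
  unfolding QV_def by measurable

lemma QV_nonneg: "0 \<le> QV n k w" by (simp add: QV_def sum_nonneg)

lemma QV_mono: "k \<le> m \<Longrightarrow> QV n k w \<le> QV n m w"
  unfolding QV_def by (intro sum_mono2) auto

lemma QV_bound: "w \<in> space M \<Longrightarrow> \<bar>QV n k w\<bar> \<le> real k * (4 * BN\<^sup>2)"
  using QV_nonneg[of n k w] sum_mono[of "{..<k}" "\<lambda>j. (dN n j w)\<^sup>2" "\<lambda>_. 4 * BN\<^sup>2"] dN_bound by (simp add: QV_def)

lemma bounded_integrable: "f \<in> borel_measurable M \<Longrightarrow> (\<And>w. w \<in> space M \<Longrightarrow> \<bar>f w\<bar> \<le> B) \<Longrightarrow> integrable M f"
  for f :: "'a \<Rightarrow> real"
  by (rule integrable_const_bound[of _ B]) auto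

lemma cell_as2_integrable:
  assumes "\<zeta> \<in> borel_measurable M" "\<And>w. w \<in> space M \<Longrightarrow> \<bar>\<zeta> w\<bar> \<le> C"
  shows "integrable PP (\<lambda>z. \<zeta> (snd z) * cell n j (fst z) * as2 z)"
  by (rule weighted_integrable[OF PP_integrable(2), of "\<lambda>z. \<zeta> (snd z) * cell n j (fst z)" C])
    (use assms in \<open>auto simp: cell_def indicator_def intro: order_trans[OF abs_ge_zero]\<close>)

lemma iso_cell:
  assumes "\<zeta> \<in> borel_measurable (G (tt n j))" "\<And>w. w \<in> space M \<Longrightarrow> \<bar>\<zeta> w\<bar> \<le> C"
  shows "(\<integral>w. \<zeta> w * dN n j w \<partial>M) = 0"
    "(\<integral>w. \<zeta> w * (dN n j w)\<^sup>2 \<partial>M) = (\<integral>z. \<zeta> (snd z) * cell n j (fst z) * as2 z \<partial>PP)"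
  using isometry[OF tt(1) tt(2) assms] by (simp_all add: dN_def cell_def mult.assoc)

lemma sum_cell_as2:
  assumes "\<And>j. j < Suc n \<Longrightarrow> \<zeta> j \<in> borel_measurable M" "\<And>j w. j < Suc n \<Longrightarrow> w \<in> space M \<Longrightarrow> \<bar>\<zeta> j w\<bar> \<le> C j"
  shows "(\<Sum>j<Suc n. \<integral>z. \<zeta> j (snd z) * cell n j (fst z) * as2 z \<partial>PP) = (\<integral>z. (\<Sum>j<Suc n. \<zeta> j (snd z) * cell n j (fst z)) * as2 z \<partial>PP)"
    "integrable PP (\<lambda>z. (\<Sum>j<Suc n. \<zeta> j (snd z) * cell n j (fst z)) * as2 z)"
proof -
  have i: "integrable PP (\<lambda>z. \<zeta> j (snd z) * cell n j (fst z) * as2 z)" if "j < Suc n" for j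
    using cell_as2_integrable[OF assms[OF that]] .
  show "(\<Sum>j<Suc n. \<integral>z. \<zeta> j (snd z) * cell n j (fst z) * as2 z \<partial>PP) = (\<integral>z. (\<Sum>j<Suc n. \<zeta> j (snd z) * cell n j (fst z)) * as2 z \<partial>PP)"
    unfolding sum_distrib_right by (rule Bochner_Integration.integral_sum[symmetric]) (use i in simp)
  show "integrable PP (\<lambda>z. (\<Sum>j<Suc n. \<zeta> j (snd z) * cell n j (fst z)) * as2 z)"
    unfolding sum_distrib_right by (rule Bochner_Integration.integrable_sum) (use i in simp)
qed

lemma QV_mean: "(\<integral>w. QV n (Suc n) w \<partial>M) \<le> K"
proof -
  have "(\<integral>w. QV n (Suc n) w \<partial>M) = (\<Sum>j<Suc n. \<integral>w. (dN n j w)\<^sup>2 \<partial>M)"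
    unfolding QV_def
    by (rule Bochner_Integration.integral_sum, rule bounded_integrable) (use dN_bound in auto)
  also have "\<dots> = (\<Sum>j<Suc n. \<integral>z. 1 * cell n j (fst z) * as2 z \<partial>PP)"
    using iso_cell(2)[of "\<lambda>_. 1" n _ 1] by simp
  also have "\<dots> = (\<integral>z. (\<Sum>j<Suc n. 1 * cell n j (fst z)) * as2 z \<partial>PP)"
    by (rule sum_cell_as2[where C = "\<lambda>_. 1"]) auto
  also have "\<dots> \<le> (\<integral>z. as2 z \<partial>PP)"
  proof (rule integral_mono[OF sum_cell_as2(2)[where C = "\<lambda>_. 1"] PP_integrable(2)])
    fix z :: "real \<times> 'a"
    have "(\<Sum>j<Suc n. 1 * cell n j (fst z)) \<le> 1"
    proof (cases rule: cell_sum_cases[of n "fst z"])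
      case (inside k)
      show ?thesis unfolding inside(4)[of "\<lambda>_. 1"] by (rule order_refl)
    next
      case outside
      show ?thesis unfolding outside(2)[of "\<lambda>_. 1"] by (rule zero_le_one)
    qed
    from mult_right_mono[OF this as2_nonneg] show "(\<Sum>j<Suc n. 1 * cell n j (fst z)) * as2 z \<le> as2 z" by simp
  qed auto
  also have "\<dots> \<le> K" by (rule PP_integrable(3))
  finally show ?thesis .
qed

text \<open>A bound in mean square that is uniform in the mesh. Squaring step by step leaves fourth
  powers, bounded by 4 BN^2 times squares, and mixed terms of the past quadratic variation with the
  next square. In the mixed terms the isometry replaces the square by \<open>as2\<close>; only then
  may the past value be enlarged to the final one, and what is left is the final value times the
  energy of the path, at most K.\<close>

lemma QV_square: "(\<integral>w. (QV n (Suc n) w)\<^sup>2 \<partial>M) \<le> (4 * BN\<^sup>2 + 2 * K) * K"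
proof -
  have iQ: "integrable M (QV n k)" for k by (rule bounded_integrable[OF _ QV_bound]) auto
  have iQ2: "integrable M (\<lambda>w. (QV n k w)\<^sup>2)" for k
    by (rule bounded_integrable[of _ "(real k * (4 * BN\<^sup>2))\<^sup>2"])
      (use power_mono[OF QV_bound, where n = 2] in auto)
  have id: "integrable M (\<lambda>w. (dN n j w)\<^sup>2)" for j by (rule bounded_integrable) (use dN_bound in auto)
  have iQd: "integrable M (\<lambda>w. QV n k w * (dN n j w)\<^sup>2)" for j k
    by (rule integrable_mult_bounded[OF id _ QV_bound]) auto
  have id4: "integrable M (\<lambda>w. (dN n j w)\<^sup>2 * (dN n j w)\<^sup>2)" for j
    by (rule integrable_mult_bounded[OF id, of _ "4 * BN\<^sup>2"]) (use dN_bound in auto)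
  have Qind: "(\<integral>w. (QV n k w)\<^sup>2 \<partial>M) \<le> 4 * BN\<^sup>2 * (\<integral>w. QV n k w \<partial>M) + 2 * (\<Sum>j<k. \<integral>z. QV n j (snd z) * cell n j (fst z) * as2 z \<partial>PP)" for k
  proof (induction k)
    case 0
    then show ?case by (simp add: QV_def)
  next
    case (Suc k)
    have "(QV n (Suc k) w)\<^sup>2 = (QV n k w)\<^sup>2 + 2 * (QV n k w * (dN n k w)\<^sup>2) + (dN n k w)\<^sup>2 * (dN n k w)\<^sup>2" for w
      by (simp add: QV_def power2_sum power2_eq_square algebra_simps)
    then have "(\<integral>w. (QV n (Suc k) w)\<^sup>2 \<partial>M) = (\<integral>w. (QV n k w)\<^sup>2 \<partial>M) + 2 * (\<integral>w. QV n k w * (dN n k w)\<^sup>2 \<partial>M) + (\<integral>w. (dN n k w)\<^sup>2 * (dN n k w)\<^sup>2 \<partial>M)"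
      using iQ2 iQd id4 by simp
    also have "(\<integral>w. QV n k w * (dN n k w)\<^sup>2 \<partial>M) = (\<integral>z. QV n k (snd z) * cell n k (fst z) * as2 z \<partial>PP)"
      by (rule iso_cell(2)[OF QV_adapted[OF order_refl] QV_bound])
    also have "(\<integral>w. (dN n k w)\<^sup>2 * (dN n k w)\<^sup>2 \<partial>M) \<le> (\<integral>w. 4 * BN\<^sup>2 * (dN n k w)\<^sup>2 \<partial>M)"
    proof (rule integral_mono[OF id4])
      show "integrable M (\<lambda>w. 4 * BN\<^sup>2 * (dN n k w)\<^sup>2)" using id by simp
      show "(dN n k w)\<^sup>2 * (dN n k w)\<^sup>2 \<le> 4 * BN\<^sup>2 * (dN n k w)\<^sup>2" if "w \<in> space M" for w
        by (rule mult_right_mono[OF dN_bound[OF that]]) simp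
    qed
    also have "\<dots> = 4 * BN\<^sup>2 * (\<integral>w. (dN n k w)\<^sup>2 \<partial>M)" by simp
    also have "(\<integral>w. (dN n k w)\<^sup>2 \<partial>M) = (\<integral>w. QV n (Suc k) w \<partial>M) - (\<integral>w. QV n k w \<partial>M)"
    proof -
      have "QV n (Suc k) = (\<lambda>w. QV n k w + (dN n k w)\<^sup>2)" by (simp add: QV_def fun_eq_iff)
      then show ?thesis using iQ[of k] id[of k] by simp
    qed
    finally show ?case using Suc.IH by (simp add: algebra_simps)
  qed
  have iw: "integrable PP (\<lambda>z. QV n (Suc n) (snd z) * as2 z)"
    by (rule weighted_integrable[OF PP_integrable(2)]) (use QV_bound in auto)
  from Qind[of "Suc n"]
  have "(\<integral>w. (QV n (Suc n) w)\<^sup>2 \<partial>M) \<le> 4 * BN\<^sup>2 * (\<integral>w. QV n (Suc n) w \<partial>M) + 2 * (\<Sum>j<Suc n. \<integral>z. QV n j (snd z) * cell n j (fst z) * as2 z \<partial>PP)" .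
  also have "(\<Sum>j<Suc n. \<integral>z. QV n j (snd z) * cell n j (fst z) * as2 z \<partial>PP) = (\<integral>z. (\<Sum>j<Suc n. QV n j (snd z) * cell n j (fst z)) * as2 z \<partial>PP)"
    by (rule sum_cell_as2(1)[OF QV_measurable QV_bound])
  also have "\<dots> \<le> (\<integral>z. QV n (Suc n) (snd z) * as2 z \<partial>PP)"
  proof (rule integral_mono[OF sum_cell_as2(2)[OF QV_measurable QV_bound]])
    show "integrable PP (\<lambda>z. QV n (Suc n) (snd z) * as2 z)" by (rule iw)
    fix z :: "real \<times> 'a"
    have "(\<Sum>j<Suc n. QV n j (snd z) * cell n j (fst z)) \<le> QV n (Suc n) (snd z)"
    proof (cases rule: cell_sum_cases[of n "fst z"])
      case (inside k)
      show ?thesis unfolding inside(4)[of "\<lambda>j. QV n j (snd z)"] using inside(1) by (intro QV_mono) simp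
    next
      case outside
      show ?thesis unfolding outside(2)[of "\<lambda>j. QV n j (snd z)"] by (rule QV_nonneg)
    qed
    then show "(\<Sum>j<Suc n. QV n j (snd z) * cell n j (fst z)) * as2 z \<le> QV n (Suc n) (snd z) * as2 z"
      by (rule mult_right_mono[OF _ as2_nonneg])
  qed
  also have "\<dots> = (\<integral>w. (\<integral>s. QV n (Suc n) w * as2 (s, w) \<partial>lborel) \<partial>M)"
  proof -
    have "integrable PP (\<lambda>(s, w). QV n (Suc n) w * as2 (s, w))"
      using iw by (simp add: case_prod_beta')
    from P.integral_snd[OF this] show ?thesis by (simp add: case_prod_beta')
  qed
  also have "\<dots> \<le> (\<integral>w. K * QV n (Suc n) w \<partial>M)"
  proof (rule integral_mono)
    have "integrable PP (\<lambda>(s, w). QV n (Suc n) w * as2 (s, w))"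
      using iw by (simp add: case_prod_beta')
    from P.integrable_snd[OF this] show "integrable M (\<lambda>w. \<integral>s. QV n (Suc n) w * as2 (s, w) \<partial>lborel)" by simp
    show "integrable M (\<lambda>w. K * QV n (Suc n) w)" using iQ by simp
    fix w assume "w \<in> space M"
    from mult_left_mono[OF path_bound(4)[OF this] QV_nonneg]
    show "(\<integral>s. QV n (Suc n) w * as2 (s, w) \<partial>lborel) \<le> K * QV n (Suc n) w" by (simp add: mult.commute)
  qed
  also have "\<dots> = K * (\<integral>w. QV n (Suc n) w \<partial>M)" by simp
  finally have "(\<integral>w. (QV n (Suc n) w)\<^sup>2 \<partial>M) \<le> (4 * BN\<^sup>2 + 2 * K) * (\<integral>w. QV n (Suc n) w \<partial>M)"
    by (simp add: algebra_simps)
  also have "\<dots> \<le> (4 * BN\<^sup>2 + 2 * K) * K"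
    using K by (intro mult_left_mono QV_mean) auto
  finally show ?thesis .
qed

text \<open>The left endpoint of the cell that contains s tends to s as the mesh shrinks; path
  continuity and domination give the limit. The support condition confines s to times at which the
  stopped process \<open>Z\<close> still agrees with \<open>X\<close>.\<close>

lemma riemann_limit:
  fixes \<psi> :: "real \<Rightarrow> real"
  assumes [measurable]: "\<psi> \<in> borel_measurable borel" "g \<in> borel_measurable PP" and g: "integrable PP g"
    and supp: "\<And>s w. w \<in> space M \<Longrightarrow> \<not> (0 < s \<and> s \<le> T w) \<Longrightarrow> g (s, w) = 0"
    and cont: "continuous_on {c..d} \<psi>" and bd: "\<And>y. c \<le> y \<Longrightarrow> y \<le> d \<Longrightarrow> \<bar>\<psi> y\<bar> \<le> C"
  shows "(\<lambda>n. \<integral>z. (\<Sum>j<Suc n. \<psi> (Z (tt n j) (snd z)) * cell n j (fst z)) * g z \<partial>PP) \<longlonglongrightarrow> (\<integral>z. \<psi> (X (fst z) (snd z)) * g z \<partial>PP)"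
proof (rule integral_dominated_convergence[where w = "\<lambda>z. \<bar>C\<bar> * \<bar>g z\<bar>"])
  have [measurable]: "Z (tt n j) \<in> borel_measurable M" for n j
    using meas_GM[OF tt(1) Z_adapted[OF tt(1)]] .
  show "(\<lambda>z. \<psi> (X (fst z) (snd z)) * g z) \<in> borel_measurable PP" by measurable
  show "(\<lambda>z. (\<Sum>j<Suc n. \<psi> (Z (tt n j) (snd z)) * cell n j (fst z)) * g z) \<in> borel_measurable PP" for n by measurable
  show "integrable PP (\<lambda>z. \<bar>C\<bar> * \<bar>g z\<bar>)" using g by simp
  show "AE z in PP. norm ((\<Sum>j<Suc n. \<psi> (Z (tt n j) (snd z)) * cell n j (fst z)) * g z) \<le> \<bar>C\<bar> * \<bar>g z\<bar>" for n
  proof (rule AE_I2)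
    fix z :: "real \<times> 'a" assume "z \<in> space PP"
    then have wM: "snd z \<in> space M" by (auto simp: space_pair_measure)
    have "\<bar>\<Sum>j<Suc n. \<psi> (Z (tt n j) (snd z)) * cell n j (fst z)\<bar> \<le> \<bar>C\<bar>"
    proof (cases rule: cell_sum_cases[of n "fst z"])
      case (inside k)
      have "\<bar>\<psi> (Z (tt n k) (snd z))\<bar> \<le> C" using Z_range[OF wM tt(1)] by (intro bd) auto
      then show ?thesis unfolding inside(4) by linarith
    next
      case outside
      show ?thesis unfolding outside(2) by simp
    qed
    then show "norm ((\<Sum>j<Suc n. \<psi> (Z (tt n j) (snd z)) * cell n j (fst z)) * g z) \<le> \<bar>C\<bar> * \<bar>g z\<bar>"
      by (simp add: abs_mult mult_right_mono)
  qed
  show "AE z in PP. (\<lambda>n. (\<Sum>j<Suc n. \<psi> (Z (tt n j) (snd z)) * cell n j (fst z)) * g z) \<longlonglongrightarrow> \<psi> (X (fst z) (snd z)) * g z"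
  proof (rule AE_I2)
    fix z :: "real \<times> 'a" assume "z \<in> space PP"
    then obtain s w where z: "z = (s, w)" and wM: "w \<in> space M" by (auto simp: space_pair_measure)
    show "(\<lambda>n. (\<Sum>j<Suc n. \<psi> (Z (tt n j) (snd z)) * cell n j (fst z)) * g z) \<longlonglongrightarrow> \<psi> (X (fst z) (snd z)) * g z"
    proof (cases "0 < s \<and> s \<le> T w")
      case True
      have "\<exists>k. tt n k < s \<and> s \<le> tt n (Suc k) \<and> (\<Sum>j<Suc n. \<psi> (Z (tt n j) w) * cell n j s) = \<psi> (Z (tt n k) w)" for n
      proof (cases rule: cell_sum_cases[of n s])
        case outside
        then show ?thesis using True T_le[OF wM] by auto
      qed (metis)
      then obtain k where k: "\<And>n. tt n (k n) < s" "\<And>n. s \<le> tt n (Suc (k n))"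
        "\<And>n. (\<Sum>j<Suc n. \<psi> (Z (tt n j) w) * cell n j s) = \<psi> (Z (tt n (k n)) w)" by metis
      have l: "(\<lambda>n. tt n (k n)) \<longlonglongrightarrow> s"
      proof (rule tendsto_sandwich)
        show "\<forall>\<^sub>F n in sequentially. s - q * (1 / real (Suc n)) \<le> tt n (k n)"
        proof (intro always_eventually allI)
          fix n show "s - q * (1 / real (Suc n)) \<le> tt n (k n)" using k(2)[of n] tt(5)[of n "k n"] by simp
        qed
        show "\<forall>\<^sub>F n in sequentially. tt n (k n) \<le> s" using k(1) by (auto simp: less_imp_le)
        have "(\<lambda>n. s - q * (1 / real (Suc n))) \<longlonglongrightarrow> s - q * 0"
          using LIMSEQ_inverse_real_of_nat by (intro tendsto_intros) (simp add: inverse_eq_divide)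
        then show "(\<lambda>n. s - q * (1 / real (Suc n))) \<longlonglongrightarrow> s" by simp
      qed (rule tendsto_const)
      have "(\<lambda>n. X (tt n (k n)) w) \<longlonglongrightarrow> X s w"
        by (rule continuous_on_tendsto_compose[OF X_cont[OF wM] l]) (use True tt(1) in auto)
      then have "(\<lambda>n. \<psi> (X (tt n (k n)) w)) \<longlonglongrightarrow> \<psi> (X s w)"
        by (rule continuous_on_tendsto_compose[OF cont]) (use X_range[OF wM] True tt(1) in auto)
      moreover have "Z (tt n (k n)) w = X (tt n (k n)) w" for n
        using k(1)[of n] True by (simp add: Z_def)
      ultimately show ?thesis unfolding z fst_conv snd_conv k(3) by (intro tendsto_mult tendsto_const) simp
    qed (use supp[OF wM] z in simp)
  qed
qed

end

lemma cvx_measurable [measurable]: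
  assumes [measurable]: "\<phi> \<in> borel_measurable borel"
  shows "cvx \<phi> c d \<in> borel_measurable borel" "cvx' \<phi> c d \<in> borel_measurable borel"
  unfolding cvx_def[abs_def] cvx'_def[abs_def]
  by (rule lborel.borel_measurable_lebesgue_integral; measurable)+

lemma cvx_bound:
  assumes "\<phi> \<in> borel_measurable borel" "\<And>y. \<bar>\<phi> y\<bar> \<le> C" "c \<le> z" "z \<le> d"
  shows "\<bar>cvx \<phi> c d z\<bar> \<le> C * (d - c)\<^sup>2"
proof -
  have C: "0 \<le> C" using assms(2)[of 0] by linarith
  have "\<bar>cvx \<phi> c d z\<bar> \<le> (\<integral>y. C * (indicator {c..d} y * max 0 (z - y)) \<partial>lborel)"
    unfolding cvx_def
  proof (rule order_trans[OF integral_abs_bound integral_mono])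
    show "integrable lborel (\<lambda>y. \<bar>indicator {c..d} y * \<phi> y * max 0 (z - y)\<bar>)"
      using cvx_integrable(1)[OF assms] by simp
    show "integrable lborel (\<lambda>y. C * (indicator {c..d} y * max 0 (z - y)))"
      using cvx_integrable(1)[of "\<lambda>_. 1" 1 c z d] assms by simp
    show "\<bar>indicator {c..d} y * \<phi> y * max 0 (z - y)\<bar> \<le> C * (indicator {c..d} y * max 0 (z - y))" for y
      using mult_right_mono[OF assms(2)[of y], of "max 0 (z - y)"] by (auto simp: indicator_def abs_mult)
  qed
  also have "\<dots> = C * ((z - c)\<^sup>2 / 2)" using integral_ramp(1)[OF assms(3,4)] by simp
  also have "\<dots> \<le> C * (d - c)\<^sup>2"
  proof (rule mult_left_mono[OF _ C])
    have "(z - c)\<^sup>2 \<le> (d - c)\<^sup>2" using assms by (intro power_mono) auto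
    then show "(z - c)\<^sup>2 / 2 \<le> (d - c)\<^sup>2" using zero_le_power2[of "d - c"] by linarith
  qed
  finally show ?thesis .
qed

lemma cvx'_continuous:
  assumes "\<phi> \<in> borel_measurable borel" "\<And>y. \<bar>\<phi> y\<bar> \<le> C" "\<And>y. 0 \<le> \<phi> y"
  shows "continuous_on {c..d} (cvx' \<phi> c d)"
proof (rule lipschitz_on_continuous_on)
  have C: "0 \<le> C" using assms(2)[of 0] by linarith
  show "C-lipschitz_on {c..d} (cvx' \<phi> c d)"
  proof (rule lipschitz_onI[OF _ C])
    fix u v assume "u \<in> {c..d}" "v \<in> {c..d}"
    then show "dist (cvx' \<phi> c d u) (cvx' \<phi> c d v) \<le> C * dist u v"
      using cvx'_mono[OF assms, of c u v d] cvx'_mono[OF assms, of c v u d]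
      by (cases "u \<le> v") (auto simp: dist_real_def)
  qed
qed

context stopped_diffusion begin

section \<open>Error terms of the discrete Ito formula\<close>

definition osc where "osc n w = Max ((\<lambda>j. \<bar>dZ n j w\<bar> + \<bar>dN n j w\<bar>) ` {..<Suc n})"

lemma Z_measurable [measurable]: "Z (tt n j) \<in> borel_measurable M"
  using meas_GM[OF tt(1) Z_adapted[OF tt(1)]] .

lemma dZ_measurable [measurable]: "dZ n j \<in> borel_measurable M"
  unfolding dZ_def by measurable

lemma dA_measurable [measurable]: "dA n j \<in> borel_measurable M"
proof -
  have "(\<lambda>w. dZ n j w - dN n j w) \<in> borel_measurable M" by measurable
  then show ?thesis by (rule measurable_cong[THEN iffD1, rotated]) (simp add: dZ_eq)
qed

lemma osc_measurable [measurable]: "osc n \<in> borel_measurable M"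
  unfolding osc_def by measurable

lemma osc_ge: "j < Suc n \<Longrightarrow> \<bar>dZ n j w\<bar> + \<bar>dN n j w\<bar> \<le> osc n w"
  unfolding osc_def by (intro Max_ge) auto

lemma osc_nonneg: "0 \<le> osc n w"
  using osc_ge[of 0 n w] by (auto intro: order_trans)

lemma osc_bound: "w \<in> space M \<Longrightarrow> osc n w \<le> d - c + 2 * BN"
  unfolding osc_def
proof (rule Max.boundedI)
  fix x assume wM: "w \<in> space M" and "x \<in> (\<lambda>j. \<bar>dZ n j w\<bar> + \<bar>dN n j w\<bar>) ` {..<Suc n}"
  then obtain j where x: "x = \<bar>dZ n j w\<bar> + \<bar>dN n j w\<bar>" by auto
  show "x \<le> d - c + 2 * BN"
    using Z_range[OF wM tt(1)[of n j]] Z_range[OF wM tt(1)[of n "Suc j"]] Nn_bound[OF wM tt(1)[of n j]] Nn_bound[OF wM tt(1)[of n "Suc j"]]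
    unfolding x dZ_def dN_def by linarith
qed auto

text \<open>Uniform continuity of both paths on [0, q] makes the increments small on all cells at
  once.\<close>

lemma osc_limit:
  assumes wM: "w \<in> space M"
  shows "(\<lambda>n. osc n w) \<longlonglongrightarrow> 0"
proof (rule LIMSEQ_I)
  fix \<epsilon> :: real assume e: "0 < \<epsilon>"
  have "continuous_on {0..q} (\<lambda>t. Z t w)"
    unfolding Z_def by (rule continuous_on_compose2[OF X_cont[OF wM]]) (use T_nonneg[OF wM] in \<open>auto intro!: continuous_intros\<close>)
  moreover have "continuous_on {0..q} (\<lambda>t. Nn t w)"
    unfolding Nn_def by (rule continuous_on_compose2[OF itoD(3)[OF ito_N wM]]) (use T_nonneg[OF wM] in \<open>auto intro!: continuous_intros\<close>)
  ultimately have u: "uniformly_continuous_on {0..q} (\<lambda>t. Z t w)" "uniformly_continuous_on {0..q} (\<lambda>t. Nn t w)"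
    by (auto intro: compact_uniformly_continuous)
  have e3: "0 < \<epsilon> / 3" using e by simp
  obtain \<delta>1 where d1: "0 < \<delta>1" "\<And>x y. x \<in> {0..q} \<Longrightarrow> y \<in> {0..q} \<Longrightarrow> dist y x < \<delta>1 \<Longrightarrow> dist (Z y w) (Z x w) < \<epsilon> / 3"
    using u(1) e3 unfolding uniformly_continuous_on_def by metis
  obtain \<delta>2 where d2: "0 < \<delta>2" "\<And>x y. x \<in> {0..q} \<Longrightarrow> y \<in> {0..q} \<Longrightarrow> dist y x < \<delta>2 \<Longrightarrow> dist (Nn y w) (Nn x w) < \<epsilon> / 3"
    using u(2) e3 unfolding uniformly_continuous_on_def by metis
  have "(\<lambda>n. q * (1 / real (Suc n))) \<longlonglongrightarrow> q * 0"
    using LIMSEQ_inverse_real_of_nat by (intro tendsto_intros) (simp add: inverse_eq_divide)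
  then have "\<forall>\<^sub>F n in sequentially. q * (1 / real (Suc n)) < min \<delta>1 \<delta>2"
    using d1(1) d2(1) by (intro order_tendstoD(2)[where y = "q * 0"]) auto
  then obtain n0 where n0: "\<And>n. n0 \<le> n \<Longrightarrow> q / real (Suc n) < min \<delta>1 \<delta>2"
    by (auto simp: eventually_sequentially)
  have "norm (osc n w - 0) < \<epsilon>" if n: "n0 \<le> n" for n
  proof -
    have "osc n w \<le> \<epsilon> / 3 + \<epsilon> / 3"
      unfolding osc_def
    proof (rule Max.boundedI)
      fix x assume "x \<in> (\<lambda>j. \<bar>dZ n j w\<bar> + \<bar>dN n j w\<bar>) ` {..<Suc n}"
      then obtain j where x: "x = \<bar>dZ n j w\<bar> + \<bar>dN n j w\<bar>" and j: "j < Suc n" by auto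
      have r: "tt n j \<in> {0..q}" "tt n (Suc j) \<in> {0..q}"
        using tt(1)[of n j] tt(1)[of n "Suc j"] tt_mono[of "Suc j" "Suc n" n] tt(2)[of n j] tt(3)[of n] j by auto
      have "dist (tt n (Suc j)) (tt n j) < min \<delta>1 \<delta>2"
        using tt(5)[of n j] n0[OF n] tt(2)[of n j] q_pos by (simp add: dist_real_def)
      then have "dist (Z (tt n (Suc j)) w) (Z (tt n j) w) < \<epsilon> / 3" "dist (Nn (tt n (Suc j)) w) (Nn (tt n j) w) < \<epsilon> / 3"
        using d1(2)[OF r] d2(2)[OF r] by auto
      then show "x \<le> \<epsilon> / 3 + \<epsilon> / 3" unfolding x dZ_def dN_def dist_real_def by linarith
    qed auto
    then show ?thesis using osc_nonneg[of n w] e by simp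
  qed
  then show "\<exists>no. \<forall>n\<ge>no. norm (osc n w - 0) < \<epsilon>" by blast
qed

lemma osc_integrable: "integrable M (osc n)" "integrable M (\<lambda>w. (osc n w)\<^sup>2)"
proof -
  show "integrable M (osc n)"
    by (rule bounded_integrable[of _ "d - c + 2 * BN"]) (use osc_bound osc_nonneg in auto)
  show "integrable M (\<lambda>w. (osc n w)\<^sup>2)"
    by (rule bounded_integrable[of _ "(d - c + 2 * BN)\<^sup>2"]) (use osc_bound osc_nonneg in \<open>auto intro!: power_mono\<close>)
qed

lemma osc_mean_limit: "(\<lambda>n. \<integral>w. osc n w \<partial>M) \<longlonglongrightarrow> 0" "(\<lambda>n. \<integral>w. (osc n w)\<^sup>2 \<partial>M) \<longlonglongrightarrow> 0"
proof -
  have "(\<lambda>n. \<integral>w. osc n w \<partial>M) \<longlonglongrightarrow> (\<integral>w. 0 \<partial>M)"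
    by (rule integral_dominated_convergence[where w = "\<lambda>_. d - c + 2 * BN"])
      (use osc_bound osc_nonneg osc_limit in auto)
  then show "(\<lambda>n. \<integral>w. osc n w \<partial>M) \<longlonglongrightarrow> 0" by simp
  have "(\<lambda>n. (osc n w)\<^sup>2) \<longlonglongrightarrow> 0" if "w \<in> space M" for w
    using tendsto_power[OF osc_limit[OF that], of 2] by simp
  then have "(\<lambda>n. \<integral>w. (osc n w)\<^sup>2 \<partial>M) \<longlonglongrightarrow> (\<integral>w. 0 \<partial>M)"
    by (intro integral_dominated_convergence[where w = "\<lambda>_. (d - c + 2 * BN)\<^sup>2"])
      (use osc_bound osc_nonneg in \<open>auto intro!: power_mono AE_I2\<close>)
  then show "(\<lambda>n. \<integral>w. (osc n w)\<^sup>2 \<partial>M) \<longlonglongrightarrow> 0" by simp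
qed

lemma osc_QV_integrable: "integrable M (\<lambda>w. osc n w * QV n k w)"
  by (rule integrable_mult_bounded[of _ _ _ "d - c + 2 * BN"])
    (use osc_bound osc_nonneg in \<open>auto intro!: bounded_integrable[OF _ QV_bound]\<close>)

text \<open>The oscillation tends to 0 in mean square, while the quadratic variation is merely
  bounded there. A Young inequality with a small weight on the bounded factor gives the limit of the
  product.\<close>

lemma osc_QV_limit: "(\<lambda>n. \<integral>w. osc n w * QV n (Suc n) w \<partial>M) \<longlonglongrightarrow> 0"
proof (rule LIMSEQ_I)
  fix \<epsilon> :: real assume e: "0 < \<epsilon>"
  define C' where "C' = (4 * BN\<^sup>2 + 2 * K) * K"
  have C': "0 \<le> C'" using K by (simp add: C'_def)
  define \<delta> where "\<delta> = \<epsilon> / (C' + 1)"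
  have d: "0 < \<delta>" "\<delta> * C' < \<epsilon>" using e C' by (auto simp: \<delta>_def field_simps)
  have "\<forall>\<^sub>F n in sequentially. (\<integral>w. (osc n w)\<^sup>2 \<partial>M) < \<delta> * \<epsilon>"
    using d e by (intro order_tendstoD(2)[OF osc_mean_limit(2)]) simp
  then obtain n0 where n0: "\<And>n. n0 \<le> n \<Longrightarrow> (\<integral>w. (osc n w)\<^sup>2 \<partial>M) < \<delta> * \<epsilon>"
    by (auto simp: eventually_sequentially)
  have "norm ((\<integral>w. osc n w * QV n (Suc n) w \<partial>M) - 0) < \<epsilon>" if n: "n0 \<le> n" for n
  proof -
    have iQ2: "integrable M (\<lambda>w. (QV n (Suc n) w)\<^sup>2)"
      by (rule bounded_integrable[of _ "(real (Suc n) * (4 * BN\<^sup>2))\<^sup>2"])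
        (use power_mono[OF QV_bound, where n = 2] in \<open>auto simp del: of_nat_Suc\<close>)
    have nn: "0 \<le> (\<integral>w. osc n w * QV n (Suc n) w \<partial>M)"
      by (intro integral_nonneg_AE AE_I2 mult_nonneg_nonneg osc_nonneg QV_nonneg)
    have "(\<integral>w. osc n w * QV n (Suc n) w \<partial>M) \<le> (\<integral>w. (\<delta> * (QV n (Suc n) w)\<^sup>2 + (osc n w)\<^sup>2 / \<delta>) / 2 \<partial>M)"
    proof (rule integral_mono[OF osc_QV_integrable])
      show "integrable M (\<lambda>w. (\<delta> * (QV n (Suc n) w)\<^sup>2 + (osc n w)\<^sup>2 / \<delta>) / 2)" using iQ2 osc_integrable(2) by simp
      show "osc n w * QV n (Suc n) w \<le> (\<delta> * (QV n (Suc n) w)\<^sup>2 + (osc n w)\<^sup>2 / \<delta>) / 2" for w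
        using square_split_bound[OF d(1), of "QV n (Suc n) w" "osc n w"] osc_nonneg[of n w] QV_nonneg[of n "Suc n" w]
        by (simp add: mult.commute)
    qed
    also have "\<dots> = (\<delta> * (\<integral>w. (QV n (Suc n) w)\<^sup>2 \<partial>M) + (\<integral>w. (osc n w)\<^sup>2 \<partial>M) / \<delta>) / 2"
      using iQ2 osc_integrable(2) by simp
    also have "\<dots> < \<epsilon>"
    proof -
      have "\<delta> * (\<integral>w. (QV n (Suc n) w)\<^sup>2 \<partial>M) \<le> \<delta> * C'"
        using QV_square[of n] d(1) by (intro mult_left_mono) (auto simp: C'_def)
      moreover have "(\<integral>w. (osc n w)\<^sup>2 \<partial>M) / \<delta> < \<epsilon>" using n0[OF n] d(1) by (simp add: divide_less_eq mult.commute)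
      ultimately show ?thesis using d(2) by simp
    qed
    finally have "(\<integral>w. osc n w * QV n (Suc n) w \<partial>M) < \<epsilon>" .
    with nn show ?thesis by simp
  qed
  then show "\<exists>no. \<forall>n\<ge>no. norm ((\<integral>w. osc n w * QV n (Suc n) w \<partial>M) - 0) < \<epsilon>" by blast
qed

lemma dA_eq: "w \<in> space M \<Longrightarrow> dA n j w = (\<integral>s. cell n j s * bs (s, w) \<partial>lborel)"
  unfolding dA_def cell_def by (rule A_diff(1)[OF _ tt(1) tt(2)])

lemma dA_sum:
  assumes wM: "w \<in> space M"
  shows "(\<Sum>j<Suc n. \<bar>dA n j w\<bar>) \<le> K"
proof -
  have i: "integrable lborel (\<lambda>s. cell n j s * \<bar>bs (s, w)\<bar>)" for j
    unfolding cell_def by (rule abs_strip_integrable[OF wM])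
  have "(\<Sum>j<Suc n. \<bar>dA n j w\<bar>) \<le> (\<Sum>j<Suc n. \<integral>s. cell n j s * \<bar>bs (s, w)\<bar> \<partial>lborel)"
    unfolding dA_def cell_def by (intro sum_mono A_diff(2)[OF wM] tt)
  also have "\<dots> = (\<integral>s. (\<Sum>j<Suc n. 1 * cell n j s) * \<bar>bs (s, w)\<bar> \<partial>lborel)"
    unfolding sum_distrib_right using i by (subst Bochner_Integration.integral_sum) auto
  also have "\<dots> \<le> (\<integral>s. \<bar>bs (s, w)\<bar> \<partial>lborel)"
  proof (rule integral_mono)
    show "integrable lborel (\<lambda>s. (\<Sum>j<Suc n. 1 * cell n j s) * \<bar>bs (s, w)\<bar>)"
      unfolding sum_distrib_right using i by (intro Bochner_Integration.integrable_sum) auto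
    show "integrable lborel (\<lambda>s. \<bar>bs (s, w)\<bar>)" using path_bound(1)[OF wM] by simp
    fix s
    have "(\<Sum>j<Suc n. 1 * cell n j s) \<le> 1"
    proof (cases rule: cell_sum_cases[of n s])
      case (inside k)
      show ?thesis unfolding inside(4)[of "\<lambda>_. 1"] by (rule order_refl)
    next
      case outside
      show ?thesis unfolding outside(2)[of "\<lambda>_. 1"] by (rule zero_le_one)
    qed
    from mult_right_mono[OF this abs_ge_zero] show "(\<Sum>j<Suc n. 1 * cell n j s) * \<bar>bs (s, w)\<bar> \<le> \<bar>bs (s, w)\<bar>" by simp
  qed
  also have "\<dots> \<le> K" by (rule path_bound(2)[OF wM])
  finally show ?thesis .
qed

text \<open>Telescoping, and \<open>cvx_taylor\<close> on each cell. The second-order term is moved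
  from dZ^2 to dN^2 through dZ^2 - dN^2 = dA (dZ + dN), whose sum is small because the variation of
  the drift is at most K and the increments are bounded by the oscillation.\<close>

lemma taylor_sum:
  assumes \<phi>: "\<phi> \<in> borel_measurable borel" and C: "\<And>y. \<bar>\<phi> y\<bar> \<le> C"
    and lip: "\<And>y z. \<bar>\<phi> y - \<phi> z\<bar> \<le> B * \<bar>y - z\<bar>" and wM: "w \<in> space M"
  shows "\<bar>cvx \<phi> c d (X (T w) w) - cvx \<phi> c d x\<^sub>0
      - (\<Sum>j<Suc n. cvx' \<phi> c d (Z (tt n j) w) * dA n j w + cvx' \<phi> c d (Z (tt n j) w) * dN n j w + \<phi> (Z (tt n j) w) * (dN n j w)\<^sup>2 / 2)\<bar>
    \<le> (C * K + 2 * B * K\<^sup>2) * osc n w + 2 * B * (osc n w * QV n (Suc n) w)"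
proof -
  have B: "0 \<le> B" using lip[of 1 0] by simp
  have C0: "0 \<le> C" using C[of 0] by linarith
  let ?o = "osc n w"
  define \<Phi> where "\<Phi> j = cvx \<phi> c d (Z (tt n j) w)" for j
  define R where "R j = \<Phi> (Suc j) - \<Phi> j - (cvx' \<phi> c d (Z (tt n j) w) * dA n j w + cvx' \<phi> c d (Z (tt n j) w) * dN n j w + \<phi> (Z (tt n j) w) * (dN n j w)\<^sup>2 / 2)" for j
  have tel: "(\<Sum>j<Suc n. \<Phi> (Suc j) - \<Phi> j) = \<Phi> (Suc n) - \<Phi> 0" by (rule sum_lessThan_telescope)
  have "\<Phi> (Suc n) = cvx \<phi> c d (X (T w) w)"
    unfolding \<Phi>_def tt(3) Z_def using T_le[OF wM] by (simp add: min_absorb2)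
  moreover have "\<Phi> 0 = cvx \<phi> c d x\<^sub>0" unfolding \<Phi>_def tt(4) using Z_0[OF wM] by simp
  ultimately have eq: "cvx \<phi> c d (X (T w) w) - cvx \<phi> c d x\<^sub>0
      - (\<Sum>j<Suc n. cvx' \<phi> c d (Z (tt n j) w) * dA n j w + cvx' \<phi> c d (Z (tt n j) w) * dN n j w + \<phi> (Z (tt n j) w) * (dN n j w)\<^sup>2 / 2)
     = (\<Sum>j<Suc n. R j)"
    unfolding R_def sum_subtractf tel[unfolded sum_subtractf] by simp
  have Rj: "\<bar>R j\<bar> \<le> C * ?o * \<bar>dA n j w\<bar> + 2 * B * K * ?o * \<bar>dA n j w\<bar> + 2 * B * ?o * (dN n j w)\<^sup>2" if j: "j < Suc n" for j
  proof -
    let ?z = "Z (tt n j) w" and ?y = "Z (tt n (Suc j)) w"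
    have y: "?y - ?z = dZ n j w" by (simp add: dZ_def)
    have t: "\<bar>\<Phi> (Suc j) - \<Phi> j - cvx' \<phi> c d ?z * dZ n j w - \<phi> ?z * (dZ n j w)\<^sup>2 / 2\<bar> \<le> B * \<bar>dZ n j w\<bar> * (dZ n j w)\<^sup>2"
      using cvx_taylor[OF \<phi> C lip, of c ?z d ?y] Z_range[OF wM tt(1)[of n j]] Z_range[OF wM tt(1)[of n "Suc j"]]
      unfolding y \<Phi>_def by simp
    have oz: "\<bar>dZ n j w\<bar> \<le> ?o" and on: "\<bar>dZ n j w + dN n j w\<bar> \<le> ?o" using osc_ge[OF j, of w] by linarith+
    have "(dZ n j w)\<^sup>2 - (dN n j w)\<^sup>2 = dA n j w * (dZ n j w + dN n j w)"
      using dZ_eq[OF wM, of n j] by (simp add: power2_eq_square algebra_simps)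
    then have "R j = (\<Phi> (Suc j) - \<Phi> j - cvx' \<phi> c d ?z * dZ n j w - \<phi> ?z * (dZ n j w)\<^sup>2 / 2) + \<phi> ?z / 2 * (dA n j w * (dZ n j w + dN n j w))"
      unfolding R_def using dZ_eq[OF wM, of n j] by (simp add: algebra_simps)
    then have "\<bar>R j\<bar> \<le> B * \<bar>dZ n j w\<bar> * (dZ n j w)\<^sup>2 + \<bar>\<phi> ?z / 2 * (dA n j w * (dZ n j w + dN n j w))\<bar>"
      using t by linarith
    also have "\<bar>\<phi> ?z / 2 * (dA n j w * (dZ n j w + dN n j w))\<bar> \<le> C * (\<bar>dA n j w\<bar> * ?o)"
      unfolding abs_mult using C[of ?z] C0 on by (intro mult_mono) auto
    \<comment> \<open>One factor of the cubic remainder is bounded by the oscillation, the other two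
      by 2 dA^2 + 2 dN^2, where dA^2 \<le> K \<bar>dA\<bar>.\<close>
    also have "B * \<bar>dZ n j w\<bar> * (dZ n j w)\<^sup>2 \<le> B * ?o * (2 * (K * \<bar>dA n j w\<bar>) + 2 * (dN n j w)\<^sup>2)"
    proof (intro mult_mono mult_left_mono oz B)
      have "(dA n j w)\<^sup>2 = \<bar>dA n j w\<bar> * \<bar>dA n j w\<bar>" by (simp add: power2_eq_square)
      also have "\<dots> \<le> K * \<bar>dA n j w\<bar>"
        using A_diff_bound[OF wM tt(1) tt(2), of n j] by (intro mult_right_mono) (auto simp: dA_def)
      finally show "(dZ n j w)\<^sup>2 \<le> 2 * (K * \<bar>dA n j w\<bar>) + 2 * (dN n j w)\<^sup>2"
        using two_square_bound(1)[of "dA n j w" "dN n j w"] dZ_eq[OF wM, of n j] by simp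
    qed (use B osc_nonneg in auto)
    finally show ?thesis by (simp add: algebra_simps)
  qed
  have "\<bar>\<Sum>j<Suc n. R j\<bar> \<le> (\<Sum>j<Suc n. \<bar>R j\<bar>)" by (rule sum_abs)
  also have "\<dots> \<le> (\<Sum>j<Suc n. C * ?o * \<bar>dA n j w\<bar> + 2 * B * K * ?o * \<bar>dA n j w\<bar> + 2 * B * ?o * (dN n j w)\<^sup>2)"
    by (intro sum_mono Rj) simp
  also have "\<dots> = (C * ?o + 2 * B * K * ?o) * (\<Sum>j<Suc n. \<bar>dA n j w\<bar>) + 2 * B * ?o * QV n (Suc n) w"
    by (simp only: QV_def sum.distrib sum_distrib_left[symmetric] distrib_right)
  also have "\<dots> \<le> (C * ?o + 2 * B * K * ?o) * K + 2 * B * ?o * QV n (Suc n) w"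
    using B C0 K osc_nonneg[of n w] by (intro add_right_mono mult_left_mono dA_sum[OF wM]) auto
  also have "\<dots> = (C * K + 2 * B * K\<^sup>2) * ?o + 2 * B * (?o * QV n (Suc n) w)"
    by (simp add: algebra_simps power2_eq_square)
  finally show ?thesis unfolding eq .
qed

end

section \<open>Occupation densities\<close>

context stopped_diffusion begin

definition XT where "XT w = X (T w) w"

lemma XT_eq: "w \<in> space M \<Longrightarrow> XT w = Z q w"
  using T_le by (simp add: XT_def Z_def min_absorb2)

lemma XT_measurable [measurable]: "XT \<in> borel_measurable M"
  using meas_GM[OF less_imp_le[OF q_pos] Z_adapted[OF less_imp_le[OF q_pos]]]
  by (rule measurable_cong[THEN iffD1, rotated]) (simp add: XT_eq)

lemma XT_range: "w \<in> space M \<Longrightarrow> c \<le> XT w \<and> XT w \<le> d"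
  using XT_eq Z_range q_pos by simp

lemma bs_supp: "w \<in> space M \<Longrightarrow> \<not> (0 < s \<and> s \<le> T w) \<Longrightarrow> bs (s, w) = 0"
  unfolding bs_def fst_conv snd_conv by (simp only: of_bool_eq mult_zero_left)

lemma as2_supp: "w \<in> space M \<Longrightarrow> \<not> (0 < s \<and> s \<le> T w) \<Longrightarrow> as2 (s, w) = 0"
  unfolding as2_def fst_conv snd_conv by (simp only: of_bool_eq mult_zero_left)

text \<open>The discrete Ito formula in expectation: the martingale term has mean zero, the isometry
  turns dN^2 into \<open>as2\<close>, the Riemann sums converge and the errors vanish. The sign of
  \<phi> serves the continuity of \<open>cvx'\<close>, the Lipschitz bound the Taylor remainder and
  the continuity of \<phi>.\<close>

lemma dynkin:
  assumes [measurable]: "\<phi> \<in> borel_measurable borel" and C: "\<And>y. \<bar>\<phi> y\<bar> \<le> C" and nn: "\<And>y. 0 \<le> \<phi> y"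
    and lip: "\<And>y z. \<bar>\<phi> y - \<phi> z\<bar> \<le> B * \<bar>y - z\<bar>"
  shows "(\<integral>w. cvx \<phi> c d (XT w) \<partial>M) - cvx \<phi> c d x\<^sub>0
     = (\<integral>z. cvx' \<phi> c d (X (fst z) (snd z)) * bs z \<partial>PP) + (\<integral>z. \<phi> (X (fst z) (snd z)) * as2 z \<partial>PP) / 2"
proof -
  have B: "0 \<le> B" using lip[of 1 0] by simp
  have C0: "0 \<le> C" using C[of 0] by linarith
  define D where "D = C * (d - c)"
  have D: "\<bar>cvx' \<phi> c d z\<bar> \<le> D" if "c \<le> z" "z \<le> d" for z
    unfolding D_def by (rule cvx'_bound[OF assms(1) C that])
  have DZ: "\<bar>cvx' \<phi> c d (Z (tt n j) w)\<bar> \<le> D" if "w \<in> space M" for w n j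
    using Z_range[OF that tt(1)] by (intro D) auto
  define \<alpha> where "\<alpha> n = (\<integral>z. (\<Sum>j<Suc n. cvx' \<phi> c d (Z (tt n j) (snd z)) * cell n j (fst z)) * bs z \<partial>PP)" for n
  define \<beta> where "\<beta> n = (\<integral>z. (\<Sum>j<Suc n. \<phi> (Z (tt n j) (snd z)) * cell n j (fst z)) * as2 z \<partial>PP)" for n
  have \<alpha>l: "\<alpha> \<longlonglongrightarrow> (\<integral>z. cvx' \<phi> c d (X (fst z) (snd z)) * bs z \<partial>PP)"
    unfolding \<alpha>_def
    by (rule riemann_limit[OF _ _ PP_integrable(1) bs_supp cvx'_continuous[OF assms(1) C nn] D]) auto
  have c\<phi>: "continuous_on {c..d} \<phi>"
  proof (rule lipschitz_on_continuous_on)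
    show "B-lipschitz_on {c..d} \<phi>" by (rule lipschitz_onI[OF _ B]) (use lip in \<open>simp add: dist_real_def\<close>)
  qed
  have \<beta>l: "\<beta> \<longlonglongrightarrow> (\<integral>z. \<phi> (X (fst z) (snd z)) * as2 z \<partial>PP)"
    unfolding \<beta>_def
    by (rule riemann_limit[OF _ _ PP_integrable(2) as2_supp c\<phi> C]) auto
  have Zad: "(\<lambda>w. cvx' \<phi> c d (Z (tt n j) w)) \<in> borel_measurable (G (tt n j))" "(\<lambda>w. \<phi> (Z (tt n j) w)) \<in> borel_measurable (G (tt n j))" for n j
    using measurable_compose[OF Z_adapted[OF tt(1)]] cvx_measurable(2)[OF assms(1)] assms(1) by blast+
  have i1: "integrable M (\<lambda>w. cvx' \<phi> c d (Z (tt n j) w) * dA n j w)" for n j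
  proof (rule integrable_mult_bounded[of _ _ _ D])
    show "integrable M (dA n j)"
      by (rule bounded_integrable[of _ K]) (use A_diff_bound[OF _ tt(1) tt(2)] in \<open>auto simp: dA_def\<close>)
  qed (use DZ in auto)
  have idN: "integrable M (\<lambda>w. (dN n j w)\<^sup>2)" for n j by (rule bounded_integrable) (use dN_bound in auto)
  have i2: "integrable M (\<lambda>w. cvx' \<phi> c d (Z (tt n j) w) * dN n j w)" for n j
    by (rule integrable_mult_bounded[of _ _ _ D, OF integrable_of_square[OF dN_measurable idN]]) (use DZ in auto)
  have i3: "integrable M (\<lambda>w. \<phi> (Z (tt n j) w) * (dN n j w)\<^sup>2)" for n j
    by (rule integrable_mult_bounded[of _ _ _ C, OF idN]) (use C in auto)
  define H where "H n w = (\<Sum>j<Suc n. cvx' \<phi> c d (Z (tt n j) w) * dA n j w + cvx' \<phi> c d (Z (tt n j) w) * dN n j w + \<phi> (Z (tt n j) w) * (dN n j w)\<^sup>2 / 2)" for n w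
  have iH: "integrable M (H n)" for n
    unfolding H_def using i1 i2 i3 by (intro Bochner_Integration.integrable_sum Bochner_Integration.integrable_add integrable_divide_zero) auto
  have eA: "(\<integral>w. cvx' \<phi> c d (Z (tt n j) w) * dA n j w \<partial>M) = (\<integral>z. cvx' \<phi> c d (Z (tt n j) (snd z)) * cell n j (fst z) * bs z \<partial>PP)"
    and iA: "integrable PP (\<lambda>z. cvx' \<phi> c d (Z (tt n j) (snd z)) * cell n j (fst z) * bs z)" for n j
  proof -
    show i: "integrable PP (\<lambda>z. cvx' \<phi> c d (Z (tt n j) (snd z)) * cell n j (fst z) * bs z)"
      by (rule weighted_integrable[OF PP_integrable(1), of _ D])
        (use DZ in \<open>auto simp: cell_def indicator_def intro: order_trans[OF abs_ge_zero]\<close>)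
    then have i': "integrable PP (\<lambda>(s, w). cvx' \<phi> c d (Z (tt n j) w) * cell n j s * bs (s, w))" by (simp add: case_prod_beta')
    have "(\<integral>w. cvx' \<phi> c d (Z (tt n j) w) * dA n j w \<partial>M) = (\<integral>w. (\<integral>s. cvx' \<phi> c d (Z (tt n j) w) * cell n j s * bs (s, w) \<partial>lborel) \<partial>M)"
      by (rule Bochner_Integration.integral_cong) (simp_all add: dA_eq mult.assoc)
    also have "\<dots> = (\<integral>z. cvx' \<phi> c d (Z (tt n j) (snd z)) * cell n j (fst z) * bs z \<partial>PP)"
      using P.integral_snd[OF i'] by (simp add: case_prod_beta')
    finally show "(\<integral>w. cvx' \<phi> c d (Z (tt n j) w) * dA n j w \<partial>M) = (\<integral>z. cvx' \<phi> c d (Z (tt n j) (snd z)) * cell n j (fst z) * bs z \<partial>PP)" .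
  qed
  have eN: "(\<integral>w. cvx' \<phi> c d (Z (tt n j) w) * dN n j w \<partial>M) = 0" for n j
    by (rule iso_cell(1)[OF Zad(1) DZ])
  have eQ: "(\<integral>w. \<phi> (Z (tt n j) w) * (dN n j w)\<^sup>2 \<partial>M) = (\<integral>z. \<phi> (Z (tt n j) (snd z)) * cell n j (fst z) * as2 z \<partial>PP)" for n j
    by (rule iso_cell(2)[OF Zad(2) C])
  have eH: "(\<integral>w. H n w \<partial>M) = \<alpha> n + \<beta> n / 2" for n
  proof -
    have "(\<integral>w. H n w \<partial>M) = (\<Sum>j<Suc n. (\<integral>w. cvx' \<phi> c d (Z (tt n j) w) * dA n j w \<partial>M) + (\<integral>w. cvx' \<phi> c d (Z (tt n j) w) * dN n j w \<partial>M) + (\<integral>w. \<phi> (Z (tt n j) w) * (dN n j w)\<^sup>2 \<partial>M) / 2)"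
      unfolding H_def using i1 i2 i3 by (subst Bochner_Integration.integral_sum) simp_all
    also have "\<dots> = (\<Sum>j<Suc n. (\<integral>z. cvx' \<phi> c d (Z (tt n j) (snd z)) * cell n j (fst z) * bs z \<partial>PP) + (\<integral>z. \<phi> (Z (tt n j) (snd z)) * cell n j (fst z) * as2 z \<partial>PP) / 2)"
      unfolding eA eN eQ by (simp only: add_0_right)
    also have "\<dots> = \<alpha> n + (\<Sum>j<Suc n. \<integral>z. \<phi> (Z (tt n j) (snd z)) * cell n j (fst z) * as2 z \<partial>PP) / 2"
      unfolding \<alpha>_def sum_distrib_right using iA
      by (subst Bochner_Integration.integral_sum) (simp_all only: sum.distrib sum_divide_distrib)
    also have "(\<Sum>j<Suc n. \<integral>z. \<phi> (Z (tt n j) (snd z)) * cell n j (fst z) * as2 z \<partial>PP) = \<beta> n"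
      unfolding \<beta>_def by (rule sum_cell_as2(1)[where C = "\<lambda>_. C"]) (use C in auto)
    finally show ?thesis .
  qed
  let ?L = "(\<integral>w. cvx \<phi> c d (XT w) \<partial>M) - cvx \<phi> c d x\<^sub>0"
  have iX: "integrable M (\<lambda>w. cvx \<phi> c d (XT w))"
    by (rule bounded_integrable[of _ "C * (d - c)\<^sup>2"]) (use XT_range in \<open>auto intro!: cvx_bound C\<close>)
  have est: "\<bar>?L - (\<alpha> n + \<beta> n / 2)\<bar> \<le> (C * K + 2 * B * K\<^sup>2) * (\<integral>w. osc n w \<partial>M) + 2 * B * (\<integral>w. osc n w * QV n (Suc n) w \<partial>M)" for n
  proof -
    have "?L - (\<alpha> n + \<beta> n / 2) = (\<integral>w. cvx \<phi> c d (XT w) - cvx \<phi> c d x\<^sub>0 - H n w \<partial>M)"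
      unfolding eH[symmetric] using iX iH by (simp add: prob_space)
    then have "\<bar>?L - (\<alpha> n + \<beta> n / 2)\<bar> \<le> (\<integral>w. \<bar>cvx \<phi> c d (XT w) - cvx \<phi> c d x\<^sub>0 - H n w\<bar> \<partial>M)"
      using integral_abs_bound by metis
    also have "\<dots> \<le> (\<integral>w. (C * K + 2 * B * K\<^sup>2) * osc n w + 2 * B * (osc n w * QV n (Suc n) w) \<partial>M)"
    proof (rule integral_mono)
      show "integrable M (\<lambda>w. \<bar>cvx \<phi> c d (XT w) - cvx \<phi> c d x\<^sub>0 - H n w\<bar>)" using iX iH by simp
      show "integrable M (\<lambda>w. (C * K + 2 * B * K\<^sup>2) * osc n w + 2 * B * (osc n w * QV n (Suc n) w))"
        using osc_integrable(1) osc_QV_integrable by simp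
      fix w assume "w \<in> space M"
      from taylor_sum[OF assms(1) C lip this, of n]
      show "\<bar>cvx \<phi> c d (XT w) - cvx \<phi> c d x\<^sub>0 - H n w\<bar> \<le> (C * K + 2 * B * K\<^sup>2) * osc n w + 2 * B * (osc n w * QV n (Suc n) w)"
        unfolding H_def XT_def .
    qed
    also have "\<dots> = (C * K + 2 * B * K\<^sup>2) * (\<integral>w. osc n w \<partial>M) + 2 * B * (\<integral>w. osc n w * QV n (Suc n) w \<partial>M)"
      using osc_integrable(1) osc_QV_integrable by simp
    finally show ?thesis .
  qed
  have "(\<lambda>n. (C * K + 2 * B * K\<^sup>2) * (\<integral>w. osc n w \<partial>M) + 2 * B * (\<integral>w. osc n w * QV n (Suc n) w \<partial>M)) \<longlonglongrightarrow> (C * K + 2 * B * K\<^sup>2) * 0 + 2 * B * 0"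
    by (intro tendsto_intros osc_mean_limit(1) osc_QV_limit)
  then have "(\<lambda>n. (C * K + 2 * B * K\<^sup>2) * (\<integral>w. osc n w \<partial>M) + 2 * B * (\<integral>w. osc n w * QV n (Suc n) w \<partial>M)) \<longlonglongrightarrow> 0" by simp
  then have "(\<lambda>n. ?L - (\<alpha> n + \<beta> n / 2)) \<longlonglongrightarrow> 0"
    by (rule Lim_null_comparison[rotated]) (use est in auto)
  moreover have "(\<lambda>n. ?L - (\<alpha> n + \<beta> n / 2)) \<longlonglongrightarrow> ?L - ((\<integral>z. cvx' \<phi> c d (X (fst z) (snd z)) * bs z \<partial>PP) + (\<integral>z. \<phi> (X (fst z) (snd z)) * as2 z \<partial>PP) / 2)"
    using \<alpha>l \<beta>l by (intro tendsto_intros) auto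
  ultimately show ?thesis using LIMSEQ_unique by fastforce
qed

text \<open>By Tanaka's formula, \<open>dens y\<close> is the expected local time at \<open>y\<close> up to \<open>T\<close>.\<close>

definition dens :: "real \<Rightarrow> real" where
  "dens y = 2 * ((\<integral>w. max 0 (XT w - y) \<partial>M) - max 0 (x\<^sub>0 - y) - (\<integral>z. of_bool (y < X (fst z) (snd z)) * bs z \<partial>PP))"

text \<open>Fubini over the level: integrating the definition of \<open>dens\<close> against \<phi>
  turns ramps into \<open>cvx\<close> and indicators into \<open>cvx'\<close>. The drift term is
  then the one in \<open>dynkin\<close>, so subtracting the two identities leaves the occupation
  formula.\<close>

lemma mixing:
  assumes [measurable]: "\<phi> \<in> borel_measurable borel" and C: "\<And>y. \<bar>\<phi> y\<bar> \<le> C" and nn: "\<And>y. 0 \<le> \<phi> y"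
  shows "integrable lborel (\<lambda>y. indicator {c..d} y * \<phi> y * dens y)"
    "(\<integral>w. cvx \<phi> c d (XT w) \<partial>M) - cvx \<phi> c d x\<^sub>0 - (\<integral>z. cvx' \<phi> c d (X (fst z) (snd z)) * bs z \<partial>PP)
     = (\<integral>y. indicator {c..d} y * \<phi> y * dens y \<partial>lborel) / 2"
proof -
  interpret Q: pair_sigma_finite M lborel ..
  interpret R: pair_sigma_finite PP lborel ..
  have C0: "0 \<le> C" using C[of 0] by linarith
  define f where "f w y = indicator {c..d} y * \<phi> y * max 0 (XT w - y)" for w y
  define g where "g z y = indicator {c..d} y * \<phi> y * (of_bool (y < X (fst z) (snd z)) * bs z)" for z :: "real \<times> 'a" and y
  have if1: "integrable (M \<Otimes>\<^sub>M lborel) (\<lambda>(w, y). f w y)"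
  proof (rule Q.Fubini_integrable)
    show "(\<lambda>(w, y). f w y) \<in> borel_measurable (M \<Otimes>\<^sub>M lborel)" unfolding f_def by measurable
    have eq: "(\<integral>y. norm (f w y) \<partial>lborel) = cvx \<phi> c d (XT w)" for w
      unfolding f_def cvx_def using nn by (intro Bochner_Integration.integral_cong) (auto simp: abs_mult)
    have "integrable M (\<lambda>w. cvx \<phi> c d (XT w))"
      by (rule bounded_integrable[of _ "C * (d - c)\<^sup>2"]) (use XT_range in \<open>auto intro!: cvx_bound C\<close>)
    then show "integrable M (\<lambda>w. \<integral>y. norm (case (w, y) of (w, y) \<Rightarrow> f w y) \<partial>lborel)"
      using eq by simp
    show "AE w in M. integrable lborel (\<lambda>y. case (w, y) of (w, y) \<Rightarrow> f w y)"
      unfolding f_def using XT_range by (intro AE_I2) (auto intro!: cvx_integrable(1) C)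
  qed
  \<comment> \<open>X is known to stay in [c, d] at nonnegative times only; at all others
    \<open>bs\<close> vanishes.\<close>
  have Xz: "bs z = 0 \<or> (c \<le> X (fst z) (snd z) \<and> X (fst z) (snd z) \<le> d)" if "z \<in> space PP" for z :: "real \<times> 'a"
  proof -
    have "snd z \<in> space M" using that by (auto simp: space_pair_measure)
    then show ?thesis using X_range[of "snd z" "fst z"] by (auto simp: bs_def)
  qed
  have ig1: "integrable (PP \<Otimes>\<^sub>M lborel) (\<lambda>(z, y). g z y)"
  proof (rule R.Fubini_integrable)
    show "(\<lambda>(z, y). g z y) \<in> borel_measurable (PP \<Otimes>\<^sub>M lborel)" unfolding g_def by measurable
    have eq: "(\<integral>y. norm (g z y) \<partial>lborel) = cvx' \<phi> c d (X (fst z) (snd z)) * \<bar>bs z\<bar>" for z :: "real \<times> 'a"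
    proof -
      have "(\<integral>y. norm (g z y) \<partial>lborel) = (\<integral>y. indicator {c..d} y * \<phi> y * of_bool (y < X (fst z) (snd z)) * \<bar>bs z\<bar> \<partial>lborel)"
        unfolding g_def using nn by (intro Bochner_Integration.integral_cong) (auto simp: abs_mult)
      then show ?thesis by (simp add: cvx'_def)
    qed
    have "integrable PP (\<lambda>z. cvx' \<phi> c d (X (fst z) (snd z)) * \<bar>bs z\<bar>)"
    proof (rule Bochner_Integration.integrable_bound)
      show "integrable PP (\<lambda>z. C * (d - c) * \<bar>bs z\<bar>)" using PP_integrable(1) by simp
      show "AE z in PP. norm (cvx' \<phi> c d (X (fst z) (snd z)) * \<bar>bs z\<bar>) \<le> norm (C * (d - c) * \<bar>bs z\<bar>)"
      proof (rule AE_I2)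
        fix z :: "real \<times> 'a" assume z: "z \<in> space PP"
        show "norm (cvx' \<phi> c d (X (fst z) (snd z)) * \<bar>bs z\<bar>) \<le> norm (C * (d - c) * \<bar>bs z\<bar>)"
        proof (cases "bs z = 0")
          case False
          then have "\<bar>cvx' \<phi> c d (X (fst z) (snd z))\<bar> \<le> C * (d - c)"
            using Xz[OF z] by (intro cvx'_bound[OF assms(1) C]) auto
          then have "\<bar>cvx' \<phi> c d (X (fst z) (snd z))\<bar> \<le> \<bar>C * (d - c)\<bar>" by linarith
          then show ?thesis by (auto simp: abs_mult[of _ "\<bar>bs z\<bar>"] intro!: mult_right_mono)
        qed simp
      qed
    qed measurable
    then show "integrable PP (\<lambda>z. \<integral>y. norm (case (z, y) of (z, y) \<Rightarrow> g z y) \<partial>lborel)" using eq by simp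
    show "AE z in PP. integrable lborel (\<lambda>y. case (z, y) of (z, y) \<Rightarrow> g z y)"
    proof (rule AE_I2)
      fix z :: "real \<times> 'a" assume z: "z \<in> space PP"
      show "integrable lborel (\<lambda>y. case (z, y) of (z, y) \<Rightarrow> g z y)"
      proof (cases "bs z = 0")
        case False
        then have "integrable lborel (\<lambda>y. indicator {c..d} y * \<phi> y * of_bool (y < X (fst z) (snd z)))"
          using Xz[OF z] by (intro cvx_integrable(2)[OF assms(1) C]) auto
        then have "integrable lborel (\<lambda>y. indicator {c..d} y * \<phi> y * of_bool (y < X (fst z) (snd z)) * bs z)" by simp
        then show ?thesis by (simp add: g_def mult.assoc)
      qed (simp add: g_def)
    qed
  qed
  define F where "F y = indicator {c..d} y * \<phi> y * (\<integral>w. max 0 (XT w - y) \<partial>M)" for y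
  define H where "H y = indicator {c..d} y * \<phi> y * (\<integral>z. of_bool (y < X (fst z) (snd z)) * bs z \<partial>PP)" for y
  define J where "J y = indicator {c..d} y * \<phi> y * max 0 (x\<^sub>0 - y)" for y
  have F: "integrable lborel F" "(\<integral>y. F y \<partial>lborel) = (\<integral>w. cvx \<phi> c d (XT w) \<partial>M)"
    using Q.integrable_snd[OF if1] Q.Fubini_integral[OF if1] by (simp_all add: F_def[abs_def] f_def cvx_def)
  have H: "integrable lborel H" "(\<integral>y. H y \<partial>lborel) = (\<integral>z. cvx' \<phi> c d (X (fst z) (snd z)) * bs z \<partial>PP)"
  proof -
    show "integrable lborel H" using R.integrable_snd[OF ig1] by (simp add: H_def[abs_def] g_def)
    have "(\<integral>y. g z y \<partial>lborel) = cvx' \<phi> c d (X (fst z) (snd z)) * bs z" for z :: "real \<times> 'a"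
    proof -
      have "(\<integral>y. g z y \<partial>lborel) = (\<integral>y. indicator {c..d} y * \<phi> y * of_bool (y < X (fst z) (snd z)) * bs z \<partial>lborel)"
        by (simp add: g_def mult.assoc)
      then show ?thesis by (simp add: cvx'_def)
    qed
    then show "(\<integral>y. H y \<partial>lborel) = (\<integral>z. cvx' \<phi> c d (X (fst z) (snd z)) * bs z \<partial>PP)"
      using R.Fubini_integral[OF ig1] by (simp add: H_def[abs_def] g_def)
  qed
  have J: "integrable lborel J" "(\<integral>y. J y \<partial>lborel) = cvx \<phi> c d x\<^sub>0"
    using cvx_integrable(1)[OF assms(1) C, of c x\<^sub>0 d] x0_range by (auto simp: J_def[abs_def] cvx_def)
  have eq: "(\<lambda>y. indicator {c..d} y * \<phi> y * dens y) = (\<lambda>y. 2 * (F y - J y - H y))"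
    by (simp add: fun_eq_iff dens_def F_def J_def H_def algebra_simps)
  show "integrable lborel (\<lambda>y. indicator {c..d} y * \<phi> y * dens y)"
    unfolding eq using F(1) H(1) J(1) by simp
  show "(\<integral>w. cvx \<phi> c d (XT w) \<partial>M) - cvx \<phi> c d x\<^sub>0 - (\<integral>z. cvx' \<phi> c d (X (fst z) (snd z)) * bs z \<partial>PP)
     = (\<integral>y. indicator {c..d} y * \<phi> y * dens y \<partial>lborel) / 2"
    unfolding eq using F H J by simp
qed

lemma occupation_lipschitz:
  assumes "\<phi> \<in> borel_measurable borel" "\<And>y. \<bar>\<phi> y\<bar> \<le> C" "\<And>y. 0 \<le> \<phi> y" "\<And>y z. \<bar>\<phi> y - \<phi> z\<bar> \<le> B * \<bar>y - z\<bar>"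
  shows "(\<integral>z. \<phi> (X (fst z) (snd z)) * as2 z \<partial>PP) = (\<integral>y. indicator {c..d} y * \<phi> y * dens y \<partial>lborel)"
  using dynkin[OF assms] mixing(2)[OF assms(1-3)] by simp

end

text \<open>Lipschitz functions with slope n above the indicator of (-\<infinity>, x]. The indicator
  itself is no admissible test function in \<open>dynkin\<close>.\<close>

definition soft_step :: "nat \<Rightarrow> real \<Rightarrow> real \<Rightarrow> real" where
  "soft_step n x y = max 0 (min 1 (1 - real n * (y - x)))"

lemma soft_step: "0 \<le> soft_step n x y" "soft_step n x y \<le> 1" "\<bar>soft_step n x y - soft_step n x z\<bar> \<le> real n * \<bar>y - z\<bar>"
proof -
  show "0 \<le> soft_step n x y" "soft_step n x y \<le> 1" by (auto simp: soft_step_def)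
  have "\<bar>soft_step n x y - soft_step n x z\<bar> \<le> \<bar>(1 - real n * (y - x)) - (1 - real n * (z - x))\<bar>"
    unfolding soft_step_def by linarith
  also have "\<dots> = \<bar>real n * (z - y)\<bar>" by (rule arg_cong[where f = abs]) (simp add: algebra_simps)
  also have "\<dots> = real n * \<bar>y - z\<bar>" by (simp add: abs_mult abs_minus_commute)
  finally show "\<bar>soft_step n x y - soft_step n x z\<bar> \<le> real n * \<bar>y - z\<bar>" .
qed

lemma soft_step_measurable [measurable]: "soft_step n x \<in> borel_measurable borel"
  unfolding soft_step_def[abs_def] by measurable

lemma soft_step_limit: "(\<lambda>n. soft_step n x y) \<longlonglongrightarrow> of_bool (y \<le> x)"
proof (cases "y \<le> x")
  case True
  have "soft_step n x y = 1" for n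
  proof -
    have "real n * (y - x) \<le> 0" using True by (intro mult_nonneg_nonpos) auto
    then show ?thesis by (auto simp: soft_step_def)
  qed
  then show ?thesis using True by simp
next
  case False
  obtain N :: nat where "1 / (y - x) \<le> real N" using real_arch_simple by blast
  then have N: "1 \<le> real N * (y - x)" using False by (simp add: field_simps)
  have "\<forall>\<^sub>F n in sequentially. soft_step n x y = of_bool (y \<le> x)"
  proof (rule eventually_sequentiallyI[of N])
    fix n assume "N \<le> n"
    then have "real N * (y - x) \<le> real n * (y - x)" using False by (intro mult_right_mono) auto
    then have "1 - real n * (y - x) \<le> 0" using N by linarith
    then show "soft_step n x y = of_bool (y \<le> x)" using False by (simp add: soft_step_def)
  qed
  then show ?thesis by (rule tendsto_eventually)
qed

context stopped_diffusion begin

lemma dens_measurable [measurable]: "(\<lambda>y. indicator {c..d} y * dens y) \<in> borel_measurable borel"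
  and dens_integrable: "integrable lborel (\<lambda>y. indicator {c..d} y * dens y)"
proof -
  show "integrable lborel (\<lambda>y. indicator {c..d} y * dens y)" using mixing(1)[of "\<lambda>_. 1" 1] by simp
  from borel_measurable_integrable[OF this] show "(\<lambda>y. indicator {c..d} y * dens y) \<in> borel_measurable borel" by simp
qed

lemma occupation_half_line:
  "(\<integral>z. of_bool (X (fst z) (snd z) \<le> x) * as2 z \<partial>PP) = (\<integral>y. of_bool (y \<le> x) * (indicator {c..d} y * dens y) \<partial>lborel)"
proof -
  have "(\<lambda>n. \<integral>z. soft_step n x (X (fst z) (snd z)) * as2 z \<partial>PP) \<longlonglongrightarrow> (\<integral>z. of_bool (X (fst z) (snd z) \<le> x) * as2 z \<partial>PP)"
  proof (rule integral_dominated_convergence[where w = as2])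
    show "AE z in PP. norm (soft_step n x (X (fst z) (snd z)) * as2 z) \<le> as2 z" for n
      using soft_step(1,2) as2_nonneg by (intro AE_I2) (auto simp: abs_mult intro!: mult_left_le_one_le)
    show "AE z in PP. (\<lambda>n. soft_step n x (X (fst z) (snd z)) * as2 z) \<longlonglongrightarrow> of_bool (X (fst z) (snd z) \<le> x) * as2 z"
      by (intro AE_I2 tendsto_mult tendsto_const soft_step_limit)
  qed (use PP_integrable(2) in measurable)
  moreover have "(\<lambda>n. \<integral>y. soft_step n x y * (indicator {c..d} y * dens y) \<partial>lborel) \<longlonglongrightarrow> (\<integral>y. of_bool (y \<le> x) * (indicator {c..d} y * dens y) \<partial>lborel)"
  proof (rule integral_dominated_convergence[where w = "\<lambda>y. \<bar>indicator {c..d} y * dens y\<bar>"])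
    show "AE y in lborel. norm (soft_step n x y * (indicator {c..d} y * dens y)) \<le> \<bar>indicator {c..d} y * dens y\<bar>" for n
      using soft_step(1,2) by (intro AE_I2) (auto simp: abs_mult intro!: mult_left_le_one_le)
    show "AE y in lborel. (\<lambda>n. soft_step n x y * (indicator {c..d} y * dens y)) \<longlonglongrightarrow> of_bool (y \<le> x) * (indicator {c..d} y * dens y)"
      by (intro AE_I2 tendsto_mult tendsto_const soft_step_limit)
    show "integrable lborel (\<lambda>y. \<bar>indicator {c..d} y * dens y\<bar>)" using dens_integrable by simp
  qed measurable
  moreover have "(\<integral>z. soft_step n x (X (fst z) (snd z)) * as2 z \<partial>PP) = (\<integral>y. soft_step n x y * (indicator {c..d} y * dens y) \<partial>lborel)" for n
    using occupation_lipschitz[of "soft_step n x" 1 "real n"] soft_step by (simp add: mult.left_commute mult.assoc)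
  ultimately show ?thesis using LIMSEQ_unique by simp
qed

text \<open>Half-lines determine a finite Borel measure, so equal distribution functions suffice.
  Nonnegativity of \<open>dens\<close> makes the right-hand side a measure; it will come from the
  local time.\<close>

lemma occupation:
  assumes nn: "\<And>y. c \<le> y \<Longrightarrow> y \<le> d \<Longrightarrow> 0 \<le> dens y" and [measurable]: "\<psi> \<in> borel_measurable borel"
  shows "(\<integral>\<^sup>+z. \<psi> (X (fst z) (snd z)) * ennreal (as2 z) \<partial>PP) = (\<integral>\<^sup>+y. \<psi> y * ennreal (indicator {c..d} y * dens y) \<partial>lborel)"
proof -
  define \<kappa> where "\<kappa> y = indicator {c..d} y * dens y" for y
  have [measurable]: "\<kappa> \<in> borel_measurable borel" and \<kappa>i: "integrable lborel \<kappa>"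
    unfolding \<kappa>_def using dens_measurable dens_integrable by simp_all
  define m1 where "m1 = distr (density PP (\<lambda>z. ennreal (as2 z))) borel (\<lambda>z. X (fst z) (snd z))"
  define m2 where "m2 = density lborel (\<lambda>y. ennreal (\<kappa> y))"
  have nn': "0 \<le> \<kappa> y" for y using nn by (auto simp: indicator_def \<kappa>_def)
  have e1: "emeasure m1 {..x} = ennreal (\<integral>z. of_bool (X (fst z) (snd z) \<le> x) * as2 z \<partial>PP)" for x
  proof -
    have "emeasure m1 {..x} = (\<integral>\<^sup>+z. indicator {..x} (X (fst z) (snd z)) * ennreal (as2 z) \<partial>PP)"
      unfolding m1_def by (subst nn_integral_indicator[symmetric], simp) (simp add: nn_integral_distr nn_integral_density mult.commute del: nn_integral_indicator)
    also have "\<dots> = (\<integral>\<^sup>+z. ennreal (of_bool (X (fst z) (snd z) \<le> x) * as2 z) \<partial>PP)"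
      by (rule nn_integral_cong) (auto simp: indicator_def)
    also have "\<dots> = ennreal (\<integral>z. of_bool (X (fst z) (snd z) \<le> x) * as2 z \<partial>PP)"
      using as2_nonneg
      by (intro nn_integral_eq_integral weighted_integrable[OF PP_integrable(2), of _ 1]) auto
    finally show ?thesis .
  qed
  have e2: "emeasure m2 {..x} = ennreal (\<integral>y. of_bool (y \<le> x) * (\<kappa> y) \<partial>lborel)" for x
  proof -
    have "emeasure m2 {..x} = (\<integral>\<^sup>+y. ennreal (of_bool (y \<le> x) * (\<kappa> y)) \<partial>lborel)"
      unfolding m2_def by (subst emeasure_density) (auto intro!: nn_integral_cong simp: indicator_def)
    also have "\<dots> = ennreal (\<integral>y. of_bool (y \<le> x) * (\<kappa> y) \<partial>lborel)"
      using nn' by (intro nn_integral_eq_integral integrable_mult_bounded[OF \<kappa>i, of _ 1]) auto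
    finally show ?thesis .
  qed
  have "(\<integral>\<^sup>+z. ennreal (as2 z) \<partial>PP) < \<infinity>"
    using PP_integrable(2) as2_nonneg by (simp add: nn_integral_eq_integral)
  moreover have "emeasure (density PP (\<lambda>z. ennreal (as2 z))) (space PP) = (\<integral>\<^sup>+z. ennreal (as2 z) \<partial>PP)"
    by (subst emeasure_density, simp, rule sets.top) (auto intro!: nn_integral_cong)
  ultimately have f1: "finite_borel_measure m1"
    by (intro finite_borel_measure.intro finite_measureI finite_borel_measure_axioms.intro)
      (auto simp: m1_def emeasure_distr)
  have "(\<integral>\<^sup>+y. ennreal (\<kappa> y) \<partial>lborel) < \<infinity>"
    using \<kappa>i nn' by (simp add: nn_integral_eq_integral)
  then have f2: "finite_borel_measure m2"
    by (intro finite_borel_measure.intro finite_measureI finite_borel_measure_axioms.intro)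
      (auto simp: m2_def emeasure_density)
  have "m1 = m2"
  proof (rule cdf_unique'[OF f1 f2])
    show "cdf m1 = cdf m2"
      by (simp add: fun_eq_iff cdf_def measure_def e1 e2 occupation_half_line[folded \<kappa>_def])
  qed
  have "(\<integral>\<^sup>+z. \<psi> (X (fst z) (snd z)) * ennreal (as2 z) \<partial>PP) = (\<integral>\<^sup>+y. \<psi> y \<partial>m1)"
    unfolding m1_def by (simp add: nn_integral_distr nn_integral_density mult.commute)
  also have "\<dots> = (\<integral>\<^sup>+y. \<psi> y * ennreal (\<kappa> y) \<partial>lborel)"
    unfolding \<open>m1 = m2\<close> m2_def by (simp add: nn_integral_density mult.commute)
  finally show ?thesis unfolding \<kappa>_def .
qed

end

section \<open>Local time of a bounded diffusion\<close>

context bm_filtration begin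

lemma ito_zero:
  assumes "ito h I"
  shows "AE w in M. I 0 w = 0"
proof -
  from assms obtain e E where el: "\<And>n. elem (e n) (E n)"
    and ap: "AE w in M. \<forall>c\<ge>0. (\<lambda>n. \<integral>\<^sup>+s\<in>{0..c}. ennreal ((e n s w - h s w)\<^sup>2) \<partial>lborel) \<longlonglongrightarrow> 0 \<and>
        uniform_limit {0..c} (\<lambda>n t. E n t w) (\<lambda>t. I t w) sequentially"
    by (auto simp: ito_def ito_approx_def)
  show ?thesis
    using ap AE_space
  proof eventually_elim
    case (elim w)
    then have "uniform_limit {0..0} (\<lambda>n t. E n t w) (\<lambda>t. I t w) sequentially" by blast
    from tendsto_uniform_limitI[OF this, of 0] have "(\<lambda>n. E n 0 w) \<longlonglongrightarrow> I 0 w" by simp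
    moreover have "E n 0 w = 0" for n by (rule elem_0[OF el elim(2)])
    ultimately show ?case by (simp add: LIMSEQ_const_iff)
  qed
qed

lemma prog_square: "prog h \<Longrightarrow> prog (\<lambda>s w. (h s w)\<^sup>2)"
  using prog_mult[of h h] by (simp add: power2_eq_square)

lemma opt_hit_integral:
  assumes "prog h" "0 \<le> q"
  shows "opt (hit q (\<lambda>u w. ennreal K < (\<integral>\<^sup>+s\<in>{0..u}. ennreal (h s w) \<partial>lborel)))"
proof (rule opt_hit[OF assms(2)])
  fix u :: real assume u: "0 \<le> u"
  note [measurable] = prog_nn_integral[OF assms(1) u]
  have "{w \<in> space (G u). ennreal K < (\<integral>\<^sup>+s\<in>{0..u}. ennreal (h s w) \<partial>lborel)} \<in> sets (G u)" by measurable
  then show "{w \<in> space M. ennreal K < (\<integral>\<^sup>+s\<in>{0..u}. ennreal (h s w) \<partial>lborel)} \<in> sets (G u)" using u by simp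
qed

lemma hit_integral_bound:
  assumes "prog h" "0 \<le> q" "w \<in> space M" "t \<le> hit q (\<lambda>u w. ennreal K < (\<integral>\<^sup>+s\<in>{0..u}. ennreal (h s w) \<partial>lborel)) w"
  shows "(\<integral>\<^sup>+s\<in>{0..t}. ennreal (h s w) \<partial>lborel) \<le> ennreal K"
proof (rule nn_integral_Icc_le)
  let ?P = "\<lambda>u w. ennreal K < (\<integral>\<^sup>+s\<in>{0..u}. ennreal (h s w) \<partial>lborel)"
  note [measurable] = prog_section[OF assms(1,3)]
  show "(\<lambda>s. ennreal (h s w)) \<in> borel_measurable borel" by measurable
  fix s assume s: "s \<in> \<rat>" "0 \<le> s" "s < t"
  then have "\<not> ?P s w" using hit_less_iff[OF assms(2), of ?P w "hit q ?P w"] assms(4) by (meson less_irrefl less_le_trans)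
  then show "(\<integral>\<^sup>+s\<in>{0..s}. ennreal (h s w) \<partial>lborel) \<le> ennreal K" by (simp add: not_less)
qed

lemma hit_integral_eq:
  assumes "0 \<le> q" "(\<integral>\<^sup>+s\<in>{0..q}. ennreal (h s w) \<partial>lborel) \<le> ennreal K"
  shows "hit q (\<lambda>u w. ennreal K < (\<integral>\<^sup>+s\<in>{0..u}. ennreal (h s w) \<partial>lborel)) w = q"
proof (rule antisym[OF hit_le[OF assms(1)]])
  let ?P = "\<lambda>u w. ennreal K < (\<integral>\<^sup>+s\<in>{0..u}. ennreal (h s w) \<partial>lborel)"
  have "\<not> ?P u w" if "u < q" for u
  proof -
    have "(\<integral>\<^sup>+s\<in>{0..u}. ennreal (h s w) \<partial>lborel) \<le> (\<integral>\<^sup>+s\<in>{0..q}. ennreal (h s w) \<partial>lborel)"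
      using that by (intro nn_integral_mono) (auto simp: indicator_def)
    then show ?thesis using assms(2) by (meson leD order_trans)
  qed
  then have "\<not> hit q ?P w < q" unfolding hit_less_iff[OF assms(1)] by (metis less_irrefl)
  then show "q \<le> hit q ?P w" by simp
qed

text \<open>Locality of the Ito integral. T is the first time at which the energy of k becomes
  positive, so the integral stopped there has zero second moment by the isometry. On a path on which
  k vanishes up to t, this time equals the horizon q for every positive rational q \<le> t, and
  continuity reaches t itself.\<close>

lemma ito_vanish:
  assumes ito: "ito k J"
  shows "AE w in M. \<forall>t\<ge>0. (\<forall>s. 0 \<le> s \<and> s \<le> t \<longrightarrow> k s w = 0) \<longrightarrow> J t w = 0"
proof -
  interpret P: pair_sigma_finite lborel M ..
  note k2 = prog_square[OF itoD(1)[OF ito]]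
  define T where "T q = hit q (\<lambda>u w. ennreal 0 < (\<integral>\<^sup>+s\<in>{0..u}. ennreal ((k s w)\<^sup>2) \<partial>lborel))" for q
  have main: "AE w in M. J (T q w) w = 0" if q: "0 < q" for q
  proof -
    have To: "opt (T q)" unfolding T_def using q by (intro opt_hit_integral[OF k2]) simp
    have Tq: "T q w \<le> q" for w unfolding T_def using q by (intro hit_le) simp
    have bd: "(\<integral>\<^sup>+s\<in>{0..T q w}. ennreal ((k s w)\<^sup>2) \<partial>lborel) \<le> ennreal 0" if "w \<in> space M" for w
      using hit_integral_bound[OF k2 _ that, of q _ 0] q unfolding T_def by simp
    have bd': "AE w in M. (\<integral>\<^sup>+s\<in>{0..T q w}. ennreal ((k s w)\<^sup>2) \<partial>lborel) \<le> ennreal 0"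
      using bd by (intro AE_I2)
    note I = ito_stopped[OF ito To Tq less_imp_le[OF q] order_refl bd' order_refl less_imp_le[OF q], of "\<lambda>_. 1" 1]
    let ?g = "\<lambda>z. (indicator {0<..q} (fst z) * (k (fst z) (snd z) * of_bool (fst z \<le> T q (snd z))))\<^sup>2"
    have "(\<integral>z. ?g z \<partial>(lborel \<Otimes>\<^sub>M M)) = 0"
    proof -
      have i: "integrable (lborel \<Otimes>\<^sub>M M) (\<lambda>(s, w). ?g (s, w))" using I(3) by (simp add: case_prod_beta')
      have "(\<integral>s. ?g (s, w) \<partial>lborel) = 0" if wM: "w \<in> space M" for w
      proof -
        note [measurable] = prog_section[OF itoD(1)[OF ito] wM]
        have "AE s in lborel. ennreal ((k s w)\<^sup>2) * indicator {0..T q w} s = 0"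
          using bd[OF wM] by (subst nn_integral_0_iff_AE[symmetric]) auto
        then have "AE s in lborel. ?g (s, w) = 0"
          by eventually_elim (auto simp: indicator_def split: if_splits)
        then show ?thesis by (rule integral_eq_zero_AE)
      qed
      then have "(\<integral>w. (\<integral>s. ?g (s, w) \<partial>lborel) \<partial>M) = 0"
        by (subst Bochner_Integration.integral_cong[OF refl, of M _ "\<lambda>_. 0"]) auto
      then show ?thesis using P.integral_snd[OF i] by (simp add: case_prod_beta')
    qed
    then have z: "(\<integral>w. (J (min q (T q w)) w - J (min 0 (T q w)) w)\<^sup>2 \<partial>M) = 0" using I(4) by simp
    have "AE w in M. (J (min q (T q w)) w - J (min 0 (T q w)) w)\<^sup>2 = 0"
      using integral_nonneg_eq_0_iff_AE[OF I(1)] z by simp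
    then show ?thesis
      using ito_zero[OF ito] AE_space
    proof eventually_elim
      case (elim w)
      then show ?case using opt_nonneg[OF To elim(3)] Tq[of w] by (simp add: min_absorb1 min_absorb2)
    qed
  qed
  have "AE w in M. \<forall>q\<in>\<rat> \<inter> {0<..}. J (T q w) w = 0"
    by (rule AE_ball_countable[THEN iffD2]) (use countable_rat main in \<open>auto intro: countable_subset[OF _ countable_rat]\<close>)
  then show ?thesis
    using ito_zero[OF ito] AE_space
  proof eventually_elim
    case (elim w)
    show ?case
    proof (intro allI impI)
      fix t :: real assume t: "0 \<le> t" and z: "\<forall>s. 0 \<le> s \<and> s \<le> t \<longrightarrow> k s w = 0"
      have Jq: "J q w = 0" if "q \<in> \<rat>" "0 < q" "q \<le> t" for q
      proof -
        have "(\<integral>\<^sup>+s\<in>{0..q}. ennreal ((k s w)\<^sup>2) \<partial>lborel) = (\<integral>\<^sup>+s. 0 \<partial>(lborel :: real measure))"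
          using z that by (intro nn_integral_cong) (auto simp: indicator_def)
        then have "T q w = q" unfolding T_def using that by (intro hit_integral_eq) auto
        moreover have "J (T q w) w = 0" using elim(1) that by blast
        ultimately show ?thesis by (simp only:)
      qed
      show "J t w = 0"
      proof (cases "t = 0")
        case False
        then have "0 < t" using t by simp
        have "\<exists>s\<in>\<rat>. max 0 (t - 1 / real (Suc k)) < s \<and> s < t" for k :: nat
          using \<open>0 < t\<close> by (intro Rats_dense_in_real) simp
        then obtain s where s: "\<And>k. s k \<in> \<rat>" "\<And>k. max 0 (t - 1 / real (Suc k)) < s k" "\<And>k. s k < t" by metis
        have slim: "s \<longlonglongrightarrow> t"
        proof (rule tendsto_sandwich)
          show "(\<lambda>k. t - 1 / real (Suc k)) \<longlonglongrightarrow> t"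
            using tendsto_diff[OF tendsto_const LIMSEQ_inverse_real_of_nat, of t] by (simp add: inverse_eq_divide)
          show "\<forall>\<^sub>F k in sequentially. t - 1 / real (Suc k) \<le> s k" using s(2) by (auto simp: less_imp_le)
          show "\<forall>\<^sub>F k in sequentially. s k \<le> t" using s(3) by (auto simp: less_imp_le)
        qed (rule tendsto_const)
        have "(\<lambda>k. J (s k) w) \<longlonglongrightarrow> J t w"
          by (rule continuous_on_tendsto_compose[OF itoD(3)[OF ito elim(3)] slim])
            (use t s(2) in \<open>auto intro!: always_eventually less_imp_le\<close>)
        moreover have "J (s k) w = 0" for k using s(1,2,3)[of k] by (intro Jq) auto
        ultimately show ?thesis by (simp add: LIMSEQ_const_iff)
      qed (use elim in simp)
    qed
  qed
qed

end

text \<open>Tanaka's formula solved for the local time; \<open>I y\<close> stands for the Ito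
  integral of the noise gated by {X > y}.\<close>

definition tanaka ::
  "(real \<Rightarrow> 'a \<Rightarrow> real) \<Rightarrow> (real \<Rightarrow> 'a \<Rightarrow> real) \<Rightarrow> real \<Rightarrow> (real \<Rightarrow> real \<Rightarrow> 'a \<Rightarrow> real) \<Rightarrow> real \<Rightarrow> real \<Rightarrow> 'a \<Rightarrow> real" where
  "tanaka X b x\<^sub>0 I y t w = 2 * (max 0 (X t w - y) - max 0 (x\<^sub>0 - y)
     - (LINT s:{0..t}|lborel. of_bool (y < X s w) * b s w) - I y t w)"

text \<open>In the application \<psi> is \<bar>\<mu>\<bar> / \<sigma>^2. By \<open>b_eq\<close>
  drift integrals become integrals over the occupation measure. The given local time is represented
  by \<open>tanaka_mono\<close>; everything else about it is computed from Tanaka's formula.\<close>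

locale tanaka_diffusion = bm_filtration M G W
  for M :: "'a measure" and G and W +
  fixes X N a b :: "real \<Rightarrow> 'a \<Rightarrow> real" and c d x\<^sub>0 :: real and \<psi> :: "real \<Rightarrow> real"
    and I :: "real \<Rightarrow> real \<Rightarrow> 'a \<Rightarrow> real" and Ys :: "real set"
  assumes X_prog: "prog X"
    and X_cont: "w \<in> space M \<Longrightarrow> continuous_on {0..} (\<lambda>t. X t w)"
    and X_range: "w \<in> space M \<Longrightarrow> 0 \<le> t \<Longrightarrow> c \<le> X t w \<and> X t w \<le> d"
    and X_0: "w \<in> space M \<Longrightarrow> X 0 w = x\<^sub>0"
    and b_prog: "prog b"
    and ito_N: "ito a N"
    and X_eq: "w \<in> space M \<Longrightarrow> 0 \<le> t \<Longrightarrow> X t w = x\<^sub>0 + (LINT s:{0..t}|lborel. b s w) + N t w"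
    and a_int: "w \<in> space M \<Longrightarrow> 0 \<le> t \<Longrightarrow> (\<integral>\<^sup>+s\<in>{0..t}. ennreal ((a s w)\<^sup>2) \<partial>lborel) < \<infinity>"
    and b_int: "w \<in> space M \<Longrightarrow> 0 \<le> t \<Longrightarrow> (\<integral>\<^sup>+s\<in>{0..t}. ennreal \<bar>b s w\<bar> \<partial>lborel) < \<infinity>"
    and \<psi>_measurable [measurable]: "\<psi> \<in> borel_measurable borel"
    and \<psi>_nonneg: "0 \<le> \<psi> y"
    and \<psi>_integrable: "integrable lborel (\<lambda>y. indicator {c..d} y * \<psi> y)"
    and b_eq: "w \<in> space M \<Longrightarrow> 0 \<le> s \<Longrightarrow> \<bar>b s w\<bar> = \<psi> (X s w) * (a s w)\<^sup>2"
    and Ys: "{c..d} \<subseteq> Ys"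
    and ito_I: "y \<in> Ys \<Longrightarrow> ito (\<lambda>s w. of_bool (y < X s w) * a s w) (I y)"
    and tanaka_mono: "y \<in> Ys \<Longrightarrow> AE w in M. \<forall>s t. 0 \<le> s \<and> s \<le> t \<longrightarrow>
      0 \<le> tanaka X b x\<^sub>0 I y s w \<and> tanaka X b x\<^sub>0 I y s w \<le> tanaka X b x\<^sub>0 I y t w"
begin

abbreviation lt where "lt \<equiv> tanaka X b x\<^sub>0 I"

lemma lt_below:
  assumes "y \<in> Ys"
  shows "AE w in M. \<forall>t\<ge>0. (\<forall>s. 0 \<le> s \<and> s \<le> t \<longrightarrow> X s w < y) \<longrightarrow> lt y t w = 0"
  using ito_vanish[OF ito_I[OF assms]] AE_space
proof eventually_elim
  case (elim w)
  show ?case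
  proof (intro allI impI)
    fix t :: real assume t: "0 \<le> t" and *: "\<forall>s. 0 \<le> s \<and> s \<le> t \<longrightarrow> X s w < y"
    have "of_bool (y < X s w) * a s w = 0" if "0 \<le> s" "s \<le> t" for s
      using * that by (simp add: not_less less_imp_le)
    then have "I y t w = 0" using elim(1) t by blast
    moreover have "(LINT s:{0..t}|lborel. of_bool (y < X s w) * b s w) = 0"
      unfolding set_lebesgue_integral_def using *
      by (intro integral_eq_zero_AE AE_I2) (auto simp: indicator_def dest: less_asym)
    moreover have "X 0 w < y" "X t w < y" using * t by auto
    ultimately show "lt y t w = 0" using X_0[OF elim(2)] by (simp add: tanaka_def)
  qed
qed

text \<open>The gate is open throughout, so gated and full noise differ by an integrand that
  vanishes, and Tanaka's formula reduces to the equation for X. In \<open>lt_below\<close> the gate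
  is closed and every term vanishes.\<close>

lemma lt_above:
  assumes "y \<in> Ys"
  shows "AE w in M. \<forall>t\<ge>0. (\<forall>s. 0 \<le> s \<and> s \<le> t \<longrightarrow> y < X s w) \<longrightarrow> lt y t w = 0"
  using ito_vanish[OF ito_diff[OF ito_I[OF assms] ito_N]] AE_space
proof eventually_elim
  case (elim w)
  show ?case
  proof (intro allI impI)
    fix t :: real assume t: "0 \<le> t" and *: "\<forall>s. 0 \<le> s \<and> s \<le> t \<longrightarrow> y < X s w"
    have "I y t w - N t w = 0" using elim(1) t * by auto
    moreover have "(LINT s:{0..t}|lborel. of_bool (y < X s w) * b s w) = (LINT s:{0..t}|lborel. b s w)"
      unfolding set_lebesgue_integral_def using *
      by (intro Bochner_Integration.integral_cong) (auto simp: indicator_def)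
    moreover have "y < X 0 w" "y < X t w" using * t by auto
    ultimately show "lt y t w = 0" using X_0[OF elim(2)] X_eq[OF elim(2) t] by (simp add: tanaka_def)
  qed
qed

lemma gated_prog: "prog (\<lambda>s w. of_bool (y < X s w) * b s w)"
  using prog_mult[OF prog_compose[OF X_prog, of "\<lambda>x. of_bool (y < x)"] b_prog] by simp

lemma b_set_integrable: "w \<in> space M \<Longrightarrow> 0 \<le> t \<Longrightarrow> set_integrable lborel {0..t} (\<lambda>s. b s w)"
  unfolding set_integrable_def
proof (rule integrableI_bounded)
  assume wM: "w \<in> space M" and t: "0 \<le> t"
  note [measurable] = prog_section[OF b_prog wM]
  show "(\<lambda>s. indicator {0..t} s *\<^sub>R b s w) \<in> borel_measurable lborel" by measurable
  have "(\<integral>\<^sup>+s. ennreal (norm (indicator {0..t} s *\<^sub>R b s w)) \<partial>lborel) = (\<integral>\<^sup>+s\<in>{0..t}. ennreal \<bar>b s w\<bar> \<partial>lborel)"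
    by (rule nn_integral_cong) (auto simp: indicator_def)
  then show "(\<integral>\<^sup>+s. ennreal (norm (indicator {0..t} s *\<^sub>R b s w)) \<partial>lborel) < \<infinity>" using b_int[OF wM t] by simp
qed

lemma lt_adapted:
  assumes "y \<in> Ys" "0 \<le> t"
  shows "lt y t \<in> borel_measurable (G t)"
proof -
  note [measurable] = prog_adapted[OF X_prog assms(2)] prog_lebesgue_integral[OF gated_prog assms(2), of y] itoD(2)[OF ito_I[OF assms(1)] assms(2)]
  show ?thesis unfolding tanaka_def[abs_def] by measurable
qed

text \<open>Serves to carry a bound from rational times before a stopping time over to the stopping
  time itself.\<close>

lemma lt_left_limit:
  assumes y: "y \<in> Ys" and wM: "w \<in> space M" and u: "u \<longlonglongrightarrow> t" "\<And>k. 0 \<le> u k" "\<And>k. u k \<le> t"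
  shows "(\<lambda>k. lt y (u k) w) \<longlonglongrightarrow> lt y t w"
proof -
  have t: "0 \<le> t" using u(2,3)[of 0] by linarith
  note [measurable] = prog_section[OF gated_prog wM, of y]
  have bi: "integrable lborel (\<lambda>s. indicator {0..t} s *\<^sub>R b s w)"
    using b_set_integrable[OF wM t] by (simp add: set_integrable_def)
  have "(\<lambda>k. LINT s:{0..u k}|lborel. of_bool (y < X s w) * b s w) \<longlonglongrightarrow> (LINT s:{0..t}|lborel. of_bool (y < X s w) * b s w)"
    unfolding set_lebesgue_integral_def
  proof (rule integral_dominated_convergence[where w = "\<lambda>s. \<bar>indicator {0..t} s *\<^sub>R b s w\<bar>"])
    show "integrable lborel (\<lambda>s. \<bar>indicator {0..t} s *\<^sub>R b s w\<bar>)" using bi by (rule integrable_abs)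
    show "AE s in lborel. (\<lambda>k. indicator {0..u k} s *\<^sub>R (of_bool (y < X s w) * b s w)) \<longlonglongrightarrow> indicator {0..t} s *\<^sub>R (of_bool (y < X s w) * b s w)"
      using AE_lborel_singleton[of t]
    proof eventually_elim
      case (elim s)
      have "\<forall>\<^sub>F k in sequentially. indicator {0..u k} s = (indicator {0..t} s :: real)"
      proof (cases "s < t")
        case True
        from order_tendstoD(1)[OF u(1) this] show ?thesis
          by eventually_elim (use True in \<open>auto simp: indicator_def\<close>)
      next
        case False
        then have "indicator {0..u k} s = (indicator {0..t} s :: real)" for k
          using elim u(3)[of k] by (auto simp: indicator_def)
        then show ?thesis by simp
      qed
      then have "(\<lambda>k. indicator {0..u k} s :: real) \<longlonglongrightarrow> indicator {0..t} s" by (rule tendsto_eventually)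
      then show ?case by (intro tendsto_scaleR tendsto_const)
    qed
    show "AE s in lborel. norm (indicator {0..u k} s *\<^sub>R (of_bool (y < X s w) * b s w)) \<le> \<bar>indicator {0..t} s *\<^sub>R b s w\<bar>" for k
      using u(3)[of k] by (intro AE_I2) (auto simp: indicator_def)
  qed measurable
  moreover have "(\<lambda>k. X (u k) w) \<longlonglongrightarrow> X t w"
    by (rule continuous_on_tendsto_compose[OF X_cont[OF wM] u(1)]) (use t u in auto)
  moreover have "(\<lambda>k. I y (u k) w) \<longlonglongrightarrow> I y t w"
    by (rule continuous_on_tendsto_compose[OF itoD(3)[OF ito_I[OF y] wM] u(1)]) (use t u in auto)
  ultimately show ?thesis unfolding tanaka_def by (intro tendsto_intros)
qed

end

locale stopped_tanaka = tanaka_diffusion +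
  fixes q K :: real and T :: "'a \<Rightarrow> real"
  assumes T_opt: "opt T" and T_le: "w \<in> space M \<Longrightarrow> T w \<le> q" and q_pos: "0 < q" and K_nonneg: "0 \<le> K"
    and ab_bound: "w \<in> space M \<Longrightarrow> (\<integral>\<^sup>+s\<in>{0..T w}. ennreal (\<bar>b s w\<bar> + (a s w)\<^sup>2) \<partial>lborel) \<le> ennreal K"

sublocale stopped_tanaka \<subseteq> stopped_diffusion
proof unfold_locales
  fix w assume wM: "w \<in> space M"
  show "(\<integral>\<^sup>+s\<in>{0..T w}. ennreal \<bar>b s w\<bar> \<partial>lborel) \<le> ennreal K" "(\<integral>\<^sup>+s\<in>{0..T w}. ennreal ((a s w)\<^sup>2) \<partial>lborel) \<le> ennreal K"
    by (rule order_trans[OF nn_integral_mono ab_bound[OF wM]]; auto simp: indicator_def intro!: ennreal_leI)+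
qed (fact X_prog X_cont X_range X_0 b_prog ito_N X_eq T_opt T_le q_pos K_nonneg)+

context stopped_tanaka begin

lemma gated_bs_integrable: "integrable PP (\<lambda>z. of_bool (y < X (fst z) (snd z)) * bs z)"
  by (rule weighted_integrable[OF PP_integrable(1), of _ 1]) auto

lemma gated_path:
  assumes wM: "w \<in> space M"
  shows "(LINT s:{0..T w}|lborel. of_bool (y < X s w) * b s w) = (\<integral>s. of_bool (y < X s w) * bs (s, w) \<partial>lborel)"
  unfolding set_lebesgue_integral_def
proof (rule integral_cong_AE)
  note [measurable] = prog_section[OF gated_prog wM, of y] prog_section[OF X_prog wM]
  show "(\<lambda>s. indicat_real {0..T w} s *\<^sub>R (of_bool (y < X s w) * b s w)) \<in> borel_measurable lborel" by measurable
  note [measurable] = borel_measurable_integrable[OF path_bound(1)[OF wM]]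
  show "(\<lambda>s. of_bool (y < X s w) * bs (s, w)) \<in> borel_measurable lborel" by measurable
  show "AE s in lborel. indicat_real {0..T w} s *\<^sub>R (of_bool (y < X s w) * b s w) = of_bool (y < X s w) * bs (s, w)"
    using AE_lborel_singleton[of 0] by eventually_elim (auto simp: bs_def indicator_def)
qed

lemma lt_at_T:
  "w \<in> space M \<Longrightarrow> lt y (T w) w = 2 * (max 0 (XT w - y) - max 0 (x\<^sub>0 - y) - (\<integral>s. of_bool (y < X s w) * bs (s, w) \<partial>lborel) - I y (T w) w)"
  by (simp add: tanaka_def gated_path XT_def)

lemma bound_of_le:
  assumes "prog h" "\<And>s w. w \<in> space M \<Longrightarrow> \<bar>h s w\<bar> \<le> \<bar>a s w\<bar>"
  shows "AE w in M. (\<integral>\<^sup>+s\<in>{0..T w}. ennreal ((h s w)\<^sup>2) \<partial>lborel) \<le> ennreal K"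
proof (rule AE_I2)
  fix w assume wM: "w \<in> space M"
  show "(\<integral>\<^sup>+s\<in>{0..T w}. ennreal ((h s w)\<^sup>2) \<partial>lborel) \<le> ennreal K"
  proof (rule order_trans[OF nn_integral_mono a_bound[OF wM]])
    fix s
    have "(h s w)\<^sup>2 \<le> (a s w)\<^sup>2" using assms(2)[OF wM] by (simp add: abs_le_square_iff[symmetric])
    then show "ennreal ((h s w)\<^sup>2) * indicator {0..T w} s \<le> ennreal ((a s w)\<^sup>2) * indicator {0..T w} s"
      by (auto simp: indicator_def intro!: ennreal_leI)
  qed
qed

text \<open>The stopped integral over (0, q] is the value at T, because T \<le> q and the integral
  starts at 0 almost surely.\<close>

lemma ito_at_T:
  assumes ito: "ito h J" and le: "\<And>s w. w \<in> space M \<Longrightarrow> \<bar>h s w\<bar> \<le> \<bar>a s w\<bar>"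
  shows "(\<lambda>w. J (T w) w) \<in> borel_measurable M" "integrable M (\<lambda>w. (J (T w) w)\<^sup>2)" "(\<integral>w. J (T w) w \<partial>M) = 0"
    "(\<integral>w. (J (T w) w)\<^sup>2 \<partial>M) = (\<integral>z. (indicator {0<..q} (fst z) * (h (fst z) (snd z) * of_bool (fst z \<le> T (snd z))))\<^sup>2 \<partial>PP)"
proof -
  have q: "0 \<le> q" using q_pos by simp
  note S = ito_stopped[OF ito T_opt T_le q K_nonneg bound_of_le[OF itoD(1)[OF ito] le] order_refl q, of "\<lambda>_. 1" 1]
  have e: "w \<in> space M \<Longrightarrow> J (min q (T w)) w = J (T w) w" "w \<in> space M \<Longrightarrow> min 0 (T w) = 0" for w
    using T_le T_nonneg by (simp_all add: min_absorb1 min_absorb2)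
  show m: "(\<lambda>w. J (T w) w) \<in> borel_measurable M"
    using meas_GM[OF q stopped_adapted[of J, OF itoD(2,3)[OF ito] T_opt q]]
    by (rule measurable_cong[THEN iffD1, rotated]) (assumption | rule e(1))+
  have J0[measurable]: "J 0 \<in> borel_measurable M" using meas_GM[OF order_refl itoD(2)[OF ito order_refl]] .
  have ae: "AE w in M. J (min q (T w)) w - J (min 0 (T w)) w = J (T w) w"
    using ito_zero[OF ito] AE_space by eventually_elim (simp add: e)
  have m': "(\<lambda>w. J (min q (T w)) w - J (min 0 (T w)) w) \<in> borel_measurable M"
    by (rule measurable_cong[THEN iffD1, of _ "\<lambda>w. J (T w) w - J 0 w"]) (use m in \<open>auto simp: e\<close>)
  have ae2: "AE w in M. (J (min q (T w)) w - J (min 0 (T w)) w)\<^sup>2 = (J (T w) w)\<^sup>2"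
    using ae by eventually_elim simp
  show "integrable M (\<lambda>w. (J (T w) w)\<^sup>2)"
    using S(1) m m' by (subst integrable_cong_AE[OF _ _ ae2, symmetric]) auto
  show "(\<integral>w. J (T w) w \<partial>M) = 0"
    using S(2) integral_cong_AE[OF m' m ae] by simp
  show "(\<integral>w. (J (T w) w)\<^sup>2 \<partial>M) = (\<integral>z. (indicator {0<..q} (fst z) * (h (fst z) (snd z) * of_bool (fst z \<le> T (snd z))))\<^sup>2 \<partial>PP)"
    using S(4) integral_cong_AE[OF _ _ ae2] m m' by simp
qed

text \<open>Bounded energy makes the stochastic integral at T centred, so the expectation of
  Tanaka's formula is the expression that defines \<open>dens\<close>.\<close>

lemma lt_mean:
  assumes y: "y \<in> Ys"
  shows "integrable M (\<lambda>w. lt y (T w) w)" "(\<integral>w. lt y (T w) w \<partial>M) = dens y"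
proof -
  have le: "\<bar>of_bool (y < X s w) * a s w\<bar> \<le> \<bar>a s w\<bar>" for s w by simp
  note J = ito_at_T[OF ito_I[OF y] le]
  have i1: "integrable M (\<lambda>w. I y (T w) w)" by (rule integrable_of_square[OF J(1,2)])
  have i2: "integrable M (\<lambda>w. max 0 (XT w - y))"
  proof (rule bounded_integrable[of _ "\<bar>d\<bar> + \<bar>y\<bar>"])
    show "\<bar>max 0 (XT w - y)\<bar> \<le> \<bar>d\<bar> + \<bar>y\<bar>" if "w \<in> space M" for w using XT_range[OF that] by linarith
  qed simp
  have i3': "integrable PP (\<lambda>(s, w). of_bool (y < X s w) * bs (s, w))"
    using gated_bs_integrable[of y] by (simp add: case_prod_beta')
  note i3 = P.integrable_snd[OF i3']
  have e3: "(\<integral>w. (\<integral>s. of_bool (y < X s w) * bs (s, w) \<partial>lborel) \<partial>M) = (\<integral>z. of_bool (y < X (fst z) (snd z)) * bs z \<partial>PP)"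
    using P.integral_snd[OF i3'] by (simp add: case_prod_beta')
  let ?R = "\<lambda>w. 2 * (max 0 (XT w - y) - max 0 (x\<^sub>0 - y) - (\<integral>s. of_bool (y < X s w) * bs (s, w) \<partial>lborel) - I y (T w) w)"
  have iR: "integrable M ?R" using i1 i2 i3 by simp
  show "integrable M (\<lambda>w. lt y (T w) w)"
    by (rule Bochner_Integration.integrable_cong[THEN iffD2, OF refl _ iR]) (rule lt_at_T)
  have "(\<integral>w. lt y (T w) w \<partial>M) = (\<integral>w. ?R w \<partial>M)"
    by (rule Bochner_Integration.integral_cong[OF refl]) (rule lt_at_T)
  also have "\<dots> = dens y" unfolding dens_def using i1 i2 i3 e3 J(3) by (simp add: prob_space)
  finally show "(\<integral>w. lt y (T w) w \<partial>M) = dens y" .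
qed

lemma dens_nonneg: "y \<in> Ys \<Longrightarrow> 0 \<le> dens y"
proof -
  assume y: "y \<in> Ys"
  have "AE w in M. 0 \<le> lt y (T w) w"
    using tanaka_mono[OF y] AE_space by eventually_elim (use T_nonneg in auto)
  from integral_nonneg_AE[OF this] show "0 \<le> dens y" using lt_mean(2)[OF y] by simp
qed

lemma occ:
  assumes "\<phi> \<in> borel_measurable borel"
  shows "(\<integral>\<^sup>+z. \<phi> (X (fst z) (snd z)) * ennreal (as2 z) \<partial>PP) = (\<integral>\<^sup>+y. \<phi> y * ennreal (indicator {c..d} y * dens y) \<partial>lborel)"
  by (rule occupation[OF dens_nonneg assms]) (use Ys in auto)

text \<open>Lebesgue measure has no atoms, hence the occupation measure has none. Where the noise
  energy vanishes, the drift vanishes with it by \<open>b_eq\<close>.\<close>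

lemma no_time_at_point:
  "AE w in M. AE s in lborel. X s w = x \<longrightarrow> bs (s, w) = 0"
  "AE z in PP. X (fst z) (snd z) = x \<longrightarrow> as2 z = 0"
proof -
  have "(\<integral>\<^sup>+z. indicator {x} (X (fst z) (snd z)) * ennreal (as2 z) \<partial>PP) = (\<integral>\<^sup>+y. indicator {x} y * ennreal (indicator {c..d} y * dens y) \<partial>lborel)"
    by (rule occ) simp
  also have "\<dots> = (\<integral>\<^sup>+y. 0 \<partial>(lborel :: real measure))"
    by (rule nn_integral_cong_AE, rule AE_mp[OF AE_lborel_singleton[of x]]) auto
  finally have z: "(\<integral>\<^sup>+z. indicator {x} (X (fst z) (snd z)) * ennreal (as2 z) \<partial>PP) = 0" by simp
  then have "AE z in PP. indicator {x} (X (fst z) (snd z)) * ennreal (as2 z) = 0"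
    by (subst (asm) nn_integral_0_iff_AE) simp_all
  then show "AE z in PP. X (fst z) (snd z) = x \<longrightarrow> as2 z = 0"
    by eventually_elim (use as2_nonneg in \<open>auto simp: indicator_def ennreal_eq_0_iff dual_order.antisym\<close>)
  have m: "(\<lambda>z. indicator {x} (X (fst z) (snd z)) * ennreal (as2 z)) \<in> borel_measurable PP" by measurable
  have "(\<integral>\<^sup>+w. (\<integral>\<^sup>+s. indicator {x} (X s w) * ennreal (as2 (s, w)) \<partial>lborel) \<partial>M) = 0"
    using P.nn_integral_snd[OF m] z by simp
  moreover have "(\<lambda>w. \<integral>\<^sup>+s. indicator {x} (X s w) * ennreal (as2 (s, w)) \<partial>lborel) \<in> borel_measurable M"
    using lborel.borel_measurable_nn_integral_fst[OF measurable_compose[OF measurable_pair_swap' m]] by simp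
  ultimately have "AE w in M. (\<integral>\<^sup>+s. indicator {x} (X s w) * ennreal (as2 (s, w)) \<partial>lborel) = 0"
    by (subst (asm) nn_integral_0_iff_AE)
  then show "AE w in M. AE s in lborel. X s w = x \<longrightarrow> bs (s, w) = 0"
    using AE_space
  proof eventually_elim
    case (elim w)
    note [measurable] = prog_section[OF X_prog elim(2)] borel_measurable_integrable[OF path_bound(3)[OF elim(2)]]
    have "AE s in lborel. indicator {x} (X s w) * ennreal (as2 (s, w)) = 0"
      using elim(1) by (subst (asm) nn_integral_0_iff_AE) simp_all
    then show ?case
    proof eventually_elim
      case (elim s)
      show ?case
      proof
        assume "X s w = x"
        then have "as2 (s, w) = 0" using elim as2_nonneg[of "(s, w)"] by (simp add: ennreal_eq_0_iff)
        then show "bs (s, w) = 0"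
          using b_eq[OF \<open>w \<in> space M\<close>, of s] by (auto simp: as2_def bs_def)
      qed
    qed
  qed
qed

text \<open>The gated integrands at y n and x differ only while y n < X \<le> x. By the isometry the
  squared distance of the integrals is the occupation of (y n, x], which tends to that of {x}, and
  this is 0. Convergence of the local times on the path is a hypothesis, so only the limit has to be
  identified.\<close>

lemma lt_left_continuous:
  assumes x: "x \<in> Ys" and y: "\<And>n. y n \<in> Ys" "\<And>n. y n < x" "y \<longlonglongrightarrow> x"
  shows "AE w in M. \<forall>l. (\<lambda>n. lt (y n) (T w) w) \<longlonglongrightarrow> l \<longrightarrow> l = lt x (T w) w"
proof -
  define \<Delta> where "\<Delta> n w = I (y n) (T w) w - I x (T w) w" for n w
  have le: "\<bar>of_bool (y n < X s w) * a s w - of_bool (x < X s w) * a s w\<bar> \<le> \<bar>a s w\<bar>" for n s w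
    using y(2)[of n] by auto
  note J = ito_at_T[OF ito_diff[OF ito_I[OF y(1)] ito_I[OF x]] le]
  have \<Delta>m[measurable]: "\<Delta> n \<in> borel_measurable M" for n unfolding \<Delta>_def by (rule J(1))
  have \<Delta>sq: "(\<integral>\<^sup>+w. ennreal ((\<Delta> n w)\<^sup>2) \<partial>M) = ennreal (\<integral>z. of_bool (y n < X (fst z) (snd z) \<and> X (fst z) (snd z) \<le> x) * as2 z \<partial>PP)" for n
  proof -
    have "(\<integral>\<^sup>+w. ennreal ((\<Delta> n w)\<^sup>2) \<partial>M) = ennreal (\<integral>w. (\<Delta> n w)\<^sup>2 \<partial>M)"
      unfolding \<Delta>_def by (rule nn_integral_eq_integral[OF J(2)]) simp
    also have "(\<integral>w. (\<Delta> n w)\<^sup>2 \<partial>M) = (\<integral>z. of_bool (y n < X (fst z) (snd z) \<and> X (fst z) (snd z) \<le> x) * as2 z \<partial>PP)"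
      unfolding \<Delta>_def J(4)
    proof (rule Bochner_Integration.integral_cong[OF refl])
      fix z :: "real \<times> 'a" assume "z \<in> space PP"
      then have "T (snd z) \<le> q" by (intro T_le) (auto simp: space_pair_measure)
      then show "(indicator {0<..q} (fst z) * ((of_bool (y n < X (fst z) (snd z)) * a (fst z) (snd z) - of_bool (x < X (fst z) (snd z)) * a (fst z) (snd z)) * of_bool (fst z \<le> T (snd z))))\<^sup>2
        = of_bool (y n < X (fst z) (snd z) \<and> X (fst z) (snd z) \<le> x) * as2 z"
        using y(2)[of n] by (auto simp: as2_def indicator_def)
    qed
    finally show ?thesis .
  qed
  have ob: "(\<lambda>n. of_bool (y n < v \<and> v \<le> x) :: real) \<longlonglongrightarrow> of_bool (v = x)" for v
  proof -
    have "\<forall>\<^sub>F n in sequentially. of_bool (y n < v \<and> v \<le> x) = (of_bool (v = x) :: real)"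
    proof (cases "v < x")
      case True
      from order_tendstoD(1)[OF y(3) this] show ?thesis by eventually_elim (use True in auto)
    next
      case False
      then show ?thesis using y(2) by (auto intro!: always_eventually)
    qed
    then show ?thesis by (rule tendsto_eventually)
  qed
  have "(\<lambda>n. \<integral>z. of_bool (y n < X (fst z) (snd z) \<and> X (fst z) (snd z) \<le> x) * as2 z \<partial>PP) \<longlonglongrightarrow> (\<integral>z. of_bool (X (fst z) (snd z) = x) * as2 z \<partial>PP)"
  proof (rule integral_dominated_convergence[where w = as2])
    show "AE z in PP. (\<lambda>n. of_bool (y n < X (fst z) (snd z) \<and> X (fst z) (snd z) \<le> x) * as2 z) \<longlonglongrightarrow> of_bool (X (fst z) (snd z) = x) * as2 z"
      by (intro AE_I2 tendsto_mult tendsto_const ob)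
    show "AE z in PP. norm (of_bool (y n < X (fst z) (snd z) \<and> X (fst z) (snd z) \<le> x) * as2 z) \<le> as2 z" for n
      using as2_nonneg by (intro AE_I2) auto
  qed (use PP_integrable(2) in measurable)
  moreover have "(\<integral>z. of_bool (X (fst z) (snd z) = x) * as2 z \<partial>PP) = 0"
    by (rule integral_eq_zero_AE, rule AE_mp[OF no_time_at_point(2)[of x]]) auto
  ultimately have \<Delta>lim: "(\<lambda>n. \<integral>\<^sup>+w. ennreal ((\<Delta> n w)\<^sup>2) \<partial>M) \<longlonglongrightarrow> 0"
    unfolding \<Delta>sq using tendsto_ennrealI by fastforce
  have "(\<integral>\<^sup>+w. liminf (\<lambda>n. ennreal ((\<Delta> n w)\<^sup>2)) \<partial>M) \<le> liminf (\<lambda>n. \<integral>\<^sup>+w. ennreal ((\<Delta> n w)\<^sup>2) \<partial>M)"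
    by (rule nn_integral_liminf) simp
  also have "\<dots> = 0" using \<Delta>lim by (intro lim_imp_Liminf) auto
  \<comment> \<open>Fatou's lemma yields a vanishing lower limit only. On a path on which
    \<open>lt (y n)\<close> converges, \<Delta> converges too, and its limit must then be 0.\<close>
  finally have "AE w in M. liminf (\<lambda>n. ennreal ((\<Delta> n w)\<^sup>2)) = 0"
    by (subst nn_integral_0_iff_AE[symmetric]) auto
  then show ?thesis
    using no_time_at_point(1)[of x] AE_space
  proof eventually_elim
    case (elim w)
    note [measurable] = prog_section[OF X_prog elim(3)] borel_measurable_integrable[OF path_bound(1)[OF elim(3)]]
    let ?\<beta> = "\<lambda>v. \<integral>s. of_bool (v < X s w) * bs (s, w) \<partial>lborel"
    have gi: "integrable lborel (\<lambda>s. of_bool (v < X s w) * bs (s, w))" for v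
      by (rule integrable_mult_bounded[OF path_bound(1)[OF elim(3)], of _ 1]) auto
    have "(\<lambda>n. \<integral>s. of_bool (y n < X s w \<and> X s w \<le> x) * bs (s, w) \<partial>lborel) \<longlonglongrightarrow> (\<integral>s. of_bool (X s w = x) * bs (s, w) \<partial>lborel)"
    proof (rule integral_dominated_convergence[where w = "\<lambda>s. \<bar>bs (s, w)\<bar>"])
      show "AE s in lborel. (\<lambda>n. of_bool (y n < X s w \<and> X s w \<le> x) * bs (s, w)) \<longlonglongrightarrow> of_bool (X s w = x) * bs (s, w)"
        by (intro AE_I2 tendsto_mult tendsto_const ob)
      show "AE s in lborel. norm (of_bool (y n < X s w \<and> X s w \<le> x) * bs (s, w)) \<le> \<bar>bs (s, w)\<bar>" for n
        by (intro AE_I2) auto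
      show "integrable lborel (\<lambda>s. \<bar>bs (s, w)\<bar>)" using path_bound(1)[OF elim(3)] by simp
    qed measurable
    moreover have "(\<integral>s. of_bool (X s w = x) * bs (s, w) \<partial>lborel) = 0"
      by (rule integral_eq_zero_AE, rule AE_mp[OF elim(2)]) auto
    moreover have "(\<integral>s. of_bool (y n < X s w \<and> X s w \<le> x) * bs (s, w) \<partial>lborel) = ?\<beta> (y n) - ?\<beta> x" for n
      using y(2)[of n] by (subst Bochner_Integration.integral_diff[OF gi gi, symmetric])
        (auto intro!: Bochner_Integration.integral_cong)
    \<comment> \<open>The drift part converges on each path by domination, since no drift is spent
      at X = x.\<close>
    ultimately have \<beta>: "(\<lambda>n. ?\<beta> (y n) - ?\<beta> x) \<longlonglongrightarrow> 0" by simp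
    show ?case
    proof (intro allI impI)
      fix l assume l: "(\<lambda>n. lt (y n) (T w) w) \<longlonglongrightarrow> l"
      have \<Delta>eq: "\<Delta> n w = (max 0 (XT w - y n) - max 0 (XT w - x)) - (max 0 (x\<^sub>0 - y n) - max 0 (x\<^sub>0 - x))
          - (?\<beta> (y n) - ?\<beta> x) - (lt (y n) (T w) w - lt x (T w) w) / 2" for n
        unfolding lt_at_T[OF elim(3)] \<Delta>_def by (simp add: field_simps)
      have "(\<lambda>n. \<Delta> n w) \<longlonglongrightarrow> (max 0 (XT w - x) - max 0 (XT w - x)) - (max 0 (x\<^sub>0 - x) - max 0 (x\<^sub>0 - x)) - 0 - (l - lt x (T w) w) / 2"
        unfolding \<Delta>eq by (intro tendsto_intros y(3) \<beta> l) simp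
      then have "(\<lambda>n. \<Delta> n w) \<longlonglongrightarrow> (lt x (T w) w - l) / 2" by (simp add: minus_divide_left)
      then have "(\<lambda>n. ennreal ((\<Delta> n w)\<^sup>2)) \<longlonglongrightarrow> ennreal (((lt x (T w) w - l) / 2)\<^sup>2)"
        by (intro tendsto_ennrealI tendsto_power)
      from lim_imp_Liminf[OF _ this] elim(1) have "ennreal (((lt x (T w) w - l) / 2)\<^sup>2) = 0" by simp
      then show "l = lt x (T w) w" by (simp add: ennreal_eq_0_iff)
    qed
  qed
qed

end

section \<open>Positivity of the local time at a visited point\<close>

text \<open>A crude bound whose purpose is a finite supremum in the Gronwall argument of
  \<open>no_delay\<close>.\<close>

lemma (in stopped_tanaka) dens_bound:
  assumes "c \<le> y" "y \<le> d"
  shows "dens y \<le> 2 * (d - c + K)"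
proof -
  have "(\<integral>w. max 0 (XT w - y) \<partial>M) \<le> (\<integral>w. d - c \<partial>M)"
  proof (rule integral_mono)
    show "integrable M (\<lambda>w. max 0 (XT w - y))"
    proof (rule bounded_integrable[of _ "d - c"])
      show "\<bar>max 0 (XT w - y)\<bar> \<le> d - c" if "w \<in> space M" for w using XT_range[OF that] assms by linarith
    qed simp
    show "max 0 (XT w - y) \<le> d - c" if "w \<in> space M" for w using XT_range[OF that] assms by linarith
  qed simp
  moreover have "\<bar>\<integral>z. of_bool (y < X (fst z) (snd z)) * bs z \<partial>PP\<bar> \<le> (\<integral>z. \<bar>bs z\<bar> \<partial>PP)"
    by (rule order_trans[OF integral_abs_bound integral_mono])
      (use gated_bs_integrable[of y] PP_integrable(1) in auto)
  moreover have "(\<integral>w. d - c \<partial>M) = d - c" by (simp add: prob_space)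
  moreover have "0 \<le> max 0 (x\<^sub>0 - y)" by simp
  ultimately show ?thesis
    unfolding dens_def using PP_integrable(4) by argo
qed

definition first_hit :: "(real \<Rightarrow> 'a \<Rightarrow> real) \<Rightarrow> real \<Rightarrow> real \<Rightarrow> 'a \<Rightarrow> real" where
  "first_hit X q x w = Inf (insert q {s. 0 \<le> s \<and> X s w = x})"

lemma first_hit_bdd: "0 \<le> q \<Longrightarrow> bdd_below (insert q {s. 0 \<le> s \<and> X s w = x})"
  by (intro bdd_belowI[of _ 0]) auto

lemma first_hit_le: "0 \<le> q \<Longrightarrow> first_hit X q x w \<le> q" "0 \<le> q \<Longrightarrow> 0 \<le> s \<Longrightarrow> X s w = x \<Longrightarrow> first_hit X q x w \<le> s"
  unfolding first_hit_def using first_hit_bdd[of q X w x] by (auto intro: cInf_lower)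

lemma first_hit_attained:
  assumes "continuous_on {0..} (\<lambda>t. X t w)" "0 \<le> q" "first_hit X q x w < q"
  shows "X (first_hit X q x w) w = x" "0 \<le> first_hit X q x w"
proof -
  have "closed ({0..} \<inter> (\<lambda>s. X s w) -` {x})"
    by (rule continuous_closed_preimage[OF assms(1)]) auto
  moreover have "{0..} \<inter> (\<lambda>s. X s w) -` {x} = {s. 0 \<le> s \<and> X s w = x}" by auto
  ultimately have "closed (insert q {s. 0 \<le> s \<and> X s w = x})" by (intro closed_insert) simp
  then have "first_hit X q x w \<in> insert q {s. 0 \<le> s \<and> X s w = x}"
    unfolding first_hit_def by (intro closed_contains_Inf first_hit_bdd[OF assms(2)]) auto
  then show "X (first_hit X q x w) w = x" "0 \<le> first_hit X q x w" using assms(3) by auto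
qed

text \<open>For t \<le> q, the point x is hit before t exactly when some [0, r] with rational r < t
  contains rational times at which X comes arbitrarily close to x. Continuity gives one direction;
  in the other, \<bar>X - x\<bar> attains its minimum on the compact [0, r]. Only countably many
  events before t are involved.\<close>

lemma (in bm_filtration) first_hit_opt:
  assumes X_prog: "prog X" and X_cont: "\<And>w. w \<in> space M \<Longrightarrow> continuous_on {0..} (\<lambda>t. X t w)" and q: "0 \<le> q"
  shows "opt (first_hit X q x)"
  unfolding opt_def
proof (intro conjI ballI allI impI)
  show "0 \<le> first_hit X q x w" for w
    unfolding first_hit_def using q by (intro cInf_greatest) auto
next
  fix t :: real assume t: "0 \<le> t"
  have iff: "first_hit X q x w < t \<longleftrightarrow> q < t \<or> (\<exists>r\<in>\<rat> \<inter> {0..<t}. \<forall>n::nat. \<exists>u\<in>\<rat> \<inter> {0..r}. \<bar>X u w - x\<bar> < 1 / real (Suc n))"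
    (is "_ \<longleftrightarrow> _ \<or> ?R") if wM: "w \<in> space M" for w
  proof -
    have "first_hit X q x w < t \<longleftrightarrow> q < t \<or> (\<exists>s. 0 \<le> s \<and> s < t \<and> X s w = x)"
      unfolding first_hit_def by (subst cInf_less_iff[OF _ first_hit_bdd[OF q]]) auto
    moreover have "(\<exists>s. 0 \<le> s \<and> s < t \<and> X s w = x) \<longleftrightarrow> ?R"
    proof
      assume "\<exists>s. 0 \<le> s \<and> s < t \<and> X s w = x"
      then obtain s where s: "0 \<le> s" "s < t" "X s w = x" by blast
      obtain r where r: "r \<in> \<rat>" "s < r" "r < t" using Rats_dense_in_real[OF s(2)] by blast
      have "\<exists>u\<in>\<rat> \<inter> {0..r}. \<bar>X u w - x\<bar> < 1 / real (Suc n)" for n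
      proof -
        have "0 < 1 / real (Suc n)" by simp
        then obtain \<delta> where \<delta>: "0 < \<delta>" "\<And>u. u \<in> {0..} \<Longrightarrow> dist u s < \<delta> \<Longrightarrow> dist (X u w) (X s w) < 1 / real (Suc n)"
          using X_cont[OF wM] s(1) unfolding continuous_on_iff by (metis atLeast_iff)
        have "s < min r (s + \<delta>)" using r \<delta> by simp
        then obtain u where u: "u \<in> \<rat>" "s < u" "u < min r (s + \<delta>)" using Rats_dense_in_real by blast
        then have "\<bar>X u w - x\<bar> < 1 / real (Suc n)" using \<delta>(2)[of u] s by (simp add: dist_real_def)
        then show ?thesis using u s by (intro bexI[of _ u]) auto
      qed
      then show ?R using r s by (intro bexI[of _ r]) auto
    next
      assume ?R
      then obtain r where r: "0 \<le> r" "r < t" and *: "\<And>n::nat. \<exists>u\<in>\<rat> \<inter> {0..r}. \<bar>X u w - x\<bar> < 1 / real (Suc n)" by auto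
      have "continuous_on {0..r} (\<lambda>u. \<bar>X u w - x\<bar>)"
        by (intro continuous_intros continuous_on_subset[OF X_cont[OF wM]]) auto
      from continuous_attains_inf[OF compact_Icc _ this] r(1)
      obtain s where s: "s \<in> {0..r}" "\<And>u. u \<in> {0..r} \<Longrightarrow> \<bar>X s w - x\<bar> \<le> \<bar>X u w - x\<bar>" by auto
      have "\<bar>X s w - x\<bar> \<le> 0"
      proof (rule ccontr)
        assume "\<not> \<bar>X s w - x\<bar> \<le> 0"
        then have "0 < \<bar>X s w - x\<bar>" by simp
        then obtain n where "1 / real (Suc n) < \<bar>X s w - x\<bar>" by (metis nat_approx_posE)
        then show False using *[of n] s(2) by (meson IntD2 less_asym less_le_trans not_less)
      qed
      then show "\<exists>s. 0 \<le> s \<and> s < t \<and> X s w = x" using s(1) r by (intro exI[of _ s]) auto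
    qed
    ultimately show ?thesis by blast
  qed
  show "{w \<in> space M. first_hit X q x w < t} \<in> sets (G t)"
  proof (cases "q < t")
    case True
    then have "{w \<in> space M. first_hit X q x w < t} = space M" using iff by auto
    then show ?thesis using space_in_G[OF t] by simp
  next
    case False
    have cr: "countable (\<rat> \<inter> A)" for A :: "real set" by (rule countable_subset[OF _ countable_rat]) auto
    have "{w \<in> space M. first_hit X q x w < t}
      = (\<Union>r\<in>\<rat> \<inter> {0..<t}. \<Inter>n::nat. \<Union>u\<in>\<rat> \<inter> {0..r}. {w \<in> space M. \<bar>X u w - x\<bar> < 1 / real (Suc n)})"
    proof -
      have "{w \<in> space M. first_hit X q x w < t}
        = {w \<in> space M. \<exists>r\<in>\<rat> \<inter> {0..<t}. \<forall>n::nat. \<exists>u\<in>\<rat> \<inter> {0..r}. \<bar>X u w - x\<bar> < 1 / real (Suc n)}"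
      proof (rule Collect_cong)
        fix w show "(w \<in> space M \<and> first_hit X q x w < t) = (w \<in> space M \<and> (\<exists>r\<in>\<rat> \<inter> {0..<t}. \<forall>n::nat. \<exists>u\<in>\<rat> \<inter> {0..r}. \<bar>X u w - x\<bar> < 1 / real (Suc n)))"
          using iff[of w] False by (cases "w \<in> space M") (simp_all only: simp_thms)
      qed
      then show ?thesis by (simp only: set_eq_iff UN_iff INT_iff mem_Collect_eq UNIV_I) blast
    qed
    also have "\<dots> \<in> sets (G t)"
    proof (rule sets.countable_UN''[OF cr])
      fix r assume r: "r \<in> \<rat> \<inter> {0..<t}"
      have "(\<Union>u\<in>\<rat> \<inter> {0..r}. {w \<in> space M. \<bar>X u w - x\<bar> < 1 / real (Suc n)}) \<in> sets (G t)" for n :: nat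
      proof (rule sets.countable_UN''[OF cr])
        fix u assume "u \<in> \<rat> \<inter> {0..r}"
        then have u: "0 \<le> u" "u \<le> t" using r by auto
        note [measurable] = meas_mono[OF u prog_adapted[OF X_prog u(1)]]
        have "{w \<in> space (G t). \<bar>X u w - x\<bar> < 1 / real (Suc n)} \<in> sets (G t)" by measurable
        then show "{w \<in> space M. \<bar>X u w - x\<bar> < 1 / real (Suc n)} \<in> sets (G t)" using t by simp
      qed
      then show "(\<Inter>n::nat. \<Union>u\<in>\<rat> \<inter> {0..r}. {w \<in> space M. \<bar>X u w - x\<bar> < 1 / real (Suc n)}) \<in> sets (G t)"
        by (intro sets.countable_INT) auto
    qed
    finally show ?thesis .
  qed
qed

context tanaka_diffusion begin

text \<open>\<psi> is integrable and a point is a null set, so small neighbourhoods carry little of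
  its mass. The value 1/4 together with the factor 2 from Tanaka's formula makes the contraction
  factor 1/2.\<close>

lemma psi_small:
  assumes "c < x" "x < d"
  obtains \<eta> where "0 < \<eta>" "c \<le> x - \<eta>" "x + \<eta> \<le> d" "(\<integral>y. indicator {x - \<eta>..x + \<eta>} y * \<psi> y \<partial>lborel) \<le> 1 / 4"
proof -
  define e where "e = min (x - c) (d - x)"
  have e: "0 < e" "e \<le> x - c" "e \<le> d - x" using assms by (auto simp: e_def)
  define U where "U n = {x - e * (1 / real (Suc n))..x + e * (1 / real (Suc n))}" for n
  have el: "e * (1 / real (Suc n)) \<le> e" "0 < e * (1 / real (Suc n))" for n
    using e(1) by (auto simp: field_simps)
  have Ucd: "U n \<subseteq> {c..d}" for n unfolding U_def using el[of n] e by auto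
  have l0: "(\<lambda>n. e * (1 / real (Suc n))) \<longlonglongrightarrow> 0"
    using tendsto_mult[OF tendsto_const LIMSEQ_inverse_real_of_nat, of e] by (simp add: inverse_eq_divide)
  have "(\<lambda>n. \<integral>y. indicator (U n) y * \<psi> y \<partial>lborel) \<longlonglongrightarrow> (\<integral>y. indicator {x} y * \<psi> y \<partial>lborel)"
  proof (rule integral_dominated_convergence[where w = "\<lambda>y. indicator {c..d} y * \<psi> y"])
    show "AE y in lborel. (\<lambda>n. indicator (U n) y * \<psi> y) \<longlonglongrightarrow> indicator {x} y * \<psi> y"
    proof (intro AE_I2 tendsto_mult tendsto_const)
      fix y
      have "\<forall>\<^sub>F n in sequentially. indicator (U n) y = (indicator {x} y :: real)"
      proof (cases "y = x")
        case True
        then have "indicator (U n) y = (indicator {x} y :: real)" for n using el(2)[of n] by (simp add: U_def less_imp_le)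
        then show ?thesis by simp
      next
        case False
        then have "\<forall>\<^sub>F n in sequentially. e * (1 / real (Suc n)) < \<bar>y - x\<bar>" by (intro order_tendstoD(2)[OF l0]) simp
        then show ?thesis by eventually_elim (use False in \<open>auto simp: U_def indicator_def\<close>)
      qed
      then show "(\<lambda>n. indicator (U n) y :: real) \<longlonglongrightarrow> indicator {x} y" by (rule tendsto_eventually)
    qed
    show "AE y in lborel. norm (indicator (U n) y * \<psi> y) \<le> indicator {c..d} y * \<psi> y" for n
      using Ucd[of n] \<psi>_nonneg by (intro AE_I2) (auto simp: indicator_def)
    show "(\<lambda>y. indicator (U n) y * \<psi> y) \<in> borel_measurable lborel" for n unfolding U_def by measurable
  qed (use \<psi>_integrable in measurable)
  moreover have "(\<integral>y. indicator {x} y * \<psi> y \<partial>lborel) = 0"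
    by (rule integral_eq_zero_AE, rule AE_mp[OF AE_lborel_singleton[of x]]) auto
  ultimately have "\<forall>\<^sub>F n in sequentially. (\<integral>y. indicator (U n) y * \<psi> y \<partial>lborel) < 1 / 4"
    by (intro order_tendstoD(2)) auto
  then obtain n where "(\<integral>y. indicator (U n) y * \<psi> y \<partial>lborel) < 1 / 4" by (auto simp: eventually_sequentially)
  then show thesis using that[of "e * (1 / real (Suc n))"] el[of n] e by (auto simp: U_def)
qed

lemma ab_prog: "prog (\<lambda>s w. \<bar>b s w\<bar> + (a s w)\<^sup>2)"
  by (rule prog_add[OF prog_compose[OF b_prog, of abs] prog_square[OF itoD(1)[OF ito_N]]]) simp

text \<open>A single cut for drift and noise. It makes the expectations finite, and by
  \<open>budget_full\<close> it is inactive on a given path for a suitable integer K.\<close>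

definition budget :: "real \<Rightarrow> real \<Rightarrow> 'a \<Rightarrow> real" where
  "budget q K = hit q (\<lambda>u w. ennreal K < (\<integral>\<^sup>+s\<in>{0..u}. ennreal (\<bar>b s w\<bar> + (a s w)\<^sup>2) \<partial>lborel))"

lemma stopped_tanakaI:
  assumes "opt T" "\<And>w. w \<in> space M \<Longrightarrow> T w \<le> budget q K w" "0 < q" "0 \<le> K"
  shows "stopped_tanaka M G W X N a b c d x\<^sub>0 \<psi> I Ys q K T"
proof (intro stopped_tanaka.intro stopped_tanaka_axioms.intro assms)
  show "tanaka_diffusion M G W X N a b c d x\<^sub>0 \<psi> I Ys" by (rule tanaka_diffusion_axioms)
  fix w assume wM: "w \<in> space M"
  have "budget q K w \<le> q" unfolding budget_def using assms(3) by (intro hit_le) simp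
  then show "T w \<le> q" using assms(2)[OF wM] by simp
  show "(\<integral>\<^sup>+s\<in>{0..T w}. ennreal (\<bar>b s w\<bar> + (a s w)\<^sup>2) \<partial>lborel) \<le> ennreal K"
    using assms(2)[OF wM] unfolding budget_def by (intro hit_integral_bound[OF ab_prog _ wM]) (use assms(3) in auto)
qed

lemma budget_opt: "0 < q \<Longrightarrow> opt (budget q K)"
  unfolding budget_def by (intro opt_hit_integral ab_prog) simp

lemma budget_full:
  assumes "w \<in> space M" "0 < q"
  shows "\<exists>K::nat. budget q (real K) w = q"
proof -
  note [measurable] = prog_section[OF b_prog assms(1)] prog_section[OF itoD(1)[OF ito_N] assms(1)]
  have "(\<integral>\<^sup>+s\<in>{0..q}. ennreal (\<bar>b s w\<bar> + (a s w)\<^sup>2) \<partial>lborel)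
     = (\<integral>\<^sup>+s. ennreal \<bar>b s w\<bar> * indicator {0..q} s + ennreal ((a s w)\<^sup>2) * indicator {0..q} s \<partial>lborel)"
    by (rule nn_integral_cong) (auto simp: indicator_def)
  also have "\<dots> = (\<integral>\<^sup>+s\<in>{0..q}. ennreal \<bar>b s w\<bar> \<partial>lborel) + (\<integral>\<^sup>+s\<in>{0..q}. ennreal ((a s w)\<^sup>2) \<partial>lborel)"
    by (rule nn_integral_add) measurable
  also have "\<dots> < \<infinity>" using a_int[OF assms(1), of q] b_int[OF assms(1), of q] assms(2) by simp
  finally have fin: "(\<integral>\<^sup>+s\<in>{0..q}. ennreal (\<bar>b s w\<bar> + (a s w)\<^sup>2) \<partial>lborel) < \<infinity>" .
  define r where "r = enn2real (\<integral>\<^sup>+s\<in>{0..q}. ennreal (\<bar>b s w\<bar> + (a s w)\<^sup>2) \<partial>lborel)"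
  have r: "(\<integral>\<^sup>+s\<in>{0..q}. ennreal (\<bar>b s w\<bar> + (a s w)\<^sup>2) \<partial>lborel) = ennreal r"
    unfolding r_def using fin by simp
  obtain K :: nat where "r \<le> real K" using real_arch_simple by blast
  then have "(\<integral>\<^sup>+s\<in>{0..q}. ennreal (\<bar>b s w\<bar> + (a s w)\<^sup>2) \<partial>lborel) \<le> ennreal (real K)"
    unfolding r by (rule ennreal_leI)
  then have "budget q (real K) w = q" unfolding budget_def using assms(2) by (intro hit_integral_eq) auto
  then show ?thesis ..
qed

end

section \<open>Gronwall argument at a visited point\<close>

lemma AE_not_in_interval:
  fixes u v :: real
  assumes "AE s in lborel. s \<notin> {u<..<v}"
  shows "v \<le> u"
proof (rule ccontr)
  assume "\<not> v \<le> u"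
  then have uv: "u \<le> v" by simp
  have "{u<..<v} \<in> null_sets lborel" using assms by (subst AE_iff_null_sets) auto
  then have "emeasure lborel {u<..<v} = 0" by (rule null_setsD1)
  then show False using uv \<open>\<not> v \<le> u\<close> by (simp add: ennreal_eq_0_iff)
qed

context tanaka_diffusion begin

text \<open>T2 ends the period in which the local time at x is still zero, and T1 is T2 cut at the
  first visit to x. Both respect the same budget, so the occupation formula holds for each, and the
  difference of the two densities describes the period in between. Comparisons are made between
  expectations; a single path enters only at the end, where the hypothesis that \<open>a\<close> is
  nonzero up to \<sigma> gives the contradiction.\<close>

lemma no_delay:
  assumes x: "c < x" "x < d" and \<sigma>: "opt \<sigma>" "\<And>w. w \<in> space M \<Longrightarrow> \<sigma> w \<le> q" and q: "0 < q"
    and alive: "\<And>w s. w \<in> space M \<Longrightarrow> 0 < s \<Longrightarrow> s \<le> \<sigma> w \<Longrightarrow> a s w \<noteq> 0" and K: "0 \<le> K"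
  shows "AE w in M. min (min (budget q K w) (hit q (\<lambda>u w. 0 < lt x u w) w)) (\<sigma> w) \<le> first_hit X q x w"
proof -
  have q0: "0 \<le> q" using q by simp
  have xY: "x \<in> Ys" using Ys x by auto
  define \<rho> where "\<rho> = hit q (\<lambda>u w. 0 < lt x u w)"
  define T2 where "T2 w = min (min (budget q K w) (\<rho> w)) (\<sigma> w)" for w
  define T1 where "T1 w = min (T2 w) (first_hit X q x w)" for w
  have \<rho>o: "opt \<rho>" unfolding \<rho>_def
  proof (rule opt_hit[OF q0])
    fix u :: real assume u: "0 \<le> u"
    note [measurable] = lt_adapted[OF xY u]
    have "{w \<in> space (G u). 0 < lt x u w} \<in> sets (G u)" by measurable
    then show "{w \<in> space M. 0 < lt x u w} \<in> sets (G u)" using u by simp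
  qed
  have T2o: "opt T2" unfolding T2_def by (intro opt_min budget_opt q \<rho>o \<sigma>)
  have T1o: "opt T1" unfolding T1_def by (intro opt_min T2o first_hit_opt X_prog X_cont q0)
  have T12: "T1 w \<le> T2 w" for w by (simp add: T1_def)
  interpret D1: stopped_tanaka M G W X N a b c d x\<^sub>0 \<psi> I Ys q K T1
    by (rule stopped_tanakaI[OF T1o _ q K]) (simp add: T1_def T2_def)
  interpret D2: stopped_tanaka M G W X N a b c d x\<^sub>0 \<psi> I Ys q K T2
    by (rule stopped_tanakaI[OF T2o _ q K]) (simp add: T2_def)
  define f where "f y = D2.dens y - D1.dens y" for y
  define D where "D z = D2.as2 z - D1.as2 z" for z
  \<comment> \<open>As T1 \<le> T2, subtracting leaves the noise energy on (T1, T2].\<close>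
  have Deq: "D z = of_bool (0 < fst z \<and> T1 (snd z) < fst z \<and> fst z \<le> T2 (snd z)) * (a (fst z) (snd z))\<^sup>2" for z
    unfolding D_def D1.as2_def D2.as2_def using T12[of "snd z"] by auto
  have D0: "0 \<le> D z" for z unfolding Deq by simp
  have Dm[measurable]: "D \<in> borel_measurable D1.PP" unfolding D_def[abs_def] by measurable
  have beq: "D2.bs z - D1.bs z = of_bool (0 < fst z \<and> T1 (snd z) < fst z \<and> fst z \<le> T2 (snd z)) * b (fst z) (snd z)" for z
    unfolding D1.bs_def D2.bs_def using T12[of "snd z"] by auto
  \<comment> \<open>This writes the drift between T1 and T2 as \<psi>(X) times noise energy, so that
    \<open>occD\<close> can evaluate its integral.\<close>
  have babs: "\<bar>D2.bs z - D1.bs z\<bar> = \<psi> (X (fst z) (snd z)) * D z" if "z \<in> space D1.PP" for z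
  proof -
    have "snd z \<in> space M" using that by (auto simp: space_pair_measure)
    then show ?thesis unfolding beq Deq using b_eq[of "snd z" "fst z"] by auto
  qed
  have ib: "integrable D1.PP (\<lambda>z. D2.bs z - D1.bs z)" using D1.PP_integrable(1) D2.PP_integrable(1) by simp
  have f_nonneg: "0 \<le> f y" if y: "y \<in> Ys" for y
  proof -
    have "f y = (\<integral>w. lt y (T2 w) w - lt y (T1 w) w \<partial>M)"
      unfolding f_def using D1.lt_mean[OF y] D2.lt_mean[OF y] by simp
    also have "\<dots> \<ge> 0"
    proof (rule integral_nonneg_AE)
      show "AE w in M. 0 \<le> lt y (T2 w) w - lt y (T1 w) w"
        using tanaka_mono[OF y] AE_space
        by eventually_elim (use T12 D1.T_nonneg in auto)
    qed
    finally show ?thesis .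
  qed
  \<comment> \<open>Before \<rho> the local time at x is not positive at rational times, hence not
    at T2 by left continuity in time. If T2 = 0, the local time is 0 because nothing has been
    integrated yet.\<close>
  have fx: "f x \<le> 0"
  proof -
    have "AE w in M. lt x (T2 w) w \<le> 0"
      using ito_zero[OF ito_I[OF xY]] AE_space
    proof eventually_elim
      case (elim w)
      show ?case
      proof (cases "0 < T2 w")
        case True
        have "\<exists>s\<in>\<rat>. max 0 (T2 w - 1 / real (Suc k)) < s \<and> s < T2 w" for k :: nat
          using True by (intro Rats_dense_in_real) simp
        then obtain s where s: "\<And>k. s k \<in> \<rat>" "\<And>k. max 0 (T2 w - 1 / real (Suc k)) < s k" "\<And>k. s k < T2 w" by metis
        have slim: "s \<longlonglongrightarrow> T2 w"
        proof (rule tendsto_sandwich)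
          show "(\<lambda>k. T2 w - 1 / real (Suc k)) \<longlonglongrightarrow> T2 w"
            using tendsto_diff[OF tendsto_const LIMSEQ_inverse_real_of_nat, of "T2 w"] by (simp add: inverse_eq_divide)
          show "\<forall>\<^sub>F k in sequentially. T2 w - 1 / real (Suc k) \<le> s k" using s(2) by (auto simp: less_imp_le)
          show "\<forall>\<^sub>F k in sequentially. s k \<le> T2 w" using s(3) by (auto simp: less_imp_le)
        qed (rule tendsto_const)
        have s0: "0 \<le> s k" "s k \<le> T2 w" for k using s(2,3)[of k] by auto
        have "lt x (s k) w \<le> 0" for k
        proof -
          have "s k < \<rho> w" using s(3)[of k] by (simp add: T2_def)
          then have "\<not> 0 < lt x (s k) w"
            using hit_less_iff[OF q0, of "\<lambda>u w. 0 < lt x u w" w "\<rho> w"] s(1) s0(1) unfolding \<rho>_def by blast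
          then show ?thesis by simp
        qed
        then show ?thesis
          using lt_left_limit[OF xY elim(2) slim s0] by (intro LIMSEQ_le_const2) auto
      next
        case False
        then have "T2 w = 0" using D2.T_nonneg[OF elim(2)] by simp
        moreover have "(LINT s:{0..0}|lborel. of_bool (x < X s w) * b s w) = 0"
          unfolding set_lebesgue_integral_def
          by (rule integral_eq_zero_AE, rule AE_mp[OF AE_lborel_singleton[of 0]]) auto
        ultimately show ?thesis using elim(1) X_0[OF elim(2)] by (simp add: tanaka_def)
      qed
    qed
    then have "(\<integral>w. lt x (T2 w) w \<partial>M) \<le> (\<integral>w. 0 \<partial>M)"
      by (intro integral_mono_AE D2.lt_mean(1) xY) auto
    then have "D2.dens x \<le> 0" using D2.lt_mean(2)[OF xY] by simp
    then show ?thesis unfolding f_def using D1.dens_nonneg[OF xY] by simp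
  qed
  obtain \<eta> where \<eta>: "0 < \<eta>" "c \<le> x - \<eta>" "x + \<eta> \<le> d" "(\<integral>y. indicator {x - \<eta>..x + \<eta>} y * \<psi> y \<partial>lborel) \<le> 1 / 4"
    by (rule psi_small[OF x])
  define U where "U = {x - \<eta>..x + \<eta>}"
  have Um[measurable]: "U \<in> sets borel" by (simp add: U_def)
  have UY: "y \<in> U \<Longrightarrow> y \<in> Ys" "y \<in> U \<Longrightarrow> c \<le> y \<and> y \<le> d" for y using Ys \<eta> by (auto simp: U_def)
  have \<psi>U: "integrable lborel (\<lambda>y. indicator U y * \<psi> y)"
  proof (rule Bochner_Integration.integrable_bound[OF \<psi>_integrable])
    show "AE y in lborel. norm (indicator U y * \<psi> y) \<le> norm (indicator {c..d} y * \<psi> y)"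
      using UY(2) by (intro AE_I2) (auto simp: indicator_def)
  qed measurable
  \<comment> \<open>Subtracting the formula for T1 from that for T2 requires the subtracted integral
    to be finite.\<close>
  have occD: "(\<integral>\<^sup>+z. \<phi> (X (fst z) (snd z)) * ennreal (D z) \<partial>D1.PP) = (\<integral>\<^sup>+y. \<phi> y * ennreal (indicator {c..d} y * f y) \<partial>lborel)"
    if \<phi>[measurable]: "\<phi> \<in> borel_measurable borel"
      and fin: "(\<integral>\<^sup>+z. \<phi> (X (fst z) (snd z)) * ennreal (D1.as2 z) \<partial>D1.PP) < \<infinity>" for \<phi>
  proof -
    define \<kappa>1 where "\<kappa>1 y = indicator {c..d} y * D1.dens y" for y
    define \<kappa>2 where "\<kappa>2 y = indicator {c..d} y * f y" for y
    have [measurable]: "\<kappa>1 \<in> borel_measurable borel" using D1.dens_measurable by (simp add: \<kappa>1_def[abs_def])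
    have [measurable]: "\<kappa>2 \<in> borel_measurable borel"
      using borel_measurable_diff[OF D2.dens_measurable D1.dens_measurable] by (simp add: \<kappa>2_def[abs_def] f_def right_diff_distrib)
    have \<kappa>0: "0 \<le> \<kappa>1 y" "0 \<le> \<kappa>2 y" for y using D1.dens_nonneg f_nonneg Ys by (auto simp: \<kappa>1_def \<kappa>2_def indicator_def)
    have "(\<integral>\<^sup>+z. \<phi> (X (fst z) (snd z)) * ennreal (D1.as2 z) \<partial>D1.PP) + (\<integral>\<^sup>+z. \<phi> (X (fst z) (snd z)) * ennreal (D z) \<partial>D1.PP)
      = (\<integral>\<^sup>+z. \<phi> (X (fst z) (snd z)) * ennreal (D2.as2 z) \<partial>D1.PP)"
    proof -
      have e: "\<phi> (X (fst z) (snd z)) * ennreal (D2.as2 z) = \<phi> (X (fst z) (snd z)) * ennreal (D1.as2 z) + \<phi> (X (fst z) (snd z)) * ennreal (D z)" for z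
      proof -
        have "ennreal (D2.as2 z) = ennreal (D1.as2 z + D z)" by (simp add: D_def)
        also have "\<dots> = ennreal (D1.as2 z) + ennreal (D z)" using D0 D1.as2_nonneg by (rule ennreal_plus[rotated])
        finally show ?thesis by (simp add: distrib_left)
      qed
      show ?thesis unfolding e by (rule nn_integral_add[symmetric]) measurable
    qed
    also have "\<dots> = (\<integral>\<^sup>+y. \<phi> y * ennreal (indicator {c..d} y * D2.dens y) \<partial>lborel)" by (rule D2.occ[OF \<phi>])
    also have "\<dots> = (\<integral>\<^sup>+y. \<phi> y * ennreal (\<kappa>1 y) \<partial>lborel) + (\<integral>\<^sup>+y. \<phi> y * ennreal (\<kappa>2 y) \<partial>lborel)"
    proof -
      have e: "\<phi> y * ennreal (indicator {c..d} y * D2.dens y) = \<phi> y * ennreal (\<kappa>1 y) + \<phi> y * ennreal (\<kappa>2 y)" for y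
      proof -
        have "indicator {c..d} y * D2.dens y = \<kappa>1 y + \<kappa>2 y" by (simp add: \<kappa>1_def \<kappa>2_def f_def algebra_simps)
        then have "ennreal (indicator {c..d} y * D2.dens y) = ennreal (\<kappa>1 y) + ennreal (\<kappa>2 y)"
          using \<kappa>0 by (simp only: ennreal_plus)
        then show ?thesis by (simp only: distrib_left)
      qed
      show ?thesis unfolding e by (rule nn_integral_add) measurable
    qed
    also have "(\<integral>\<^sup>+y. \<phi> y * ennreal (\<kappa>1 y) \<partial>lborel) = (\<integral>\<^sup>+z. \<phi> (X (fst z) (snd z)) * ennreal (D1.as2 z) \<partial>D1.PP)"
      unfolding \<kappa>1_def by (rule D1.occ[OF \<phi>, symmetric])
    finally show ?thesis using fin unfolding \<kappa>2_def by (auto simp: ennreal_add_left_cancel)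
  qed
  text \<open>Gronwall's argument at \<open>x\<close>: both \<open>(X - y)\<^sup>+\<close> and \<open>(X - x)\<^sup>+\<close> start from the point \<open>X = x\<close>, so the
    boundary terms have the favourable sign on either side of \<open>x\<close>, and only the drift remains.\<close>
  have key: "f y \<le> 2 * (\<integral>z. indicator U (X (fst z) (snd z)) * \<bar>D2.bs z - D1.bs z\<bar> \<partial>D1.PP)" if y: "y \<in> U" for y
  proof -
    define g where "g w = (max 0 (D2.XT w - y) - max 0 (D1.XT w - y)) - (max 0 (D2.XT w - x) - max 0 (D1.XT w - x))" for w
    define ww where "ww z = (of_bool (y < X (fst z) (snd z)) - of_bool (x < X (fst z) (snd z))) * (D2.bs z - D1.bs z)" for z :: "real \<times> 'a"
    have i: "integrable M (\<lambda>w. max 0 (D1.XT w - v))" "integrable M (\<lambda>w. max 0 (D2.XT w - v))" for v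
    proof -
      show "integrable M (\<lambda>w. max 0 (D1.XT w - v))"
      proof (rule D1.bounded_integrable[of _ "\<bar>d\<bar> + \<bar>v\<bar>"])
        show "\<bar>max 0 (D1.XT w - v)\<bar> \<le> \<bar>d\<bar> + \<bar>v\<bar>" if "w \<in> space M" for w using D1.XT_range[OF that] by linarith
      qed simp
      show "integrable M (\<lambda>w. max 0 (D2.XT w - v))"
      proof (rule D1.bounded_integrable[of _ "\<bar>d\<bar> + \<bar>v\<bar>"])
        show "\<bar>max 0 (D2.XT w - v)\<bar> \<le> \<bar>d\<bar> + \<bar>v\<bar>" if "w \<in> space M" for w using D2.XT_range[OF that] by linarith
      qed simp
    qed
    have wi: "integrable D1.PP ww"
      unfolding ww_def by (rule D1.weighted_integrable[OF ib, of _ 1]) auto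
    have "f y - f x = 2 * (\<integral>w. g w \<partial>M) - 2 * (\<integral>z. ww z \<partial>D1.PP)"
    proof -
      have "(\<integral>z. ww z \<partial>D1.PP) = (\<integral>z. of_bool (y < X (fst z) (snd z)) * D2.bs z - of_bool (y < X (fst z) (snd z)) * D1.bs z
          - (of_bool (x < X (fst z) (snd z)) * D2.bs z - of_bool (x < X (fst z) (snd z)) * D1.bs z) \<partial>D1.PP)"
        unfolding ww_def by (rule Bochner_Integration.integral_cong) (auto simp: algebra_simps)
      also have "\<dots> = (\<integral>z. of_bool (y < X (fst z) (snd z)) * D2.bs z \<partial>D1.PP) - (\<integral>z. of_bool (y < X (fst z) (snd z)) * D1.bs z \<partial>D1.PP)
          - ((\<integral>z. of_bool (x < X (fst z) (snd z)) * D2.bs z \<partial>D1.PP) - (\<integral>z. of_bool (x < X (fst z) (snd z)) * D1.bs z \<partial>D1.PP))"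
        using D1.gated_bs_integrable D2.gated_bs_integrable by simp
      finally show ?thesis
        unfolding f_def D1.dens_def D2.dens_def g_def using i by (simp add: algebra_simps)
    qed
    moreover have "(\<integral>w. g w \<partial>M) \<le> (\<integral>w. 0 \<partial>M)"
    proof (rule integral_mono)
      show "integrable M g" unfolding g_def using i by simp
      fix w assume wM: "w \<in> space M"
      show "g w \<le> 0"
      proof (cases "T1 w = T2 w")
        case True
        then show ?thesis by (simp add: g_def D1.XT_def D2.XT_def)
      next
        case False
        then have fh: "first_hit X q x w < T2 w" "T1 w = first_hit X q x w" by (auto simp: T1_def min_def split: if_splits)
        then have "first_hit X q x w < q" using D2.T_le[OF wM] by simp
        from first_hit_attained(1)[where X = X, OF X_cont[OF wM] q0 this] have "D1.XT w = x" by (simp add: D1.XT_def fh)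
        \<comment> \<open>With X = x at T1 and X = u at T2 this is (u - y)^+ - (x - y)^+ \<le> (u -
          x)^+, the subadditivity of the positive part.\<close>
        then show ?thesis by (simp add: g_def)
      qed
    qed simp
    moreover have "- (\<integral>z. ww z \<partial>D1.PP) \<le> (\<integral>z. indicator U (X (fst z) (snd z)) * \<bar>D2.bs z - D1.bs z\<bar> \<partial>D1.PP)"
    proof -
      have "- (\<integral>z. ww z \<partial>D1.PP) = (\<integral>z. - ww z \<partial>D1.PP)" by simp
      also have "\<dots> \<le> (\<integral>z. indicator U (X (fst z) (snd z)) * \<bar>D2.bs z - D1.bs z\<bar> \<partial>D1.PP)"
      proof (rule integral_mono)
        show "integrable D1.PP (\<lambda>z. - ww z)" using wi by simp
        show "integrable D1.PP (\<lambda>z. indicator U (X (fst z) (snd z)) * \<bar>D2.bs z - D1.bs z\<bar>)"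
          by (rule D1.weighted_integrable[OF integrable_abs[OF ib], of _ 1]) auto
        show "- ww z \<le> indicator U (X (fst z) (snd z)) * \<bar>D2.bs z - D1.bs z\<bar>" for z :: "real \<times> 'a"
          using y \<eta>(1) by (auto simp: ww_def U_def indicator_def)
      qed
      finally show ?thesis .
    qed
    ultimately show ?thesis using fx by simp
  qed
  have iUb: "integrable D1.PP (\<lambda>z. indicator U (X (fst z) (snd z)) * \<bar>D2.bs z - D1.bs z\<bar>)"
    by (rule D1.weighted_integrable[OF integrable_abs[OF ib], of _ 1]) auto
  \<comment> \<open>Any upper bound F for f on U can be halved: \<open>key\<close> has the factor 2,
    and the drift spent in U between T1 and T2 is the integral of \<psi> f over U, at most F /
    4.\<close>
  have step: "f y \<le> F / 2" if F: "0 \<le> F" "\<And>y. y \<in> U \<Longrightarrow> f y \<le> F" and y: "y \<in> U" for F y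
  proof -
    \<comment> \<open>Finite because it is at most the total drift up to T1.\<close>
    have fin: "(\<integral>\<^sup>+z. ennreal (indicator U (X (fst z) (snd z)) * \<psi> (X (fst z) (snd z))) * ennreal (D1.as2 z) \<partial>D1.PP) < \<infinity>"
    proof -
      have "(\<integral>\<^sup>+z. ennreal (indicator U (X (fst z) (snd z)) * \<psi> (X (fst z) (snd z))) * ennreal (D1.as2 z) \<partial>D1.PP)
        \<le> (\<integral>\<^sup>+z. ennreal \<bar>D1.bs z\<bar> \<partial>D1.PP)"
      proof (rule nn_integral_mono)
        fix z :: "real \<times> 'a" assume "z \<in> space D1.PP"
        then have wM: "snd z \<in> space M" by (auto simp: space_pair_measure)
        have "indicator U (X (fst z) (snd z)) * \<psi> (X (fst z) (snd z)) * D1.as2 z \<le> \<bar>D1.bs z\<bar>"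
          using b_eq[OF wM, of "fst z"] \<psi>_nonneg[of "X (fst z) (snd z)"] by (auto simp: D1.as2_def D1.bs_def indicator_def)
        then show "ennreal (indicator U (X (fst z) (snd z)) * \<psi> (X (fst z) (snd z))) * ennreal (D1.as2 z) \<le> ennreal \<bar>D1.bs z\<bar>"
          using \<psi>_nonneg D1.as2_nonneg by (subst ennreal_mult[symmetric]) (auto intro: ennreal_leI)
      qed
      also have "\<dots> < \<infinity>" using D1.PP_integrable(1) by (simp add: nn_integral_eq_integral)
      finally show ?thesis .
    qed
    have "ennreal (\<integral>z. indicator U (X (fst z) (snd z)) * \<bar>D2.bs z - D1.bs z\<bar> \<partial>D1.PP)
      = (\<integral>\<^sup>+z. ennreal (indicator U (X (fst z) (snd z)) * \<bar>D2.bs z - D1.bs z\<bar>) \<partial>D1.PP)"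
      by (rule nn_integral_eq_integral[OF iUb, symmetric]) simp
    also have "\<dots> = (\<integral>\<^sup>+z. ennreal (indicator U (X (fst z) (snd z)) * \<psi> (X (fst z) (snd z))) * ennreal (D z) \<partial>D1.PP)"
      using \<psi>_nonneg D0 by (intro nn_integral_cong) (simp add: babs ennreal_mult[symmetric] mult.assoc)
    also have "\<dots> = (\<integral>\<^sup>+y. ennreal (indicator U y * \<psi> y) * ennreal (indicator {c..d} y * f y) \<partial>lborel)"
      by (rule occD[OF _ fin]) measurable
    also have "\<dots> \<le> (\<integral>\<^sup>+y. ennreal (F * (indicator U y * \<psi> y)) \<partial>lborel)"
    proof (rule nn_integral_mono)
      fix y
      have "indicator U y * \<psi> y * (indicator {c..d} y * f y) \<le> F * (indicator U y * \<psi> y)"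
      proof (cases "y \<in> U")
        case True
        from mult_left_mono[OF F(2)[OF True] \<psi>_nonneg[of y]] show ?thesis
          using UY(2)[OF True] True by (simp add: mult.commute)
      qed simp
      moreover have "0 \<le> indicator {c..d} y * f y" using f_nonneg Ys by (auto simp: indicator_def)
      ultimately show "ennreal (indicator U y * \<psi> y) * ennreal (indicator {c..d} y * f y) \<le> ennreal (F * (indicator U y * \<psi> y))"
        using \<psi>_nonneg by (subst ennreal_mult[symmetric]) (auto intro: ennreal_leI)
    qed
    also have "\<dots> = ennreal (F * (\<integral>y. indicator U y * \<psi> y \<partial>lborel))"
      using \<psi>U F(1) \<psi>_nonneg by (subst nn_integral_eq_integral) auto
    finally have "(\<integral>z. indicator U (X (fst z) (snd z)) * \<bar>D2.bs z - D1.bs z\<bar> \<partial>D1.PP) \<le> F * (\<integral>y. indicator U y * \<psi> y \<partial>lborel)"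
      using F(1) \<psi>_nonneg by (subst (asm) ennreal_le_iff) (auto intro!: mult_nonneg_nonneg integral_nonneg_AE)
    also have "\<dots> \<le> F * (1 / 4)" using \<eta>(4) F(1) unfolding U_def by (intro mult_left_mono)
    finally show ?thesis using key[OF y] by simp
  qed
  have f0: "f y = 0" if y: "y \<in> U" for y
  proof -
    have bdd: "bdd_above (f ` U)"
    proof (rule bdd_aboveI2)
      fix y assume "y \<in> U"
      then show "f y \<le> 2 * (d - c + K)"
        unfolding f_def using D2.dens_bound[of y] D1.dens_nonneg[of y] UY[of y] by simp
    qed
    \<comment> \<open>Applying \<open>step\<close> to the supremum replaces an iteration: a finite
      nonnegative number that is at most half of itself is 0.\<close>
    define s where "s = Sup (f ` U)"
    have le: "f y \<le> s" if "y \<in> U" for y unfolding s_def using that by (intro cSup_upper bdd) auto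
    have "0 \<le> s" using f_nonneg[OF UY(1)[OF y]] le[OF y] by simp
    have "Sup (f ` U) \<le> s / 2"
    proof (rule cSup_least)
      fix v assume "v \<in> f ` U"
      then obtain y where "v = f y" "y \<in> U" by auto
      then show "v \<le> s / 2" using step[OF \<open>0 \<le> s\<close> le] by simp
    qed (use y in auto)
    then have "s \<le> s / 2" unfolding s_def[symmetric] .
    then show ?thesis using le[OF y] f_nonneg[OF UY(1)[OF y]] \<open>0 \<le> s\<close> by simp
  qed
  have "(\<integral>\<^sup>+z. indicator U (X (fst z) (snd z)) * ennreal (D z) \<partial>D1.PP) = (\<integral>\<^sup>+y. indicator U y * ennreal (indicator {c..d} y * f y) \<partial>lborel)"
  proof (rule occD)
    have "(\<integral>\<^sup>+z. indicator U (X (fst z) (snd z)) * ennreal (D1.as2 z) \<partial>D1.PP) \<le> (\<integral>\<^sup>+z. ennreal (D1.as2 z) \<partial>D1.PP)"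
      by (rule nn_integral_mono) (auto simp: indicator_def)
    also have "\<dots> < \<infinity>" using D1.PP_integrable(2) D1.as2_nonneg by (simp add: nn_integral_eq_integral)
    finally show "(\<integral>\<^sup>+z. indicator U (X (fst z) (snd z)) * ennreal (D1.as2 z) \<partial>D1.PP) < \<infinity>" .
  qed measurable
  also have "\<dots> = (\<integral>\<^sup>+y. 0 \<partial>(lborel :: real measure))"
    by (rule nn_integral_cong) (auto simp: indicator_def f0)
  finally have z: "(\<integral>\<^sup>+z. indicator U (X (fst z) (snd z)) * ennreal (D z) \<partial>D1.PP) = 0" by simp
  have m: "(\<lambda>z. indicator U (X (fst z) (snd z)) * ennreal (D z)) \<in> borel_measurable D1.PP" by measurable
  have "(\<integral>\<^sup>+w. (\<integral>\<^sup>+s. indicator U (X s w) * ennreal (D (s, w)) \<partial>lborel) \<partial>M) = 0"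
    using D1.P.nn_integral_snd[OF m] z by simp
  moreover have "(\<lambda>w. \<integral>\<^sup>+s. indicator U (X s w) * ennreal (D (s, w)) \<partial>lborel) \<in> borel_measurable M"
    using lborel.borel_measurable_nn_integral_fst[OF measurable_compose[OF measurable_pair_swap' m]] by simp
  ultimately have "AE w in M. (\<integral>\<^sup>+s. indicator U (X s w) * ennreal (D (s, w)) \<partial>lborel) = 0"
    by (subst (asm) nn_integral_0_iff_AE)
  then have "AE w in M. T2 w \<le> first_hit X q x w"
    using AE_space
  proof eventually_elim
    case (elim w)
    show ?case
    proof (rule ccontr)
      assume "\<not> T2 w \<le> first_hit X q x w"
      then have fh: "first_hit X q x w < T2 w" "T1 w = first_hit X q x w" by (auto simp: T1_def)
      then have "first_hit X q x w < q" using D2.T_le[OF elim(2)] by simp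
      note att = first_hit_attained[where X = X, OF X_cont[OF elim(2)] q0 this]
      \<comment> \<open>Right after its visit to x the path stays in U for a positive time, during
        which \<open>a\<close> is nonzero; \<open>D\<close> is then positive on an interval, against
        the vanishing integral.\<close>
      obtain \<delta> where \<delta>: "0 < \<delta>" "\<And>u. u \<in> {0..} \<Longrightarrow> dist u (first_hit X q x w) < \<delta> \<Longrightarrow> dist (X u w) (X (first_hit X q x w) w) < \<eta>"
        using X_cont[OF elim(2)] att(2) \<eta>(1) unfolding continuous_on_iff by (metis atLeast_iff)
      have ms: "(\<lambda>s. D (s, w)) \<in> borel_measurable borel"
        using measurable_compose[OF measurable_Pair2'[OF elim(2)] Dm] by simp
      note [measurable] = ms prog_section[OF X_prog elim(2)]
      have "AE s in lborel. indicator U (X s w) * ennreal (D (s, w)) = 0"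
        using elim(1) by (subst (asm) nn_integral_0_iff_AE) simp_all
      then have "AE s in lborel. s \<notin> {first_hit X q x w<..<min (T2 w) (first_hit X q x w + \<delta>)}"
      proof eventually_elim
        case (elim s)
        show ?case
        proof
          assume s: "s \<in> {first_hit X q x w<..<min (T2 w) (first_hit X q x w + \<delta>)}"
          then have "dist (X s w) x < \<eta>" using \<delta>(2)[of s] att by (auto simp: dist_real_def)
          then have "X s w \<in> U" by (auto simp: U_def dist_real_def)
          moreover have "a s w \<noteq> 0" using s att(2) by (intro alive[OF \<open>w \<in> space M\<close>]) (auto simp: T2_def)
          then have "0 < D (s, w)" unfolding Deq using s att(2) fh by simp
          ultimately show False using elim by simp
        qed
      qed
      from AE_not_in_interval[OF this] fh(1) \<delta>(1) show False by simp
    qed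
  qed
  then show ?thesis unfolding T2_def \<rho>_def .
qed

text \<open>On a given path the budget is inactive for some integer K, so the first rational time
  with positive local time comes no later than the first visit, unless \<sigma> intervenes.
  Monotonicity carries positivity from a time before t to t.\<close>

lemma lt_positive:
  assumes x: "c < x" "x < d" and \<sigma>: "opt \<sigma>" "\<And>w. w \<in> space M \<Longrightarrow> \<sigma> w \<le> q" and q: "0 < q"
    and alive: "\<And>w s. w \<in> space M \<Longrightarrow> 0 < s \<Longrightarrow> s \<le> \<sigma> w \<Longrightarrow> a s w \<noteq> 0"
  shows "AE w in M. \<forall>s t. 0 \<le> s \<and> s < t \<and> t \<le> \<sigma> w \<and> X s w = x \<longrightarrow> 0 < lt x t w"
proof -
  have xY: "x \<in> Ys" using Ys x by auto
  have "AE w in M. \<forall>K::nat. min (min (budget q (real K) w) (hit q (\<lambda>u w. 0 < lt x u w) w)) (\<sigma> w) \<le> first_hit X q x w"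
    unfolding AE_all_countable by (intro allI no_delay[OF x \<sigma> q alive]) auto
  then show ?thesis
    using tanaka_mono[OF xY] AE_space
  proof eventually_elim
    case (elim w)
    show ?case
    proof (intro allI impI)
      fix s t assume "0 \<le> s \<and> s < t \<and> t \<le> \<sigma> w \<and> X s w = x"
      then have st: "0 \<le> s" "s < t" "t \<le> \<sigma> w" "X s w = x" by auto
      have tq: "t \<le> q" using st \<sigma>(2)[OF elim(3)] by simp
      obtain K :: nat where K: "budget q (real K) w = q" using budget_full[OF elim(3) q] by blast
      have fh: "first_hit X q x w \<le> s" by (rule first_hit_le(2)) (use q st in auto)
      have "min (min q (hit q (\<lambda>u w. 0 < lt x u w) w)) (\<sigma> w) \<le> first_hit X q x w"
        using elim(1) K by metis
      then have "hit q (\<lambda>u w. 0 < lt x u w) w < t" using fh st tq by linarith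
      then obtain u where u: "0 \<le> u" "u < t" "0 < lt x u w"
        using hit_less_iff[of q "\<lambda>u w. 0 < lt x u w" w t] q tq by auto
      then show "0 < lt x t w" using elim(2) by (meson less_imp_le less_le_trans)
    qed
  qed
qed

end

section \<open>Augmentation of the filtration\<close>

text \<open>The sets that agree with a set of \<open>F\<^sub>t\<close> up to a null set. Changing an adapted process
  on a null set keeps it adapted, so that almost sure path properties may be assumed to hold everywhere.\<close>

definition augmented :: "'a measure \<Rightarrow> (real \<Rightarrow> 'a measure) \<Rightarrow> real \<Rightarrow> 'a measure" where
  "augmented M F t = sigma (space M) {A \<in> sets M. \<exists>B\<in>sets (F t). AE w in M. w \<in> A \<longleftrightarrow> w \<in> B}"

text \<open>The generating family is already a \<sigma>-algebra, since a countable union collects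
  only countably many null sets. Events of the augmented filtration can therefore be replaced by
  given ones directly.\<close>

lemma sets_augmented:
  assumes "subalgebra M (F t)"
  shows "sets (augmented M F t) = {A \<in> sets M. \<exists>B\<in>sets (F t). AE w in M. w \<in> A \<longleftrightarrow> w \<in> B}"
    and "space (augmented M F t) = space M"
proof -
  let ?S = "{A \<in> sets M. \<exists>B\<in>sets (F t). AE w in M. w \<in> A \<longleftrightarrow> w \<in> B}"
  have sp: "space (F t) = space M" using assms by (simp add: subalgebra_def)
  have sub: "?S \<subseteq> Pow (space M)" using sets.sets_into_space by auto
  show "space (augmented M F t) = space M" unfolding augmented_def using sub by (rule space_measure_of)
  have "sigma_algebra (space M) ?S"
    unfolding sigma_algebra_iff2
  proof (intro conjI ballI allI impI sub)
    show "{} \<in> ?S" by (auto intro!: bexI[of _ "{}"])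
    fix A assume "A \<in> ?S"
    then obtain B where A: "A \<in> sets M" and B: "B \<in> sets (F t)" "AE w in M. w \<in> A \<longleftrightarrow> w \<in> B" by auto
    have "AE w in M. w \<in> space M - A \<longleftrightarrow> w \<in> space M - B" using B(2) by eventually_elim auto
    moreover have "space M - B \<in> sets (F t)" using sets.compl_sets[OF B(1)] sp by simp
    ultimately show "space M - A \<in> ?S" using A by blast
  next
    fix A :: "nat \<Rightarrow> 'a set" assume "range A \<subseteq> ?S"
    then have A: "\<And>n. A n \<in> sets M" "\<And>n. \<exists>B\<in>sets (F t). AE w in M. w \<in> A n \<longleftrightarrow> w \<in> B" by auto
    then obtain B where B: "\<And>n. B n \<in> sets (F t)" "\<And>n. AE w in M. w \<in> A n \<longleftrightarrow> w \<in> B n" by metis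
    have "AE w in M. \<forall>n. w \<in> A n \<longleftrightarrow> w \<in> B n" using B(2) by (simp add: AE_all_countable)
    then have "AE w in M. w \<in> (\<Union>n. A n) \<longleftrightarrow> w \<in> (\<Union>n. B n)" by eventually_elim auto
    moreover have "(\<Union>n. B n) \<in> sets (F t)" using B(1) by auto
    ultimately show "(\<Union>n. A n) \<in> ?S" using A(1) by blast
  qed
  then have "sigma_sets (space M) ?S = ?S" by (rule sigma_algebra.sigma_sets_eq)
  then show "sets (augmented M F t) = ?S" unfolding augmented_def using sub by (simp add: sets_measure_of)
qed

lemma subalgebra_augmented: "subalgebra M (F t) \<Longrightarrow> subalgebra M (augmented M F t)"
  by (auto simp: subalgebra_def[of _ "augmented M F t"] sets_augmented)

lemma augmented_measurable:
  assumes "subalgebra M (F t)" "f \<in> borel_measurable M" "g \<in> borel_measurable (F t)" "AE w in M. f w = g w"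
  shows "f \<in> borel_measurable (augmented M F t)"
proof (rule measurableI)
  fix B :: "'b set" assume B: "B \<in> sets borel"
  have sp: "space (F t) = space M" using assms(1) by (simp add: subalgebra_def)
  have "f -` B \<inter> space M \<in> sets M" "g -` B \<inter> space M \<in> sets (F t)"
    using measurable_sets[OF assms(2) B] measurable_sets[OF assms(3) B] sp by auto
  moreover have "AE w in M. w \<in> f -` B \<inter> space M \<longleftrightarrow> w \<in> g -` B \<inter> space M"
    using assms(4) by eventually_elim simp
  ultimately show "f -` B \<inter> space (augmented M F t) \<in> sets (augmented M F t)"
    unfolding sets_augmented[where F = F, OF assms(1)] by blast
qed (simp add: sets_augmented[where F = F, OF assms(1)])

lemma augmented_bm:
  assumes "filtered_prob_space M F" "brownian_motion M F W"
  obtains W' where "bm_filtration M (augmented M F) W'" "AE w in M. \<forall>t\<ge>0. W' t w = W t w"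
proof -
  from assms(1) have M: "prob_space M" and sub: "\<And>t. 0 \<le> t \<Longrightarrow> subalgebra M (F t)"
    and mono: "\<And>s t. 0 \<le> s \<Longrightarrow> s \<le> t \<Longrightarrow> subalgebra (F t) (F s)"
    by (auto simp: filtered_prob_space_def)
  interpret prob_space M by (rule M)
  from assms(2) have Wad: "\<And>t. 0 \<le> t \<Longrightarrow> W t \<in> borel_measurable (F t)"
    and Wc: "AE w in M. W 0 w = 0 \<and> continuous_on {0..} (\<lambda>t. W t w)"
    and Wd: "\<And>s t. 0 \<le> s \<Longrightarrow> s < t \<Longrightarrow> distributed M lborel (\<lambda>w. W t w - W s w) (normal_density 0 (sqrt (t - s)))"
    and Wi: "\<And>s t. 0 \<le> s \<Longrightarrow> s < t \<Longrightarrow> indep_set (sets (F s)) {(\<lambda>w. W t w - W s w) -` B \<inter> space M | B. B \<in> sets borel}"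
    by (auto simp: brownian_motion_def)
  from AE_E[OF Wc] obtain N where N: "{w \<in> space M. \<not> (W 0 w = 0 \<and> continuous_on {0..} (\<lambda>t. W t w))} \<subseteq> N"
    "emeasure M N = 0" "N \<in> sets M" by blast
  \<comment> \<open>Setting the paths to 0 on a null set makes all of them continuous and keeps them
    adapted to the augmented filtration.\<close>
  define W' where "W' t w = (if w \<in> N then 0 else W t w)" for t w
  have Nae: "AE w in M. w \<notin> N" using N(2,3) by (intro AE_not_in) auto
  have W'eq: "AE w in M. \<forall>t. W' t w = W t w" using Nae by eventually_elim (simp add: W'_def)
  have WM: "W t \<in> borel_measurable M" if "0 \<le> t" for t using measurable_from_subalg[OF sub[OF that] Wad[OF that]] .
  have W'M: "W' t \<in> borel_measurable M" if "0 \<le> t" for t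
    unfolding W'_def[abs_def] using WM[OF that] N(3) by measurable
  have "bm_filtration M (augmented M F) W'"
  proof (intro bm_filtration.intro bm_filtration_axioms.intro M)
    show "subalgebra M (augmented M F t)" if "0 \<le> t" for t by (rule subalgebra_augmented[where F = F, OF sub[OF that]])
    show "subalgebra (augmented M F t) (augmented M F s)" if "0 \<le> s" "s \<le> t" for s t
    proof -
      have "0 \<le> t" using that by simp
      moreover have "sets (F s) \<subseteq> sets (F t)" using mono[OF that] by (simp add: subalgebra_def)
      ultimately show ?thesis
        unfolding subalgebra_def sets_augmented[where F = F, OF sub[OF that(1)]] sets_augmented[where F = F, OF sub[OF \<open>0 \<le> t\<close>]] by blast
    qed
    show "A \<in> sets (augmented M F t)" if "0 \<le> t" "A \<in> null_sets M" for t A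
    proof -
      have "AE w in M. w \<in> A \<longleftrightarrow> w \<in> {}" using AE_not_in[OF that(2)] by eventually_elim simp
      then show ?thesis unfolding sets_augmented[where F = F, OF sub[OF that(1)]] using that(2) by blast
    qed
    show "W' t \<in> borel_measurable (augmented M F t)" if "0 \<le> t" for t
      by (rule augmented_measurable[where F = F, OF sub[OF that] W'M[OF that] Wad[OF that]]) (use W'eq in auto)
    show "continuous_on {0..} (\<lambda>t. W' t w)" if "w \<in> space M" for w
      using N(1) that by (cases "w \<in> N") (auto simp: W'_def)
    fix s t :: real assume st: "0 \<le> s" "s < t"
    then have t: "0 \<le> t" by simp
    have ae: "AE w in M. W' t w - W' s w = W t w - W s w" using W'eq by eventually_elim simp
    have m: "(\<lambda>w. W' t w - W' s w) \<in> borel_measurable M" "(\<lambda>w. W t w - W s w) \<in> borel_measurable M"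
      using W'M[OF t] W'M[OF st(1)] WM[OF t] WM[OF st(1)] by simp_all
    show "distributed M lborel (\<lambda>w. W' t w - W' s w) (normal_density 0 (sqrt (t - s)))"
    proof -
      have "distr M lborel (\<lambda>w. W' t w - W' s w) = distr M lborel (\<lambda>w. W t w - W s w)"
        using m by (intro distr_cong_AE ae) auto
      then show ?thesis using Wd[OF st] m by (simp add: distributed_def)
    qed
    show "indep_set (sets (augmented M F s)) {(\<lambda>w. W' t w - W' s w) -` B \<inter> space M | B. B \<in> sets borel}"
      unfolding indep_sets2_eq
    proof (intro conjI ballI)
      show "sets (augmented M F s) \<subseteq> events" unfolding sets_augmented[where F = F, OF sub[OF st(1)]] by blast
      show "{(\<lambda>w. W' t w - W' s w) -` B \<inter> space M | B. B \<in> sets borel} \<subseteq> events"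
        using measurable_sets[OF m(1)] by auto
      \<comment> \<open>Each event of the augmented past agrees almost surely with one of
        \<open>F s\<close>, and likewise the increment events of W' with those of W. The product
        rule concerns probabilities only and carries over.\<close>
      fix a b assume a: "a \<in> sets (augmented M F s)" and "b \<in> {(\<lambda>w. W' t w - W' s w) -` B \<inter> space M | B. B \<in> sets borel}"
      then obtain B where B: "B \<in> sets borel" "b = (\<lambda>w. W' t w - W' s w) -` B \<inter> space M" by blast
      define b' where "b' = (\<lambda>w. W t w - W s w) -` B \<inter> space M"
      obtain a' where a': "a \<in> events" "a' \<in> sets (F s)" "AE w in M. w \<in> a \<longleftrightarrow> w \<in> a'"
        using a unfolding sets_augmented[where F = F, OF sub[OF st(1)]] by blast
      have ev: "a' \<in> events" using a'(2) sub[OF st(1)] by (auto simp: subalgebra_def)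
      have bev: "b \<in> events" "b' \<in> events" unfolding B(2) b'_def
        using measurable_sets[OF m(1) B(1)] measurable_sets[OF m(2) B(1)] by auto
      have bb: "AE w in M. w \<in> b \<longleftrightarrow> w \<in> b'" using ae unfolding B(2) b'_def by eventually_elim simp
      have "prob (a \<inter> b) = prob (a' \<inter> b')"
        by (rule finite_measure_eq_AE) (use a' bb ev bev in auto)
      also have "\<dots> = prob a' * prob b'"
        using Wi[OF st] a'(2) B(1) unfolding indep_sets2_eq b'_def by blast
      also have "prob a' = prob a" by (rule finite_measure_eq_AE) (use a' ev in auto)
      also have "prob b' = prob b" by (rule finite_measure_eq_AE) (use bb bev in auto)
      finally show "prob (a \<inter> b) = prob a * prob b" .
    qed
  qed
  then show thesis by (rule that) (use W'eq in auto)
qed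

section \<open>Ito integrals in the augmented filtration\<close>

lemma continuous_on_atLeast:
  fixes f :: "real \<Rightarrow> real"
  assumes "\<And>T. 0 \<le> T \<Longrightarrow> continuous_on {0..T} f"
  shows "continuous_on {0..} f"
  unfolding continuous_on_iff
proof (intro ballI allI impI)
  fix x e :: real assume x: "x \<in> {0..}" and e: "0 < e"
  from assms[of "x + 1"] x e obtain d where d: "0 < d" "\<And>y. y \<in> {0..x + 1} \<Longrightarrow> dist y x < d \<Longrightarrow> dist (f y) (f x) < e"
    unfolding continuous_on_iff by (metis add_increasing2 atLeastAtMost_iff atLeast_iff le_add_same_cancel1 zero_le_one)
  have "dist (f y) (f x) < e" if "y \<in> {0..}" "dist y x < min d 1" for y
    using that d(2)[of y] by (auto simp: dist_real_def)
  then show "\<exists>d>0. \<forall>x'\<in>{0..}. dist x' x < d \<longrightarrow> dist (f x') (f x) < e"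
    using d(1) by (intro exI[of _ "min d 1"]) auto
qed

context bm_filtration begin

text \<open>One open-ended step switches \<xi> on at p i, and another switches it off at p (i + 1),
  where it is still known.\<close>

lemma elem_simple:
  assumes FG: "\<And>t (f :: 'a \<Rightarrow> real). 0 \<le> t \<Longrightarrow> f \<in> borel_measurable (F t) \<Longrightarrow> f \<in> borel_measurable (G t)"
    and "simple_process M F N p \<xi>"
  shows "elem (simple_val N p \<xi>) (simple_integral W N p \<xi>)"
proof -
  from assms(2) have p0: "0 \<le> p 0" and pm: "\<And>i. i < N \<Longrightarrow> p i \<le> p (Suc i)"
    and \<xi>: "\<And>i. i < N \<Longrightarrow> \<xi> i \<in> borel_measurable (F (p i))" and "\<And>i. i < N \<Longrightarrow> \<exists>C. \<forall>w\<in>space M. \<bar>\<xi> i w\<bar> \<le> C"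
    by (auto simp: simple_process_def)
  then obtain C where C: "\<And>i w. i < N \<Longrightarrow> w \<in> space M \<Longrightarrow> \<bar>\<xi> i w\<bar> \<le> C i" by metis
  define D where "D = (\<Sum>i<N. \<bar>C i\<bar>)"
  have D: "\<bar>\<xi> i w\<bar> \<le> D" if "i < N" "w \<in> space M" for i w
  proof -
    have "\<bar>C i\<bar> \<le> D" unfolding D_def by (rule member_le_sum) (use that in auto)
    then show ?thesis using C[OF that] by linarith
  qed
  have pn: "0 \<le> p i" if "i \<le> N" for i using that
  proof (induction i)
    case (Suc i)
    then show ?case using pm[of i] by simp
  qed (use p0 in simp)
  have \<xi>G: "\<xi> i \<in> borel_measurable (G (p i))" if "i < N" for i by (rule FG[OF _ \<xi>[OF that]]) (use pn that in simp)
  have 1: "elem (\<lambda>s w. 0 + (\<Sum>i\<in>{..<N}. \<xi> i w * of_bool (p i < s)))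
      (\<lambda>t w. 0 + (\<Sum>i\<in>{..<N}. \<xi> i w * (W t w - W (min t (p i)) w)))"
    by (rule elem_sum_term[OF elem.zero]) (use \<xi>G pn D in auto)
  have 2: "elem (\<lambda>s w. 0 + (\<Sum>i\<in>{..<N}. \<xi> i w * of_bool (p i < s)) + (\<Sum>i\<in>{..<N}. - \<xi> i w * of_bool (p (Suc i) < s)))
      (\<lambda>t w. 0 + (\<Sum>i\<in>{..<N}. \<xi> i w * (W t w - W (min t (p i)) w)) + (\<Sum>i\<in>{..<N}. - \<xi> i w * (W t w - W (min t (p (Suc i))) w)))"
  proof (rule elem_sum_term[OF 1])
    fix i assume "i \<in> {..<N}"
    then show "(\<lambda>w. - \<xi> i w) \<in> borel_measurable (G (p (Suc i)))"
      using meas_mono[OF pn[of i] pm[of i] \<xi>G[of i]] by simp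
  qed (use pn D in auto)
  show ?thesis
  proof (rule elem.on_space[OF 2])
    fix s w
    show "simple_val N p \<xi> s w = 0 + (\<Sum>i\<in>{..<N}. \<xi> i w * of_bool (p i < s)) + (\<Sum>i\<in>{..<N}. - \<xi> i w * of_bool (p (Suc i) < s))"
      unfolding simple_val_def add_0 sum.distrib[symmetric]
    proof (rule sum.cong[OF refl])
      fix i assume "i \<in> {..<N}"
      then show "\<xi> i w * indicator {p i<..p (Suc i)} s = \<xi> i w * of_bool (p i < s) + - \<xi> i w * of_bool (p (Suc i) < s)"
        using pm[of i] by (auto simp: indicator_def)
    qed
    show "simple_integral W N p \<xi> s w = 0 + (\<Sum>i\<in>{..<N}. \<xi> i w * (W s w - W (min s (p i)) w)) + (\<Sum>i\<in>{..<N}. - \<xi> i w * (W s w - W (min s (p (Suc i))) w))"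
      unfolding simple_integral_def add_0 sum.distrib[symmetric] by (rule sum.cong) (auto simp: algebra_simps)
  qed
qed

lemma has_ito_approx:
  assumes FG: "\<And>t (f :: 'a \<Rightarrow> real). 0 \<le> t \<Longrightarrow> f \<in> borel_measurable (F t) \<Longrightarrow> f \<in> borel_measurable (G t)"
    and W: "AE w in M. \<forall>t\<ge>0. W t w = W\<^sub>0 t w" and H: "has_ito_integral M F W\<^sub>0 H I"
  obtains e E where "ito_approx H I e E"
proof -
  from H obtain N p \<xi> where sp: "\<And>n. simple_process M F (N n) (p n) (\<xi> n)"
    and ap: "AE w in M. \<forall>T\<ge>0. (\<lambda>n. \<integral>\<^sup>+s\<in>{0..T}. ennreal ((simple_val (N n) (p n) (\<xi> n) s w - H s w)\<^sup>2) \<partial>lborel) \<longlonglongrightarrow> 0 \<and>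
           uniform_limit {0..T} (\<lambda>n t. simple_integral W\<^sub>0 (N n) (p n) (\<xi> n) t w) (\<lambda>t. I t w) sequentially"
    unfolding has_ito_integral_def by blast
  have pn: "0 \<le> p n i" if "i \<le> N n" for n i using that
  proof (induction i)
    case (Suc i)
    then have "p n i \<le> p n (Suc i)" using sp[of n] by (auto simp: simple_process_def)
    then show ?case using Suc by simp
  qed (use sp[of n] in \<open>auto simp: simple_process_def\<close>)
  have "ito_approx H I (\<lambda>n. simple_val (N n) (p n) (\<xi> n)) (\<lambda>n. simple_integral W (N n) (p n) (\<xi> n))"
    unfolding ito_approx_def
  proof (intro conjI allI elem_simple[OF FG sp])
    show "AE w in M. \<forall>c\<ge>0. (\<lambda>n. \<integral>\<^sup>+s\<in>{0..c}. ennreal ((simple_val (N n) (p n) (\<xi> n) s w - H s w)\<^sup>2) \<partial>lborel) \<longlonglongrightarrow> 0 \<and>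
           uniform_limit {0..c} (\<lambda>n t. simple_integral W (N n) (p n) (\<xi> n) t w) (\<lambda>t. I t w) sequentially"
      using ap W
    proof eventually_elim
      case (elim w)
      have eq: "simple_integral W (N n) (p n) (\<xi> n) t w = simple_integral W\<^sub>0 (N n) (p n) (\<xi> n) t w" if "0 \<le> t" for n t
        unfolding simple_integral_def
        by (rule sum.cong[OF refl]) (use elim(2) that pn in auto)
      show ?case
      proof (intro allI impI conjI)
        fix c :: real assume c: "0 \<le> c"
        show "(\<lambda>n. \<integral>\<^sup>+s\<in>{0..c}. ennreal ((simple_val (N n) (p n) (\<xi> n) s w - H s w)\<^sup>2) \<partial>lborel) \<longlonglongrightarrow> 0"
          using elim(1) c by blast
        have "uniform_limit {0..c} (\<lambda>n t. simple_integral W\<^sub>0 (N n) (p n) (\<xi> n) t w) (\<lambda>t. I t w) sequentially"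
          using elim(1) c by blast
        then show "uniform_limit {0..c} (\<lambda>n t. simple_integral W (N n) (p n) (\<xi> n) t w) (\<lambda>t. I t w) sequentially"
          by (rule uniform_limit_cong'[THEN iffD1, rotated -1]) (use eq in auto)
      qed
    qed
  qed auto
  then show thesis by (rule that)
qed

lemma ito_approx_continuous:
  assumes "ito_approx h I e E"
  shows "AE w in M. continuous_on {0..} (\<lambda>t. I t w)"
proof -
  from assms have el: "\<And>n. elem (e n) (E n)"
    and ap: "AE w in M. \<forall>c\<ge>0. (\<lambda>n. \<integral>\<^sup>+s\<in>{0..c}. ennreal ((e n s w - h s w)\<^sup>2) \<partial>lborel) \<longlonglongrightarrow> 0 \<and>
        uniform_limit {0..c} (\<lambda>n t. E n t w) (\<lambda>t. I t w) sequentially"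
    by (auto simp: ito_approx_def)
  show ?thesis
    using ap AE_space
  proof eventually_elim
    case (elim w)
    show ?case
    proof (rule continuous_on_atLeast)
      fix c :: real assume c: "0 \<le> c"
      show "continuous_on {0..c} (\<lambda>t. I t w)"
      proof (rule uniform_limit_theorem)
        show "\<forall>\<^sub>F n in sequentially. continuous_on {0..c} (\<lambda>t. E n t w)"
          by (intro always_eventually allI continuous_on_subset[OF elem_continuous[OF el elim(2)]]) auto
        show "uniform_limit {0..c} (\<lambda>n t. E n t w) (\<lambda>t. I t w) sequentially" using elim(1) c by blast
      qed simp
    qed
  qed
qed

text \<open>Agreement at positive times suffices because the energy ignores the single time 0. This
  matters below, where \<open>alive\<close> is 0 at time 0 while the gate of the equation is
  1.\<close>

lemma ito_approx_cong:
  assumes "ito_approx h I e E" "AE w in M. \<forall>s>0. h' s w = h s w" "AE w in M. \<forall>t\<ge>0. I' t w = I t w"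
  shows "ito_approx h' I' e E"
proof -
  have "AE w in M. \<forall>c\<ge>0. (\<lambda>n. \<integral>\<^sup>+s\<in>{0..c}. ennreal ((e n s w - h s w)\<^sup>2) \<partial>lborel) \<longlonglongrightarrow> 0 \<and>
        uniform_limit {0..c} (\<lambda>n t. E n t w) (\<lambda>t. I t w) sequentially"
    using assms(1) by (auto simp: ito_approx_def)
  then have "AE w in M. \<forall>c\<ge>0. (\<lambda>n. \<integral>\<^sup>+s\<in>{0..c}. ennreal ((e n s w - h' s w)\<^sup>2) \<partial>lborel) \<longlonglongrightarrow> 0 \<and>
        uniform_limit {0..c} (\<lambda>n t. E n t w) (\<lambda>t. I' t w) sequentially"
    using assms(2,3)
  proof eventually_elim
    case (elim w)
    show ?case
    proof (intro allI impI conjI)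
      fix c :: real assume c: "0 \<le> c"
      have "(\<integral>\<^sup>+s\<in>{0..c}. ennreal ((e n s w - h' s w)\<^sup>2) \<partial>lborel) = (\<integral>\<^sup>+s\<in>{0..c}. ennreal ((e n s w - h s w)\<^sup>2) \<partial>lborel)" for n
      proof (rule nn_integral_cong_AE)
        show "AE s in lborel. ennreal ((e n s w - h' s w)\<^sup>2) * indicator {0..c} s = ennreal ((e n s w - h s w)\<^sup>2) * indicator {0..c} s"
          using AE_lborel_singleton[of 0] by eventually_elim (use elim(2) in \<open>auto simp: indicator_def\<close>)
      qed
      then show "(\<lambda>n. \<integral>\<^sup>+s\<in>{0..c}. ennreal ((e n s w - h' s w)\<^sup>2) \<partial>lborel) \<longlonglongrightarrow> 0" using elim(1) c by simp
      have "uniform_limit {0..c} (\<lambda>n t. E n t w) (\<lambda>t. I t w) sequentially" using elim(1) c by blast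
      then show "uniform_limit {0..c} (\<lambda>n t. E n t w) (\<lambda>t. I' t w) sequentially"
        by (rule uniform_limit_cong'[THEN iffD1, rotated -1]) (use elim(3) in auto)
    qed
  qed
  then show ?thesis using assms(1) by (auto simp: ito_approx_def)
qed

text \<open>The pathwise limit of adapted elementary integrals is adapted. On the null set where
  convergence or continuity may fail it is replaced by 0, which is harmless as null sets are known
  at all times.\<close>

lemma ito_of_approx:
  assumes ap: "ito_approx h I e E" and h: "prog h"
  obtains J where "ito h J" "AE w in M. \<forall>t\<ge>0. J t w = I t w"
proof -
  from ap have el: "\<And>n. elem (e n) (E n)"
    and ul: "AE w in M. \<forall>c\<ge>0. (\<lambda>n. \<integral>\<^sup>+s\<in>{0..c}. ennreal ((e n s w - h s w)\<^sup>2) \<partial>lborel) \<longlonglongrightarrow> 0 \<and>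
        uniform_limit {0..c} (\<lambda>n t. E n t w) (\<lambda>t. I t w) sequentially"
    by (auto simp: ito_approx_def)
  have "AE w in M. continuous_on {0..} (\<lambda>t. I t w) \<and> (\<forall>t\<ge>0. (\<lambda>n. E n t w) \<longlonglongrightarrow> I t w)"
    using ul ito_approx_continuous[OF ap]
  proof eventually_elim
    case (elim w)
    have "(\<lambda>n. E n t w) \<longlonglongrightarrow> I t w" if t: "0 \<le> t" for t
    proof -
      have "uniform_limit {0..t} (\<lambda>n t. E n t w) (\<lambda>t. I t w) sequentially" using elim(1) t by blast
      from tendsto_uniform_limitI[OF this, of t] t show ?thesis by simp
    qed
    then show ?case using elim(2) by blast
  qed
  from AE_E[OF this] obtain N where N: "{w \<in> space M. \<not> (continuous_on {0..} (\<lambda>t. I t w) \<and> (\<forall>t\<ge>0. (\<lambda>n. E n t w) \<longlonglongrightarrow> I t w))} \<subseteq> N"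
    "emeasure M N = 0" "N \<in> sets M" by blast
  have null: "N \<in> null_sets M" using N by auto
  define J where "J t w = (if w \<in> N then 0 else lim (\<lambda>n. E n t w))" for t w
  have J: "J t w = I t w" if "w \<in> space M" "w \<notin> N" "0 \<le> t" for t w
    unfolding J_def using N(1) that by (auto intro!: limI)
  have ae: "AE w in M. \<forall>t\<ge>0. J t w = I t w"
    using AE_not_in[OF null] AE_space by eventually_elim (use J in auto)
  have "ito h J"
    unfolding ito_def
  proof (intro conjI h allI impI ballI exI)
    show "ito_approx h J e E" by (rule ito_approx_cong[OF ap _ ae]) simp
    fix t :: real assume t: "0 \<le> t"
    note [measurable] = null_G[OF t null] elem_adapted[OF el t]
    have "(\<lambda>w. lim (\<lambda>n. E n t w)) \<in> borel_measurable (G t)" by (rule borel_measurable_lim_metric) measurable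
    then show "J t \<in> borel_measurable (G t)" unfolding J_def[abs_def] by measurable
  next
    fix w assume wM: "w \<in> space M"
    show "continuous_on {0..} (\<lambda>t. J t w)"
    proof (cases "w \<in> N")
      case True
      then show ?thesis by (simp add: J_def)
    next
      case False
      then have "continuous_on {0..} (\<lambda>t. I t w)" using N(1) wM by auto
      then show ?thesis by (rule continuous_on_cong[THEN iffD1, rotated -1]) (use J[OF wM False] in auto)
    qed
  qed
  then show thesis using that ae by blast
qed

end

section \<open>The diffusion stopped on leaving a compact interval\<close>

lemma exit_time_less_iff:
  "exit_time Y l r w < u \<longleftrightarrow> (\<exists>s\<ge>0. ereal s < u \<and> Y s w \<notin> {l<..<r})"
  unfolding exit_time_def hit_time_def Inf_less_iff by auto

lemma stopped_at_id: "ereal t \<le> z \<Longrightarrow> stopped_at t z = t"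
  by (simp add: stopped_at_def min_absorb1)

text \<open>Restricted to [0, t], g differs from f at most at time 0 and so inherits its
  measurability. This spares a separate measurability proof for the coefficients along Y.\<close>

lemma set_lebesgue_integral_cong_pos:
  fixes f g :: "real \<Rightarrow> real"
  assumes [measurable]: "f \<in> borel_measurable borel" and eq: "\<And>s. 0 < s \<Longrightarrow> f s = g s"
  shows "(LINT s:{0..t}|lborel. f s) = (LINT s:{0..t}|lborel. g s)"
  unfolding set_lebesgue_integral_def
proof (rule integral_cong_AE)
  show "AE s in lborel. indicator {0..t} s *\<^sub>R f s = indicator {0..t} s *\<^sub>R g s"
    using AE_lborel_singleton[of 0] by eventually_elim (use eq in \<open>auto simp: indicator_def\<close>)
  have "(\<lambda>s. indicator {0..t} s *\<^sub>R g s) = (\<lambda>s. if s = 0 then indicator {0..t} 0 *\<^sub>R g 0 else indicator {0..t} s *\<^sub>R f s)"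
    using eq by (auto simp: fun_eq_iff indicator_def)
  then show "(\<lambda>s. indicator {0..t} s *\<^sub>R g s) \<in> borel_measurable lborel" by simp
qed simp

lemma set_nn_integral_cong_pos:
  fixes f g :: "real \<Rightarrow> ennreal"
  assumes "\<And>s. 0 < s \<Longrightarrow> f s = g s"
  shows "(\<integral>\<^sup>+s\<in>{0..t}. f s \<partial>lborel) = (\<integral>\<^sup>+s\<in>{0..t}. g s \<partial>lborel)"
  by (rule nn_integral_cong_AE, use AE_lborel_singleton[of 0] in eventually_elim)
    (use assms in \<open>auto simp: indicator_def\<close>)

text \<open>One null set collects the failures of the path properties that involve no level.
  Tanaka's formula keeps a null set of its own for each y, since the levels are uncountable.\<close>

locale interior_diffusion = bm_filtration M G W
  for M :: "'a measure" and G and W +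
  fixes Y :: "real \<Rightarrow> 'a \<Rightarrow> ereal" and \<mu> \<sigma> :: "real \<Rightarrow> real" and L :: "real \<Rightarrow> real \<Rightarrow> 'a \<Rightarrow> real"
    and l r :: ereal and x\<^sub>0 c d :: real and N\<^sub>0 :: "'a set"
    and I\<^sub>0 :: "real \<Rightarrow> 'a \<Rightarrow> real" and e E :: "nat \<Rightarrow> real \<Rightarrow> 'a \<Rightarrow> real"
  assumes lc: "l < ereal c" and cx: "c < x\<^sub>0" and xd: "x\<^sub>0 < d" and dr: "ereal d < r"
    and \<mu>_measurable: "(\<lambda>x. indicator (einterval l r) x * \<mu> x) \<in> borel_measurable borel"
    and \<sigma>_measurable: "(\<lambda>x. indicator (einterval l r) x * \<sigma> x) \<in> borel_measurable borel"
    and \<sigma>_nonzero: "x \<in> einterval l r \<Longrightarrow> \<sigma> x \<noteq> 0"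
    and drift_integrable: "set_integrable lborel {c..d} (\<lambda>x. \<mu> x / (\<sigma> x)\<^sup>2)"
    and Y_adapted: "0 \<le> t \<Longrightarrow> Y t \<in> borel_measurable (G t)"
    and null: "N\<^sub>0 \<in> null_sets M"
    and Y_0: "w \<in> space M \<Longrightarrow> w \<notin> N\<^sub>0 \<Longrightarrow> Y 0 w = ereal x\<^sub>0"
    and Y_cont: "w \<in> space M \<Longrightarrow> w \<notin> N\<^sub>0 \<Longrightarrow> continuous_on {0..} (\<lambda>t. Y t w)"
    and Y_range: "w \<in> space M \<Longrightarrow> w \<notin> N\<^sub>0 \<Longrightarrow> 0 \<le> t \<Longrightarrow> Y t w \<in> {l..r}"
    and Y_absorb: "w \<in> space M \<Longrightarrow> w \<notin> N\<^sub>0 \<Longrightarrow> 0 \<le> s \<Longrightarrow> s \<le> t \<Longrightarrow> Y s w \<in> {l, r} \<Longrightarrow> Y t w = Y s w"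
    and sde_integrable: "w \<in> space M \<Longrightarrow> w \<notin> N\<^sub>0 \<Longrightarrow> 0 \<le> t \<Longrightarrow>
      set_integrable lborel {0..t} (\<lambda>s. of_bool (ereal s \<le> exit_time Y (ereal c) (ereal d) w) * \<mu> (real_of_ereal (Y s w)))"
    and sde_eq: "w \<in> space M \<Longrightarrow> w \<notin> N\<^sub>0 \<Longrightarrow> 0 \<le> t \<Longrightarrow>
      real_of_ereal (Y (stopped_at t (exit_time Y (ereal c) (ereal d) w)) w) - x\<^sub>0
        = (LINT s:{0..t}|lborel. of_bool (ereal s \<le> exit_time Y (ereal c) (ereal d) w) * \<mu> (real_of_ereal (Y s w))) + I\<^sub>0 t w"
    and I0_cont: "w \<in> space M \<Longrightarrow> w \<notin> N\<^sub>0 \<Longrightarrow> continuous_on {0..} (\<lambda>t. I\<^sub>0 t w)"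
    and approx: "ito_approx (\<lambda>s w. of_bool (ereal s \<le> exit_time Y (ereal c) (ereal d) w) * \<sigma> (real_of_ereal (Y s w))) I\<^sub>0 e E"
    and approx_conv: "w \<in> space M \<Longrightarrow> w \<notin> N\<^sub>0 \<Longrightarrow> 0 \<le> t \<Longrightarrow>
      (\<lambda>n. \<integral>\<^sup>+s\<in>{0..t}. ennreal ((e n s w - of_bool (ereal s \<le> exit_time Y (ereal c) (ereal d) w) * \<sigma> (real_of_ereal (Y s w)))\<^sup>2) \<partial>lborel) \<longlonglongrightarrow> 0"
    and tanaka_formula: "y \<in> einterval l r \<Longrightarrow> \<exists>I' e' E'.
      ito_approx (\<lambda>s w. of_bool (ereal s \<le> exit_time Y (ereal c) (ereal d) w) * of_bool (ereal y < Y s w) * \<sigma> (real_of_ereal (Y s w))) I' e' E' \<and>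
      (AE w in M. \<forall>t\<ge>0. max 0 (real_of_ereal (Y (stopped_at t (exit_time Y (ereal c) (ereal d) w)) w) - y) - max 0 (x\<^sub>0 - y)
           - L (stopped_at t (exit_time Y (ereal c) (ereal d) w)) y w / 2
         = (LINT s:{0..t}|lborel. of_bool (ereal s \<le> exit_time Y (ereal c) (ereal d) w) * of_bool (ereal y < Y s w) * \<mu> (real_of_ereal (Y s w))) + I' t w)"
    and L_mono: "y \<in> einterval l r \<Longrightarrow> AE w in M. mono_on {t. 0 \<le> t \<and> ereal t < exit_time Y l r w} (\<lambda>t. L t y w)"
begin

abbreviation \<tau> where "\<tau> \<equiv> exit_time Y (ereal c) (ereal d)"

definition good where "good w \<longleftrightarrow> w \<in> space M \<and> w \<notin> N\<^sub>0"

lemma AE_good: "AE w in M. good w"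
  using AE_not_in[OF null] AE_space by eventually_elim (simp add: good_def)

lemma goodD: "good w \<Longrightarrow> w \<in> space M" "good w \<Longrightarrow> w \<notin> N\<^sub>0"
  by (auto simp: good_def)

lemma cd_J: "x \<in> {c..d} \<Longrightarrow> x \<in> einterval l r"
  using less_le_trans[OF lc, of "ereal x"] le_less_trans[OF _ dr, of "ereal x"] by (simp add: einterval_def)

lemma tau_less:
  assumes "0 \<le> s" "ereal s < \<tau> w"
  shows "ereal c < Y s w \<and> Y s w < ereal d"
proof (rule ccontr)
  assume "\<not> ?thesis"
  then have "\<tau> w \<le> ereal s" unfolding exit_time_def hit_time_def using assms(1) by (intro Inf_lower) auto
  then show False using assms(2) by simp
qed

text \<open>Before \<tau> the path lies in the open interval, and continuity places it in the closed
  one at \<tau> itself.\<close>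

lemma tau_le:
  assumes g: "good w" and s: "0 \<le> s" "ereal s \<le> \<tau> w"
  shows "ereal c \<le> Y s w \<and> Y s w \<le> ereal d"
proof (cases "ereal s < \<tau> w \<or> s = 0")
  case True
  then show ?thesis
    using tau_less[OF s(1), of w] Y_0[OF goodD[OF g]] cx xd by (auto intro: less_imp_le)
next
  case False
  then have s0: "0 < s" using s by simp
  define u where "u n = s - s * (1 / real (Suc n))" for n
  have "(\<lambda>n. u n) \<longlonglongrightarrow> s - s * 0"
    unfolding u_def using LIMSEQ_inverse_real_of_nat by (intro tendsto_intros) (simp add: inverse_eq_divide)
  then have ul: "u \<longlonglongrightarrow> s" by simp
  have u: "0 \<le> u n" "u n < s" for n
    using s0 by (auto simp: u_def field_simps)
  have "(\<lambda>n. Y (u n) w) \<longlonglongrightarrow> Y s w"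
    by (rule continuous_on_tendsto_compose[OF Y_cont[OF goodD[OF g]] ul]) (use s u in auto)
  moreover have "Y (u n) w \<in> {ereal c..ereal d}" for n
  proof -
    have "ereal (u n) < \<tau> w" using u(2)[of n] s(2) by (metis ereal_less(1) less_ereal.simps(1) less_le_trans)
    from tau_less[OF u(1) this] show ?thesis by (auto intro: less_imp_le)
  qed
  ultimately have "Y s w \<in> {ereal c..ereal d}" by (rule closed_sequentially[OF closed_atLeastAtMost, rotated]) 
  then show ?thesis by simp
qed

text \<open>Y clamped to [c, d]. Clamping gives a real process with continuous paths at all times,
  including those at which Y may be infinite, and changes nothing up to \<tau>.\<close>

definition R where "R t w = (if w \<in> N\<^sub>0 then x\<^sub>0 else real_of_ereal (max (ereal c) (min (ereal d) (Y (max 0 t) w))))"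

lemma R_ereal: "w \<notin> N\<^sub>0 \<Longrightarrow> ereal (R t w) = max (ereal c) (min (ereal d) (Y (max 0 t) w))"
proof -
  assume wM: "w \<notin> N\<^sub>0"
  have "max (ereal c) (min (ereal d) (Y (max 0 t) w)) \<le> max (ereal c) (ereal d)" "ereal c \<le> max (ereal c) (min (ereal d) (Y (max 0 t) w))"
    by (auto simp: max_def)
  then have "\<bar>max (ereal c) (min (ereal d) (Y (max 0 t) w))\<bar> \<noteq> \<infinity>"
    by (auto simp: max_def min_def split: if_splits)
  then show ?thesis using wM by (simp add: R_def ereal_real)
qed

lemma R_range: "c \<le> R t w \<and> R t w \<le> d"
proof (cases "w \<in> N\<^sub>0")
  case False
  have "ereal c \<le> ereal (R t w) \<and> ereal (R t w) \<le> ereal d"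
    unfolding R_ereal[OF False] using cx xd by auto
  then show ?thesis by simp
qed (use cx xd in \<open>simp add: R_def\<close>)

lemma R_eq:
  assumes "good w" "0 \<le> s" "ereal s \<le> \<tau> w"
  shows "ereal (R s w) = Y s w" "R s w = real_of_ereal (Y s w)"
proof -
  show 1: "ereal (R s w) = Y s w"
    using tau_le[OF assms] R_ereal[OF goodD(2)[OF assms(1)], of s] assms(2) by (simp add: max_absorb2 min_absorb2)
  show "R s w = real_of_ereal (Y s w)" using 1 by (metis real_of_ereal.simps(1))
qed

text \<open>Clamping sends everything outside (c, d) to an endpoint. Leaving the interval thus
  becomes hitting one of two points, to which \<open>first_hit_opt\<close> applies.\<close>

lemma R_boundary: "good w \<Longrightarrow> 0 \<le> s \<Longrightarrow> Y s w \<notin> {ereal c<..<ereal d} \<longleftrightarrow> R s w = c \<or> R s w = d"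
proof -
  assume g: "good w" and s: "0 \<le> s"
  have "R s w = c \<longleftrightarrow> ereal (R s w) = ereal c" "R s w = d \<longleftrightarrow> ereal (R s w) = ereal d" by simp_all
  then show ?thesis
    unfolding R_ereal[OF goodD(2)[OF g]] using s cx xd by (auto simp: max_def min_def not_le)
qed

lemma R_cont: "w \<in> space M \<Longrightarrow> continuous_on {0..} (\<lambda>t. R t w)"
proof (cases "w \<in> N\<^sub>0")
  case False
  assume wM: "w \<in> space M"
  have "continuous_on {0..} (\<lambda>t. Y (max 0 t) w)"
    by (rule continuous_on_compose2[OF Y_cont[OF wM False]]) (auto intro!: continuous_intros)
  then have c: "continuous_on {0..} (\<lambda>t. max (ereal c) (min (ereal d) (Y (max 0 t) w)))"
    by (intro continuous_on_max continuous_on_min continuous_on_const)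
  have "continuous_on {0..} (\<lambda>t. real_of_ereal (max (ereal c) (min (ereal d) (Y (max 0 t) w))))"
  proof (rule continuous_on_compose2[OF continuous_on_real c])
    show "(\<lambda>t. max (ereal c) (min (ereal d) (Y (max 0 t) w))) ` {0..} \<subseteq> UNIV - {\<infinity>, -\<infinity>}"
    proof (rule image_subsetI)
      fix t
      show "max (ereal c) (min (ereal d) (Y (max 0 t) w)) \<in> UNIV - {\<infinity>, -\<infinity>}" unfolding R_ereal[OF False, symmetric] by simp
    qed
  qed
  then show ?thesis using False by (simp add: R_def)
qed (simp add: R_def)

lemma R_adapted: "0 \<le> t \<Longrightarrow> R t \<in> borel_measurable (G t)"
proof -
  assume t: "0 \<le> t"
  note [measurable] = Y_adapted[OF t] null_G[OF t null]
  have "R t = (\<lambda>w. if w \<in> N\<^sub>0 then x\<^sub>0 else real_of_ereal (max (ereal c) (min (ereal d) (Y t w))))"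
    using t by (auto simp: R_def fun_eq_iff)
  also have "\<dots> \<in> borel_measurable (G t)" by measurable
  finally show ?thesis .
qed

lemma R_prog: "prog R"
proof -
  have "(\<lambda>s w. R (max 0 s) w) = R" by (simp add: R_def fun_eq_iff)
  with prog_of_continuous[of R, OF R_adapted R_cont] show ?thesis by simp
qed

text \<open>The exit time capped at q, expressed by first hits in order to be optional. The value 0
  on the exceptional set switches off the coefficients there.\<close>

definition S where "S q w = (if w \<in> N\<^sub>0 then 0 else min (first_hit R q c w) (first_hit R q d w))"

lemma S_eq:
  assumes g: "good w" and q: "0 \<le> q"
  shows "ereal (S q w) = min (ereal q) (\<tau> w)"
proof -
  have "ereal (S q w) < ereal u \<longleftrightarrow> min (ereal q) (\<tau> w) < ereal u" for u
  proof -
    have "S q w < u \<longleftrightarrow> q < u \<or> (\<exists>s\<ge>0. s < u \<and> (R s w = c \<or> R s w = d))"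
      using goodD(2)[OF g] unfolding S_def first_hit_def
      by (auto simp: min_less_iff_disj cInf_less_iff[OF _ first_hit_bdd[OF q]])
    also have "\<dots> \<longleftrightarrow> q < u \<or> (\<exists>s\<ge>0. s < u \<and> Y s w \<notin> {ereal c<..<ereal d})"
      using R_boundary[OF g] by blast
    also have "\<dots> \<longleftrightarrow> min (ereal q) (\<tau> w) < ereal u"
      unfolding min_less_iff_disj exit_time_less_iff by simp
    finally show ?thesis by simp
  qed
  moreover have "0 \<le> \<tau> w" unfolding exit_time_def hit_time_def by (intro Inf_greatest) auto
  then have "\<bar>min (ereal q) (\<tau> w)\<bar> \<noteq> \<infinity>" using q by (auto simp: min_def)
  then obtain v where v: "min (ereal q) (\<tau> w) = ereal v" by (metis ereal_real)
  ultimately have "S q w < u \<longleftrightarrow> v < u" for u by simp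
  then have "S q w = v" by (metis less_irrefl linorder_less_linear)
  then show ?thesis using v by simp
qed

lemma S_stopped: "good w \<Longrightarrow> 0 \<le> q \<Longrightarrow> S q w = stopped_at q (\<tau> w)"
  unfolding stopped_at_def using S_eq by (metis real_of_ereal.simps(1))

lemma S_bounds: "0 \<le> q \<Longrightarrow> w \<in> space M \<Longrightarrow> 0 \<le> S q w \<and> S q w \<le> q"
proof -
  assume q: "0 \<le> q" and wM: "w \<in> space M"
  have "0 \<le> first_hit R q y w" for y unfolding first_hit_def using q by (intro cInf_greatest) auto
  then show ?thesis using first_hit_le(1)[OF q, of R] q by (auto simp: S_def min_def)
qed

lemma S_opt: "0 \<le> q \<Longrightarrow> opt (S q)"
proof -
  assume q: "0 \<le> q"
  have o: "opt (\<lambda>w. min (first_hit R q c w) (first_hit R q d w))"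
    by (intro opt_min first_hit_opt R_prog R_cont q)
  show ?thesis unfolding opt_def
  proof (intro conjI ballI allI impI)
    show "0 \<le> S q w" if "w \<in> space M" for w using S_bounds[OF q that] by simp
    fix t :: real assume t: "0 \<le> t"
    show "{w \<in> space M. S q w < t} \<in> sets (G t)"
    proof (cases "t = 0")
      case True
      then have "{w \<in> space M. S q w < t} = {}" using S_bounds[OF q] by (auto simp: not_less)
      then show ?thesis by (simp only: sets.empty_sets)
    next
      case False
      then have "{w \<in> space M. S q w < t}
          = N\<^sub>0 \<inter> space M \<union> {w \<in> space M. min (first_hit R q c w) (first_hit R q d w) < t} - N\<^sub>0 \<union> N\<^sub>0 \<inter> space M"
        using t unfolding S_def by auto
      moreover have "N\<^sub>0 \<in> sets (G t)" using null_G[OF t null] .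
      moreover have "{w \<in> space M. min (first_hit R q c w) (first_hit R q d w) < t} \<in> sets (G t)" using o t unfolding opt_def by blast
      ultimately show ?thesis using space_in_G[OF t] by (simp add: sets.Int sets.Un sets.Diff)
    qed
  qed
qed

definition X where "X t w = R (S (max 0 t) w) w"
text \<open>The cap in \<open>S s\<close> is s itself, so no horizon has to be fixed: on good paths
  and for s > 0 this says s \<le> \<tau>. Time 0 is left out because \<open>S\<close> is 0 on the
  exceptional set, where \<open>alive\<close> has to vanish identically.\<close>

definition alive where "alive s w = (of_bool (0 < s \<and> s \<le> S s w) :: real)"
definition a where "a s w = alive s w * (indicator (einterval l r) (X s w) * \<sigma> (X s w))"
definition b where "b s w = alive s w * (indicator (einterval l r) (X s w) * \<mu> (X s w))"
text \<open>Defined as the remainder, so that the equation for X holds on every path;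
  \<open>ito_N\<close> then shows that it is the Ito integral of \<open>a\<close>.\<close>

definition N where "N t w = X t w - x\<^sub>0 - (LINT s:{0..t}|lborel. b s w)"

lemma X_range: "c \<le> X t w \<and> X t w \<le> d" unfolding X_def by (rule R_range)

lemma X_J: "indicator (einterval l r) (X t w) = (1::real)"
  using cd_J[of "X t w"] X_range[of t w] by simp

lemma alive_good: "good w \<Longrightarrow> 0 < s \<Longrightarrow> alive s w = of_bool (ereal s \<le> \<tau> w)"
proof -
  assume g: "good w" and s: "0 < s"
  have "s \<le> S s w \<longleftrightarrow> ereal s \<le> ereal (S s w)" by simp
  also have "\<dots> \<longleftrightarrow> ereal s \<le> \<tau> w" unfolding S_eq[OF g less_imp_le[OF s]] by simp
  finally show ?thesis using s by (simp add: alive_def)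
qed

lemma alive_bad: "w \<in> N\<^sub>0 \<Longrightarrow> alive s w = 0"
  by (simp add: alive_def S_def)

lemma X_stopped: "good w \<Longrightarrow> 0 \<le> t \<Longrightarrow> X t w = real_of_ereal (Y (stopped_at t (\<tau> w)) w)"
proof -
  assume g: "good w" and t: "0 \<le> t"
  have "ereal (S t w) \<le> \<tau> w" unfolding S_eq[OF g t] by simp
  then have "R (S t w) w = real_of_ereal (Y (S t w) w)"
    using S_bounds[OF t goodD(1)[OF g]] by (intro R_eq(2)[OF g]) auto
  then show ?thesis using t S_stopped[OF g t] by (simp add: X_def)
qed

lemma X_before: "good w \<Longrightarrow> 0 \<le> t \<Longrightarrow> ereal t \<le> \<tau> w \<Longrightarrow> ereal (X t w) = Y t w"
  using X_stopped[of w t] R_eq[of w t] by (simp add: stopped_at_id)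

lemma X_bad: "w \<in> N\<^sub>0 \<Longrightarrow> X t w = x\<^sub>0"
  by (simp add: X_def R_def)

lemma X_0: "w \<in> space M \<Longrightarrow> X 0 w = x\<^sub>0"
proof (cases "w \<in> N\<^sub>0")
  case False
  assume wM: "w \<in> space M"
  have "S 0 w = 0" using S_bounds[OF order_refl wM] by simp
  moreover have "ereal (R 0 w) = ereal x\<^sub>0" unfolding R_ereal[OF False] using Y_0[OF wM False] cx xd by (simp add: max_absorb2 min_absorb2)
  ultimately show ?thesis by (simp add: X_def)
qed (rule X_bad)

lemma X_cont: "w \<in> space M \<Longrightarrow> continuous_on {0..} (\<lambda>t. X t w)"
proof (cases "w \<in> N\<^sub>0")
  case False
  assume wM: "w \<in> space M"
  then have g: "good w" using False by (simp add: good_def)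
  have "continuous_on {0..} (\<lambda>t. S t w)"
  proof (cases "\<tau> w")
    case (real v)
    have "S t w = min t v" if "0 \<le> t" for t
    proof -
      have "ereal (S t w) = ereal (min t v)" unfolding S_eq[OF g that] real ereal_min ..
      then show ?thesis unfolding ereal.inject .
    qed
    moreover have "continuous_on {0..} (\<lambda>t. min t v)" by (intro continuous_intros)
    ultimately show ?thesis by (simp cong: continuous_on_cong_simp)
  next
    case PInf
    have "S t w = t" if "0 \<le> t" for t
    proof -
      have "ereal (S t w) = ereal t" unfolding S_eq[OF g that] PInf by simp
      then show ?thesis by simp
    qed
    then show ?thesis using continuous_on_id by (simp cong: continuous_on_cong_simp)
  next
    case MInf
    have "0 \<le> \<tau> w" unfolding exit_time_def hit_time_def by (intro Inf_greatest) auto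
    then show ?thesis using MInf by simp
  qed
  then have "continuous_on {0..} (\<lambda>t. R (S t w) w)"
    by (rule continuous_on_compose2[OF R_cont[OF wM]]) (use S_bounds[OF _ wM] in auto)
  then show ?thesis by (rule continuous_on_cong[THEN iffD1, OF refl, rotated]) (simp add: X_def)
qed (simp add: X_bad)

lemma X_adapted: "0 \<le> t \<Longrightarrow> X t \<in> borel_measurable (G t)"
proof -
  assume t: "0 \<le> t"
  show ?thesis
    by (rule measurable_cong[THEN iffD1, OF _ prog_stopped[OF R_prog S_opt[OF t] t]])
      (use S_bounds[OF t] t in \<open>simp add: X_def min_absorb2\<close>)
qed

lemma X_prog: "prog X"
proof -
  have "(\<lambda>s w. X (max 0 s) w) = X" by (simp add: X_def fun_eq_iff)
  with prog_of_continuous[of X, OF X_adapted X_cont] show ?thesis by simp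
qed

text \<open>For 0 < s \<le> t the cap may be raised from s to t: on good paths both tests mean s
  \<le> \<tau>, and on the exceptional set both fail.\<close>

lemma alive_prog: "prog alive"
proof (rule progI)
  fix t :: real assume t: "0 \<le> t"
  note [measurable] = opt_min_adapted[OF S_opt[OF t] t]
  have m: "(\<lambda>z :: real \<times> 'a. of_bool (0 < fst z \<and> fst z \<le> min t (S t (snd z)))) \<in> borel_measurable (borel \<Otimes>\<^sub>M G t)"
    by measurable
  show "(\<lambda>z. alive (fst z) (snd z) * indicator {..t} (fst z)) \<in> borel_measurable (borel \<Otimes>\<^sub>M G t)"
  proof (rule measurable_cong[THEN iffD1, OF _ m])
    fix z :: "real \<times> 'a" assume "z \<in> space (borel \<Otimes>\<^sub>M G t)"
    then have wM: "snd z \<in> space M" using t by (auto simp: space_pair_measure)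
    show "(of_bool (0 < fst z \<and> fst z \<le> min t (S t (snd z))) :: real) = alive (fst z) (snd z) * indicator {..t} (fst z)"
    proof (cases "snd z \<in> N\<^sub>0")
      case True
      then show ?thesis by (auto simp: alive_bad S_def)
    next
      case False
      then have g: "good (snd z)" using wM by (simp add: good_def)
      show ?thesis
      proof (cases "0 < fst z \<and> fst z \<le> t")
        case True
        have "fst z \<le> S t (snd z) \<longleftrightarrow> ereal (fst z) \<le> ereal (S t (snd z))" by simp
        also have "\<dots> \<longleftrightarrow> ereal (fst z) \<le> \<tau> (snd z)" unfolding S_eq[OF g t] using True by simp
        finally show ?thesis using True alive_good[OF g] by auto
      next
        case False
        then show ?thesis by (auto simp: alive_def indicator_def)
      qed
    qed
  qed
qed

lemma a_prog: "prog a"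
  unfolding a_def[abs_def] by (rule prog_mult[OF alive_prog prog_compose[OF X_prog \<sigma>_measurable]])

lemma b_prog: "prog b"
  unfolding b_def[abs_def] by (rule prog_mult[OF alive_prog prog_compose[OF X_prog \<mu>_measurable]])

lemma X_alive: "good w \<Longrightarrow> 0 < s \<Longrightarrow> alive s w * f (X s w) = of_bool (ereal s \<le> \<tau> w) * f (real_of_ereal (Y s w))"
proof (cases "ereal s \<le> \<tau> w")
  case True
  assume g: "good w" and s: "0 < s"
  have "X s w = real_of_ereal (Y s w)"
    using X_before[OF g less_imp_le[OF s] True] by (metis real_of_ereal.simps(1))
  then show ?thesis using alive_good[OF g s] by simp
qed (simp add: alive_good)

lemma a_good: "good w \<Longrightarrow> 0 < s \<Longrightarrow> a s w = of_bool (ereal s \<le> \<tau> w) * \<sigma> (real_of_ereal (Y s w))"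
  unfolding a_def X_J using X_alive[of w s \<sigma>] by simp

lemma b_good: "good w \<Longrightarrow> 0 < s \<Longrightarrow> b s w = of_bool (ereal s \<le> \<tau> w) * \<mu> (real_of_ereal (Y s w))"
  unfolding b_def X_J using X_alive[of w s \<mu>] by simp

lemma N_good: "good w \<Longrightarrow> 0 \<le> t \<Longrightarrow> N t w = I\<^sub>0 t w"
proof -
  assume g: "good w" and t: "0 \<le> t"
  have "(LINT s:{0..t}|lborel. b s w) = (LINT s:{0..t}|lborel. of_bool (ereal s \<le> \<tau> w) * \<mu> (real_of_ereal (Y s w)))"
    by (rule set_lebesgue_integral_cong_pos[OF prog_section[OF b_prog goodD(1)[OF g]] b_good[OF g]])
  then show ?thesis unfolding N_def X_stopped[OF g t] using sde_eq[OF goodD[OF g] t] by simp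
qed

lemma N_bad: "w \<in> N\<^sub>0 \<Longrightarrow> N t w = 0"
  by (simp add: N_def X_bad b_def alive_bad set_lebesgue_integral_def)

lemma N_adapted: "0 \<le> t \<Longrightarrow> N t \<in> borel_measurable (G t)"
  unfolding N_def[abs_def]
  by (intro borel_measurable_diff borel_measurable_const prog_lebesgue_integral[OF b_prog] X_adapted)

lemma N_cont: "w \<in> space M \<Longrightarrow> continuous_on {0..} (\<lambda>t. N t w)"
proof (cases "w \<in> N\<^sub>0")
  case False
  assume wM: "w \<in> space M"
  have "N t w = I\<^sub>0 t w" if "t \<in> {0..}" for t using N_good[of w t] wM False that by (simp add: good_def)
  then show ?thesis using I0_cont[OF wM False] by (simp cong: continuous_on_cong_simp)
qed (simp add: N_bad)

lemma ito_N: "ito a N"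
  unfolding ito_def
proof (intro conjI a_prog allI impI ballI N_adapted N_cont exI)
  show "ito_approx a N e E"
  proof (rule ito_approx_cong[OF approx])
    show "AE w in M. \<forall>s>0. a s w = of_bool (ereal s \<le> \<tau> w) * \<sigma> (real_of_ereal (Y s w))"
      using AE_good by eventually_elim (simp add: a_good)
    show "AE w in M. \<forall>t\<ge>0. N t w = I\<^sub>0 t w"
      using AE_good by eventually_elim (simp add: N_good)
  qed
qed

lemma elem_e: "elem (e n) (E n)"
  using approx by (simp add: ito_approx_def)

text \<open>Some elementary integrand has energy distance less than 1 from \<open>a\<close> on
  [0, t], and it is bounded.\<close>

lemma a_int:
  assumes wM: "w \<in> space M" and t: "0 \<le> t"
  shows "(\<integral>\<^sup>+s\<in>{0..t}. ennreal ((a s w)\<^sup>2) \<partial>lborel) < \<infinity>"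
proof (cases "w \<in> N\<^sub>0")
  case True
  then show ?thesis by (simp add: a_def alive_bad)
next
  case False
  then have g: "good w" using wM by (simp add: good_def)
  note [measurable] = prog_section[OF a_prog wM] prog_section[OF elem_prog[OF elem_e] wM]
  have "(\<integral>\<^sup>+s\<in>{0..t}. ennreal ((e n s w - a s w)\<^sup>2) \<partial>lborel)
      = (\<integral>\<^sup>+s\<in>{0..t}. ennreal ((e n s w - of_bool (ereal s \<le> \<tau> w) * \<sigma> (real_of_ereal (Y s w)))\<^sup>2) \<partial>lborel)" for n
    by (rule set_nn_integral_cong_pos) (simp add: a_good[OF g])
  then have "(\<lambda>n. \<integral>\<^sup>+s\<in>{0..t}. ennreal ((e n s w - a s w)\<^sup>2) \<partial>lborel) \<longlonglongrightarrow> 0"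
    using approx_conv[OF wM False t] by simp
  from order_tendstoD(2)[OF this, of 1] obtain n where n: "(\<integral>\<^sup>+s\<in>{0..t}. ennreal ((e n s w - a s w)\<^sup>2) \<partial>lborel) < 1"
    by (auto simp: eventually_sequentially)
  obtain C where C: "\<And>s. \<bar>e n s w\<bar> \<le> C" using elem_bounded[OF elem_e, of n] wM by blast
  have e2: "(e n s w)\<^sup>2 \<le> C\<^sup>2" for s using C[of s] by (metis abs_ge_zero power2_abs power_mono)
  have "(\<integral>\<^sup>+s\<in>{0..t}. ennreal ((a s w)\<^sup>2) \<partial>lborel)
      \<le> (\<integral>\<^sup>+s. 2 * (ennreal ((e n s w - a s w)\<^sup>2) * indicator {0..t} s) + 2 * (ennreal (C\<^sup>2) * indicator {0..t} s) \<partial>lborel)"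
  proof (rule nn_integral_mono)
    fix s
    have "(a s w)\<^sup>2 \<le> 2 * (e n s w)\<^sup>2 + 2 * (e n s w - a s w)\<^sup>2"
      using two_square_bound(2)[of "e n s w" "e n s w - a s w"] by simp
    then have "(a s w)\<^sup>2 \<le> 2 * (e n s w - a s w)\<^sup>2 + 2 * C\<^sup>2" using e2[of s] by linarith
    then have "ennreal ((a s w)\<^sup>2) \<le> ennreal (2 * (e n s w - a s w)\<^sup>2 + 2 * C\<^sup>2)" by (rule ennreal_leI)
    also have "\<dots> = 2 * ennreal ((e n s w - a s w)\<^sup>2) + 2 * ennreal (C\<^sup>2)" by (simp add: ennreal_mult)
    finally show "ennreal ((a s w)\<^sup>2) * indicator {0..t} s \<le> 2 * (ennreal ((e n s w - a s w)\<^sup>2) * indicator {0..t} s) + 2 * (ennreal (C\<^sup>2) * indicator {0..t} s)"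
      by (simp add: indicator_def)
  qed
  also have "\<dots> = 2 * (\<integral>\<^sup>+s\<in>{0..t}. ennreal ((e n s w - a s w)\<^sup>2) \<partial>lborel) + 2 * (ennreal (C\<^sup>2) * ennreal t)"
    using t by (subst nn_integral_add) (simp_all add: nn_integral_cmult nn_integral_cmult_indicator)
  also have "\<dots> < \<infinity>"
    using n order.strict_trans[OF n] by (simp add: ennreal_mult_less_top)
  finally show ?thesis .
qed

lemma b_int:
  assumes wM: "w \<in> space M" and t: "0 \<le> t"
  shows "(\<integral>\<^sup>+s\<in>{0..t}. ennreal \<bar>b s w\<bar> \<partial>lborel) < \<infinity>"
proof (cases "w \<in> N\<^sub>0")
  case True
  then show ?thesis by (simp add: b_def alive_bad)
next
  case False
  then have g: "good w" using wM by (simp add: good_def)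
  let ?f = "\<lambda>s. of_bool (ereal s \<le> \<tau> w) * \<mu> (real_of_ereal (Y s w))"
  have "(\<integral>\<^sup>+s\<in>{0..t}. ennreal \<bar>b s w\<bar> \<partial>lborel) = (\<integral>\<^sup>+s\<in>{0..t}. ennreal \<bar>?f s\<bar> \<partial>lborel)"
    by (rule set_nn_integral_cong_pos) (simp add: b_good[OF g])
  also have "\<dots> = (\<integral>\<^sup>+s. ennreal (norm (indicator {0..t} s *\<^sub>R ?f s)) \<partial>lborel)"
    by (rule nn_integral_cong) (auto simp: indicator_def)
  also have "\<dots> < \<infinity>" using sde_integrable[OF wM False t] unfolding set_integrable_def integrable_iff_bounded by blast
  finally show ?thesis .
qed

definition \<psi> where "\<psi> y = \<bar>indicator (einterval l r) y * \<mu> y\<bar> / (indicator (einterval l r) y * \<sigma> y)\<^sup>2"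

lemma \<psi>_measurable: "\<psi> \<in> borel_measurable borel"
proof -
  note [measurable] = \<sigma>_measurable \<mu>_measurable
  show ?thesis unfolding \<psi>_def[abs_def] by measurable
qed

lemma \<psi>_integrable: "integrable lborel (\<lambda>y. indicator {c..d} y * \<psi> y)"
proof -
  have "indicator {c..d} y * \<psi> y = \<bar>indicator {c..d} y *\<^sub>R (\<mu> y / (\<sigma> y)\<^sup>2)\<bar>" for y
    using cd_J[of y] by (auto simp: \<psi>_def indicator_def abs_mult)
  then show ?thesis using integrable_abs[OF drift_integrable[unfolded set_integrable_def]] by simp
qed

lemma b_eq: "\<bar>b s w\<bar> = \<psi> (X s w) * (a s w)\<^sup>2"
proof -
  have "\<sigma> (X s w) \<noteq> 0" using \<sigma>_nonzero cd_J X_range by auto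
  then show ?thesis unfolding b_def a_def \<psi>_def X_J by (simp add: alive_def abs_mult power_mult_distrib)
qed

text \<open>If the exit time were at most s, absorption would keep Y at an endpoint at all times
  after s, and continuity would place \<open>Y s\<close> there too. Arguing at times after s avoids
  the question whether the infimum is attained.\<close>

lemma exit_absorb:
  assumes g: "good w" and s: "0 \<le> s" "Y s w \<in> {l<..<r}"
  shows "ereal s < exit_time Y l r w"
proof (rule ccontr)
  assume n: "\<not> ereal s < exit_time Y l r w"
  have ex: "\<exists>u\<ge>0. u < s + e \<and> Y u w \<in> {l, r}" if "0 < e" for e
  proof -
    have "exit_time Y l r w < ereal (s + e)" using n that by (simp add: not_less le_less_trans)
    then obtain u where "0 \<le> u" "u < s + e" "Y u w \<notin> {l<..<r}" unfolding exit_time_less_iff by auto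
    then show ?thesis using Y_range[OF goodD[OF g], of u] by auto
  qed
  show False
  proof -
    define u where "u n = s + 1 / real (Suc n)" for n
    have "Y (u n) w \<in> {l, r}" for n
    proof -
      obtain v where v: "0 \<le> v" "v < u n" "Y v w \<in> {l, r}" using ex[of "1 / real (Suc n)"] by (auto simp: u_def)
      then show ?thesis using Y_absorb[OF goodD[OF g] v(1) _ v(3), of "u n"] by auto
    qed
    moreover have "(\<lambda>n. Y (u n) w) \<longlonglongrightarrow> Y s w"
    proof (rule continuous_on_tendsto_compose[OF Y_cont[OF goodD[OF g]]])
      show "u \<longlonglongrightarrow> s" unfolding u_def using tendsto_add[OF tendsto_const[of s] LIMSEQ_inverse_real_of_nat] by (simp add: inverse_eq_divide)
    qed (use s in \<open>auto simp: u_def\<close>)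
    moreover have "closed {l, r}" by (intro finite_imp_closed) simp
    ultimately have "Y s w \<in> {l, r}" by (rule closed_sequentially[rotated])
    then show False using s(2) by (simp only: insert_iff empty_iff) auto
  qed
qed

text \<open>Monotonicity of the local time is given strictly before the exit from J, and a path
  stopped inside [c, d] has not left J.\<close>

lemma stopped_alive:
  assumes g: "good w" and t: "0 \<le> t"
  shows "ereal (S t w) < exit_time Y l r w"
proof (rule exit_absorb[OF g])
  show "0 \<le> S t w" using S_bounds[OF t goodD(1)[OF g]] by simp
  then have "ereal c \<le> Y (S t w) w \<and> Y (S t w) w \<le> ereal d" by (intro tau_le[OF g]) (simp_all add: S_eq[OF g t])
  then show "Y (S t w) w \<in> {l<..<r}" using less_le_trans[OF lc] le_less_trans[OF _ dr] by auto
qed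

section \<open>Tanaka's formula for the stopped process\<close>

definition tanaka_data where
  "tanaka_data y J \<longleftrightarrow> ito (\<lambda>s w. of_bool (y < X s w) * a s w) J \<and>
     (AE w in M. \<forall>t\<ge>0. 2 * (max 0 (X t w - y) - max 0 (x\<^sub>0 - y) - (LINT s:{0..t}|lborel. of_bool (y < X s w) * b s w) - J t w) = L (stopped_at t (\<tau> w)) y w)"

lemma gate_prog: "prog k \<Longrightarrow> prog (\<lambda>s w. of_bool (y < X s w) * k s w)"
  using prog_mult[OF prog_compose[OF X_prog, of "\<lambda>x. of_bool (y < x)"]] by simp

lemma gate_good:
  assumes g: "good w" and s: "0 < s" 
  shows "of_bool (y < X s w) * (of_bool (ereal s \<le> \<tau> w) * z) = (of_bool (ereal s \<le> \<tau> w) * of_bool (ereal y < Y s w) * z :: real)"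
proof (cases "ereal s \<le> \<tau> w")
  case True
  show ?thesis unfolding X_before[OF g less_imp_le[OF s] True, symmetric] by simp
qed simp

lemma tanaka_data_exists:
  assumes y: "y \<in> einterval l r"
  shows "\<exists>J. tanaka_data y J"
proof -
  from tanaka_formula[OF y] obtain I' e' E' where
    ap: "ito_approx (\<lambda>s w. of_bool (ereal s \<le> \<tau> w) * of_bool (ereal y < Y s w) * \<sigma> (real_of_ereal (Y s w))) I' e' E'"
    and tf: "AE w in M. \<forall>t\<ge>0. max 0 (real_of_ereal (Y (stopped_at t (\<tau> w)) w) - y) - max 0 (x\<^sub>0 - y) - L (stopped_at t (\<tau> w)) y w / 2
         = (LINT s:{0..t}|lborel. of_bool (ereal s \<le> \<tau> w) * of_bool (ereal y < Y s w) * \<mu> (real_of_ereal (Y s w))) + I' t w"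
    by blast
  have "ito_approx (\<lambda>s w. of_bool (y < X s w) * a s w) I' e' E'"
  proof (rule ito_approx_cong[OF ap])
    show "AE w in M. \<forall>s>0. of_bool (y < X s w) * a s w = of_bool (ereal s \<le> \<tau> w) * of_bool (ereal y < Y s w) * \<sigma> (real_of_ereal (Y s w))"
      using AE_good by eventually_elim (simp only: a_good gate_good simp_thms cong: imp_cong)
  qed simp
  from ito_of_approx[OF this gate_prog[OF a_prog]] obtain J
    where J: "ito (\<lambda>s w. of_bool (y < X s w) * a s w) J" "AE w in M. \<forall>t\<ge>0. J t w = I' t w" .
  have "AE w in M. \<forall>t\<ge>0. 2 * (max 0 (X t w - y) - max 0 (x\<^sub>0 - y) - (LINT s:{0..t}|lborel. of_bool (y < X s w) * b s w) - J t w) = L (stopped_at t (\<tau> w)) y w"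
    using AE_good tf J(2)
  proof eventually_elim
    case (elim w)
    show ?case
    proof (intro allI impI)
      fix t :: real assume t: "0 \<le> t"
      have "(LINT s:{0..t}|lborel. of_bool (y < X s w) * b s w)
          = (LINT s:{0..t}|lborel. of_bool (ereal s \<le> \<tau> w) * of_bool (ereal y < Y s w) * \<mu> (real_of_ereal (Y s w)))"
        by (rule set_lebesgue_integral_cong_pos[OF prog_section[OF gate_prog[OF b_prog] goodD(1)[OF elim(1)]]])
          (simp only: b_good[OF elim(1)] gate_good[OF elim(1)])
      then show "2 * (max 0 (X t w - y) - max 0 (x\<^sub>0 - y) - (LINT s:{0..t}|lborel. of_bool (y < X s w) * b s w) - J t w) = L (stopped_at t (\<tau> w)) y w"
        using elim(2,3) t X_stopped[OF elim(1) t] by (simp add: algebra_simps)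
    qed
  qed
  then show ?thesis using J(1) unfolding tanaka_data_def by blast
qed

text \<open>Tanaka's formula provides an integral for each level separately; a choice makes them one
  family.\<close>

definition I where "I y = (SOME J. tanaka_data y J)"

lemma I: "y \<in> einterval l r \<Longrightarrow> tanaka_data y (I y)"
  unfolding I_def by (rule someI_ex[OF tanaka_data_exists])

lemma tanaka_L: "y \<in> einterval l r \<Longrightarrow> AE w in M. \<forall>t\<ge>0. tanaka X b x\<^sub>0 I y t w = L (stopped_at t (\<tau> w)) y w"
  using I unfolding tanaka_data_def tanaka_def by blast

lemma tanaka_0:
  assumes "y \<in> einterval l r"
  shows "AE w in M. tanaka X b x\<^sub>0 I y 0 w = 0"
proof -
  have "AE w in M. I y 0 w = 0" using I[OF assms] ito_zero unfolding tanaka_data_def by blast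
  then show ?thesis
    using AE_space
  proof eventually_elim
    case (elim w)
    have "(LINT s:{0..0}|lborel. of_bool (y < X s w) * b s w) = 0"
      unfolding set_lebesgue_integral_def
      by (rule integral_eq_zero_AE) (use AE_lborel_singleton[of 0] in \<open>eventually_elim, auto simp: indicator_def\<close>)
    then show ?case using elim X_0[OF elim(2)] by (simp add: tanaka_def)
  qed
qed

text \<open>The expression equals L at the stopped time and inherits its monotonicity; nonnegativity
  follows from the value 0 at time 0.\<close>

lemma tanaka_mono:
  assumes y: "y \<in> einterval l r"
  shows "AE w in M. \<forall>s t. 0 \<le> s \<and> s \<le> t \<longrightarrow> 0 \<le> tanaka X b x\<^sub>0 I y s w \<and> tanaka X b x\<^sub>0 I y s w \<le> tanaka X b x\<^sub>0 I y t w"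
  using AE_good tanaka_L[OF y] tanaka_0[OF y] L_mono[OF y]
proof eventually_elim
  case (elim w)
  have m: "tanaka X b x\<^sub>0 I y s w \<le> tanaka X b x\<^sub>0 I y t w" if st: "0 \<le> s" "s \<le> t" for s t
  proof -
    have t: "0 \<le> t" using st by simp
    have "ereal (S s w) \<le> ereal (S t w)" unfolding S_eq[OF elim(1) st(1)] S_eq[OF elim(1) t]
      using st(2) by (intro min.mono) simp_all
    then have "L (S s w) y w \<le> L (S t w) y w"
      using stopped_alive[OF elim(1) st(1)] stopped_alive[OF elim(1) t] S_bounds[OF st(1) goodD(1)[OF elim(1)]] S_bounds[OF t goodD(1)[OF elim(1)]]
      by (intro mono_onD[OF elim(4)]) simp_all
    then show ?thesis using elim(2) st t S_stopped[OF elim(1)] by simp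
  qed
  show ?case
  proof (intro allI impI conjI)
    fix s t :: real assume "0 \<le> s \<and> s \<le> t"
    then show "0 \<le> tanaka X b x\<^sub>0 I y s w" "tanaka X b x\<^sub>0 I y s w \<le> tanaka X b x\<^sub>0 I y t w"
      using m[of 0 s] m[of s t] elim(3) by auto
  qed
qed

lemma tanaka_diffusion: "tanaka_diffusion M G W X N a b c d x\<^sub>0 \<psi> I (einterval l r)"
proof (intro tanaka_diffusion.intro tanaka_diffusion_axioms.intro bm_filtration_axioms)
  show "c \<le> X t w \<and> X t w \<le> d" for t w by (rule X_range)
  show "X t w = x\<^sub>0 + (LINT s:{0..t}|lborel. b s w) + N t w" for t w by (simp add: N_def)
  show "{c..d} \<subseteq> einterval l r" using cd_J by blast
  show "0 \<le> \<psi> y" for y by (simp add: \<psi>_def)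
  show "ito (\<lambda>s w. of_bool (y < X s w) * a s w) (I y)" if "y \<in> einterval l r" for y
    using I[OF that] by (simp add: tanaka_data_def)
qed (rule X_prog X_cont X_0 b_prog ito_N a_int b_int \<psi>_measurable \<psi>_integrable b_eq tanaka_mono; assumption)+

sublocale D: tanaka_diffusion M G W X N a b c d x\<^sub>0 \<psi> I "einterval l r"
  by (rule tanaka_diffusion)

section \<open>Transfer to the local time of Y up to the exit from [c, d]\<close>

lemma lt_L: "y \<in> einterval l r \<Longrightarrow> AE w in M. \<forall>t\<ge>0. ereal t \<le> \<tau> w \<longrightarrow> tanaka X b x\<^sub>0 I y t w = L t y w"
  using tanaka_L by (rule AE_mp) (auto simp: stopped_at_id)

theorem local_time_off_range:
  assumes y: "y \<in> einterval l r"
  shows "AE w in M. \<forall>t\<ge>0. ereal t \<le> \<tau> w \<longrightarrow>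
    ((\<forall>s. 0 \<le> s \<and> s \<le> t \<longrightarrow> Y s w < ereal y) \<or> (\<forall>s. 0 \<le> s \<and> s \<le> t \<longrightarrow> ereal y < Y s w)) \<longrightarrow> L t y w = 0"
  using AE_good D.lt_below[OF y] D.lt_above[OF y] lt_L[OF y]
proof eventually_elim
  case (elim w)
  show ?case
  proof (intro allI impI)
    fix t assume t: "0 \<le> t" "ereal t \<le> \<tau> w"
      and yr: "(\<forall>s. 0 \<le> s \<and> s \<le> t \<longrightarrow> Y s w < ereal y) \<or> (\<forall>s. 0 \<le> s \<and> s \<le> t \<longrightarrow> ereal y < Y s w)"
    have X: "Y s w = ereal (X s w)" if "0 \<le> s \<and> s \<le> t" for s
      using X_before[OF elim(1), of s] that t(2) by (metis ereal_less_eq(3) order_trans)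
    have "(\<forall>s. 0 \<le> s \<and> s \<le> t \<longrightarrow> X s w < y) \<or> (\<forall>s. 0 \<le> s \<and> s \<le> t \<longrightarrow> y < X s w)"
      using yr X by auto
    then have "tanaka X b x\<^sub>0 I y t w = 0" using elim(2,3) t(1) by blast
    then show "L t y w = 0" using elim(4) t by simp
  qed
qed

theorem local_time_positive:
  assumes x: "c < x" "x < d"
  shows "AE w in M. \<forall>s t. 0 \<le> s \<and> s < t \<and> ereal t \<le> \<tau> w \<and> Y s w = ereal x \<longrightarrow> 0 < L t x w"
proof -
  have xJ: "x \<in> einterval l r" using cd_J[of x] x by simp
  have alive: "a s w \<noteq> 0" if wM: "w \<in> space M" and s: "0 < s" "s \<le> S q w" and q: "0 \<le> q" for q s w
  proof -
    have g: "good w" using s wM by (cases "w \<in> N\<^sub>0") (simp_all add: S_def good_def)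
    have "ereal s \<le> min (ereal q) (\<tau> w)" unfolding S_eq[OF g q, symmetric] using s(2) by simp
    then have "alive s w = 1" using alive_good[OF g s(1)] by simp
    moreover have "\<sigma> (X s w) \<noteq> 0" using \<sigma>_nonzero cd_J X_range by auto
    ultimately show ?thesis by (simp add: a_def X_J)
  qed
  \<comment> \<open>\<open>lt_positive\<close> has a finite horizon; integer horizons exhaust all
    times and share one null set.\<close>
  have "AE w in M. \<forall>s t. 0 \<le> s \<and> s < t \<and> t \<le> S (real (Suc n)) w \<and> X s w = x \<longrightarrow> 0 < tanaka X b x\<^sub>0 I x t w" for n
  proof (rule D.lt_positive[OF x, where q = "real (Suc n)"])
    show "opt (S (real (Suc n)))" by (rule S_opt) simp
    show "S (real (Suc n)) w \<le> real (Suc n)" if "w \<in> space M" for w using S_bounds[OF _ that, of "real (Suc n)"] by simp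
    show "a s w \<noteq> 0" if "w \<in> space M" "0 < s" "s \<le> S (real (Suc n)) w" for s w by (rule alive[OF that]) simp
  qed simp
  then have "AE w in M. \<forall>n. \<forall>s t. 0 \<le> s \<and> s < t \<and> t \<le> S (real (Suc n)) w \<and> X s w = x \<longrightarrow> 0 < tanaka X b x\<^sub>0 I x t w"
    by (simp only: AE_all_countable) blast
  then show ?thesis
    using AE_good lt_L[OF xJ]
  proof eventually_elim
    case (elim w)
    show ?case
    proof (intro allI impI)
      fix s t assume st: "0 \<le> s \<and> s < t \<and> ereal t \<le> \<tau> w \<and> Y s w = ereal x"
      obtain n where "t \<le> real n" using real_arch_simple by blast
      then have n: "t \<le> real (Suc n)" by simp
      have "ereal t \<le> ereal (S (real (Suc n)) w)" unfolding S_eq[OF elim(2) of_nat_0_le_iff] using st n by simp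
      then have "t \<le> S (real (Suc n)) w" by (simp only: ereal_less_eq)
      moreover have "ereal s \<le> \<tau> w" using st by (meson ereal_less_eq(3) less_imp_le order_trans)
      then have "ereal (X s w) = ereal x" using X_before[OF elim(2), of s] st by simp
      then have "X s w = x" by (simp only: ereal.inject)
      ultimately have "0 < tanaka X b x\<^sub>0 I x t w" using elim(1) st by blast
      then show "0 < L t x w" using elim(3) st by simp
    qed
  qed
qed

text \<open>\<open>lt_left_continuous\<close> speaks of one bounded optional time. For every
  rational t the countably many budgets share a null set, and on each path the budget time equals t
  for some K.\<close>

theorem local_time_left_limit:
  assumes x: "c < x" "x < d" and y: "\<And>n. y n \<in> einterval l r" "\<And>n. y n < x" "y \<longlonglongrightarrow> x"
  shows "AE w in M. \<forall>t\<in>\<rat>. 0 < t \<and> ereal t \<le> \<tau> w \<longrightarrow> (\<forall>z. (\<lambda>n. L t (y n) w) \<longlonglongrightarrow> z \<longrightarrow> z = L t x w)"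
proof -
  have xJ: "x \<in> einterval l r" using cd_J[of x] x by simp
  have "AE w in M. \<forall>t\<in>\<rat>. 0 < t \<longrightarrow> (\<forall>K::nat. \<forall>z. (\<lambda>n. tanaka X b x\<^sub>0 I (y n) (D.budget t (real K) w) w) \<longlonglongrightarrow> z
      \<longrightarrow> z = tanaka X b x\<^sub>0 I x (D.budget t (real K) w) w)"
  proof (subst AE_ball_countable[OF countable_rat], intro ballI)
    fix t :: real assume "t \<in> \<rat>"
    show "AE w in M. 0 < t \<longrightarrow> (\<forall>K::nat. \<forall>z. (\<lambda>n. tanaka X b x\<^sub>0 I (y n) (D.budget t (real K) w) w) \<longlonglongrightarrow> z
      \<longrightarrow> z = tanaka X b x\<^sub>0 I x (D.budget t (real K) w) w)"
    proof (cases "0 < t")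
      case True
      have "AE w in M. \<forall>z. (\<lambda>n. tanaka X b x\<^sub>0 I (y n) (D.budget t (real K) w) w) \<longlonglongrightarrow> z \<longrightarrow> z = tanaka X b x\<^sub>0 I x (D.budget t (real K) w) w" for K :: nat
      proof -
        interpret St: stopped_tanaka M G W X N a b c d x\<^sub>0 \<psi> I "einterval l r" t "real K" "D.budget t (real K)"
          by (rule D.stopped_tanakaI) (use D.budget_opt[OF True] True in simp_all)
        show ?thesis by (rule St.lt_left_continuous[OF xJ y])
      qed
      then show ?thesis by (simp add: AE_all_countable)
    qed simp
  qed
  moreover have "AE w in M. \<forall>n. \<forall>t\<ge>0. ereal t \<le> \<tau> w \<longrightarrow> tanaka X b x\<^sub>0 I (y n) t w = L t (y n) w"
    using lt_L[OF y(1)] by (simp add: AE_all_countable)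
  ultimately show ?thesis
    using lt_L[OF xJ] AE_space
  proof eventually_elim
    case (elim w)
    show ?case
    proof (intro ballI impI allI)
      fix t z assume t: "t \<in> \<rat>" "0 < t \<and> ereal t \<le> \<tau> w" and z: "(\<lambda>n. L t (y n) w) \<longlonglongrightarrow> z"
      obtain K :: nat where K: "D.budget t (real K) w = t" using D.budget_full[OF elim(4)] t(2) by blast
      have "\<forall>z. (\<lambda>n. tanaka X b x\<^sub>0 I (y n) t w) \<longlonglongrightarrow> z \<longrightarrow> z = tanaka X b x\<^sub>0 I x t w"
        using elim(1) t K by metis
      then show "z = L t x w" using z elim(2,3) t(2) by simp
    qed
  qed
qed

end

lemma interior_diffusion_exists:
  assumes lr: "l < ereal c" "c < x\<^sub>0" "x\<^sub>0 < d" "ereal d < r"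
    and \<mu>: "\<mu> \<in> borel_measurable (restrict_space borel (einterval l r))"
    and \<sigma>: "\<sigma> \<in> borel_measurable (restrict_space borel (einterval l r))" "\<And>x. x \<in> einterval l r \<Longrightarrow> \<sigma> x \<noteq> 0"
    and \<mu>\<sigma>: "set_integrable lborel {c..d} (\<lambda>x. \<mu> x / (\<sigma> x)\<^sup>2)"
    and F: "filtered_prob_space M F" and W: "brownian_motion M F W"
    and Y: "sde_solution M F W l r \<mu> \<sigma> x\<^sub>0 Y" and L: "local_time M F W l r \<mu> \<sigma> x\<^sub>0 Y L"
  obtains G W' N\<^sub>0 I\<^sub>0 e E where "interior_diffusion M G W' Y \<mu> \<sigma> L l r x\<^sub>0 c d N\<^sub>0 I\<^sub>0 e E"
proof -
  define \<tau> where "\<tau> = exit_time Y (ereal c) (ereal d)"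
  have sub: "subalgebra M (F t)" if "0 \<le> t" for t using F that by (simp add: filtered_prob_space_def)
  obtain W' where bm: "bm_filtration M (augmented M F) W'" and WW: "AE w in M. \<forall>t\<ge>0. W' t w = W t w"
    by (rule augmented_bm[OF F W])
  interpret bm_filtration M "augmented M F" W' by (rule bm)
  have FG: "f \<in> borel_measurable (augmented M F t)" if t: "0 \<le> t" and f: "f \<in> borel_measurable (F t)"
    for t and f :: "'a \<Rightarrow> 'b :: topological_space"
    by (rule augmented_measurable[where F = F, OF sub[OF t] measurable_from_subalg[OF sub[OF t] f] f]) simp
  from Y lr have Yad: "\<And>t. 0 \<le> t \<Longrightarrow> Y t \<in> borel_measurable (F t)"
    and Yreg: "AE w in M. Y 0 w = ereal x\<^sub>0 \<and> continuous_on {0..} (\<lambda>t. Y t w) \<and> (\<forall>t\<ge>0. Y t w \<in> {l..r}) \<and>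
        (\<forall>s t. 0 \<le> s \<and> s \<le> t \<and> Y s w \<in> {l, r} \<longrightarrow> Y t w = Y s w)"
    and "has_stoch_integral M F W (\<lambda>s w. \<mu> (real_of_ereal (Y s w))) (\<lambda>s w. \<sigma> (real_of_ereal (Y s w)))
             (\<lambda>s w. of_bool (ereal s \<le> \<tau> w)) (\<lambda>t w. real_of_ereal (Y (stopped_at t (\<tau> w)) w) - x\<^sub>0)"
    unfolding sde_solution_def Let_def \<tau>_def by blast+
  then obtain I\<^sub>0 where I0: "has_ito_integral M F W (\<lambda>s w. of_bool (ereal s \<le> \<tau> w) * \<sigma> (real_of_ereal (Y s w))) I\<^sub>0"
    and sde: "AE w in M. \<forall>t\<ge>0. set_integrable lborel {0..t} (\<lambda>s. of_bool (ereal s \<le> \<tau> w) * \<mu> (real_of_ereal (Y s w))) \<and>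
       real_of_ereal (Y (stopped_at t (\<tau> w)) w) - x\<^sub>0 = (LINT s:{0..t}|lborel. of_bool (ereal s \<le> \<tau> w) * \<mu> (real_of_ereal (Y s w))) + I\<^sub>0 t w"
    unfolding has_stoch_integral_def by blast
  obtain e E where eE: "ito_approx (\<lambda>s w. of_bool (ereal s \<le> \<tau> w) * \<sigma> (real_of_ereal (Y s w))) I\<^sub>0 e E"
    by (rule has_ito_approx[OF FG WW I0])
  then have conv: "AE w in M. \<forall>t\<ge>0. (\<lambda>n. \<integral>\<^sup>+s\<in>{0..t}. ennreal ((e n s w - of_bool (ereal s \<le> \<tau> w) * \<sigma> (real_of_ereal (Y s w)))\<^sup>2) \<partial>lborel) \<longlonglongrightarrow> 0"
    unfolding ito_approx_def by (elim conjE AE_mp) (rule AE_I2, blast)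
  define P where "P w \<longleftrightarrow> (Y 0 w = ereal x\<^sub>0 \<and> continuous_on {0..} (\<lambda>t. Y t w) \<and> (\<forall>t\<ge>0. Y t w \<in> {l..r}) \<and>
        (\<forall>s t. 0 \<le> s \<and> s \<le> t \<and> Y s w \<in> {l, r} \<longrightarrow> Y t w = Y s w)) \<and>
      (\<forall>t\<ge>0. set_integrable lborel {0..t} (\<lambda>s. of_bool (ereal s \<le> \<tau> w) * \<mu> (real_of_ereal (Y s w))) \<and>
       real_of_ereal (Y (stopped_at t (\<tau> w)) w) - x\<^sub>0 = (LINT s:{0..t}|lborel. of_bool (ereal s \<le> \<tau> w) * \<mu> (real_of_ereal (Y s w))) + I\<^sub>0 t w) \<and>
      continuous_on {0..} (\<lambda>t. I\<^sub>0 t w) \<and>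
      (\<forall>t\<ge>0. (\<lambda>n. \<integral>\<^sup>+s\<in>{0..t}. ennreal ((e n s w - of_bool (ereal s \<le> \<tau> w) * \<sigma> (real_of_ereal (Y s w)))\<^sup>2) \<partial>lborel) \<longlonglongrightarrow> 0)" for w
  have "AE w in M. P w" 
    using Yreg sde ito_approx_continuous[OF eE] conv
    by eventually_elim (unfold P_def, rule conjI[OF _ conjI[OF _ conjI]])
  from AE_E[OF this] obtain N\<^sub>0 where N0: "{w \<in> space M. \<not> P w} \<subseteq> N\<^sub>0" "emeasure M N\<^sub>0 = 0" "N\<^sub>0 \<in> sets M" by blast
  have PN: "P w" if "w \<in> space M" "w \<notin> N\<^sub>0" for w using N0(1) that by blast
  note P1 = PN[unfolded P_def, THEN conjunct1] and P2 = PN[unfolded P_def, THEN conjunct2, THEN conjunct1]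
    and P34 = PN[unfolded P_def, THEN conjunct2, THEN conjunct2]
  have J: "einterval l r \<in> sets borel" by simp
  have "interior_diffusion M (augmented M F) W' Y \<mu> \<sigma> L l r x\<^sub>0 c d N\<^sub>0 I\<^sub>0 e E"
  proof (intro interior_diffusion.intro bm interior_diffusion_axioms.intro lr \<sigma>(2) \<mu>\<sigma>)
    show "(\<lambda>x. indicator (einterval l r) x * \<mu> x) \<in> borel_measurable borel" "(\<lambda>x. indicator (einterval l r) x * \<sigma> x) \<in> borel_measurable borel"
      using \<mu> \<sigma>(1) by (simp_all add: borel_measurable_restrict_space_iff J)
    show "Y t \<in> borel_measurable (augmented M F t)" if "0 \<le> t" for t by (rule FG[OF that Yad[OF that]])
    show "N\<^sub>0 \<in> null_sets M" using N0 by blast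
    show "ito_approx (\<lambda>s w. of_bool (ereal s \<le> exit_time Y (ereal c) (ereal d) w) * \<sigma> (real_of_ereal (Y s w))) I\<^sub>0 e E"
      using eE unfolding \<tau>_def .
    fix w assume wM: "w \<in> space M" "w \<notin> N\<^sub>0"
    show "Y 0 w = ereal x\<^sub>0" by (rule P1[OF wM, THEN conjunct1])
    show "continuous_on {0..} (\<lambda>t. Y t w)" by (rule P1[OF wM, THEN conjunct2, THEN conjunct1])
    show "continuous_on {0..} (\<lambda>t. I\<^sub>0 t w)" by (rule P34[OF wM, THEN conjunct1])
    fix t :: real assume t: "0 \<le> t"
    show "Y t w \<in> {l..r}" by (rule P1[OF wM, THEN conjunct2, THEN conjunct2, THEN conjunct1, rule_format, OF t])
    show "set_integrable lborel {0..t} (\<lambda>s. of_bool (ereal s \<le> exit_time Y (ereal c) (ereal d) w) * \<mu> (real_of_ereal (Y s w)))"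
      by (rule P2[OF wM, unfolded \<tau>_def, rule_format, OF t, THEN conjunct1])
    show "real_of_ereal (Y (stopped_at t (exit_time Y (ereal c) (ereal d) w)) w) - x\<^sub>0
        = (LINT s:{0..t}|lborel. of_bool (ereal s \<le> exit_time Y (ereal c) (ereal d) w) * \<mu> (real_of_ereal (Y s w))) + I\<^sub>0 t w"
      by (rule P2[OF wM, unfolded \<tau>_def, rule_format, OF t, THEN conjunct2])
    show "(\<lambda>n. \<integral>\<^sup>+s\<in>{0..t}. ennreal ((e n s w - of_bool (ereal s \<le> exit_time Y (ereal c) (ereal d) w) * \<sigma> (real_of_ereal (Y s w)))\<^sup>2) \<partial>lborel) \<longlonglongrightarrow> 0"
      by (rule P34[OF wM, unfolded \<tau>_def, THEN conjunct2, rule_format, OF t])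
  next
    fix w s t assume wM: "w \<in> space M" "w \<notin> N\<^sub>0" and st: "0 \<le> s" "s \<le> t" "Y s w \<in> {l, r}"
    show "Y t w = Y s w"
      by (rule P1[OF wM, THEN conjunct2, THEN conjunct2, THEN conjunct2, rule_format]) (intro conjI st)
  next
    fix y assume y: "y \<in> einterval l r"
    show "AE w in M. mono_on {t. 0 \<le> t \<and> ereal t < exit_time Y l r w} (\<lambda>t. L t y w)"
      using L[unfolded local_time_def, THEN conjunct2] by eventually_elim (use y in blast)
    from L[unfolded local_time_def, THEN conjunct1, rule_format, OF y, of c d] lr have "has_stoch_integral M F W (\<lambda>s w. \<mu> (real_of_ereal (Y s w))) (\<lambda>s w. \<sigma> (real_of_ereal (Y s w)))
             (\<lambda>s w. of_bool (ereal s \<le> \<tau> w) * of_bool (ereal y < Y s w))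
             (\<lambda>t w. max 0 (real_of_ereal (Y (stopped_at t (\<tau> w)) w) - y) - max 0 (x\<^sub>0 - y) - L (stopped_at t (\<tau> w)) y w / 2)"
      unfolding Let_def \<tau>_def by blast
    then obtain I' where I': "has_ito_integral M F W (\<lambda>s w. of_bool (ereal s \<le> \<tau> w) * of_bool (ereal y < Y s w) * \<sigma> (real_of_ereal (Y s w))) I'"
      and tf: "AE w in M. \<forall>t\<ge>0. set_integrable lborel {0..t} (\<lambda>s. of_bool (ereal s \<le> \<tau> w) * of_bool (ereal y < Y s w) * \<mu> (real_of_ereal (Y s w))) \<and>
        max 0 (real_of_ereal (Y (stopped_at t (\<tau> w)) w) - y) - max 0 (x\<^sub>0 - y) - L (stopped_at t (\<tau> w)) y w / 2
         = (LINT s:{0..t}|lborel. of_bool (ereal s \<le> \<tau> w) * of_bool (ereal y < Y s w) * \<mu> (real_of_ereal (Y s w))) + I' t w"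
      unfolding has_stoch_integral_def by blast
    obtain e' E' where eE': "ito_approx (\<lambda>s w. of_bool (ereal s \<le> \<tau> w) * of_bool (ereal y < Y s w) * \<sigma> (real_of_ereal (Y s w))) I' e' E'"
      by (rule has_ito_approx[OF FG WW I'])
    have "AE w in M. \<forall>t\<ge>0. max 0 (real_of_ereal (Y (stopped_at t (\<tau> w)) w) - y) - max 0 (x\<^sub>0 - y) - L (stopped_at t (\<tau> w)) y w / 2
         = (LINT s:{0..t}|lborel. of_bool (ereal s \<le> \<tau> w) * of_bool (ereal y < Y s w) * \<mu> (real_of_ereal (Y s w))) + I' t w"
      using tf by eventually_elim blast
    with eE' show "\<exists>I' e' E'.
      ito_approx (\<lambda>s w. of_bool (ereal s \<le> exit_time Y (ereal c) (ereal d) w) * of_bool (ereal y < Y s w) * \<sigma> (real_of_ereal (Y s w))) I' e' E' \<and>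
      (AE w in M. \<forall>t\<ge>0. max 0 (real_of_ereal (Y (stopped_at t (exit_time Y (ereal c) (ereal d) w)) w) - y) - max 0 (x\<^sub>0 - y)
           - L (stopped_at t (exit_time Y (ereal c) (ereal d) w)) y w / 2
         = (LINT s:{0..t}|lborel. of_bool (ereal s \<le> exit_time Y (ereal c) (ereal d) w) * of_bool (ereal y < Y s w) * \<mu> (real_of_ereal (Y s w))) + I' t w)"
      unfolding \<tau>_def by blast
  qed
  then show thesis by (rule that)
qed

section \<open>Path properties and integrals of the local time\<close>

lemma ball_Int_sets: "ball (x :: real) e \<inter> einterval l r \<in> sets (restrict_space borel (einterval l r))"
  by (subst sets_restrict_space_iff) (auto intro: sets.Int)

text \<open>From here on a single path is fixed and the arguments are deterministic.\<close>

locale continuous_path =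
  fixes Y :: "real \<Rightarrow> 'a \<Rightarrow> ereal" and l r :: ereal and x\<^sub>0 :: real and w :: 'a
  assumes Y_0: "Y 0 w = ereal x\<^sub>0" and x\<^sub>0: "x\<^sub>0 \<in> einterval l r"
    and Y_cont: "continuous_on {0..} (\<lambda>t. Y t w)"
    and Y_range: "0 \<le> t \<Longrightarrow> Y t w \<in> {l..r}"
begin

abbreviation \<zeta> where "\<zeta> \<equiv> exit_time Y l r w"

definition g where "g s = real_of_ereal (Y s w)"

lemma Y_before: "0 \<le> s \<Longrightarrow> ereal s < \<zeta> \<Longrightarrow> Y s w = ereal (g s) \<and> g s \<in> einterval l r"
proof -
  assume s: "0 \<le> s" "ereal s < \<zeta>"
  have "Y s w \<in> {l<..<r}"
  proof (rule ccontr)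
    assume "Y s w \<notin> {l<..<r}"
    then have "\<zeta> \<le> ereal s" unfolding exit_time_def hit_time_def using s(1) by (intro Inf_lower) auto
    then show False using s(2) by simp
  qed
  then have lr: "l < Y s w" "Y s w < r" by auto
  then have "\<bar>Y s w\<bar> \<noteq> \<infinity>" by auto
  then have "Y s w = ereal (g s)" by (simp add: g_def ereal_real)
  then show ?thesis using lr by (simp add: einterval_def)
qed

lemma Y_upto: "0 \<le> s \<Longrightarrow> s \<le> t \<Longrightarrow> ereal t < \<zeta> \<Longrightarrow> Y s w = ereal (g s) \<and> g s \<in> einterval l r"
  using Y_before[of s] le_less_trans[of "ereal s" "ereal t" \<zeta>] by simp

lemma g_cont:
  assumes "ereal t < \<zeta>"
  shows "continuous_on {0..t} g"
  unfolding g_def[abs_def]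
proof (rule continuous_on_compose2[OF continuous_on_real])
  show "continuous_on {0..t} (\<lambda>t. Y t w)" by (rule continuous_on_subset[OF Y_cont]) auto
  show "(\<lambda>t. Y t w) ` {0..t} \<subseteq> UNIV - {\<infinity>, -\<infinity>}"
  proof (rule image_subsetI)
    fix s assume "s \<in> {0..t}"
    then have "Y s w = ereal (g s)" using Y_upto[of s t] assms by simp
    then show "Y s w \<in> UNIV - {\<infinity>, -\<infinity>}" by simp
  qed
qed

lemma range_interval:
  assumes "0 \<le> t" "ereal t < \<zeta>"
  obtains m K where "m \<in> einterval l r" "K \<in> einterval l r" "m \<le> x\<^sub>0" "x\<^sub>0 \<le> K" "g ` {0..t} = {m..K}"
proof -
  have c: "compact (g ` {0..t})" "connected (g ` {0..t})"
    using g_cont[OF assms(2)] by (auto intro!: compact_continuous_image connected_continuous_image)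
  then obtain m K where mK: "g ` {0..t} = {m..K}" using connected_compact_interval_1[of "g ` {0..t}"] by blast
  have "g 0 \<in> g ` {0..t}" using assms(1) by auto
  moreover have "g 0 = x\<^sub>0" by (simp add: g_def Y_0)
  ultimately have x: "m \<le> x\<^sub>0" "x\<^sub>0 \<le> K" using mK by auto
  have J: "g s \<in> einterval l r" if "s \<in> {0..t}" for s
    using Y_upto[of s t] that assms(2) by simp
  have "m \<in> g ` {0..t}" "K \<in> g ` {0..t}" unfolding mK using x by auto
  then have "m \<in> einterval l r" "K \<in> einterval l r" using J by auto
  then show thesis using that x mK by blast
qed

text \<open>The range up to t is a compact subinterval of J, so rational numbers fit strictly
  between its endpoints and those of J. Countably many localising intervals thus reach all times
  before the exit.\<close>

lemma rational_interval:
  assumes "0 \<le> t" "ereal t < \<zeta>"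
  obtains c d where "c \<in> \<rat>" "d \<in> \<rat>" "l < ereal c" "c < x\<^sub>0" "x\<^sub>0 < d" "ereal d < r"
    "ereal t \<le> exit_time Y (ereal c) (ereal d) w" "\<forall>s. 0 \<le> s \<and> s \<le> t \<longrightarrow> c < g s \<and> g s < d"
proof -
  obtain m K where mK: "m \<in> einterval l r" "K \<in> einterval l r" "m \<le> x\<^sub>0" "x\<^sub>0 \<le> K" "g ` {0..t} = {m..K}"
    by (rule range_interval[OF assms])
  obtain c where c: "l < ereal (real_of_rat c)" "real_of_rat c < m"
    using ereal_dense3[of l "ereal m"] mK(1) by (auto simp: einterval_def)
  obtain d where d: "K < real_of_rat d" "ereal (real_of_rat d) < r"
    using ereal_dense3[of "ereal K" r] mK(2) by (auto simp: einterval_def)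
  have gr: "real_of_rat c < g s \<and> g s < real_of_rat d" if "0 \<le> s" "s \<le> t" for s
  proof -
    have "g s \<in> {m..K}" unfolding mK(5)[symmetric] using that by simp
    then show ?thesis using c d by auto
  qed
  have "ereal t \<le> exit_time Y (ereal (real_of_rat c)) (ereal (real_of_rat d)) w"
  proof (rule ccontr)
    assume "\<not> ?thesis"
    then obtain s where s: "0 \<le> s" "s < t" "Y s w \<notin> {ereal (real_of_rat c)<..<ereal (real_of_rat d)}"
      unfolding not_le exit_time_less_iff by auto
    have "Y s w = ereal (g s)" using Y_upto[OF s(1) _ assms(2)] s(2) by simp
    then show False using s gr[of s] by simp
  qed
  then show thesis using that[of "real_of_rat c" "real_of_rat d"] c d mK(3,4) gr by auto
qed

end

text \<open>The hypotheses list what countably many null sets can provide: vanishing at rational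
  levels, positivity at the points of \<open>Xs\<close>, and the left limit there at rational times
  along the single sequence \<open>ys x\<close>. Regularity in the level supplies the rest.\<close>

locale regular_path = continuous_path Y l r x\<^sub>0 w for Y :: "real \<Rightarrow> 'a \<Rightarrow> ereal" and l r x\<^sub>0 w +
  fixes L :: "real \<Rightarrow> real \<Rightarrow> 'a \<Rightarrow> real" and Xs :: "real set" and ys :: "real \<Rightarrow> nat \<Rightarrow> real"
  assumes L_mono: "y \<in> einterval l r \<Longrightarrow> mono_on {t. 0 \<le> t \<and> ereal t < exit_time Y l r w} (\<lambda>t. L t y w)"
    and L_right: "0 \<le> t \<Longrightarrow> ereal t < exit_time Y l r w \<Longrightarrow> y \<in> einterval l r \<Longrightarrow> ((\<lambda>z. L t z w) \<longlongrightarrow> L t y w) (at_right y)"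
    and L_left: "0 \<le> t \<Longrightarrow> ereal t < exit_time Y l r w \<Longrightarrow> y \<in> einterval l r \<Longrightarrow> \<exists>c. ((\<lambda>z. L t z w) \<longlongrightarrow> c) (at_left y)"
    and off_range: "y \<in> \<rat> \<Longrightarrow> y \<in> einterval l r \<Longrightarrow> 0 \<le> t \<Longrightarrow> ereal t < exit_time Y l r w \<Longrightarrow>
      (\<forall>s. 0 \<le> s \<and> s \<le> t \<longrightarrow> Y s w < ereal y) \<or> (\<forall>s. 0 \<le> s \<and> s \<le> t \<longrightarrow> ereal y < Y s w) \<Longrightarrow> L t y w = 0"
    and positive: "x \<in> Xs \<Longrightarrow> 0 \<le> s \<Longrightarrow> s < t \<Longrightarrow> ereal t < exit_time Y l r w \<Longrightarrow> Y s w = ereal x \<Longrightarrow> 0 < L t x w"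
    and left_limit: "x \<in> Xs \<Longrightarrow> t \<in> \<rat> \<Longrightarrow> ereal t < exit_time Y l r w \<Longrightarrow> 0 \<le> s \<Longrightarrow> s < t \<Longrightarrow> Y s w = ereal x \<Longrightarrow>
      (\<lambda>n. L t (ys x n) w) \<longlonglongrightarrow> z \<Longrightarrow> z = L t x w"
    and Xs: "Xs \<subseteq> einterval l r"
    and ys: "x \<in> Xs \<Longrightarrow> ys x n < x" "x \<in> Xs \<Longrightarrow> ys x \<longlonglongrightarrow> x"
begin

text \<open>If L were nonzero at y, right continuity would make it nonzero at all levels slightly to
  the right, among them a rational one off the range.\<close>

lemma L_off_range:
  assumes t: "0 \<le> t" "ereal t < \<zeta>" and y: "y \<in> einterval l r" "y \<notin> g ` {0..t}"
  shows "L t y w = 0"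
proof (rule ccontr)
  assume "L t y w \<noteq> 0"
  from tendsto_imp_eventually_ne[OF L_right[OF t y(1)] this]
  obtain u where u: "y < u" "\<And>z. y < z \<Longrightarrow> z < u \<Longrightarrow> L t z w \<noteq> 0"
    unfolding eventually_at_right_field by blast
  obtain m K where mK: "m \<in> einterval l r" "K \<in> einterval l r" "m \<le> x\<^sub>0" "x\<^sub>0 \<le> K" "g ` {0..t} = {m..K}"
    by (rule range_interval[OF t])
  obtain v where v: "y < v" "ereal v < r"
    using ereal_dense3[of "ereal y" r] y(1) by (auto simp: einterval_def)
  \<comment> \<open>A level below the range must not reach m when moved to the right; a level above
    the range only has to stay in J.\<close>
  define b where "b = (if y < m then min u (min v m) else min u v)"
  have "y < b" using u v by (simp add: b_def)
  then obtain q where q: "q \<in> \<rat>" "y < q" "q < b" using Rats_dense_in_real by blast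
  have qJ: "q \<in> einterval l r"
  proof -
    have "ereal q < r" using q(3) v(2) by (auto simp: b_def split: if_splits intro: less_trans[of "ereal q" "ereal v"])
    moreover have "l < ereal q" using y(1) q(2) by (auto simp: einterval_def intro: less_trans[of l "ereal y"])
    ultimately show ?thesis by (simp add: einterval_def)
  qed
  have gr: "Y s w = ereal (g s) \<and> g s \<in> {m..K}" if "0 \<le> s \<and> s \<le> t" for s
    using Y_upto[of s t] that t(2) unfolding mK(5)[symmetric] by simp
  have "q < m \<or> K < q" using q y(2) unfolding mK(5) by (auto simp: b_def split: if_splits)
  then have "(\<forall>s. 0 \<le> s \<and> s \<le> t \<longrightarrow> Y s w < ereal q) \<or> (\<forall>s. 0 \<le> s \<and> s \<le> t \<longrightarrow> ereal q < Y s w)"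
    using gr by fastforce
  then have "L t q w = 0" by (rule off_range[OF q(1) qJ t])
  then show False using u(2)[OF q(2)] q(3) by (auto simp: b_def split: if_splits)
qed

lemma L_locally_bounded:
  assumes t: "0 \<le> t" "ereal t < \<zeta>" and y: "y \<in> einterval l r"
  shows "\<exists>C. \<exists>e>0. \<forall>z\<in>ball y e. L t z w \<le> C"
proof -
  obtain c where c: "((\<lambda>z. L t z w) \<longlongrightarrow> c) (at_left y)" using L_left[OF t y] by blast
  obtain u where u: "u < y" "\<And>z. u < z \<Longrightarrow> z < y \<Longrightarrow> L t z w < c + 1"
    using order_tendstoD(2)[OF c, of "c + 1"] unfolding eventually_at_left_field by auto
  obtain v where v: "y < v" "\<And>z. y < z \<Longrightarrow> z < v \<Longrightarrow> L t z w < L t y w + 1"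
    using order_tendstoD(2)[OF L_right[OF t y], of "L t y w + 1"] unfolding eventually_at_right_field by auto
  have "L t z w \<le> max (c + 1) (L t y w + 1)" if "z \<in> ball y (min (y - u) (v - y))" for z
    using u(2)[of z] v(2)[of z] that by (cases z y rule: linorder_cases) (auto simp: dist_real_def)
  then show ?thesis using u v by (intro exI[of _ "max (c + 1) (L t y w + 1)"] exI[of _ "min (y - u) (v - y)"]) auto
qed

lemma integral_finite:
  fixes \<nu> :: "real measure"
  assumes \<nu>: "sets \<nu> = sets (restrict_space borel (einterval l r))" and t: "0 \<le> t" "ereal t < \<zeta>"
    and D: "\<And>s. 0 \<le> s \<Longrightarrow> s \<le> t \<Longrightarrow> Y s w \<notin> D_set l r \<nu>"
  shows "(\<integral>\<^sup>+y. ennreal (L t y w) \<partial>\<nu>) < \<infinity>"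
proof -
  have sp: "space \<nu> = einterval l r" using sets_eq_imp_space_eq[OF \<nu>] by (simp add: space_restrict_space)
  have meas: "ball y e \<inter> einterval l r \<in> sets \<nu>" for y e unfolding \<nu> by (rule ball_Int_sets)
  \<comment> \<open>A point of the range is not in D and so has a ball of finite measure; it is
    shrunk until L is bounded on it as well.\<close>
  have loc: "\<exists>C e. 0 < e \<and> (\<forall>z\<in>ball y e. L t z w \<le> C) \<and> emeasure \<nu> (ball y e \<inter> einterval l r) < \<infinity>" if y: "y \<in> g ` {0..t}" for y
  proof -
    from y obtain s where "s \<in> {0..t}" and yg: "y = g s" by blast
    then have s: "0 \<le> s" "s \<le> t" by simp_all
    then have Y: "Y s w = ereal y" "y \<in> einterval l r"
      using Y_upto[OF s t(2)] yg by simp_all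
    then obtain e where e: "0 < e" "emeasure \<nu> (ball y e \<inter> einterval l r) \<noteq> \<infinity>"
      using D[OF s(1,2)] by (auto simp: D_set_def)
    obtain C e' where C: "0 < e'" "\<And>z. z \<in> ball y e' \<Longrightarrow> L t z w \<le> C" using L_locally_bounded[OF t Y(2)] by blast
    have "emeasure \<nu> (ball y (min e e') \<inter> einterval l r) \<le> emeasure \<nu> (ball y e \<inter> einterval l r)"
      by (rule emeasure_mono[OF _ meas]) auto
    also have "\<dots> < \<infinity>" using e(2) by (simp add: less_top)
    finally show ?thesis using e(1) C by (intro exI[of _ C] exI[of _ "min e e'"]) simp
  qed
  then obtain C e where Ce: "\<And>y. y \<in> g ` {0..t} \<Longrightarrow> 0 < e y" "\<And>y z. y \<in> g ` {0..t} \<Longrightarrow> z \<in> ball y (e y) \<Longrightarrow> L t z w \<le> C y"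
    "\<And>y. y \<in> g ` {0..t} \<Longrightarrow> emeasure \<nu> (ball y (e y) \<inter> einterval l r) < \<infinity>" by metis
  have "compact (g ` {0..t})" by (rule compact_continuous_image[OF g_cont[OF t(2)]]) simp
  then obtain T where T: "T \<subseteq> g ` {0..t}" "finite T" "g ` {0..t} \<subseteq> (\<Union>y\<in>T. ball y (e y))"
    by (rule compactE_image[of _ "g ` {0..t}" "\<lambda>y. ball y (e y)"]) (use Ce(1) in auto)
  have "(\<integral>\<^sup>+y. ennreal (L t y w) \<partial>\<nu>) \<le> (\<integral>\<^sup>+y. (\<Sum>x\<in>T. ennreal (C x) * indicator (ball x (e x) \<inter> einterval l r) y) \<partial>\<nu>)"
  proof (rule nn_integral_mono)
    fix y assume "y \<in> space \<nu>"
    then have y: "y \<in> einterval l r" by (simp add: sp)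
    show "ennreal (L t y w) \<le> (\<Sum>x\<in>T. ennreal (C x) * indicator (ball x (e x) \<inter> einterval l r) y)"
    proof (cases "y \<in> g ` {0..t}")
      case True
      then obtain x where x: "x \<in> T" "y \<in> ball x (e x)" using T(3) by blast
      have "ennreal (L t y w) \<le> ennreal (C x) * indicator (ball x (e x) \<inter> einterval l r) y"
        using Ce(2)[of x y] x T(1) y by (auto intro: ennreal_leI)
      also have "\<dots> \<le> (\<Sum>x\<in>T. ennreal (C x) * indicator (ball x (e x) \<inter> einterval l r) y)"
        by (rule member_le_sum[OF x(1) _ T(2)]) simp
      finally show ?thesis .
    qed (simp add: L_off_range[OF t y])
  qed
  also have "\<dots> = (\<Sum>x\<in>T. ennreal (C x) * emeasure \<nu> (ball x (e x) \<inter> einterval l r))"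
    using meas by (simp add: nn_integral_sum nn_integral_cmult_indicator)
  also have "\<dots> < \<infinity>" using T(1,2) Ce(3) by (auto simp: ennreal_sum_less_top ennreal_mult_less_top)
  finally show ?thesis .
qed

text \<open>A left limit exists by the cadlag property, and convergence along the single sequence
  \<open>ys x\<close> is enough to identify it with the positive value at x.\<close>

lemma L_bounded_below:
  assumes x: "x \<in> Xs" and q: "q \<in> \<rat>" "ereal q < \<zeta>" and s: "0 \<le> s" "s < q" "Y s w = ereal x"
  obtains \<delta> \<epsilon> where "0 < \<delta>" "0 < \<epsilon>" "\<And>z. z \<in> ball x \<epsilon> \<Longrightarrow> \<delta> \<le> L q z w"
proof -
  have q0: "0 \<le> q" using s by simp
  have xJ: "x \<in> einterval l r" using x Xs by blast
  define \<delta> where "\<delta> = L q x w / 2"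
  have \<delta>: "0 < \<delta>" "\<delta> < L q x w" using positive[OF x s(1,2) q(2) s(3)] by (simp_all add: \<delta>_def)
  obtain c where c: "((\<lambda>z. L q z w) \<longlongrightarrow> c) (at_left x)" using L_left[OF q0 q(2) xJ] by blast
  have "filterlim (ys x) (at_left x) sequentially"
    using ys[OF x] by (intro filterlim_at_withinI) auto
  then have "(\<lambda>n. L q (ys x n) w) \<longlonglongrightarrow> c" by (rule filterlim_compose[OF c])
  then have cx: "c = L q x w" by (rule left_limit[OF x q s])
  obtain u where u: "u < x" "\<And>z. u < z \<Longrightarrow> z < x \<Longrightarrow> \<delta> < L q z w"
    using order_tendstoD(1)[OF c, of \<delta>] \<delta> cx unfolding eventually_at_left_field by auto
  obtain v where v: "x < v" "\<And>z. x < z \<Longrightarrow> z < v \<Longrightarrow> \<delta> < L q z w"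
    using order_tendstoD(1)[OF L_right[OF q0 q(2) xJ] \<delta>(2)] unfolding eventually_at_right_field by auto
  show thesis
  proof (rule that[OF \<delta>(1)])
    show "0 < min (x - u) (v - x)" using u v by simp
    show "\<delta> \<le> L q z w" if "z \<in> ball x (min (x - u) (v - x))" for z
      using u(2)[of z] v(2)[of z] \<delta> that by (cases z x rule: linorder_cases) (auto simp: dist_real_def)
  qed
qed

text \<open>Before \<zeta> this is monotonicity. At \<zeta> the limit of the monotone local time is
  its supremum over earlier times, which dominates the value at q.\<close>

lemma local_time_ext_ge:
  assumes y: "y \<in> einterval l r" and q: "0 \<le> q" "ereal q < t" and t: "t \<le> \<zeta>"
  shows "ennreal (L q y w) \<le> local_time_ext (exit_time Y l r) L t y w"
proof -
  have mono: "ennreal (L u y w) \<le> ennreal (L v y w)" if "0 \<le> u" "u \<le> v" "ereal v < \<zeta>" for u v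
    using that by (intro ennreal_leI mono_onD[OF L_mono[OF y]]) (auto intro: le_less_trans[of "ereal u" "ereal v"])
  show ?thesis
  proof (cases "t < \<zeta>")
    case True
    obtain t' where t': "t = ereal t'" using q(2) True by (cases t) auto
    then show ?thesis using True mono[OF q(1), of t'] q(2) by (simp add: local_time_ext_def)
  next
    case False
    then have tz: "t = \<zeta>" using t by simp
    define f where "f s = ennreal (L (real_of_ereal s) y w)" for s
    define U where "U = (SUP s\<in>{0..<\<zeta>}. f s)"
    have q0: "ereal q < \<zeta>" using q(2) tz by simp
    have real: "\<exists>s'. s = ereal s'" if "0 \<le> s" "s < \<zeta>" for s using that by (cases s) auto
    have fm: "f u \<le> f v" if uv: "0 \<le> u" "u \<le> v" "v < \<zeta>" for u v
    proof -
      obtain u' where "u = ereal u'" using real[of u] uv by (meson le_less_trans)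
      moreover obtain v' where "v = ereal v'" using real[of v] uv by (meson order_trans)
      ultimately show ?thesis using mono[of u' v'] uv by (simp add: f_def)
    qed
    have "(f \<longlongrightarrow> U) (at_left \<zeta>)"
    proof (rule order_tendstoI)
      fix a assume "a < U"
      then obtain s where s: "s \<in> {0..<\<zeta>}" "a < f s" unfolding U_def less_SUP_iff by blast
      show "\<forall>\<^sub>F v in at_left \<zeta>. a < f v"
        unfolding eventually_at_left[OF q0] using s fm[of s] by (intro exI[of _ s]) (auto intro: less_le_trans)
    next
      fix a assume a: "U < a"
      have "f s < a" if "0 < s" "s < \<zeta>" for s
      proof -
        have "f s \<le> U" unfolding U_def using that by (intro SUP_upper) auto
        then show ?thesis using a by simp
      qed
      moreover have "0 < \<zeta>" using q(1) q0 by (metis ereal_less_eq(5) le_less_trans)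
      ultimately show "\<forall>\<^sub>F v in at_left \<zeta>. f v < a" unfolding eventually_at_left[OF q0] by blast
    qed
    moreover have "\<not> trivial_limit (at_left \<zeta>)"
      unfolding trivial_limit_def eventually_at_left[OF q0] using dense by blast
    ultimately have "Lim (at_left \<zeta>) f = U" by (intro tendsto_Lim)
    moreover have "f (ereal q) \<le> U" unfolding U_def using q(1) q0 by (intro SUP_upper) auto
    ultimately show ?thesis using False by (simp add: local_time_ext_def f_def[abs_def])
  qed
qed

text \<open>The path runs from x0 to z and passes x on its way by the intermediate value theorem. A
  rational time q strictly between this passage and t lies before \<zeta> even when t = \<zeta>, so
  \<open>L_bounded_below\<close> applies at q.\<close>

lemma integral_infinite:
  fixes \<nu> :: "real measure"
  assumes \<nu>: "sets \<nu> = sets (restrict_space borel (einterval l r))" and s: "0 \<le> s" "ereal s < t" "t \<le> \<zeta>"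
    and D: "Y s w = ereal z" and x: "x \<in> Xs" "x\<^sub>0 \<le> x \<and> x \<le> z \<or> z \<le> x \<and> x \<le> x\<^sub>0"
    and inf: "\<And>\<epsilon>. 0 < \<epsilon> \<Longrightarrow> emeasure \<nu> (ball x \<epsilon> \<inter> einterval l r) = \<infinity>"
  shows "(\<integral>\<^sup>+y. local_time_ext (exit_time Y l r) L t y w \<partial>\<nu>) = \<infinity>"
proof -
  have sp: "space \<nu> = einterval l r" using sets_eq_imp_space_eq[OF \<nu>] by (simp add: space_restrict_space)
  have sz: "ereal s < \<zeta>" using s by simp
  have g0: "g 0 = x\<^sub>0" "g s = z" by (simp_all add: g_def Y_0 D)
  have "\<exists>u. 0 \<le> u \<and> u \<le> s \<and> g u = x"
    using IVT'[of g 0 x s] IVT2'[of g s x 0] x(2) s(1) g_cont[OF sz] g0 by auto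
  then obtain u where u: "0 \<le> u" "u \<le> s" "g u = x" by blast
  then have Yu: "Y u w = ereal x" using Y_upto[of u s] sz by simp
  obtain q' where q': "ereal s < ereal (real_of_rat q')" "ereal (real_of_rat q') < t" using ereal_dense3[OF s(2)] by blast
  define q where "q = real_of_rat q'"
  have q: "q \<in> \<rat>" "u < q" "ereal q < t" using q' u by (auto simp: q_def)
  have q0: "0 \<le> q" "ereal q < \<zeta>" using u(1) q(2) less_le_trans[OF q(3) s(3)] by simp_all
  obtain \<delta> \<epsilon> where \<delta>: "0 < \<delta>" "0 < \<epsilon>" "\<And>z. z \<in> ball x \<epsilon> \<Longrightarrow> \<delta> \<le> L q z w"
    using L_bounded_below[OF x(1) q(1) q0(2) u(1) q(2) Yu] by blast
  have "\<infinity> = (\<integral>\<^sup>+y. ennreal \<delta> * indicator (ball x \<epsilon> \<inter> einterval l r) y \<partial>\<nu>)"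
  proof -
    have "ball x \<epsilon> \<inter> einterval l r \<in> sets \<nu>" unfolding \<nu> by (rule ball_Int_sets)
    then show ?thesis using \<delta>(1) inf[OF \<delta>(2)] by (simp add: nn_integral_cmult_indicator ennreal_mult_top)
  qed
  also have "\<dots> \<le> (\<integral>\<^sup>+y. local_time_ext (exit_time Y l r) L t y w \<partial>\<nu>)"
  proof (rule nn_integral_mono)
    fix y assume "y \<in> space \<nu>"
    then have y: "y \<in> einterval l r" by (simp add: sp)
    have "ennreal (L q y w) \<le> local_time_ext (exit_time Y l r) L t y w" by (rule local_time_ext_ge[OF y q0(1) q(3) s(3)])
    then show "ennreal \<delta> * indicator (ball x \<epsilon> \<inter> einterval l r) y \<le> local_time_ext (exit_time Y l r) L t y w"
      using \<delta>(3)[of y] by (auto simp: indicator_def intro: order_trans[OF ennreal_leI])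
  qed
  finally show ?thesis by (simp add: top_unique)
qed

end

section \<open>Assembling the almost sure events\<close>

lemma sequence_below:
  assumes "x \<in> einterval l r"
  obtains y where "\<And>n. y n \<in> einterval l r" "\<And>n. y n < x" "y \<longlonglongrightarrow> x"
proof -
  obtain u where u: "l < ereal u" "u < x" using ereal_dense3[of l "ereal x"] assms by (auto simp: einterval_def)
  define y where "y n = x - (x - u) * inverse (real (Suc n))" for n
  have "(\<lambda>n. inverse (real (Suc n))) \<longlonglongrightarrow> 0" by (rule LIMSEQ_inverse_real_of_nat)
  then have "y \<longlonglongrightarrow> x - (x - u) * 0" unfolding y_def by (intro tendsto_intros)
  moreover have y: "u \<le> y n" "y n < x" for n
  proof -
    have "inverse (real (Suc n)) \<le> 1" "0 < inverse (real (Suc n))" by (simp_all add: field_simps)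
    then have "(x - u) * inverse (real (Suc n)) \<le> (x - u) * 1" "0 < (x - u) * inverse (real (Suc n))"
      using u(2) by (auto intro!: mult_left_mono)
    then show "u \<le> y n" "y n < x" by (simp_all add: y_def)
  qed
  moreover have "y n \<in> einterval l r" for n
    using less_le_trans[OF u(1), of "ereal (y n)"] less_trans[of "ereal (y n)" "ereal x" r] y[of n] assms by (simp add: einterval_def)
  ultimately show thesis using that[of y] by simp
qed

text \<open>A ball around x contains balls around all points close enough to x. This is the
  closedness of D within J, by which the points nearest to x0 belong to D.\<close>

lemma infinite_points_attained:
  fixes \<nu> :: "real measure"
  assumes \<nu>: "sets \<nu> = sets (restrict_space borel (einterval l r))" and J: "x \<in> einterval l r"
    and lim: "\<And>e. 0 < e \<Longrightarrow> \<exists>z. dist x z < e \<and> (\<forall>\<epsilon>>0. emeasure \<nu> (ball z \<epsilon> \<inter> einterval l r) = \<infinity>)"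
    and e: "0 < e"
  shows "emeasure \<nu> (ball x e \<inter> einterval l r) = \<infinity>"
proof -
  obtain z where z: "dist x z < e" "\<And>\<epsilon>. 0 < \<epsilon> \<Longrightarrow> emeasure \<nu> (ball z \<epsilon> \<inter> einterval l r) = \<infinity>"
    using lim[OF e] by blast
  have "\<infinity> = emeasure \<nu> (ball z (e - dist x z) \<inter> einterval l r)" using z by simp
  also have "\<dots> \<le> emeasure \<nu> (ball x e \<inter> einterval l r)"
  proof (rule emeasure_mono)
    show "ball z (e - dist x z) \<inter> einterval l r \<subseteq> ball x e \<inter> einterval l r"
    proof
      fix y assume "y \<in> ball z (e - dist x z) \<inter> einterval l r"
      then show "y \<in> ball x e \<inter> einterval l r" using dist_triangle[of x y z] by simp
    qed
    show "ball x e \<inter> einterval l r \<in> sets \<nu>" unfolding \<nu> by (rule ball_Int_sets)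
  qed
  finally show ?thesis by (simp add: top_unique)
qed

text \<open>The null sets are gathered over rational interval endpoints, rational levels and the
  finite set \<open>Xs\<close>; the interval is chosen afterwards, for each path and time.\<close>

lemma AE_regular_path:
  assumes \<mu>: "\<mu> \<in> borel_measurable (restrict_space borel (einterval l r))"
    and \<sigma>: "\<sigma> \<in> borel_measurable (restrict_space borel (einterval l r))" "\<And>x. x \<in> einterval l r \<Longrightarrow> \<sigma> x \<noteq> 0"
    and \<mu>\<sigma>: "\<And>K. compact K \<Longrightarrow> K \<subseteq> einterval l r \<Longrightarrow> set_integrable lborel K (\<lambda>x. \<mu> x / (\<sigma> x)\<^sup>2)"
    and x0: "x\<^sub>0 \<in> einterval l r"
    and F: "filtered_prob_space M F" and W: "brownian_motion M F W"
    and Y: "sde_solution M F W l r \<mu> \<sigma> x\<^sub>0 Y" and L: "local_time M F W l r \<mu> \<sigma> x\<^sub>0 Y L"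
    and Xs: "finite Xs" "Xs \<subseteq> einterval l r"
  obtains ys where "AE w in M. regular_path Y l r x\<^sub>0 w L Xs ys"
proof -
  have "\<forall>x. \<exists>y. x \<in> Xs \<longrightarrow> (\<forall>n. y n \<in> einterval l r) \<and> (\<forall>n. y n < x) \<and> y \<longlonglongrightarrow> x"
    using sequence_below Xs(2) by (metis subsetD)
  then obtain ys where ys: "\<And>x n. x \<in> Xs \<Longrightarrow> ys x n \<in> einterval l r" "\<And>x n. x \<in> Xs \<Longrightarrow> ys x n < x" "\<And>x. x \<in> Xs \<Longrightarrow> ys x \<longlonglongrightarrow> x"
    by metis
  define F1 where "F1 c d y w \<longleftrightarrow> (\<forall>t\<ge>0. ereal t \<le> exit_time Y (ereal c) (ereal d) w \<longrightarrow>
    ((\<forall>s. 0 \<le> s \<and> s \<le> t \<longrightarrow> Y s w < ereal y) \<or> (\<forall>s. 0 \<le> s \<and> s \<le> t \<longrightarrow> ereal y < Y s w)) \<longrightarrow> L t y w = 0)" for c d y :: real and w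
  define F2 where "F2 c d x w \<longleftrightarrow> (\<forall>s t. 0 \<le> s \<and> s < t \<and> ereal t \<le> exit_time Y (ereal c) (ereal d) w \<and> Y s w = ereal x \<longrightarrow> 0 < L t x w)"
    for c d x :: real and w
  define F3 where "F3 c d x w \<longleftrightarrow> (\<forall>t\<in>\<rat>. 0 < t \<and> ereal t \<le> exit_time Y (ereal c) (ereal d) w \<longrightarrow>
      (\<forall>z. (\<lambda>n. L t (ys x n) w) \<longlonglongrightarrow> z \<longrightarrow> z = L t x w))" for c d x :: real and w
  define Q where "Q = {(c, d). c \<in> \<rat> \<and> d \<in> \<rat> \<and> l < ereal c \<and> c < x\<^sub>0 \<and> x\<^sub>0 < d \<and> ereal d < r}"
  have Q: "countable Q" by (rule countable_subset[of _ "\<rat> \<times> \<rat>"]) (auto simp: Q_def intro: countable_rat)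
  have "AE w in M. (\<forall>y\<in>\<rat> \<inter> einterval l r. F1 (fst p) (snd p) y w) \<and>
      (\<forall>x\<in>Xs. fst p < x \<and> x < snd p \<longrightarrow> F2 (fst p) (snd p) x w \<and> F3 (fst p) (snd p) x w)" if "p \<in> Q" for p
  proof -
    obtain c d where p: "p = (c, d)" by (cases p)
    have cd: "l < ereal c" "c < x\<^sub>0" "x\<^sub>0 < d" "ereal d < r" using that unfolding p Q_def by auto
    have "{c..d} \<subseteq> einterval l r"
      using less_le_trans[OF cd(1)] le_less_trans[OF _ cd(4)] by (auto simp: einterval_def)
    then have i: "set_integrable lborel {c..d} (\<lambda>x. \<mu> x / (\<sigma> x)\<^sup>2)" by (rule \<mu>\<sigma>[OF compact_Icc])
    obtain G W' N\<^sub>0 I\<^sub>0 e E where "interior_diffusion M G W' Y \<mu> \<sigma> L l r x\<^sub>0 c d N\<^sub>0 I\<^sub>0 e E"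
      by (rule interior_diffusion_exists[OF cd \<mu> \<sigma> i F W Y L])
    then interpret interior_diffusion M G W' Y \<mu> \<sigma> L l r x\<^sub>0 c d N\<^sub>0 I\<^sub>0 e E .
    have 1: "AE w in M. \<forall>y\<in>\<rat> \<inter> einterval l r. F1 c d y w"
    proof (subst AE_ball_countable)
      show "countable (\<rat> \<inter> einterval l r)" by (rule countable_Int1[OF countable_rat])
      show "\<forall>y\<in>\<rat> \<inter> einterval l r. AE w in M. F1 c d y w" unfolding F1_def using local_time_off_range by blast
    qed
    have 2: "AE w in M. \<forall>x\<in>Xs. c < x \<and> x < d \<longrightarrow> F2 c d x w \<and> F3 c d x w"
    proof (subst AE_ball_countable[OF countable_finite[OF Xs(1)]], intro ballI)
      fix x assume x: "x \<in> Xs"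
      show "AE w in M. c < x \<and> x < d \<longrightarrow> F2 c d x w \<and> F3 c d x w"
      proof (cases "c < x \<and> x < d")
        case True
        then have cxd: "c < x" "x < d" by simp_all
        show ?thesis
          using local_time_positive[OF cxd] local_time_left_limit[OF cxd ys[OF x]]
          unfolding F2_def F3_def by eventually_elim (intro impI conjI)
      next
        case False
        then show ?thesis by (intro AE_I2) blast
      qed
    qed
    from 1 2 show ?thesis unfolding p by eventually_elim simp
  qed
  then have F123: "AE w in M. \<forall>p\<in>Q. (\<forall>y\<in>\<rat> \<inter> einterval l r. F1 (fst p) (snd p) y w) \<and>
      (\<forall>x\<in>Xs. fst p < x \<and> x < snd p \<longrightarrow> F2 (fst p) (snd p) x w \<and> F3 (fst p) (snd p) x w)"
    by (subst AE_ball_countable[OF Q]) blast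
  have "AE w in M. regular_path Y l r x\<^sub>0 w L Xs ys"
    using F123 Y[unfolded sde_solution_def, THEN conjunct2, THEN conjunct1] L[unfolded local_time_def, THEN conjunct2]
  proof eventually_elim
    case (elim w)
    interpret continuous_path Y l r x\<^sub>0 w
      by (rule continuous_path.intro) (use elim(2) x0 in blast)+
    \<comment> \<open>One of the countably many intervals contains the path up to t, so the facts
      localised at its exit time apply at t.\<close>
    have rat: "\<exists>c d. (c, d) \<in> Q \<and> ereal t \<le> exit_time Y (ereal c) (ereal d) w \<and> (\<forall>s x. 0 \<le> s \<and> s \<le> t \<and> Y s w = ereal x \<longrightarrow> c < x \<and> x < d)"
      if t: "0 \<le> t" "ereal t < \<zeta>" for t
    proof -
      obtain c d where cd: "c \<in> \<rat>" "d \<in> \<rat>" "l < ereal c" "c < x\<^sub>0" "x\<^sub>0 < d" "ereal d < r"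
        "ereal t \<le> exit_time Y (ereal c) (ereal d) w" "\<forall>s. 0 \<le> s \<and> s \<le> t \<longrightarrow> c < g s \<and> g s < d"
        by (rule rational_interval[OF t])
      have "g s = x" if "Y s w = ereal x" for s x using that by (simp add: g_def)
      then show ?thesis using cd by (intro exI[of _ c] exI[of _ d]) (auto simp: Q_def)
    qed
    show ?case
    proof (intro regular_path.intro regular_path_axioms.intro continuous_path_axioms Xs(2) ys(2,3))
      fix y t assume y: "y \<in> einterval l r"
      show "mono_on {t. 0 \<le> t \<and> ereal t < exit_time Y l r w} (\<lambda>t. L t y w)" using elim(3) y by blast
      assume t: "0 \<le> t" "ereal t < exit_time Y l r w"
      show "((\<lambda>z. L t z w) \<longlongrightarrow> L t y w) (at_right y)" "\<exists>c. ((\<lambda>z. L t z w) \<longlongrightarrow> c) (at_left y)" using elim(3) y t by blast+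
      assume "y \<in> \<rat>" "(\<forall>s. 0 \<le> s \<and> s \<le> t \<longrightarrow> Y s w < ereal y) \<or> (\<forall>s. 0 \<le> s \<and> s \<le> t \<longrightarrow> ereal y < Y s w)"
      moreover obtain c d where cd: "(c, d) \<in> Q" "ereal t \<le> exit_time Y (ereal c) (ereal d) w" using rat[OF t] by blast
      ultimately show "L t y w = 0" using bspec[OF elim(1) cd(1)] y t(1) unfolding F1_def fst_conv snd_conv by blast
    next
      fix x s t assume x: "x \<in> Xs" and st: "0 \<le> s" "s < t" "ereal t < exit_time Y l r w" "Y s w = ereal x"
      then have "0 \<le> t" by simp
      with rat st(3) obtain c d where cd: "(c, d) \<in> Q" "ereal t \<le> exit_time Y (ereal c) (ereal d) w" "c < x" "x < d"
        using st(1,2,4) less_imp_le by metis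
      have F: "F2 c d x w" "F3 c d x w" using bspec[OF elim(1) cd(1)] cd(3,4) x by auto
      show "0 < L t x w" using F(1) st cd(2) unfolding F2_def by blast
      show "z = L t x w" if "t \<in> \<rat>" "(\<lambda>n. L t (ys x n) w) \<longlonglongrightarrow> z" for z
        using F(2) that st(1,2) cd(2) unfolding F3_def by (metis le_less_trans)
    qed
  qed
  then show thesis by (rule that)
qed

theorem theorem6p1:
  fixes M :: "'a measure" and F :: "real \<Rightarrow> 'a measure" and W :: "real \<Rightarrow> 'a \<Rightarrow> real"
    and l r :: ereal and \<mu> \<sigma> :: "real \<Rightarrow> real" and x\<^sub>0 :: real
    and Y :: "real \<Rightarrow> 'a \<Rightarrow> ereal" and L :: "real \<Rightarrow> real \<Rightarrow> 'a \<Rightarrow> real"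
    and \<nu> :: "real measure"
  assumes "l < r"
    and "\<mu> \<in> borel_measurable (restrict_space borel (einterval l r))"
    and "\<sigma> \<in> borel_measurable (restrict_space borel (einterval l r))"
    and "\<forall>x\<in>einterval l r. \<sigma> x \<noteq> 0"
    and "\<forall>K. compact K \<and> K \<subseteq> einterval l r \<longrightarrow> set_integrable lborel K (\<lambda>x. 1 / (\<sigma> x)\<^sup>2)"
    and "\<forall>K. compact K \<and> K \<subseteq> einterval l r \<longrightarrow> set_integrable lborel K (\<lambda>x. \<mu> x / (\<sigma> x)\<^sup>2)"
    and "x\<^sub>0 \<in> einterval l r"
    and "filtered_prob_space M F"
    and "brownian_motion M F W"
    and "sde_solution M F W l r \<mu> \<sigma> x\<^sub>0 Y"
    and "local_time M F W l r \<mu> \<sigma> x\<^sub>0 Y L"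
    and "sets \<nu> = sets (restrict_space borel (einterval l r))"
  shows "AE \<omega> in M.
    (\<forall>t::ereal. 0 \<le> t \<and> t < hit_time Y (D_set l r \<nu>) \<omega> \<longrightarrow>
       (\<integral>\<^sup>+ y. local_time_ext (exit_time Y l r) L t y \<omega> \<partial>\<nu>) < \<infinity>) \<and>
    (\<forall>t::ereal. hit_time Y (D_set l r \<nu>) \<omega> < t \<and> t \<le> exit_time Y l r \<omega> \<longrightarrow>
       (\<integral>\<^sup>+ y. local_time_ext (exit_time Y l r) L t y \<omega> \<partial>\<nu>) = \<infinity>)"
proof -
  define D where "D = {x \<in> einterval l r. \<forall>\<epsilon>>0. emeasure \<nu> (ball x \<epsilon> \<inter> einterval l r) = \<infinity>}"
  \<comment> \<open>The points of D next to x0 on either side. If D has no point on one side, the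
    infimum or supremum is some unspecified real number, and intersecting with D makes it
    harmless.\<close>
  define Xs where "Xs = D \<inter> {Inf (D \<inter> {x\<^sub>0..}), Sup (D \<inter> {..x\<^sub>0})}"
  have Xs: "finite Xs" "Xs \<subseteq> einterval l r" by (auto simp: Xs_def D_def)
  have conv: "x \<in> einterval l r" if "u \<in> einterval l r" "v \<in> einterval l r" "u \<le> x" "x \<le> v" for u v x
    using that by (auto simp: einterval_def intro: less_le_trans[of l "ereal u"] le_less_trans[of _ "ereal v"])
  have D: "x \<in> D" if "x \<in> einterval l r" "\<And>e. 0 < e \<Longrightarrow> \<exists>z\<in>D. dist x z < e" for x
    using infinite_points_attained[OF assms(12) that(1)] that unfolding D_def by blast
  \<comment> \<open>The point z at which a path meets D is random, but a deterministic point of D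
    next to x0 lies on the way from x0 to z.\<close>
  have between: "\<exists>x\<in>Xs. x\<^sub>0 \<le> x \<and> x \<le> z \<or> z \<le> x \<and> x \<le> x\<^sub>0" if z: "z \<in> D" for z
  proof (cases "x\<^sub>0 \<le> z")
    case True
    let ?S = "D \<inter> {x\<^sub>0..}"
    have S: "z \<in> ?S" "bdd_below ?S" using z True by (auto intro: bdd_belowI[of _ x\<^sub>0])
    have b: "x\<^sub>0 \<le> Inf ?S" "Inf ?S \<le> z" using S by (auto intro!: cInf_greatest cInf_lower)
    have "Inf ?S \<in> D"
    proof (rule D)
      show "Inf ?S \<in> einterval l r" using conv[OF assms(7) _ b] z by (simp add: D_def)
      fix e :: real assume "0 < e"
      then obtain y where y: "y \<in> ?S" "y < Inf ?S + e" using cInf_lessD[of ?S "Inf ?S + e"] S(1) by auto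
      then show "\<exists>z\<in>D. dist (Inf ?S) z < e" using cInf_lower[OF y(1) S(2)] by (intro bexI[of _ y]) (auto simp: dist_real_def)
    qed
    then show ?thesis using b by (intro bexI[of _ "Inf ?S"]) (auto simp: Xs_def)
  next
    case False
    let ?S = "D \<inter> {..x\<^sub>0}"
    have S: "z \<in> ?S" "bdd_above ?S" using z False by (auto intro: bdd_aboveI[of _ x\<^sub>0])
    have b: "z \<le> Sup ?S" "Sup ?S \<le> x\<^sub>0" using S by (auto intro!: cSup_least cSup_upper)
    have "Sup ?S \<in> D"
    proof (rule D)
      show "Sup ?S \<in> einterval l r" using conv[OF _ assms(7) b] z by (simp add: D_def)
      fix e :: real assume "0 < e"
      then obtain y where y: "y \<in> ?S" "Sup ?S - e < y" using less_cSupD[of ?S "Sup ?S - e"] S(1) by auto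
      then show "\<exists>z\<in>D. dist (Sup ?S) z < e" using cSup_upper[OF y(1) S(2)] by (intro bexI[of _ y]) (auto simp: dist_real_def)
    qed
    then show ?thesis using b by (intro bexI[of _ "Sup ?S"]) (auto simp: Xs_def)
  qed
  have \<mu>\<sigma>: "set_integrable lborel K (\<lambda>x. \<mu> x / (\<sigma> x)\<^sup>2)" if "compact K" "K \<subseteq> einterval l r" for K
    using assms(6) that by blast
  obtain ys where "AE w in M. regular_path Y l r x\<^sub>0 w L Xs ys"
    by (rule AE_regular_path[OF assms(2,3) _ \<mu>\<sigma> assms(7-11) Xs]) (use assms(4) in blast)
  then show ?thesis
  proof eventually_elim
    case (elim w)
    then interpret regular_path Y l r x\<^sub>0 w L Xs ys .
    \<comment> \<open>The endpoints l and r belong to D, so D is reached no later than the exit from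
      J; before that, the extended local time is the ordinary one.\<close>
    have hit: "hit_time Y (D_set l r \<nu>) w \<le> \<zeta>"
      unfolding exit_time_def hit_time_def
    proof (rule Inf_superset_mono, rule image_mono, rule Collect_mono, intro impI conjI; elim conjE)
      fix t assume "0 \<le> t" "Y t w \<in> - {l<..<r}"
      then show "Y t w \<in> D_set l r \<nu>" using Y_range[of t] by (auto simp: D_set_def)
    qed
    show ?case
    proof (intro conjI allI impI; elim conjE)
      fix t :: ereal assume t: "0 \<le> t" "t < hit_time Y (D_set l r \<nu>) w"
      then have "t < \<zeta>" using hit by simp
      moreover then obtain t' where t': "t = ereal t'" using t(1) by (cases t) auto
      moreover have "Y s w \<notin> D_set l r \<nu>" if "0 \<le> s" "s \<le> t'" for s
      proof
        assume "Y s w \<in> D_set l r \<nu>"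
        then have "hit_time Y (D_set l r \<nu>) w \<le> ereal s" unfolding hit_time_def using that by (intro Inf_lower) auto
        also have "\<dots> \<le> t" using that(2) t' by simp
        finally show False using t(2) by simp
      qed
      ultimately show "(\<integral>\<^sup>+ y. local_time_ext (exit_time Y l r) L t y w \<partial>\<nu>) < \<infinity>"
        using integral_finite[OF assms(12), of t'] t(1) by (simp add: local_time_ext_def)
    next
      fix t :: ereal assume t: "hit_time Y (D_set l r \<nu>) w < t" "t \<le> exit_time Y l r w"
      then obtain s where s: "0 \<le> s" "ereal s < t" "Y s w \<in> D_set l r \<nu>" unfolding hit_time_def Inf_less_iff by auto
      have "ereal s < \<zeta>" using s(2) t(2) by simp
      from Y_before[OF s(1) this] have Ys: "Y s w = ereal (g s)" "g s \<in> einterval l r" by simp_all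
      \<comment> \<open>Since s < \<zeta>, the path is still inside J, so what it has met is not an
        endpoint.\<close>
      then have "g s \<in> D" using s(3) by (auto simp: D_set_def D_def einterval_def)
      from between[OF this] obtain x where x: "x \<in> Xs" "x\<^sub>0 \<le> x \<and> x \<le> g s \<or> g s \<le> x \<and> x \<le> x\<^sub>0" by blast
      show "(\<integral>\<^sup>+ y. local_time_ext (exit_time Y l r) L t y w \<partial>\<nu>) = \<infinity>"
        by (rule integral_infinite[OF assms(12) s(1,2) t(2) Ys(1) x]) (use x(1) in \<open>auto simp: Xs_def D_def\<close>)
    qed
  qed
qed

end
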